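(* Let $\tilde u(x,t)$ be the exact solution of $u_t+f(u)_x=0$ on $I$ with initial condition $\tilde u_0$ and periodic or compactly supported boundary conditions. Suppose $f$ is sufficiently smooth and there is $T>0$ such that $\tilde u$ is smooth for all $t\in[0,T]$. For any given integer $k\ge1$, let $u(\cdot,t)\in\mathbb V^k$ be the numerical solution of Scheme B, Scheme C or Scheme D on a quasi-uniform mesh with initial condition $\pi\tilde u_0\in\mathbb V^k$. If an upwind numerical flux is used, then for small enough $h$ $$\max_{0\le t\le T}\|\tilde u(\cdot,t)-u(\cdot,t)\|_{L^2(I)}\le Ch^{k+1}.$$ If a general monotone flux is used, then for small enough $h$ $$\max_{0\le t\le T}\|\tilde u(\cdot,t)-u(\cdot,t)\|_{L^2(I)}\le Ch^{k+\frac12}.$$ Here $C>0$ depends on the uniform bound on $\tilde u$ and its derivatives in $I\times[0,T]$, but not on $u$ and $h$.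
   Context: $I$ is a bounded interval divided into cells $I_j=[x_{j-\frac12},x_{j+\frac12}]$, $j=1,\dots,N$, $h_j=|I_j|$, $h=\max_jh_j$; quasi-uniform means there is a constant, independent of $h$, with $\max_jh_j\le \mathrm{const}\cdot\min_jh_j$. $\mathbb V^k=\{v\in L^2(I):v|_{I_j}\in\mathbb P^k(I_j)\ \forall j\}$ ($\mathbb P^k$: polynomials of degree $\le k$); $\pi$ is the $L^2$-projection onto $\mathbb V^k$; $v^\pm_{j+\frac12}=v(x^\pm_{j+\frac12})$; $[\![u]\!]_{j+\frac12}=u^+_{j+\frac12}-u^-_{j+\frac12}$; $\overline u_j$ is the average of $u$ on $I_j$; $\hat f_{j+\frac12}=\hat f(u^-_{j+\frac12},u^+_{j+\frac12})$; $H^+_{j-\frac12}=\hat f_{j-\frac12}-f(u^+_{j-\frac12})$, $H^-_{j+\frac12}=-\hat f_{j+\frac12}+f(u^-_{j+\frac12})$. Numerical fluxes are Lipschitz continuous and consistent ($\hat f(u,u)=f(u)$). A monotone flux is one that is nondecreasing in its first and nonincreasing in its second argument. An upwind flux is a monotone flux with $\hat f(u^-,u^+)=f(u^-)$ if $f'\ge0$ between $u^-$ and $u^+$, and $\hat f(u^-,u^+)=f(u^+)$ if $f'<0$ between $u^-$ and $u^+$. Each scheme has the form: seek $u(\cdot,t)\in\mathbb V^k$ such that for all $v\in\mathbb V^k$ and all $j$, $$\int_{I_j}u_tv\,dx-\int_{I_j}f(u)v_x\,dx+\hat f_{j+\frac12}v^-_{j+\frac12}-\hat f_{j-\frac12}v^+_{j-\frac12}=-\sigma_j\int_{I_j}(u-\overline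 u_j)v\,dx,$$ with $\sigma_j=B_j[u;U]$ for Scheme B, $\sigma_j=C_j[u;U,r]$ for Scheme C, $\sigma_j=D_j[u;r,\epsilon_1,\epsilon_2]$ for Scheme D. Here $U\in C^3(\mathbb R)$ is a fixed function with $U''>0$, $r\in\{k+1,k+2\}$, $\epsilon_1,\epsilon_2>0$ are fixed, $q_j[u;U]=\max_{x\in I_j}|U'''(u(x))|/\min_{x\in I_j}|U''(u(x))|$, and $$B_j[u;U]=q_j[u;U]\Big\{\tfrac{C_k}{2\sqrt{h_j}}\|f(u)_x-\pi[f(u)_x]\|_{L^2(I_j)}+\tfrac{\beta_k}{2h_j}(|H^+_{j-\frac12}|+|H^-_{j+\frac12}|)\Big\},$$ $$C_j[u;U,r]=q_j[u;U]\Big\{\tfrac{C_kC(k,r)h_j^{r-3/2}}{2}\|\partial_x^rf(u)\|_{L^2(I_j)}+\tfrac{\beta_k}{2h_j}(|H^+_{j-\frac12}|+|H^-_{j+\frac12}|)\Big\},$$ $$D_j[u;r,\epsilon_1,\epsilon_2]=\epsilon_1h_j^{r-3/2}\|\partial_x^rf(u)\|_{L^2(I_j)}+\epsilon_2\frac{|[\![u]\!]_{j-\frac12}|+|[\![u]\!]_{j+\frac12}|}{h_j}.$$ Constants (depending only on $k$, $r$): $C_k$ is the optimal constant in $\|p\|_{L^4(I_j)}\le\sqrt{C_k}h_j^{-1/4}\|p\|_{L^2(I_j)}$, $p\in\mathbb P^k(I_j)$; $C(k,r)$ is the optimal constant in $\|g_x-\pi[g_x]\|_{L^2(I_j)}\le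 C(k,r)h_j^{r-1}\|\partial_x^rg\|_{L^2(I_j)}$ for smooth $g$ on $I_j$; $\beta_k$ is a constant (e.g. $(k+1)^4$) such that, for every $U\in C^3(\mathbb R)$, $u\in\mathbb V^k$ and $j$, both $|\pi[U'(u)-U'(u^+_{j-\frac12})](x^+_{j-\frac12})|$ and $|\pi[U'(u)-U'(u^-_{j+\frac12})](x^-_{j+\frac12})|$ are at most $\frac{\beta_k}{2h_j}\max_{x\in I_j}|U'''(u(x))|\int_{I_j}|u-\overline u_j|^2dx$. *)

theory Defs
  imports "HOL-Analysis.Analysis" "HOL-Computational_Algebra.Polynomial"
begin

definition C_class :: "nat \<Rightarrow> (real \<Rightarrow> real) \<Rightarrow> bool" where
  "C_class m g \<longleftrightarrow>
     (\<forall>i<m. \<forall>x. (deriv ^^ i) g field_differentiable at x) \<and> continuous_on UNIV ((deriv ^^ m) g)"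

definition L2norm :: "real \<Rightarrow> real \<Rightarrow> (real \<Rightarrow> real) \<Rightarrow> real" where
  "L2norm a b g = sqrt (integral {a..b} (\<lambda>x. (g x)\<^sup>2))"

definition L4norm :: "real \<Rightarrow> real \<Rightarrow> (real \<Rightarrow> real) \<Rightarrow> real" where
  "L4norm a b g = root 4 (integral {a..b} (\<lambda>x. (g x) ^ 4))"

definition L2proj :: "nat \<Rightarrow> real \<Rightarrow> real \<Rightarrow> (real \<Rightarrow> real) \<Rightarrow> real poly" where
  "L2proj k a b g =
     (THE p. degree p \<le> k \<and>
        (\<forall>q. degree q \<le> k \<longrightarrow> integral {a..b} (\<lambda>x. (g x - poly p x) * poly q x) = 0))"

definition avg :: "real \<Rightarrow> real \<Rightarrow> (real \<Rightarrow> real) \<Rightarrow> real" where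
  "avg a b g = integral {a..b} g / (b - a)"


section \<open>Constants\<close>

text \<open>The inequalities below are invariant under affine maps of the cell, so each constant is taken
  over all nondegenerate intervals.\<close>

definition CL4 :: "nat \<Rightarrow> real" where
  "CL4 k = Inf {c. 0 \<le> c \<and>
     (\<forall>a b p. a < b \<longrightarrow> degree p \<le> k \<longrightarrow>
        L4norm a b (poly p) \<le> sqrt c * (b - a) powr (- 1 / 4) * L2norm a b (poly p))}"

text \<open>A function smooth on a closed interval extends to a smooth function on the line, so it
  suffices to quantify over the latter.\<close>

definition Cproj :: "nat \<Rightarrow> nat \<Rightarrow> real" where
  "Cproj k r = Inf {c. 0 \<le> c \<and>
     (\<forall>a b g. a < b \<longrightarrow> (\<forall>m. C_class m g) \<longrightarrow>
        L2norm a b (\<lambda>x. deriv g x - poly (L2proj k a b (deriv g)) x)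
          \<le> c * (b - a) ^ (r - 1) * L2norm a b ((deriv ^^ r) g))}"

definition beta_admissible :: "nat \<Rightarrow> real \<Rightarrow> bool" where
  "beta_admissible k \<beta> \<longleftrightarrow>
     (\<forall>a b U p. a < b \<longrightarrow> C_class 3 U \<longrightarrow> degree p \<le> k \<longrightarrow>
        (\<forall>e\<in>{a, b}.
          \<bar>poly (L2proj k a b (\<lambda>x. deriv U (poly p x) - deriv U (poly p e))) e\<bar>
            \<le> \<beta> / (2 * (b - a)) * (SUP x\<in>{a..b}. \<bar>(deriv ^^ 3) U (poly p x)\<bar>)
               * integral {a..b} (\<lambda>x. \<bar>poly p x - avg a b (poly p)\<bar>\<^sup>2)))"


section \<open>Meshes and the discontinuous piecewise polynomial space\<close>

text \<open>The node \<open>X i\<close>, for \<open>i = 0, \<dots>, N\<close>, is $x_{i+1/2}$; the cell \<open>j\<close>, for \<open>j = 1, \<dots>, N\<close>, is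
  \<open>{X (j - 1)..X j}\<close>.\<close>

definition is_mesh :: "real \<Rightarrow> real \<Rightarrow> nat \<Rightarrow> (nat \<Rightarrow> real) \<Rightarrow> bool" where
  "is_mesh a b N X \<longleftrightarrow> 1 \<le> N \<and> X 0 = a \<and> X N = b \<and> (\<forall>j\<in>{1..N}. X (j - 1) < X j)"

definition cell_size :: "(nat \<Rightarrow> real) \<Rightarrow> nat \<Rightarrow> real" where
  "cell_size X j = X j - X (j - 1)"

definition mesh_size :: "nat \<Rightarrow> (nat \<Rightarrow> real) \<Rightarrow> real" where
  "mesh_size N X = Max (cell_size X ` {1..N})"

definition quasi_uniform :: "real \<Rightarrow> nat \<Rightarrow> (nat \<Rightarrow> real) \<Rightarrow> bool" where
  "quasi_uniform \<kappa> N X \<longleftrightarrow> mesh_size N X \<le> \<kappa> * Min (cell_size X ` {1..N})"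

text \<open>An element \<open>v\<close> of the space is given by its restrictions to the cells: on cell \<open>j\<close> it equals
  \<open>poly (v j)\<close>. The values of \<open>v\<close> at indices outside \<open>{1..N}\<close> are irrelevant.\<close>

definition Vspace :: "nat \<Rightarrow> nat \<Rightarrow> (nat \<Rightarrow> real poly) set" where
  "Vspace k N = {v. \<forall>j\<in>{1..N}. degree (v j) \<le> k}"

text \<open>The norm on the whole interval of \<open>g - v\<close>, where \<open>v\<close> is piecewise polynomial.\<close>

definition L2dist_broken ::
    "nat \<Rightarrow> (nat \<Rightarrow> real) \<Rightarrow> (real \<Rightarrow> real) \<Rightarrow> (nat \<Rightarrow> real poly) \<Rightarrow> real" where
  "L2dist_broken N X g v =
     sqrt (\<Sum>j\<in>{1..N}. integral {X (j - 1)..X j} (\<lambda>x. (g x - poly (v j) x)\<^sup>2))"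

datatype boundary = Periodic | Compact_support

text \<open>Left and right traces at the node \<open>X i\<close>. At the two boundary nodes the exterior trace is the
  one from the opposite end in the periodic case, and zero in the compactly supported case.\<close>

definition trace_left ::
    "boundary \<Rightarrow> nat \<Rightarrow> (nat \<Rightarrow> real) \<Rightarrow> (nat \<Rightarrow> real poly) \<Rightarrow> nat \<Rightarrow> real" where
  "trace_left bc N X v i =
     (if 1 \<le> i then poly (v i) (X i)
      else (case bc of Periodic \<Rightarrow> poly (v N) (X N) | Compact_support \<Rightarrow> 0))"

definition trace_right ::
    "boundary \<Rightarrow> nat \<Rightarrow> (nat \<Rightarrow> real) \<Rightarrow> (nat \<Rightarrow> real poly) \<Rightarrow> nat \<Rightarrow> real" where
  "trace_right bc N X v i =
     (if i < N then poly (v (Suc i)) (X i)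
      else (case bc of Periodic \<Rightarrow> poly (v 1) (X 0) | Compact_support \<Rightarrow> 0))"

definition jump ::
    "boundary \<Rightarrow> nat \<Rightarrow> (nat \<Rightarrow> real) \<Rightarrow> (nat \<Rightarrow> real poly) \<Rightarrow> nat \<Rightarrow> real" where
  "jump bc N X v i = trace_right bc N X v i - trace_left bc N X v i"


section \<open>Numerical fluxes\<close>

text \<open>Lipschitz continuity is required on bounded sets only: a globally Lipschitz consistent flux
  would exist only for globally Lipschitz \<open>f\<close>, which excludes e.g. the Burgers equation.\<close>

definition numerical_flux :: "(real \<Rightarrow> real) \<Rightarrow> (real \<Rightarrow> real \<Rightarrow> real) \<Rightarrow> bool" where
  "numerical_flux f fh \<longleftrightarrow>
     (\<forall>R. \<exists>L. L-lipschitz_on ({-R..R} \<times> {-R..R}) (\<lambda>(ul, ur). fh ul ur)) \<and> (\<forall>w. fh w w = f w)"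

definition monotone_flux :: "(real \<Rightarrow> real) \<Rightarrow> (real \<Rightarrow> real \<Rightarrow> real) \<Rightarrow> bool" where
  "monotone_flux f fh \<longleftrightarrow>
     numerical_flux f fh \<and> (\<forall>ur. mono (\<lambda>ul. fh ul ur)) \<and> (\<forall>ul. antimono (\<lambda>ur. fh ul ur))"

definition upwind_flux :: "(real \<Rightarrow> real) \<Rightarrow> (real \<Rightarrow> real \<Rightarrow> real) \<Rightarrow> bool" where
  "upwind_flux f fh \<longleftrightarrow>
     monotone_flux f fh \<and>
     (\<forall>ul ur. ((\<forall>s\<in>closed_segment ul ur. 0 \<le> deriv f s) \<longrightarrow> fh ul ur = f ul) \<and>
              ((\<forall>s\<in>closed_segment ul ur. deriv f s < 0) \<longrightarrow> fh ul ur = f ur))"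


section \<open>The schemes\<close>

definition flux_at :: "boundary \<Rightarrow> (real \<Rightarrow> real \<Rightarrow> real) \<Rightarrow> nat \<Rightarrow> (nat \<Rightarrow> real) \<Rightarrow>
    (nat \<Rightarrow> real poly) \<Rightarrow> nat \<Rightarrow> real" where
  "flux_at bc fh N X v i = fh (trace_left bc N X v i) (trace_right bc N X v i)"

definition H_plus :: "boundary \<Rightarrow> (real \<Rightarrow> real) \<Rightarrow> (real \<Rightarrow> real \<Rightarrow> real) \<Rightarrow> nat \<Rightarrow> (nat \<Rightarrow> real) \<Rightarrow>
    (nat \<Rightarrow> real poly) \<Rightarrow> nat \<Rightarrow> real" where
  "H_plus bc f fh N X v i = flux_at bc fh N X v i - f (trace_right bc N X v i)"

definition H_minus :: "boundary \<Rightarrow> (real \<Rightarrow> real) \<Rightarrow> (real \<Rightarrow> real \<Rightarrow> real) \<Rightarrow> nat \<Rightarrow> (nat \<Rightarrow> real) \<Rightarrow>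
    (nat \<Rightarrow> real poly) \<Rightarrow> nat \<Rightarrow> real" where
  "H_minus bc f fh N X v i = - flux_at bc fh N X v i + f (trace_left bc N X v i)"

definition q_coeff :: "(real \<Rightarrow> real) \<Rightarrow> (nat \<Rightarrow> real) \<Rightarrow> (nat \<Rightarrow> real poly) \<Rightarrow> nat \<Rightarrow> real" where
  "q_coeff U X v j =
     (SUP x\<in>{X (j - 1)..X j}. \<bar>(deriv ^^ 3) U (poly (v j) x)\<bar>) /
     (INF x\<in>{X (j - 1)..X j}. \<bar>(deriv ^^ 2) U (poly (v j) x)\<bar>)"

datatype scheme =
    SchemeB "real \<Rightarrow> real"
  | SchemeC "real \<Rightarrow> real" nat
  | SchemeD nat real real

fun scheme_admissible :: "nat \<Rightarrow> scheme \<Rightarrow> bool" where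
  "scheme_admissible k (SchemeB U) \<longleftrightarrow> C_class 3 U \<and> (\<forall>w. 0 < (deriv ^^ 2) U w)"
| "scheme_admissible k (SchemeC U r) \<longleftrightarrow>
     C_class 3 U \<and> (\<forall>w. 0 < (deriv ^^ 2) U w) \<and> r \<in> {k + 1, k + 2}"
| "scheme_admissible k (SchemeD r \<epsilon>1 \<epsilon>2) \<longleftrightarrow> r \<in> {k + 1, k + 2} \<and> 0 < \<epsilon>1 \<and> 0 < \<epsilon>2"

text \<open>Since \<open>poly (v j)\<close> is defined on the whole line, the derivatives of \<open>f(v)\<close> on the closed cell
  are those of \<open>\<lambda>y. f (poly (v j) y)\<close>.\<close>

fun sigma :: "nat \<Rightarrow> real \<Rightarrow> boundary \<Rightarrow> (real \<Rightarrow> real) \<Rightarrow> (real \<Rightarrow> real \<Rightarrow> real) \<Rightarrow> nat \<Rightarrow>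
    (nat \<Rightarrow> real) \<Rightarrow> scheme \<Rightarrow> (nat \<Rightarrow> real poly) \<Rightarrow> nat \<Rightarrow> real" where
  "sigma k \<beta> bc f fh N X (SchemeB U) v j =
     q_coeff U X v j *
       (CL4 k / (2 * sqrt (cell_size X j)) *
          (let g = deriv (\<lambda>y. f (poly (v j) y))
           in L2norm (X (j - 1)) (X j) (\<lambda>x. g x - poly (L2proj k (X (j - 1)) (X j) g) x))
        + \<beta> / (2 * cell_size X j) *
          (\<bar>H_plus bc f fh N X v (j - 1)\<bar> + \<bar>H_minus bc f fh N X v j\<bar>))"
| "sigma k \<beta> bc f fh N X (SchemeC U r) v j =
     q_coeff U X v j *
       (CL4 k * Cproj k r * cell_size X j powr (real r - 3 / 2) / 2 *
          L2norm (X (j - 1)) (X j) ((deriv ^^ r) (\<lambda>y. f (poly (v j) y)))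
        + \<beta> / (2 * cell_size X j) *
          (\<bar>H_plus bc f fh N X v (j - 1)\<bar> + \<bar>H_minus bc f fh N X v j\<bar>))"
| "sigma k \<beta> bc f fh N X (SchemeD r \<epsilon>1 \<epsilon>2) v j =
     \<epsilon>1 * cell_size X j powr (real r - 3 / 2) *
        L2norm (X (j - 1)) (X j) ((deriv ^^ r) (\<lambda>y. f (poly (v j) y)))
     + \<epsilon>2 * (\<bar>jump bc N X v (j - 1)\<bar> + \<bar>jump bc N X v j\<bar>) / cell_size X j"

text \<open>\<open>u t\<close> is the numerical solution at time \<open>t\<close> and \<open>ut\<close> its time derivative (one-sided at the
  end points of \<open>{0..T}\<close>); \<open>w0\<close> is the exact initial value.\<close>

definition numerical_solution :: "nat \<Rightarrow> real \<Rightarrow> boundary \<Rightarrow> (real \<Rightarrow> real) \<Rightarrow>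
    (real \<Rightarrow> real \<Rightarrow> real) \<Rightarrow> scheme \<Rightarrow> real \<Rightarrow> nat \<Rightarrow> (nat \<Rightarrow> real) \<Rightarrow> (real \<Rightarrow> real) \<Rightarrow>
    (real \<Rightarrow> nat \<Rightarrow> real poly) \<Rightarrow> bool" where
  "numerical_solution k \<beta> bc f fh S T N X w0 u \<longleftrightarrow>
     (\<forall>t\<in>{0..T}. u t \<in> Vspace k N) \<and>
     (\<forall>j\<in>{1..N}. u 0 j = L2proj k (X (j - 1)) (X j) w0) \<and>
     (\<forall>t\<in>{0..T}. \<exists>ut\<in>Vspace k N.
        (\<forall>j\<in>{1..N}. \<forall>x\<in>{X (j - 1)..X j}.
           ((\<lambda>s. poly (u s j) x) has_real_derivative poly (ut j) x) (at t within {0..T})) \<and>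
        (\<forall>v\<in>Vspace k N. \<forall>j\<in>{1..N}.
           integral {X (j - 1)..X j} (\<lambda>x. poly (ut j) x * poly (v j) x)
           - integral {X (j - 1)..X j} (\<lambda>x. f (poly (u t j) x) * poly (pderiv (v j)) x)
           + flux_at bc fh N X (u t) j * poly (v j) (X j)
           - flux_at bc fh N X (u t) (j - 1) * poly (v j) (X (j - 1))
           = - sigma k \<beta> bc f fh N X S (u t) j *
               integral {X (j - 1)..X j}
                 (\<lambda>x. (poly (u t j) x - avg (X (j - 1)) (X j) (poly (u t j))) * poly (v j) x)))"


section \<open>The exact solution\<close>

text \<open>The exact solution \<open>w x t\<close> is regarded as a function on the whole line in \<open>x\<close>, via its periodic
  extension or its extension by zero.\<close>

fun boundary_condition :: "boundary \<Rightarrow> real \<Rightarrow> real \<Rightarrow> real \<Rightarrow> (real \<Rightarrow> real \<Rightarrow> real) \<Rightarrow> bool" where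
  "boundary_condition Periodic a b T w \<longleftrightarrow> (\<forall>t\<in>{0..T}. \<forall>x. w (x + (b - a)) t = w x t)"
| "boundary_condition Compact_support a b T w \<longleftrightarrow>
     (\<forall>t\<in>{0..T}. closure {x. w x t \<noteq> 0} \<subseteq> {a<..<b})"

definition exact_solution :: "boundary \<Rightarrow> (real \<Rightarrow> real) \<Rightarrow> real \<Rightarrow> real \<Rightarrow> real \<Rightarrow>
    (real \<Rightarrow> real) \<Rightarrow> (real \<Rightarrow> real \<Rightarrow> real) \<Rightarrow> bool" where
  "exact_solution bc f a b T w0 w \<longleftrightarrow>
     boundary_condition bc a b T w \<and> (\<forall>x\<in>{a..b}. w x 0 = w0 x) \<and>
     (\<forall>x. \<forall>t\<in>{0..T}. \<exists>fx. ((\<lambda>y. f (w y t)) has_real_derivative fx) (at x) \<and>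
        ((\<lambda>s. w x s) has_real_derivative (- fx)) (at t within {0..T}))"

text \<open>\<open>w\<close> is of class $C^m$ on the strip \<open>UNIV \<times> {0..T}\<close> (one-sided time derivatives at \<open>0\<close> and \<open>T\<close>),
  and all its derivatives of order at most \<open>m\<close> are bounded by \<open>M\<close> on \<open>{a..b} \<times> {0..T}\<close>. Here \<open>D i j\<close>
  is the derivative of order \<open>i\<close> in \<open>x\<close> and order \<open>j\<close> in \<open>t\<close>.\<close>

definition smooth_with_bound ::
    "nat \<Rightarrow> real \<Rightarrow> real \<Rightarrow> real \<Rightarrow> real \<Rightarrow> (real \<Rightarrow> real \<Rightarrow> real) \<Rightarrow> bool" where
  "smooth_with_bound m a b T M w \<longleftrightarrow>
     (\<exists>D :: nat \<Rightarrow> nat \<Rightarrow> real \<Rightarrow> real \<Rightarrow> real.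
        (\<forall>x. \<forall>t\<in>{0..T}. D 0 0 x t = w x t) \<and>
        (\<forall>i j. i + j < m \<longrightarrow> (\<forall>x. \<forall>t\<in>{0..T}.
           ((\<lambda>y. D i j y t) has_real_derivative D (Suc i) j x t) (at x) \<and>
           ((\<lambda>s. D i j x s) has_real_derivative D i (Suc j) x t) (at t within {0..T}))) \<and>
        (\<forall>i j. i + j \<le> m \<longrightarrow>
           continuous_on (UNIV \<times> {0..T}) (\<lambda>(x, t). D i j x t) \<and>
           (\<forall>x\<in>{a..b}. \<forall>t\<in>{0..T}. \<bar>D i j x t\<bar> \<le> M)))"

end

theory Submission
  imports Defs
begin

text \<open>
  Let \<open>w\<close> be the exact solution, \<open>u\<close> the numerical one, \<open>q\<close> a cellwise polynomial projection of \<open>w\<close>,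
  \<open>e = u - q\<close> and \<open>\<eta> = w - q\<close>, so that \<open>u = w + e - \<eta>\<close> with \<open>\<eta> = O(h^(k+1))\<close>. Testing the scheme with
  \<open>e\<close> gives the time derivative of the energy \<open>E = \<integral> e\<^sup>2\<close>, and the whole theorem is a bound
  \<open>E' \<le> C E + C \<tau>\<^sup>2\<close>, in which \<open>\<tau> = h^(k+1)\<close> for upwind fluxes and \<open>\<tau> = h^(k+1/2)\<close> for monotone ones.
  Gronwall's inequality then gives the rate \<open>\<tau>\<close>. The bound is proved only as long as \<open>|e| \<le> 1\<close>; since
  \<open>|e|\<^sup>2 \<le> C E / h\<close> for polynomials and \<open>\<tau>\<^sup>2 / h\<close> tends to zero, the resulting estimate is stronger than
  this assumption, and a continuity argument (\<open>gronwall_bootstrap\<close>) removes it.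

  Volume terms (\<open>cell_energy_inequality\<close>). The gradient \<open>e_x\<close> costs a factor \<open>1/h\<close>, so the nonlinear term
  \<open>(f(w + e) - f(w)) e_x\<close> must not be estimated by size. With an antiderivative \<open>\<Phi>\<close> of \<open>f\<close> it is, up to
  \<open>O(e\<^sup>2)\<close>, the exact derivative of \<open>\<Phi>(w + e) - \<Phi>(w) - f(w) e\<close>, so that only values at the nodes remain.
  What is left is the linear term \<open>f'(w) \<eta> e_x\<close>. It is harmless if \<open>\<eta>\<close> is orthogonal to polynomials of
  degree less than \<open>k\<close>, because \<open>f'(w)\<close> is constant on the cell up to \<open>O(h)\<close>, and also if
  \<open>f'(w) = O(h)\<close> on the cell.

  Node terms. After summation over the cells the node between two cells contributes
  \<open>F (y2 - y1) - (\<Phi>(y2) - \<Phi>(y1))\<close>, where \<open>y1\<close>, \<open>y2\<close> are the two traces of \<open>w + e\<close> and the flux \<open>F\<close> is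
  taken at the traces of \<open>u\<close>, which are within \<open>|\<eta>|\<close> of \<open>y1\<close>, \<open>y2\<close>. Monotone fluxes do not exceed \<open>f\<close>
  between increasing arguments, which makes this quantity at most \<open>C \<eta>\<^sup>2\<close> (\<open>monotone_flux_node\<close>). There are
  about \<open>1/h\<close> nodes, whence the loss of half an order. For an upwind flux the loss is avoided by a
  suitable \<open>q\<close>: each cell uses the Gauss-Radau projection that is exact at its downwind end, so that the
  flux is evaluated without error, and a projection exact at both ends where \<open>f'(w)\<close> is of size \<open>h\<close>. The
  choice can be made once for all times because \<open>f'(w)\<close> solves a linear ordinary differential equation
  in \<open>t\<close> at each fixed \<open>x\<close> and so keeps its sign and size (\<open>linear_ode_sign\<close>). If \<open>f'\<close> changes sign
  between the traces although \<open>|f'(w)|\<close> exceeds a multiple of \<open>h\<close>, then one of the traces of \<open>e\<close> is at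
  least of size \<open>h\<close>, and the crude bound \<open>C \<eta>\<^sup>2\<close> is itself of the form \<open>h e\<^sup>2\<close> (\<open>upwind_flux_node\<close>).

  Damping terms. All three coefficients \<open>\<sigma>\<close> are nonnegative and satisfy
  \<open>\<sigma> h \<le> C (h^(k+1) + sup |e| + jumps)\<close> (\<open>sigma_bound\<close>): by the chain rule the derivative of order \<open>r\<close> of
  \<open>f(u)\<close> is at most \<open>C (1 + sup |e| / h^r)\<close>, as \<open>u\<close> is a smooth function plus a polynomial of size
  \<open>sup |e|\<close>. Nonnegativity discards the square \<open>\<sigma> \<integral> (e - e_avg)\<^sup>2\<close>, and what remains of
  \<open>\<sigma> \<integral> (u - u_avg) e\<close> contains the oscillation of \<open>q\<close>, which is another factor \<open>h\<close>.
\<close>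

section \<open>Orthonormal polynomials on the unit interval\<close>

lemma integrable_poly_mult [simp, intro]:
  fixes p q :: "real poly"
  shows "(\<lambda>x. poly p x * poly q x) integrable_on {a..b}"
  by (intro integrable_continuous_interval continuous_intros)

lemma integral_rescale_unit:
  fixes g :: "real \<Rightarrow> real"
  assumes "a < b" "continuous_on {a..b} g"
  shows "integral {a..b} g = (b - a) * integral {0..1} (\<lambda>s. g (a + (b - a) * s))"
proof -
  have gi: "(g has_integral integral {a..b} g) (cbox a b)"
    using assms by (simp add: integrable_continuous_interval integrable_integral)
  have "((\<lambda>x. g ((b - a) *\<^sub>R x + a)) has_integral (1 / (\<bar>b - a\<bar> ^ DIM(real))) *\<^sub>R integral {a..b} g)
      ((\<lambda>x. (1 / (b - a)) *\<^sub>R x + - ((1 / (b - a)) *\<^sub>R a)) ` cbox a b)"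
    by (rule has_integral_affinity[OF gi]) (use assms in auto)
  moreover have "(\<lambda>x. (1 / (b - a)) *\<^sub>R x + - ((1 / (b - a)) *\<^sub>R a)) ` cbox a b = {0..1}"
  proof -
    have "(\<lambda>x. (1 / (b - a)) *\<^sub>R x + - ((1 / (b - a)) *\<^sub>R a)) = (\<lambda>x. (1 / (b - a)) *\<^sub>R x + (- a / (b - a)))"
      by auto
    then have "(\<lambda>x. (1 / (b - a)) *\<^sub>R x + - ((1 / (b - a)) *\<^sub>R a)) ` cbox a b
        = cbox ((1 / (b - a)) *\<^sub>R a + (- a / (b - a))) ((1 / (b - a)) *\<^sub>R b + (- a / (b - a)))"
      by (simp only: image_affinity_cbox) (use assms in auto)
    also have "\<dots> = {0..1}"
      using assms by (simp add: diff_divide_distrib[symmetric])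
    finally show ?thesis .
  qed
  ultimately have "((\<lambda>x. g (a + (b - a) * x)) has_integral (1 / (b - a)) * integral {a..b} g) {0..1}"
    using assms by (simp add: add.commute)
  then have "integral {0..1} (\<lambda>x. g (a + (b - a) * x)) = (1 / (b - a)) * integral {a..b} g"
    by (rule integral_unique)
  then show ?thesis using assms by simp
qed

definition ip :: "real poly \<Rightarrow> real poly \<Rightarrow> real" where
  "ip p q = integral {0..1} (\<lambda>x. poly p x * poly q x)"

lemma ip_commute: "ip p q = ip q p"
  by (simp add: ip_def mult.commute)

lemma ip_add_left: "ip (p + q) r = ip p r + ip q r"
  unfolding ip_def by (simp add: distrib_right integral_add integrable_poly_mult)

lemma ip_diff_left: "ip (p - q) r = ip p r - ip q r"
  unfolding ip_def by (simp add: left_diff_distrib integral_diff integrable_poly_mult)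

lemma ip_smult_left: "ip (smult c p) r = c * ip p r"
  unfolding ip_def by (simp add: mult.assoc)

lemma ip_0_left: "ip 0 r = 0"
  by (simp add: ip_def)

lemma ip_sum_left: "ip (\<Sum>i\<in>A. f i) r = (\<Sum>i\<in>A. ip (f i) r)"
  by (induction A rule: infinite_finite_induct) (auto simp: ip_add_left ip_0_left)

lemma ip_smult_right: "ip r (smult c p) = c * ip r p"
  by (simp only: ip_commute[of r] ip_smult_left)

lemma integral_weighted_square_pos:
  fixes w :: "real \<Rightarrow> real" and p :: "real poly"
  assumes "a < b" "p \<noteq> 0" "continuous_on {a..b} w"
    and "\<And>x. x \<in> {a<..<b} \<Longrightarrow> 0 < w x" "\<And>x. x \<in> {a..b} \<Longrightarrow> 0 \<le> w x"
  shows "0 < integral {a..b} (\<lambda>x. w x * (poly p x)\<^sup>2)"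
proof -
  have cont: "continuous_on {a..b} (\<lambda>x. w x * (poly p x)\<^sup>2)"
    by (intro continuous_intros assms)
  have "0 \<le> integral {a..b} (\<lambda>x. w x * (poly p x)\<^sup>2)"
    using assms by (intro integral_nonneg integrable_continuous_interval cont) auto
  moreover have "integral {a..b} (\<lambda>x. w x * (poly p x)\<^sup>2) \<noteq> 0"
  proof
    assume "integral {a..b} (\<lambda>x. w x * (poly p x)\<^sup>2) = 0"
    then have "\<forall>x\<in>{a..b}. w x * (poly p x)\<^sup>2 = 0"
      using integral_eq_0_iff[OF cont \<open>a < b\<close>] assms by auto
    then have "{a<..<b} \<subseteq> {x. poly p x = 0}"
      using assms(4) by force
    moreover have "infinite {a<..<b}" using \<open>a < b\<close> by (rule infinite_Ioo)
    ultimately show False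
      using poly_roots_finite[OF \<open>p \<noteq> 0\<close>] finite_subset by blast
  qed
  ultimately show ?thesis by linarith
qed

lemma ip_pos: "p \<noteq> 0 \<Longrightarrow> 0 < ip p p"
  using integral_weighted_square_pos[of 0 1 p "\<lambda>x. 1"] by (simp add: ip_def power2_eq_square)

lemma orthonormal_expansion_coeff:
  fixes n :: nat
  assumes "\<And>i j. i \<le> n \<Longrightarrow> j \<le> n \<Longrightarrow> ip (\<phi> i) (\<phi> j) = (if i = j then 1 else 0)"
    and "p = (\<Sum>i\<le>n. smult (c i) (\<phi> i))" "j \<le> n"
  shows "c j = ip p (\<phi> j)"
proof -
  have "ip p (\<phi> j) = (\<Sum>i\<le>n. c i * ip (\<phi> i) (\<phi> j))"
    by (simp add: assms(2) ip_sum_left ip_smult_left)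
  also have "\<dots> = (\<Sum>i\<le>n. if i = j then c i else 0)"
    using assms by (intro sum.cong) auto
  also have "\<dots> = c j" using assms(3) by simp
  finally show ?thesis by simp
qed

text \<open>Gram-Schmidt on the monomials, one degree at a time. The expansion is stated for every \<open>m \<le> n\<close>
  because orthogonality of the last polynomial to all polynomials of smaller degree is read off from it.\<close>

lemma orthonormal_polys_exist:
  "\<exists>\<phi> :: nat \<Rightarrow> real poly. (\<forall>i\<le>n. degree (\<phi> i) \<le> i) \<and>
     (\<forall>i\<le>n. \<forall>j\<le>n. ip (\<phi> i) (\<phi> j) = (if i = j then 1 else 0)) \<and>
     (\<forall>m\<le>n. \<forall>p. degree p \<le> m \<longrightarrow> p = (\<Sum>i\<le>m. smult (ip p (\<phi> i)) (\<phi> i)))"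
proof (induction n)
  case 0
  have c: "p = smult (ip p 1) 1" if "degree p = 0" for p :: "real poly"
  proof -
    from that obtain c where "p = [:c:]" by (rule degree_eq_zeroE)
    then show ?thesis by (simp add: ip_def)
  qed
  show ?case
    by (rule exI[of _ "\<lambda>i. 1"]) (use c in \<open>auto simp: ip_def\<close>)
next
  case (Suc n)
  then obtain \<phi> :: "nat \<Rightarrow> real poly" where
    deg: "\<And>i. i \<le> n \<Longrightarrow> degree (\<phi> i) \<le> i" and
    orth: "\<And>i j. i \<le> n \<Longrightarrow> j \<le> n \<Longrightarrow> ip (\<phi> i) (\<phi> j) = (if i = j then 1 else 0)" and
    span: "\<And>m p. m \<le> n \<Longrightarrow> degree p \<le> m \<Longrightarrow> p = (\<Sum>i\<le>m. smult (ip p (\<phi> i)) (\<phi> i))"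
    by blast
  define x where "x = (monom 1 (Suc n) :: real poly)"
  define s where "s = (\<Sum>i\<le>n. smult (ip x (\<phi> i)) (\<phi> i))"
  define r where "r = x - s"
  have degs: "degree s \<le> n" unfolding s_def
    by (intro degree_sum_le) (use deg in \<open>auto intro!: order_trans[OF degree_smult_le] intro: order_trans\<close>)
  have coef: "coeff r (Suc n) = 1"
    using degs by (simp add: r_def x_def coeff_eq_0)
  then have r0: "r \<noteq> 0" by auto
  have degr: "degree r \<le> Suc n"
    unfolding r_def x_def using degs by (intro degree_diff_le) (auto simp: degree_monom_le)
  have ro: "ip r (\<phi> j) = 0" if "j \<le> n" for j
  proof -
    have "ip s (\<phi> j) = (\<Sum>i\<le>n. ip x (\<phi> i) * ip (\<phi> i) (\<phi> j))"
      by (simp add: s_def ip_sum_left ip_smult_left)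
    also have "\<dots> = (\<Sum>i\<le>n. if i = j then ip x (\<phi> i) else 0)"
      using orth that by (intro sum.cong) auto
    also have "\<dots> = ip x (\<phi> j)" using that by simp
    finally show ?thesis by (simp add: r_def ip_diff_left)
  qed
  define N where "N = sqrt (ip r r)"
  have N: "N > 0" "N * N = ip r r" using ip_pos[OF r0] by (auto simp: N_def)
  define \<psi> where "\<psi> = \<phi> (Suc n := smult (1 / N) r)"
  have \<psi>: "\<psi> i = \<phi> i" if "i \<le> n" for i using that by (simp add: \<psi>_def)
  have \<psi>S: "\<psi> (Suc n) = smult (1 / N) r" by (simp add: \<psi>_def)
  have one: "ip (\<psi> (Suc n)) (\<psi> (Suc n)) = 1"
    using N ip_pos[OF r0] by (simp add: \<psi>S ip_smult_left ip_smult_right)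
  have orth': "ip (\<psi> i) (\<psi> j) = (if i = j then 1 else 0)" if "i \<le> Suc n" "j \<le> Suc n" for i j
    using that orth one ro ip_commute
    by (auto simp: le_Suc_eq \<psi> \<psi>S ip_smult_left ip_smult_right)
  have span': "p = (\<Sum>i\<le>m. smult (ip p (\<psi> i)) (\<psi> i))" if "m \<le> Suc n" "degree p \<le> m" for m p
  proof (cases "m \<le> n")
    case True
    then have "(\<Sum>i\<le>m. smult (ip p (\<psi> i)) (\<psi> i)) = (\<Sum>i\<le>m. smult (ip p (\<phi> i)) (\<phi> i))"
      by (intro sum.cong) (auto simp: \<psi>)
    then show ?thesis using span[OF True that(2)] by simp
  next
    case False
    then have m: "m = Suc n" using that by simp
    define c where "c = coeff p (Suc n)"
    define p' where "p' = p - smult c r"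
    have "coeff p' i = 0" if "n < i" for i
    proof (cases "i = Suc n")
      case True then show ?thesis by (simp add: p'_def coef c_def)
    next
      case False
      then have "degree p < i" "degree r < i" using that \<open>degree p \<le> m\<close> m degr by auto
      then show ?thesis by (simp add: p'_def coeff_eq_0)
    qed
    then have "degree p' \<le> n" by (intro degree_le) auto
    then have "p' = (\<Sum>i\<le>n. smult (ip p' (\<phi> i)) (\<phi> i))"
      using span[of n p'] by simp
    also have "\<dots> = (\<Sum>i\<le>n. smult (ip p' (\<psi> i)) (\<psi> i))"
      by (intro sum.cong) (auto simp: \<psi>)
    finally have "p' = (\<Sum>i\<le>n. smult (ip p' (\<psi> i)) (\<psi> i))" .
    moreover have "smult (c * N) (\<psi> (Suc n)) = smult c r" using N by (simp add: \<psi>S)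
    ultimately have e: "p = (\<Sum>i\<le>n. smult (ip p' (\<psi> i)) (\<psi> i)) + smult (c * N) (\<psi> (Suc n))"
      unfolding p'_def by (metis diff_add_cancel)
    define d where "d i = (if i = Suc n then c * N else ip p' (\<psi> i))" for i
    have e': "p = (\<Sum>i\<le>Suc n. smult (d i) (\<psi> i))"
    proof -
      have "(\<Sum>i\<le>n. smult (ip p' (\<psi> i)) (\<psi> i)) = (\<Sum>i\<le>n. smult (d i) (\<psi> i))"
        by (intro sum.cong) (auto simp: d_def)
      then show ?thesis using e by (simp add: d_def)
    qed
    have "(\<Sum>i\<le>Suc n. smult (d i) (\<psi> i)) = (\<Sum>i\<le>Suc n. smult (ip p (\<psi> i)) (\<psi> i))"
      using orthonormal_expansion_coeff[OF orth' e'] by (intro sum.cong) auto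
    then show ?thesis unfolding m using e' by (rule trans[rotated])
  qed
  show ?case
  proof (rule exI[of _ \<psi>], intro conjI allI impI)
    show "degree (\<psi> i) \<le> i" if "i \<le> Suc n" for i
      using that deg degr by (auto simp: le_Suc_eq \<psi> \<psi>S intro: order_trans[OF degree_smult_le])
  qed (use orth' span' in auto)
qed

lemma orthonormal_leading_orth_lower:
  fixes \<phi> :: "nat \<Rightarrow> real poly"
  assumes orth: "\<forall>i\<le>k. \<forall>j\<le>k. ip (\<phi> i) (\<phi> j) = (if i = j then 1 else 0)"
    and span: "\<forall>m\<le>k. \<forall>p. degree p \<le> m \<longrightarrow> p = (\<Sum>i\<le>m. smult (ip p (\<phi> i)) (\<phi> i))"
    and "degree s < k"
  shows "ip s (\<phi> k) = 0"
proof -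
  have e: "s = (\<Sum>i\<le>degree s. smult (ip s (\<phi> i)) (\<phi> i))"
    using span \<open>degree s < k\<close> by auto
  have "ip s (\<phi> k) = (\<Sum>i\<le>degree s. ip s (\<phi> i) * ip (\<phi> i) (\<phi> k))"
    by (subst e) (simp add: ip_sum_left ip_smult_left)
  also have "\<dots> = 0" using assms by (intro sum.neutral) auto
  finally show ?thesis .
qed

text \<open>A zero of the last polynomial at an end point \<open>e\<close> could be split off as a factor \<open>x - e\<close>, which has
  a constant sign on the interval; the cofactor has smaller degree, and its inner product with the
  polynomial would be both zero and an integral of \<open>(x - e) s\<^sup>2\<close>. This makes the Gauss-Radau
  interpolation problem solvable.\<close>

lemma orthonormal_leading_nonzero_at_ends:
  fixes \<phi> :: "nat \<Rightarrow> real poly"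
  assumes deg: "degree (\<phi> k) \<le> k"
    and orth: "\<forall>i\<le>k. \<forall>j\<le>k. ip (\<phi> i) (\<phi> j) = (if i = j then 1 else 0)"
    and span: "\<forall>m\<le>k. \<forall>p. degree p \<le> m \<longrightarrow> p = (\<Sum>i\<le>m. smult (ip p (\<phi> i)) (\<phi> i))"
    and e: "e \<in> {0, 1}"
  shows "poly (\<phi> k) e \<noteq> 0"
proof
  assume "poly (\<phi> k) e = 0"
  then obtain s where s: "\<phi> k = [:- e, 1:] * s"
    by (auto simp: poly_eq_0_iff_dvd elim: dvdE)
  have "ip (\<phi> k) (\<phi> k) = 1" using orth by auto
  then have "\<phi> k \<noteq> 0" by (auto simp: ip_0_left)
  then have s0: "s \<noteq> 0" using s by auto
  have "degree (\<phi> k) = degree [:- e, 1:] + degree s"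
    unfolding s using s0 by (intro degree_mult_eq) auto
  then have "degree s < k" using deg by simp
  then have "ip s (\<phi> k) = 0"
    by (rule orthonormal_leading_orth_lower[OF orth span])
  moreover have "ip s (\<phi> k) = integral {0..1} (\<lambda>x. (x - e) * (poly s x)\<^sup>2)"
    by (simp add: ip_def s power2_eq_square algebra_simps)
  moreover have "\<dots> \<noteq> 0"
  proof (cases "e = 0")
    case True
    show ?thesis
      using integral_weighted_square_pos[of 0 1 s "\<lambda>x. x - e"] s0 True
      by (simp add: continuous_intros)
  next
    case False
    then have "e = 1" using e by simp
    then have "0 < integral {0..1} (\<lambda>x. (e - x) * (poly s x)\<^sup>2)"
      by (intro integral_weighted_square_pos s0) (auto intro!: continuous_intros)
    moreover have "integral {0..1} (\<lambda>x. (x - e) * (poly s x)\<^sup>2)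
        = - integral {0..1} (\<lambda>x. (e - x) * (poly s x)\<^sup>2)"
      by (subst integral_neg[symmetric]) (simp add: algebra_simps)
    ultimately show ?thesis by simp
  qed
  ultimately show False by simp
qed

section \<open>Orthogonal bases and inverse inequalities on a cell\<close>

text \<open>An affine image of the orthonormal basis on the unit interval. The scaling by \<open>b - a\<close> (rather than
  to norm one) keeps the values of the basis bounded uniformly in the length of the cell. The last line
  bounds the leading polynomial from below at the ends of the cell.\<close>

definition cell_basis :: "nat \<Rightarrow> real \<Rightarrow> real \<Rightarrow> real \<Rightarrow> (nat \<Rightarrow> real poly) \<Rightarrow> bool" where
  "cell_basis k C a b \<phi> \<longleftrightarrow>
     (\<forall>i\<le>k. degree (\<phi> i) \<le> i) \<and>
     (\<forall>i\<le>k. \<forall>j\<le>k. integral {a..b} (\<lambda>x. poly (\<phi> i) x * poly (\<phi> j) x) = (if i = j then b - a else 0)) \<and>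
     (\<forall>p. degree p \<le> k \<longrightarrow>
        p = (\<Sum>i\<le>k. smult (integral {a..b} (\<lambda>x. poly p x * poly (\<phi> i) x) / (b - a)) (\<phi> i))) \<and>
     (\<forall>p. degree p < k \<longrightarrow> integral {a..b} (\<lambda>x. poly p x * poly (\<phi> k) x) = 0) \<and>
     (\<forall>i\<le>k. \<forall>x\<in>{a..b}. \<bar>poly (\<phi> i) x\<bar> \<le> C \<and> \<bar>poly (pderiv (\<phi> i)) x\<bar> \<le> C / (b - a)) \<and>
     1 \<le> C * \<bar>poly (\<phi> k) a\<bar> \<and> 1 \<le> C * \<bar>poly (\<phi> k) b\<bar>"

lemma poly_bounded_unit:
  fixes p :: "real poly"
  shows "\<exists>B. \<forall>x\<in>{0..1}. \<bar>poly p x\<bar> \<le> B"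
proof -
  have "compact (poly p ` {0..1})"
    by (intro compact_continuous_image continuous_intros compact_Icc)
  then show ?thesis
    using bounded_real[of "poly p ` {0..1}"] compact_imp_bounded by auto
qed

lemma cell_basis_exists:
  "\<exists>C\<ge>1. \<forall>a b. a < b \<longrightarrow> (\<exists>\<phi>. cell_basis k C a b \<phi>)"
proof -
  obtain \<phi> :: "nat \<Rightarrow> real poly" where
    deg: "\<forall>i\<le>k. degree (\<phi> i) \<le> i" and
    orth: "\<forall>i\<le>k. \<forall>j\<le>k. ip (\<phi> i) (\<phi> j) = (if i = j then 1 else 0)" and
    span: "\<forall>m\<le>k. \<forall>p. degree p \<le> m \<longrightarrow> p = (\<Sum>i\<le>m. smult (ip p (\<phi> i)) (\<phi> i))"
    using orthonormal_polys_exist[of k] by blast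
  have ex1: "\<forall>i. \<exists>B. \<forall>x\<in>{0..1}. \<bar>poly (\<phi> i) x\<bar> \<le> B"
    by (intro allI poly_bounded_unit)
  obtain B1 where B1': "\<forall>i. \<forall>x\<in>{0..1}. \<bar>poly (\<phi> i) x\<bar> \<le> B1 i"
    using choice[OF ex1] by blast
  have ex2: "\<forall>i. \<exists>B. \<forall>x\<in>{0..1}. \<bar>poly (pderiv (\<phi> i)) x\<bar> \<le> B"
    by (intro allI poly_bounded_unit)
  obtain B2 where B2': "\<forall>i. \<forall>x\<in>{0..1}. \<bar>poly (pderiv (\<phi> i)) x\<bar> \<le> B2 i"
    using choice[OF ex2] by blast
  have B1: "\<bar>poly (\<phi> i) x\<bar> \<le> B1 i" and B2: "\<bar>poly (pderiv (\<phi> i)) x\<bar> \<le> B2 i" if "x \<in> {0..1}" for i x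
    using B1' B2' that by blast+
  have nz: "poly (\<phi> k) 0 \<noteq> 0" "poly (\<phi> k) 1 \<noteq> 0"
    using orthonormal_leading_nonzero_at_ends[OF _ orth span] deg by auto
  \<comment> \<open>The summands bound the values, the derivatives and the reciprocals of the two end values.\<close>
  define C where "C = 1 + (\<Sum>i\<le>k. \<bar>B1 i\<bar> + \<bar>B2 i\<bar>) + 1 / \<bar>poly (\<phi> k) 0\<bar> + 1 / \<bar>poly (\<phi> k) 1\<bar>"
  have S0: "0 \<le> (\<Sum>i\<le>k. \<bar>B1 i\<bar> + \<bar>B2 i\<bar>)" by (intro sum_nonneg) auto
  have C1: "1 \<le> C" using S0 by (simp add: C_def)
  have CB: "\<bar>B1 i\<bar> + \<bar>B2 i\<bar> \<le> C" if "i \<le> k" for i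
  proof -
    have "\<bar>B1 i\<bar> + \<bar>B2 i\<bar> \<le> (\<Sum>i\<le>k. \<bar>B1 i\<bar> + \<bar>B2 i\<bar>)"
      by (rule member_le_sum) (use that in auto)
    then show ?thesis by (simp add: C_def add_increasing2)
  qed
  have CE: "1 \<le> C * \<bar>poly (\<phi> k) e\<bar>" if "e \<in> {0, 1}" for e
  proof -
    have "1 / \<bar>poly (\<phi> k) e\<bar> \<le> C" using that S0 by (auto simp: C_def add_increasing)
    moreover have "0 < \<bar>poly (\<phi> k) e\<bar>" using nz that by auto
    ultimately show ?thesis by (simp add: field_simps)
  qed
  have "\<exists>\<psi>. cell_basis k C a b \<psi>" if ab: "a < b" for a b
  proof -
    define h where "h = b - a"
    have h: "h > 0" using ab by (simp add: h_def)
    define l where "l = [:- a / h, 1 / h:]"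
    define l' where "l' = [:a, h:]"
    have ll: "pcompose l' l = [:0, 1:]" using h by (simp add: l_def l'_def pcompose_pCons)
    have degl: "degree l = 1" "degree l' = 1" using h by (simp_all add: l_def l'_def)
    define \<psi> where "\<psi> i = pcompose (\<phi> i) l" for i
    have ev: "poly (\<psi> i) (a + h * s) = poly (\<phi> i) s" for i s
      using h by (simp add: \<psi>_def poly_pcompose l_def field_simps)
    have evd: "poly (pderiv (\<psi> i)) (a + h * s) = poly (pderiv (\<phi> i)) s / h" for i s
      using h by (simp add: \<psi>_def pderiv_pcompose poly_pcompose l_def pderiv_pCons field_simps)
    have int: "integral {a..b} (\<lambda>x. poly p x * poly (\<psi> i) x) = h * ip (pcompose p l') (\<phi> i)" for p i
      unfolding h_def ip_def
      by (subst integral_rescale_unit[OF ab])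
        (use ev in \<open>auto intro!: continuous_intros simp: poly_pcompose l'_def h_def mult.commute\<close>)
    have bck: "pcompose (pcompose p l') l = p" for p
      by (simp add: pcompose_assoc[symmetric] ll)
    have degp: "degree (pcompose p l') = degree p" for p
      using degl by (simp add: degree_pcompose)
    have bck': "pcompose (\<psi> i) l' = \<phi> i" for i
    proof -
      have "pcompose l l' = [:0, 1:]" using h by (simp add: l_def l'_def pcompose_pCons)
      then show ?thesis by (simp add: \<psi>_def pcompose_assoc[symmetric])
    qed
    have xs: "\<exists>s\<in>{0..1}. x = a + h * s" if "x \<in> {a..b}" for x
      using that h by (intro bexI[of _ "(x - a) / h"]) (auto simp: field_simps h_def)
    show ?thesis
      unfolding cell_basis_def
    proof (rule exI[of _ \<psi>], intro conjI allI impI ballI)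
      fix i assume i: "i \<le> k"
      show "degree (\<psi> i) \<le> i" using deg i degl by (simp add: \<psi>_def degree_pcompose)
      show "integral {a..b} (\<lambda>x. poly (\<psi> i) x * poly (\<psi> j) x) = (if i = j then b - a else 0)"
        if "j \<le> k" for j
        using orth i that by (simp add: int bck' h_def)
    next
      fix p :: "real poly" assume p: "degree p \<le> k"
      then have "pcompose p l' = (\<Sum>i\<le>k. smult (ip (pcompose p l') (\<phi> i)) (\<phi> i))"
        using span degp by auto
      then have "pcompose (pcompose p l') l = pcompose (\<Sum>i\<le>k. smult (ip (pcompose p l') (\<phi> i)) (\<phi> i)) l"
        by (rule arg_cong)
      then have "p = (\<Sum>i\<le>k. smult (ip (pcompose p l') (\<phi> i)) (\<psi> i))"
        by (simp add: bck pcompose_sum pcompose_smult \<psi>_def)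
      also have "\<dots> = (\<Sum>i\<le>k. smult (integral {a..b} (\<lambda>x. poly p x * poly (\<psi> i) x) / (b - a)) (\<psi> i))"
        using h by (simp add: int h_def)
      finally show "p = \<dots>" .
    next
      fix p :: "real poly" assume p: "degree p < k"
      then show "integral {a..b} (\<lambda>x. poly p x * poly (\<psi> k) x) = 0"
        unfolding int using orthonormal_leading_orth_lower[OF orth span] degp by simp
    next
      fix i x assume i: "i \<le> k" and x: "x \<in> {a..b}"
      then obtain s where s: "s \<in> {0..1}" "x = a + h * s" using xs by blast
      show "\<bar>poly (\<psi> i) x\<bar> \<le> C"
        using B1[OF s(1), of i] CB[OF i] by (simp add: s(2) ev)
      have "\<bar>poly (pderiv (\<phi> i)) s\<bar> \<le> C"
        using B2[OF s(1), of i] CB[OF i] by simp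
      then show "\<bar>poly (pderiv (\<psi> i)) x\<bar> \<le> C / (b - a)"
        using h by (simp add: s(2) evd h_def[symmetric] divide_right_mono)
    next
      show "1 \<le> C * \<bar>poly (\<psi> k) a\<bar>" using ev[of k 0] CE[of 0] by simp
      show "1 \<le> C * \<bar>poly (\<psi> k) b\<bar>" using ev[of k 1] CE[of 1] by (simp add: h_def)
    qed
  qed
  then show ?thesis using C1 by blast
qed

text \<open>The coefficient of \<open>g\<close> with respect to a basis element \<open>\<phi>\<close> in the scaling of \<open>cell_basis\<close>.\<close>

definition moment :: "real \<Rightarrow> real \<Rightarrow> (real \<Rightarrow> real) \<Rightarrow> real poly \<Rightarrow> real" where
  "moment a b g \<phi> = integral {a..b} (\<lambda>x. g x * poly \<phi> x) / (b - a)"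

lemma integrable_cont_poly [intro]:
  fixes g :: "real \<Rightarrow> real"
  shows "continuous_on {a..b} g \<Longrightarrow> (\<lambda>x. g x * poly p x) integrable_on {a..b}"
  by (intro integrable_continuous_interval continuous_intros)

lemma abs_integral_le_sup:
  fixes g :: "real \<Rightarrow> real"
  assumes "a \<le> b" "continuous_on {a..b} g" "\<And>x. x \<in> {a..b} \<Longrightarrow> \<bar>g x\<bar> \<le> S"
  shows "\<bar>integral {a..b} g\<bar> \<le> S * (b - a)"
  using integral_bound[of a b g S] assms by auto

lemma abs_moment_le:
  assumes "a < b" "continuous_on {a..b} g" "\<And>x. x \<in> {a..b} \<Longrightarrow> \<bar>g x\<bar> \<le> S"
    and "\<And>x. x \<in> {a..b} \<Longrightarrow> \<bar>poly \<phi> x\<bar> \<le> C"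
  shows "\<bar>moment a b g \<phi>\<bar> \<le> S * C"
proof -
  have S0: "0 \<le> S" using assms(1) assms(3)[of a] by force
  have "\<bar>integral {a..b} (\<lambda>x. g x * poly \<phi> x)\<bar> \<le> (S * C) * (b - a)"
    using assms S0 by (intro abs_integral_le_sup continuous_intros)
      (auto simp: abs_mult intro!: mult_mono)
  then show ?thesis using assms(1) by (simp add: moment_def field_simps)
qed

lemma moment_diff:
  assumes "continuous_on {a..b} g" "continuous_on {a..b} h"
  shows "moment a b (\<lambda>x. g x - h x) \<phi> = moment a b g \<phi> - moment a b h \<phi>"
  unfolding moment_def
  by (simp add: left_diff_distrib integral_diff integrable_cont_poly assms diff_divide_distrib)

lemma pderiv_sum_smult:
  "pderiv (\<Sum>i\<in>A. smult (c i) (f i)) = (\<Sum>i\<in>A. smult (c i) (pderiv (f i)))"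
  by (induction A rule: infinite_finite_induct) (auto simp: pderiv_add pderiv_smult)

text \<open>Inverse inequalities. Both come from the expansion in the basis, the first through the
  \<open>L\<^sup>2\<close> norm of \<open>p\<close>, the second through its supremum.\<close>

lemma cell_basis_sup_inverse:
  assumes "cell_basis k C a b \<phi>" "a < b" "1 \<le> C" "degree p \<le> k" "x \<in> {a..b}"
  shows "(poly p x)\<^sup>2 \<le> (C * (k + 1))\<^sup>2 / (b - a) * integral {a..b} (\<lambda>x. (poly p x)\<^sup>2)"
    and "(\<And>y. y \<in> {a..b} \<Longrightarrow> \<bar>poly p y\<bar> \<le> S) \<Longrightarrow> \<bar>poly (pderiv p) x\<bar> \<le> C\<^sup>2 * (k + 1) * S / (b - a)"
proof -
  define c where "c i = moment a b (poly p) (\<phi> i)" for i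
  have p: "p = (\<Sum>i\<le>k. smult (c i) (\<phi> i))"
    using assms unfolding cell_basis_def c_def moment_def by blast
  have bd: "\<bar>poly (\<phi> i) y\<bar> \<le> C" "\<bar>poly (pderiv (\<phi> i)) y\<bar> \<le> C / (b - a)"
    if "i \<le> k" "y \<in> {a..b}" for i y
    using assms(1) that unfolding cell_basis_def by auto
  have "integral {a..b} (\<lambda>x. (poly p x)\<^sup>2) = integral {a..b} (\<lambda>x. \<Sum>i\<le>k. c i * (poly p x * poly (\<phi> i) x))"
  proof (rule integral_cong)
    fix x
    have "(poly p x)\<^sup>2 = poly p x * poly (\<Sum>i\<le>k. smult (c i) (\<phi> i)) x"
      using p by (simp add: power2_eq_square)
    also have "\<dots> = (\<Sum>i\<le>k. c i * (poly p x * poly (\<phi> i) x))"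
      by (simp add: poly_sum sum_distrib_left mult_ac)
    finally show "(poly p x)\<^sup>2 = \<dots>" .
  qed
  also have "\<dots> = (\<Sum>i\<le>k. c i * integral {a..b} (\<lambda>x. poly p x * poly (\<phi> i) x))"
    by (subst integral_sum) (auto intro!: integrable_continuous_interval continuous_intros)
  also have "\<dots> = (b - a) * (\<Sum>i\<le>k. (c i)\<^sup>2)"
    using assms(2) by (simp add: c_def moment_def power2_eq_square sum_distrib_left)
  finally have I: "(\<Sum>i\<le>k. (c i)\<^sup>2) = integral {a..b} (\<lambda>x. (poly p x)\<^sup>2) / (b - a)"
    using assms(2) by simp
  define m where "m = sqrt (integral {a..b} (\<lambda>x. (poly p x)\<^sup>2) / (b - a))"
  have I0: "0 \<le> integral {a..b} (\<lambda>x. (poly p x)\<^sup>2) / (b - a)"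
    unfolding I[symmetric] by (intro sum_nonneg) auto
  have m: "m\<^sup>2 = integral {a..b} (\<lambda>x. (poly p x)\<^sup>2) / (b - a)" "m \<ge> 0" using I0 by (auto simp: m_def)
  have ci: "\<bar>c i\<bar> \<le> m" if "i \<le> k" for i
  proof -
    have "(c i)\<^sup>2 \<le> m\<^sup>2"
      unfolding m(1) I[symmetric] by (rule member_le_sum) (use that in auto)
    then show ?thesis using m(2) by (simp add: abs_le_square_iff[symmetric])
  qed
  have "\<bar>poly p x\<bar> = \<bar>\<Sum>i\<le>k. c i * poly (\<phi> i) x\<bar>"
    by (subst p) (simp add: poly_sum)
  also have "\<dots> \<le> (\<Sum>i\<le>k. \<bar>c i * poly (\<phi> i) x\<bar>)" by (rule sum_abs)
  also have "\<dots> \<le> (\<Sum>i\<le>k. m * C)"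
    using ci bd(1)[OF _ assms(5)] assms(3) m(2) by (intro sum_mono) (auto simp: abs_mult intro!: mult_mono)
  also have "\<dots> = C * (k + 1) * m" by simp
  finally have "(poly p x)\<^sup>2 \<le> (C * (k + 1) * m)\<^sup>2"
    using abs_le_square_iff[of "poly p x" "C * (k + 1) * m"] m(2) assms(3) by (simp add: abs_mult)
  then show "(poly p x)\<^sup>2 \<le> (C * (k + 1))\<^sup>2 / (b - a) * integral {a..b} (\<lambda>x. (poly p x)\<^sup>2)"
    by (simp add: power_mult_distrib m)
  assume S: "\<And>y. y \<in> {a..b} \<Longrightarrow> \<bar>poly p y\<bar> \<le> S"
  have S0: "0 \<le> S" using S[OF assms(5)] by linarith
  have cS: "\<bar>c i\<bar> \<le> S * C" if "i \<le> k" for i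
    unfolding c_def using that S bd by (intro abs_moment_le assms) (auto intro!: continuous_intros)
  have "\<bar>poly (pderiv p) x\<bar> = \<bar>\<Sum>i\<le>k. c i * poly (pderiv (\<phi> i)) x\<bar>"
    by (subst p) (simp add: poly_sum pderiv_sum_smult)
  also have "\<dots> \<le> (\<Sum>i\<le>k. \<bar>c i * poly (pderiv (\<phi> i)) x\<bar>)" by (rule sum_abs)
  also have "\<dots> \<le> (\<Sum>i\<le>k. (S * C) * (C / (b - a)))"
  proof (rule sum_mono)
    fix i assume "i \<in> {..k}"
    then show "\<bar>c i * poly (pderiv (\<phi> i)) x\<bar> \<le> (S * C) * (C / (b - a))"
      unfolding abs_mult using cS[of i] bd(2)[OF _ assms(5), of i] assms(2,3) S0 by (intro mult_mono) auto
  qed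
  also have "\<dots> = C\<^sup>2 * (k + 1) * S / (b - a)" by (simp add: power2_eq_square)
  finally show "\<bar>poly (pderiv p) x\<bar> \<le> C\<^sup>2 * (k + 1) * S / (b - a)" .
qed

section \<open>The L2 projection\<close>

text \<open>The description in the definition of the projection is met by the truncated expansion in an
  orthogonal basis, and by nothing else: the difference of two solutions is orthogonal to itself.\<close>

lemma L2proj_characterization:
  assumes "a < b" "continuous_on {a..b} g"
  shows "degree (L2proj k a b g) \<le> k"
    and "degree q \<le> k \<Longrightarrow> integral {a..b} (\<lambda>x. (g x - poly (L2proj k a b g) x) * poly q x) = 0"
proof -
  obtain C \<phi> where "cell_basis k C a b \<phi>" using cell_basis_exists assms(1) by blast
  then have deg: "\<And>i. i \<le> k \<Longrightarrow> degree (\<phi> i) \<le> i"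
    and orth: "\<And>i j. i \<le> k \<Longrightarrow> j \<le> k \<Longrightarrow>
        integral {a..b} (\<lambda>x. poly (\<phi> i) x * poly (\<phi> j) x) = (if i = j then b - a else 0)"
    and span: "\<And>p. degree p \<le> k \<Longrightarrow>
        p = (\<Sum>i\<le>k. smult (integral {a..b} (\<lambda>x. poly p x * poly (\<phi> i) x) / (b - a)) (\<phi> i))"
    unfolding cell_basis_def by auto
  let ?P = "\<lambda>p. degree p \<le> k \<and>
    (\<forall>q. degree q \<le> k \<longrightarrow> integral {a..b} (\<lambda>x. (g x - poly p x) * poly q x) = 0)"
  define p where "p = (\<Sum>i\<le>k. smult (moment a b g (\<phi> i)) (\<phi> i))"
  have int1: "(\<lambda>x. (g x - poly r x) * poly q x) integrable_on {a..b}" for q r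
    by (intro integrable_continuous_interval continuous_intros assms)
  have pj: "integral {a..b} (\<lambda>x. (g x - poly p x) * poly (\<phi> j) x) = 0" if "j \<le> k" for j
  proof -
    have "integral {a..b} (\<lambda>x. (g x - poly p x) * poly (\<phi> j) x)
        = integral {a..b} (\<lambda>x. g x * poly (\<phi> j) x) - integral {a..b} (\<lambda>x. poly p x * poly (\<phi> j) x)"
      unfolding left_diff_distrib by (intro integral_diff integrable_cont_poly assms integrable_poly_mult)
    also have "integral {a..b} (\<lambda>x. poly p x * poly (\<phi> j) x)
        = integral {a..b} (\<lambda>x. \<Sum>i\<le>k. moment a b g (\<phi> i) * (poly (\<phi> i) x * poly (\<phi> j) x))"
      by (simp add: p_def poly_sum sum_distrib_right mult.assoc)
    also have "\<dots> = (\<Sum>i\<le>k. moment a b g (\<phi> i) * integral {a..b} (\<lambda>x. poly (\<phi> i) x * poly (\<phi> j) x))"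
      by (subst integral_sum) (auto intro!: integrable_continuous_interval continuous_intros)
    also have "\<dots> = (\<Sum>i\<le>k. if i = j then moment a b g (\<phi> i) * (b - a) else 0)"
      using orth that by (intro sum.cong) auto
    also have "\<dots> = moment a b g (\<phi> j) * (b - a)" using that by simp
    finally show ?thesis using assms(1) by (simp add: moment_def)
  qed
  have pq: "integral {a..b} (\<lambda>x. (g x - poly p x) * poly q x) = 0" if q: "degree q \<le> k" for q
  proof -
    define c where "c i = integral {a..b} (\<lambda>x. poly q x * poly (\<phi> i) x) / (b - a)" for i
    have qe: "q = (\<Sum>i\<le>k. smult (c i) (\<phi> i))" unfolding c_def by (rule span[OF q])
    have "integral {a..b} (\<lambda>x. (g x - poly p x) * poly q x)
        = integral {a..b} (\<lambda>x. \<Sum>i\<le>k. c i * ((g x - poly p x) * poly (\<phi> i) x))"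
      by (subst qe) (simp add: poly_sum sum_distrib_left mult_ac)
    also have "\<dots> = (\<Sum>i\<le>k. c i * integral {a..b} (\<lambda>x. (g x - poly p x) * poly (\<phi> i) x))"
      by (subst integral_sum) (auto intro!: integrable_continuous_interval continuous_intros assms)
    also have "\<dots> = 0" using pj by simp
    finally show ?thesis .
  qed
  have degp: "degree p \<le> k"
    unfolding p_def
    by (intro degree_sum_le) (use deg in \<open>auto intro!: order_trans[OF degree_smult_le] intro: order_trans\<close>)
  have P: "?P p" using degp pq by blast
  have uniq: "r = p" if r: "?P r" for r
  proof (rule ccontr)
    assume "r \<noteq> p"
    then have nz: "r - p \<noteq> 0" by simp
    have d: "degree (r - p) \<le> k" using r degp by (intro degree_diff_le) auto
    have "integral {a..b} (\<lambda>x. 1 * (poly (r - p) x)\<^sup>2)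
        = integral {a..b} (\<lambda>x. (g x - poly p x) * poly (r - p) x - (g x - poly r x) * poly (r - p) x)"
      by (simp add: power2_eq_square algebra_simps)
    also have "\<dots> = 0"
      by (subst integral_diff[OF int1 int1]) (use pq[OF d] r d in auto)
    finally show False
      using integral_weighted_square_pos[OF assms(1) nz, of "\<lambda>x. 1"] by auto
  qed
  have "L2proj k a b g = p"
    unfolding L2proj_def using P uniq by (rule the_equality)
  then show "degree (L2proj k a b g) \<le> k"
    and "degree q \<le> k \<Longrightarrow> integral {a..b} (\<lambda>x. (g x - poly (L2proj k a b g) x) * poly q x) = 0"
    using P by auto
qed

lemma L2proj_best:
  assumes "a < b" "continuous_on {a..b} g" "degree p \<le> k"
  shows "integral {a..b} (\<lambda>x. (g x - poly (L2proj k a b g) x)\<^sup>2) \<le> integral {a..b} (\<lambda>x. (g x - poly p x)\<^sup>2)"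
proof -
  let ?P = "L2proj k a b g"
  note P = L2proj_characterization[OF assms(1,2), where k = k]
  have d: "degree (?P - p) \<le> k" using P(1) assms(3) by (rule degree_diff_le)
  have i: "f integrable_on {a..b}" if "continuous_on {a..b} f" for f :: "real \<Rightarrow> real"
    using that by (rule integrable_continuous_interval)
  have "integral {a..b} (\<lambda>x. (g x - poly p x)\<^sup>2)
      = integral {a..b} (\<lambda>x. ((g x - poly ?P x)\<^sup>2 + 2 * ((g x - poly ?P x) * poly (?P - p) x)) + (poly (?P - p) x)\<^sup>2)"
    by (rule integral_cong) (simp add: power2_eq_square algebra_simps)
  also have "\<dots> = integral {a..b} (\<lambda>x. (g x - poly ?P x)\<^sup>2)
      + 2 * integral {a..b} (\<lambda>x. (g x - poly ?P x) * poly (?P - p) x)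
      + integral {a..b} (\<lambda>x. (poly (?P - p) x)\<^sup>2)"
    by (subst integral_add, (intro i continuous_intros assms)+)+ simp
  also have "\<dots> = integral {a..b} (\<lambda>x. (g x - poly ?P x)\<^sup>2) + integral {a..b} (\<lambda>x. (poly (?P - p) x)\<^sup>2)"
    using P(2)[OF d] by simp
  finally show ?thesis
    using integral_nonneg[of "\<lambda>x. (poly (?P - p) x)\<^sup>2" "{a..b}"]
    by (simp add: integrable_continuous_interval continuous_intros)
qed

lemma L2proj_cong:
  assumes "\<And>x. x \<in> {a..b} \<Longrightarrow> g x = h x"
  shows "L2proj k a b g = L2proj k a b h"
proof -
  have "integral {a..b} (\<lambda>x. (g x - poly p x) * poly q x) = integral {a..b} (\<lambda>x. (h x - poly p x) * poly q x)" for p q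
    using assms by (intro integral_cong) auto
  then show ?thesis by (simp add: L2proj_def)
qed

section \<open>Differentiation in time of the energy\<close>

text \<open>Integrate the Lagrange interpolation formula at \<open>n + 1\<close> points of the interval.\<close>

lemma interpolatory_quadrature:
  fixes a b :: real
  assumes "a < b"
  shows "\<exists>(w :: nat \<Rightarrow> real) x. (\<forall>i\<le>n. x i \<in> {a..b}) \<and>
    (\<forall>p :: real poly. degree p \<le> n \<longrightarrow> integral {a..b} (poly p) = (\<Sum>i\<le>n. w i * poly p (x i)))"
proof -
  define x where "x i = a + (b - a) * (real i / (n + 1))" for i
  have x: "x i \<in> {a..b}" if "i \<le> n" for i
  proof -
    have "0 \<le> real i / (n + 1)" "real i / (n + 1) \<le> 1" using that by auto
    then have "0 \<le> (b - a) * (real i / (n + 1))" "(b - a) * (real i / (n + 1)) \<le> (b - a) * 1"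
      using assms by (intro mult_nonneg_nonneg mult_left_mono; simp)+
    then show ?thesis by (simp add: x_def)
  qed
  have inj: "x i = x j \<longleftrightarrow> i = j" for i j
    using assms by (simp add: x_def)
  define l where "l i = (\<Prod>j\<in>{..n} - {i}. smult (1 / (x i - x j)) [:- x j, 1:])" for i
  have li: "poly (l i) (x m) = (if i = m then 1 else 0)" if "i \<le> n" "m \<le> n" for i m
  proof (cases "i = m")
    case True
    have "poly (smult (1 / (x i - x j)) [:- x j, 1:]) (x i) = 1" if "j \<noteq> i" for j
    proof -
      have "x i - x j \<noteq> 0" using inj[of i j] that by simp
      then show ?thesis by (simp add: diff_divide_distrib[symmetric])
    qed
    then show ?thesis unfolding l_def poly_prod using True by (intro trans[OF prod.neutral]) auto
  next
    case False
    then show ?thesis unfolding l_def poly_prod using that by (auto intro!: prod_zero bexI[of _ m])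
  qed
  have degl: "degree (l i) \<le> n" if "i \<le> n" for i
  proof -
    have "degree (l i) \<le> (\<Sum>j\<in>{..n} - {i}. degree (smult (1 / (x i - x j)) [:- x j, 1:]))"
      unfolding l_def by (rule order_trans[OF degree_prod_sum_le]) (simp_all only: comp_def finite_Diff finite_atMost order_refl)
    also have "\<dots> \<le> (\<Sum>j\<in>{..n} - {i}. 1)"
      by (intro sum_mono) (auto intro: order_trans[OF degree_smult_le])
    also have "\<dots> = n" using that by simp
    finally show ?thesis .
  qed
  have "integral {a..b} (poly p) = (\<Sum>i\<le>n. integral {a..b} (poly (l i)) * poly p (x i))"
    if p: "degree p \<le> n" for p
  proof -
    have "p = (\<Sum>i\<le>n. smult (poly p (x i)) (l i))"
    proof (rule poly_eqI_degree[where A = "x ` {..n}"])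
      have c: "card (x ` {..n}) = Suc n" using inj by (subst card_image) (auto intro: inj_onI)
      show "degree p < card (x ` {..n})" using p c by simp
      have "degree (\<Sum>i\<le>n. smult (poly p (x i)) (l i)) \<le> n"
        by (intro degree_sum_le) (use degl in \<open>auto intro!: order_trans[OF degree_smult_le]\<close>)
      then show "degree (\<Sum>i\<le>n. smult (poly p (x i)) (l i)) < card (x ` {..n})" using c by simp
      show "poly p y = poly (\<Sum>i\<le>n. smult (poly p (x i)) (l i)) y" if "y \<in> x ` {..n}" for y
      proof -
        from that obtain m where m: "m \<le> n" "y = x m" by auto
        have "(\<Sum>i\<le>n. poly p (x i) * poly (l i) (x m)) = (\<Sum>i\<le>n. if i = m then poly p (x i) else 0)"
          using li m by (intro sum.cong) auto
        then show ?thesis using m by (simp add: poly_sum)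
      qed
    qed
    then have "integral {a..b} (poly p) = integral {a..b} (\<lambda>y. \<Sum>i\<le>n. poly p (x i) * poly (l i) y)"
      by (intro integral_cong) (metis (no_types, lifting) poly_smult poly_sum sum.cong)
    also have "\<dots> = (\<Sum>i\<le>n. integral {a..b} (poly (l i)) * poly p (x i))"
      by (subst integral_sum) (auto intro!: integrable_continuous_interval continuous_intros simp: mult.commute)
    finally show ?thesis .
  qed
  then show ?thesis
    by (intro exI[of _ "\<lambda>i. integral {a..b} (poly (l i))"] exI[of _ x] conjI allI impI) (rule x)
qed

text \<open>The numerical solution is differentiable in time at each point of a cell only, and nothing is
  known about uniformity in \<open>x\<close>. For polynomials of bounded degree an exact quadrature rule replaces the
  integral by finitely many point values, for which pointwise derivatives suffice.\<close>

lemma has_derivative_integral_poly_square: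
  fixes e :: "real \<Rightarrow> real poly"
  assumes "a < b" and t: "t \<in> S"
    and deg: "\<And>s. s \<in> S \<Longrightarrow> degree (e s) \<le> k" "degree et \<le> k"
    and der: "\<And>x. x \<in> {a..b} \<Longrightarrow> ((\<lambda>s. poly (e s) x) has_real_derivative poly et x) (at t within S)"
  shows "((\<lambda>s. integral {a..b} (\<lambda>x. (poly (e s) x)\<^sup>2)) has_real_derivative
      2 * integral {a..b} (\<lambda>x. poly et x * poly (e t) x)) (at t within S)"
proof -
  obtain w x where x: "\<And>i. i \<le> 2 * k \<Longrightarrow> x i \<in> {a..b}" and
    q: "\<And>p :: real poly. degree p \<le> 2 * k \<Longrightarrow> integral {a..b} (poly p) = (\<Sum>i\<le>2 * k. w i * poly p (x i))"
    using interpolatory_quadrature[OF assms(1), of "2 * k"] by blast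
  have e2: "integral {a..b} (\<lambda>x. (poly (e s) x)\<^sup>2) = (\<Sum>i\<le>2 * k. w i * (poly (e s) (x i))\<^sup>2)" if "s \<in> S" for s
  proof -
    have "degree ((e s)\<^sup>2) \<le> 2 * k"
      using deg(1)[OF that] degree_power_le[of "e s" 2] by (simp add: mult.commute)
    from q[OF this] show ?thesis by (simp add: poly_power[abs_def])
  qed
  have et: "integral {a..b} (\<lambda>x. poly et x * poly (e t) x) = (\<Sum>i\<le>2 * k. w i * (poly et (x i) * poly (e t) (x i)))"
  proof -
    have "degree (et * e t) \<le> 2 * k"
      using deg(1)[OF t] deg(2) degree_mult_le[of et "e t"] by linarith
    from q[OF this] show ?thesis by (simp add: poly_mult[abs_def])
  qed
  have d: "((\<lambda>s. (poly (e s) y)\<^sup>2) has_real_derivative 2 * (poly et y * poly (e t) y)) (at t within S)"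
    if "y \<in> {a..b}" for y
    using DERIV_mult[OF der[OF that] der[OF that]] by (simp add: power2_eq_square algebra_simps)
  have "((\<lambda>s. \<Sum>i\<le>2 * k. w i * (poly (e s) (x i))\<^sup>2) has_real_derivative
      (\<Sum>i\<le>2 * k. w i * (2 * (poly et (x i) * poly (e t) (x i))))) (at t within S)"
    by (intro DERIV_sum DERIV_cmult d x) auto
  moreover have "(\<Sum>i\<le>2 * k. w i * (2 * (poly et (x i) * poly (e t) (x i))))
      = 2 * integral {a..b} (\<lambda>x. poly et x * poly (e t) x)"
    unfolding et sum_distrib_left by (intro sum.cong) auto
  ultimately have D: "((\<lambda>s. \<Sum>i\<le>2 * k. w i * (poly (e s) (x i))\<^sup>2) has_real_derivative
      2 * integral {a..b} (\<lambda>x. poly et x * poly (e t) x)) (at t within S)"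
    by simp
  show ?thesis
    by (rule has_field_derivative_transform_within[OF D zero_less_one t]) (simp add: e2)
qed

section \<open>Local projections\<close>

lemma moment_has_derivative:
  assumes "a < b" and t: "t \<in> {0..T}"
    and der: "\<And>s x. s \<in> {0..T} \<Longrightarrow> x \<in> {a..b} \<Longrightarrow>
      ((\<lambda>s. W s x) has_real_derivative Wt s x) (at s within {0..T})"
    and cWt: "continuous_on ({0..T} \<times> {a..b}) (\<lambda>(s, x). Wt s x)"
    and cW: "\<And>s. s \<in> {0..T} \<Longrightarrow> continuous_on {a..b} (W s)"
  shows "((\<lambda>s. moment a b (W s) \<phi>) has_real_derivative moment a b (Wt t) \<phi>) (at t within {0..T})"
proof -
  have "((\<lambda>s. integral (cbox a b) (\<lambda>x. W s x * poly \<phi> x)) has_field_derivative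
      integral (cbox a b) (\<lambda>x. Wt t x * poly \<phi> x)) (at t within {0..T})"
  proof (rule leibniz_rule_field_derivative)
    show "((\<lambda>s. W s x * poly \<phi> x) has_real_derivative Wt s x * poly \<phi> x) (at s within {0..T})"
      if "s \<in> {0..T}" "x \<in> cbox a b" for s x
      using der[of s x] that by (auto intro!: derivative_eq_intros)
    show "(\<lambda>x. W s x * poly \<phi> x) integrable_on cbox a b" if "s \<in> {0..T}" for s
      using cW[OF that] by auto
    have "continuous_on ({0..T} \<times> {a..b}) (\<lambda>z. (case z of (s, x) \<Rightarrow> Wt s x) * poly \<phi> (snd z))"
      by (intro continuous_intros cWt)
    then show "continuous_on ({0..T} \<times> cbox a b) (\<lambda>(s, x). Wt s x * poly \<phi> x)"
      by (simp add: case_prod_unfold)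
  qed (use t in auto)
  then show ?thesis unfolding moment_def cbox_interval by (rule DERIV_cdivide)
qed

text \<open>The properties of a local projection that enter the error estimate. The flags \<open>exl\<close>, \<open>exr\<close> demand
  exactness at the left and the right end. Unless both are set, the error is orthogonal to the
  polynomials of degree less than \<open>k\<close>, hence to the derivative of every test function; prescribing both
  end values uses up one degree of freedom too many for this. The last clause says that the projection
  commutes with differentiation in time.\<close>

definition cell_projector ::
  "nat \<Rightarrow> real \<Rightarrow> real \<Rightarrow> real \<Rightarrow> bool \<Rightarrow> bool \<Rightarrow> ((real \<Rightarrow> real) \<Rightarrow> real poly) \<Rightarrow> bool" where
  "cell_projector k C a b exl exr Q \<longleftrightarrow>
     (\<forall>g. degree (Q g) \<le> k) \<and>
     (\<forall>p. degree p \<le> k \<longrightarrow> Q (poly p) = p) \<and>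
     (\<forall>g h. continuous_on {a..b} g \<longrightarrow> continuous_on {a..b} h \<longrightarrow> Q (\<lambda>x. g x - h x) = Q g - Q h) \<and>
     (\<forall>g S. continuous_on {a..b} g \<longrightarrow> (\<forall>x\<in>{a..b}. \<bar>g x\<bar> \<le> S) \<longrightarrow> (\<forall>x\<in>{a..b}. \<bar>poly (Q g) x\<bar> \<le> C * S)) \<and>
     (exl \<longrightarrow> (\<forall>g. poly (Q g) a = g a)) \<and>
     (exr \<longrightarrow> (\<forall>g. poly (Q g) b = g b)) \<and>
     (\<not> (exl \<and> exr) \<longrightarrow> (\<forall>g p. continuous_on {a..b} g \<longrightarrow> degree p < k \<longrightarrow>
        integral {a..b} (\<lambda>x. (g x - poly (Q g) x) * poly p x) = 0)) \<and>
     (\<forall>T W Wt t. t \<in> {0..T} \<longrightarrow>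
        (\<forall>s\<in>{0..T}. \<forall>x\<in>{a..b}. ((\<lambda>s. W s x) has_real_derivative Wt s x) (at s within {0..T})) \<longrightarrow>
        continuous_on ({0..T} \<times> {a..b}) (\<lambda>(s, x). Wt s x) \<longrightarrow>
        (\<forall>s\<in>{0..T}. continuous_on {a..b} (W s)) \<longrightarrow>
        (\<forall>x\<in>{a..b}. ((\<lambda>s. poly (Q (W s)) x) has_real_derivative poly (Q (Wt t)) x) (at t within {0..T})))"

lemma affine_combination_diff:
  fixes A :: real
  shows "(A - B) + ((u - v) - (A' - B')) / d * z = (A + (u - A') / d * z) - (B + (v - B') / d * z)"
  by (simp add: divide_inverse algebra_simps)

text \<open>The Gauss-Radau projection: the first \<open>k\<close> moments are those of \<open>g\<close>, and the leading coefficient is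
  adjusted so that the value at \<open>e\<close> is that of \<open>g\<close>.\<close>

definition radau :: "nat \<Rightarrow> real \<Rightarrow> real \<Rightarrow> (nat \<Rightarrow> real poly) \<Rightarrow> real \<Rightarrow> (real \<Rightarrow> real) \<Rightarrow> real poly" where
  "radau k a b \<phi> e g = (\<Sum>i<k. smult (moment a b g (\<phi> i)) (\<phi> i)) +
     smult ((g e - (\<Sum>i<k. moment a b g (\<phi> i) * poly (\<phi> i) e)) / poly (\<phi> k) e) (\<phi> k)"

text \<open>All properties follow from the explicit formula. The stability constant is obtained by bounding
  each moment by \<open>C\<close> times the supremum and the division by \<open>poly (\<phi> k) e\<close> by a factor \<open>C\<close>.\<close>

lemma cell_projector_radau:
  assumes cb: "cell_basis k C a b \<phi>" and ab: "a < b" and C: "1 \<le> C" and e: "e \<in> {a, b}"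
  shows "cell_projector k (k * C\<^sup>2 + (1 + k * C\<^sup>2) * C\<^sup>2) a b (e = a) (e = b) (radau k a b \<phi> e)"
proof -
  have deg: "\<And>i. i \<le> k \<Longrightarrow> degree (\<phi> i) \<le> i"
    and orth: "\<And>i j. i \<le> k \<Longrightarrow> j \<le> k \<Longrightarrow>
        integral {a..b} (\<lambda>x. poly (\<phi> i) x * poly (\<phi> j) x) = (if i = j then b - a else 0)"
    and span: "\<And>p. degree p \<le> k \<Longrightarrow> p = (\<Sum>i\<le>k. smult (moment a b (poly p) (\<phi> i)) (\<phi> i))"
    and lead: "\<And>p. degree p < k \<Longrightarrow> integral {a..b} (\<lambda>x. poly p x * poly (\<phi> k) x) = 0"
    and bd: "\<And>i x. i \<le> k \<Longrightarrow> x \<in> {a..b} \<Longrightarrow> \<bar>poly (\<phi> i) x\<bar> \<le> C"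
    and ends: "1 \<le> C * \<bar>poly (\<phi> k) a\<bar>" "1 \<le> C * \<bar>poly (\<phi> k) b\<bar>"
    using cb unfolding cell_basis_def moment_def by auto
  have enz: "1 \<le> C * \<bar>poly (\<phi> k) e\<bar>" using e ends by auto
  then have nz: "poly (\<phi> k) e \<noteq> 0" by auto
  have ein: "e \<in> {a..b}" using e ab by auto
  let ?R = "radau k a b \<phi> e"
  have sumR: "poly (?R g) x = (\<Sum>i<k. moment a b g (\<phi> i) * poly (\<phi> i) x) +
      (g e - (\<Sum>i<k. moment a b g (\<phi> i) * poly (\<phi> i) e)) / poly (\<phi> k) e * poly (\<phi> k) x" for g x
    by (simp add: radau_def poly_sum)
  have exact: "poly (?R g) e = g e" for g
    using nz by (simp add: sumR)
  have degk: "degree (\<phi> i) \<le> k" if "i \<le> k" for i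
    using deg[OF that] that by linarith
  have degR: "degree (?R g) \<le> k" for g
    unfolding radau_def
  proof (rule degree_add_le)
    show "degree (\<Sum>i<k. smult (moment a b g (\<phi> i)) (\<phi> i)) \<le> k"
      by (intro degree_sum_le) (use degk in \<open>auto intro!: order_trans[OF degree_smult_le]\<close>)
    show "degree (smult ((g e - (\<Sum>i<k. moment a b g (\<phi> i) * poly (\<phi> i) e)) / poly (\<phi> k) e) (\<phi> k)) \<le> k"
      using degk[of k] by (auto intro: order_trans[OF degree_smult_le])
  qed
  have repro: "?R (poly p) = p" if p: "degree p \<le> k" for p
  proof -
    define c where "c i = moment a b (poly p) (\<phi> i)" for i
    have "{..k} = insert k {..<k}" by auto
    then have pe: "p = (\<Sum>i<k. smult (c i) (\<phi> i)) + smult (c k) (\<phi> k)"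
      using span[OF p] by (simp add: c_def add.commute)
    have "poly p e = (\<Sum>i<k. c i * poly (\<phi> i) e) + c k * poly (\<phi> k) e"
      by (subst pe) (simp add: poly_sum)
    then have ck: "(poly p e - (\<Sum>i<k. c i * poly (\<phi> i) e)) / poly (\<phi> k) e = c k"
      using nz by simp
    have "?R (poly p) = (\<Sum>i<k. smult (c i) (\<phi> i)) + smult (c k) (\<phi> k)"
      unfolding radau_def c_def[symmetric] ck ..
    then show ?thesis by (simp only: pe[symmetric])
  qed
  have diff: "?R (\<lambda>x. g x - h x) = ?R g - ?R h"
    if "continuous_on {a..b} g" "continuous_on {a..b} h" for g h
  proof -
    have sd: "(\<Sum>i<k. moment a b (\<lambda>x. g x - h x) (\<phi> i) * poly (\<phi> i) x)
        = (\<Sum>i<k. moment a b g (\<phi> i) * poly (\<phi> i) x) - (\<Sum>i<k. moment a b h (\<phi> i) * poly (\<phi> i) x)" for x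
      unfolding moment_diff[OF that] left_diff_distrib sum_subtractf ..
    have "poly (?R (\<lambda>x. g x - h x)) x = poly (?R g - ?R h) x" for x
      unfolding poly_diff sumR sd by (rule affine_combination_diff)
    then show ?thesis by (intro poly_eq_poly_eq_iff[THEN iffD1] ext)
  qed
  have bound: "\<bar>poly (?R g) x\<bar> \<le> (k * C\<^sup>2 + (1 + k * C\<^sup>2) * C\<^sup>2) * S"
    if g: "continuous_on {a..b} g" "\<And>y. y \<in> {a..b} \<Longrightarrow> \<bar>g y\<bar> \<le> S" and x: "x \<in> {a..b}" for g S x
  proof -
    have S0: "0 \<le> S" using g(2)[OF x] by linarith
    have m: "\<bar>moment a b g (\<phi> i)\<bar> \<le> S * C" if "i \<le> k" for i
      using g bd that by (intro abs_moment_le ab) auto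
    have s: "\<bar>\<Sum>i<k. moment a b g (\<phi> i) * poly (\<phi> i) y\<bar> \<le> k * (S * C * C)" if y: "y \<in> {a..b}" for y
    proof -
      have "\<bar>\<Sum>i<k. moment a b g (\<phi> i) * poly (\<phi> i) y\<bar> \<le> (\<Sum>i<k. \<bar>moment a b g (\<phi> i) * poly (\<phi> i) y\<bar>)"
        by (rule sum_abs)
      also have "\<dots> \<le> (\<Sum>i<k. (S * C) * C)"
      proof (rule sum_mono)
        fix i assume "i \<in> {..<k}"
        then show "\<bar>moment a b g (\<phi> i) * poly (\<phi> i) y\<bar> \<le> (S * C) * C"
          unfolding abs_mult using m[of i] bd[OF _ y, of i] S0 C by (intro mult_mono) auto
      qed
      finally show ?thesis by simp
    qed
    have inv: "1 / \<bar>poly (\<phi> k) e\<bar> \<le> C" using enz nz by (simp add: field_simps)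
    have "\<bar>(g e - (\<Sum>i<k. moment a b g (\<phi> i) * poly (\<phi> i) e)) / poly (\<phi> k) e * poly (\<phi> k) x\<bar>
        = \<bar>g e - (\<Sum>i<k. moment a b g (\<phi> i) * poly (\<phi> i) e)\<bar> * (1 / \<bar>poly (\<phi> k) e\<bar>) * \<bar>poly (\<phi> k) x\<bar>"
      by (simp add: abs_mult abs_divide)
    also have "\<dots> \<le> (S + k * (S * C * C)) * C * C"
      using s[OF ein] g(2)[OF ein] inv bd[OF _ x, of k] S0 C
      by (intro mult_mono) auto
    finally have "\<bar>poly (?R g) x\<bar> \<le> k * (S * C * C) + (S + k * (S * C * C)) * C * C"
      using s[OF x] unfolding sumR by linarith
    also have "\<dots> = (k * C\<^sup>2 + (1 + k * C\<^sup>2) * C\<^sup>2) * S"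
      by (simp add: power2_eq_square algebra_simps)
    finally show ?thesis .
  qed
  have orthR: "integral {a..b} (\<lambda>x. (g x - poly (?R g) x) * poly p x) = 0"
    if g: "continuous_on {a..b} g" and p: "degree p < k" for g p
  proof -
    have low: "integral {a..b} (\<lambda>x. (g x - poly (?R g) x) * poly (\<phi> j) x) = 0" if j: "j < k" for j
    proof -
      define B where "B = (g e - (\<Sum>i<k. moment a b g (\<phi> i) * poly (\<phi> i) e)) / poly (\<phi> k) e"
      have "integral {a..b} (\<lambda>x. poly (?R g) x * poly (\<phi> j) x)
          = integral {a..b} (\<lambda>x. (\<Sum>i<k. moment a b g (\<phi> i) * (poly (\<phi> i) x * poly (\<phi> j) x)) +
              B * (poly (\<phi> k) x * poly (\<phi> j) x))"
        unfolding sumR B_def[symmetric] by (simp add: sum_distrib_right distrib_right mult.assoc)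
      also have "\<dots> = integral {a..b} (\<lambda>x. \<Sum>i<k. moment a b g (\<phi> i) * (poly (\<phi> i) x * poly (\<phi> j) x)) +
              integral {a..b} (\<lambda>x. B * (poly (\<phi> k) x * poly (\<phi> j) x))"
        by (intro integral_add integrable_continuous_interval continuous_intros)
      also have "\<dots> = (\<Sum>i<k. moment a b g (\<phi> i) * integral {a..b} (\<lambda>x. poly (\<phi> i) x * poly (\<phi> j) x)) +
              B * integral {a..b} (\<lambda>x. poly (\<phi> k) x * poly (\<phi> j) x)"
        by (subst integral_sum) (auto intro!: integrable_continuous_interval continuous_intros)
      also have "\<dots> = (\<Sum>i<k. if i = j then moment a b g (\<phi> i) * (b - a) else 0)"
      proof -
        have "integral {a..b} (\<lambda>x. poly (\<phi> k) x * poly (\<phi> j) x) = 0" using orth[of k j] j by simp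
        moreover have "(\<Sum>i<k. moment a b g (\<phi> i) * integral {a..b} (\<lambda>x. poly (\<phi> i) x * poly (\<phi> j) x))
            = (\<Sum>i<k. if i = j then moment a b g (\<phi> i) * (b - a) else 0)"
        proof (rule sum.cong)
          fix i assume "i \<in> {..<k}"
          then show "moment a b g (\<phi> i) * integral {a..b} (\<lambda>x. poly (\<phi> i) x * poly (\<phi> j) x)
              = (if i = j then moment a b g (\<phi> i) * (b - a) else 0)"
            using orth[of i j] j by simp
        qed simp
        ultimately show ?thesis by simp
      qed
      also have "\<dots> = moment a b g (\<phi> j) * (b - a)" using j by simp
      finally have "integral {a..b} (\<lambda>x. poly (?R g) x * poly (\<phi> j) x) = moment a b g (\<phi> j) * (b - a)" .
      then show ?thesis
        unfolding left_diff_distrib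
        by (subst integral_diff) (use g ab in \<open>auto simp: moment_def\<close>)
    qed
    define c where "c i = moment a b (poly p) (\<phi> i)" for i
    have ck: "c k = 0" using lead[OF p] by (simp add: c_def moment_def)
    have pe: "p = (\<Sum>i\<le>k. smult (c i) (\<phi> i))" using span p by (simp add: c_def)
    have "integral {a..b} (\<lambda>x. (g x - poly (?R g) x) * poly p x)
        = integral {a..b} (\<lambda>x. \<Sum>i\<le>k. c i * ((g x - poly (?R g) x) * poly (\<phi> i) x))"
      by (subst pe) (simp add: poly_sum sum_distrib_left sum_distrib_right mult_ac)
    also have "\<dots> = (\<Sum>i\<le>k. c i * integral {a..b} (\<lambda>x. (g x - poly (?R g) x) * poly (\<phi> i) x))"
      by (subst integral_sum) (auto intro!: integrable_continuous_interval continuous_intros g)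
    also have "\<dots> = 0"
    proof (rule sum.neutral, rule ballI)
      fix i assume "i \<in> {..k}"
      then show "c i * integral {a..b} (\<lambda>x. (g x - poly (?R g) x) * poly (\<phi> i) x) = 0"
        using low[of i] ck by (cases "i = k") auto
    qed
    finally show ?thesis .
  qed
  have dt: "((\<lambda>s. poly (?R (W s)) x) has_real_derivative poly (?R (Wt t)) x) (at t within {0..T})"
    if "t \<in> {0..T}"
      "\<forall>s\<in>{0..T}. \<forall>x\<in>{a..b}. ((\<lambda>s. W s x) has_real_derivative Wt s x) (at s within {0..T})"
      "continuous_on ({0..T} \<times> {a..b}) (\<lambda>(s, x). Wt s x)"
      "\<forall>s\<in>{0..T}. continuous_on {a..b} (W s)" for T W Wt t x
  proof -
    have m: "((\<lambda>s. moment a b (W s) \<phi>) has_real_derivative moment a b (Wt t) \<phi>) (at t within {0..T})" for \<phi>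
      using that by (intro moment_has_derivative[OF ab]) auto
    have w: "((\<lambda>s. W s e) has_real_derivative Wt t e) (at t within {0..T})"
      using that ein by blast
    show ?thesis
      unfolding sumR by (intro DERIV_add DERIV_sum DERIV_cmult_right DERIV_cdivide DERIV_diff w m)
  qed
  show ?thesis
    unfolding cell_projector_def
    using degR repro diff bound exact orthR dt by (intro conjI allI impI ballI) auto
qed

text \<open>A projection exact at the right end is made exact at the left end as well by adding the multiple
  of \<open>b - x\<close> that corrects the left value.\<close>

lemma cell_projector_both_ends:
  assumes R: "cell_projector k C a b exl True Q" and ab: "a < b" and k: "1 \<le> k" and C: "0 \<le> C"
  shows "cell_projector k (1 + 2 * C) a b True True
    (\<lambda>g. Q g + smult ((g a - poly (Q g) a) / (b - a)) [:b, - 1:])"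
proof -
  let ?B = "\<lambda>g. Q g + smult ((g a - poly (Q g) a) / (b - a)) [:b, - 1:]"
  have Q: "\<And>g. degree (Q g) \<le> k" "\<And>p. degree p \<le> k \<Longrightarrow> Q (poly p) = p"
    "\<And>g h. continuous_on {a..b} g \<Longrightarrow> continuous_on {a..b} h \<Longrightarrow> Q (\<lambda>x. g x - h x) = Q g - Q h"
    "\<And>g S x. continuous_on {a..b} g \<Longrightarrow> (\<And>x. x \<in> {a..b} \<Longrightarrow> \<bar>g x\<bar> \<le> S) \<Longrightarrow> x \<in> {a..b} \<Longrightarrow>
       \<bar>poly (Q g) x\<bar> \<le> C * S"
    "\<And>g. poly (Q g) b = g b"
    using R unfolding cell_projector_def by auto
  have Qt: "\<And>T W Wt t x. t \<in> {0..T} \<Longrightarrow>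
        (\<forall>s\<in>{0..T}. \<forall>x\<in>{a..b}. ((\<lambda>s. W s x) has_real_derivative Wt s x) (at s within {0..T})) \<Longrightarrow>
        continuous_on ({0..T} \<times> {a..b}) (\<lambda>(s, x). Wt s x) \<Longrightarrow>
        (\<forall>s\<in>{0..T}. continuous_on {a..b} (W s)) \<Longrightarrow> x \<in> {a..b} \<Longrightarrow>
        ((\<lambda>s. poly (Q (W s)) x) has_real_derivative poly (Q (Wt t)) x) (at t within {0..T})"
    using R unfolding cell_projector_def by blast
  have ev: "poly (?B g) x = poly (Q g) x + (g a - poly (Q g) a) / (b - a) * (b - x)" for g x
  proof -
    define c where "c = (g a - poly (Q g) a) / (b - a)"
    show ?thesis unfolding c_def[symmetric] by (simp add: algebra_simps)
  qed
  have aI: "a \<in> {a..b}" using ab by simp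
  have deg: "degree (?B g) \<le> k" for g
    using Q(1) k by (intro degree_add_le) (auto intro!: order_trans[OF degree_smult_le])
  have bound: "\<bar>poly (?B g) x\<bar> \<le> (1 + 2 * C) * S"
    if g: "continuous_on {a..b} g" "\<And>y. y \<in> {a..b} \<Longrightarrow> \<bar>g y\<bar> \<le> S" and x: "x \<in> {a..b}" for g S x
  proof -
    have S0: "0 \<le> S" using g(2)[OF x] by linarith
    have q: "0 \<le> (b - x) / (b - a)" "(b - x) / (b - a) \<le> 1" using x ab by (auto simp: field_simps)
    have "\<bar>(g a - poly (Q g) a) / (b - a) * (b - x)\<bar> = \<bar>g a - poly (Q g) a\<bar> * ((b - x) / (b - a))"
      using x ab by (simp add: abs_mult abs_divide)
    also have "\<dots> \<le> \<bar>g a - poly (Q g) a\<bar> * 1" using q by (intro mult_left_mono) auto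
    also have "\<dots> \<le> S + C * S" using g(2)[OF aI] Q(4)[OF g aI] by auto
    finally have "\<bar>(g a - poly (Q g) a) / (b - a) * (b - x)\<bar> \<le> S + C * S" .
    then have "\<bar>poly (?B g) x\<bar> \<le> C * S + (S + C * S)"
      unfolding ev using Q(4)[OF g x] by linarith
    then show ?thesis by (simp add: algebra_simps)
  qed
  have dt: "((\<lambda>s. poly (?B (W s)) x) has_real_derivative poly (?B (Wt t)) x) (at t within {0..T})"
    if *: "t \<in> {0..T}"
      "\<forall>s\<in>{0..T}. \<forall>x\<in>{a..b}. ((\<lambda>s. W s x) has_real_derivative Wt s x) (at s within {0..T})"
      "continuous_on ({0..T} \<times> {a..b}) (\<lambda>(s, x). Wt s x)"
      "\<forall>s\<in>{0..T}. continuous_on {a..b} (W s)" "x \<in> {a..b}" for T W Wt t x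
  proof -
    have w: "((\<lambda>s. W s a) has_real_derivative Wt t a) (at t within {0..T})"
      using * aI by blast
    show ?thesis
      unfolding ev
      by (intro DERIV_add DERIV_cmult_right DERIV_cdivide DERIV_diff w Qt[OF *] Qt[OF *(1-4) aI])
  qed
  have diff: "?B (\<lambda>x. g x - h x) = ?B g - ?B h"
    if "continuous_on {a..b} g" "continuous_on {a..b} h" for g h
  proof -
    have "poly (?B (\<lambda>x. g x - h x)) x = poly (?B g - ?B h) x" for x
      unfolding poly_diff ev ev[of "\<lambda>x. g x - h x"] unfolding Q(3)[OF that] poly_diff
      by (rule affine_combination_diff)
    then show ?thesis by (intro poly_eq_poly_eq_iff[THEN iffD1] ext)
  qed
  show ?thesis
    unfolding cell_projector_def
  proof (intro conjI allI impI ballI)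
    show "degree (?B g) \<le> k" for g by (rule deg)
    show "?B (poly p) = p" if "degree p \<le> k" for p using Q(2)[OF that] by simp
    show "?B (\<lambda>x. g x - h x) = ?B g - ?B h" if "continuous_on {a..b} g" "continuous_on {a..b} h" for g h
      using that by (rule diff)
    show "\<bar>poly (?B g) x\<bar> \<le> (1 + 2 * C) * S"
      if "continuous_on {a..b} g" "\<forall>y\<in>{a..b}. \<bar>g y\<bar> \<le> S" "x \<in> {a..b}" for g S x
      using bound[of g S x] that by blast
    show "poly (?B g) a = g a" for g using ab unfolding ev by simp
    show "poly (?B g) b = g b" for g unfolding ev using Q(5) by simp
    show "((\<lambda>s. poly (?B (W s)) x) has_real_derivative poly (?B (Wt t)) x) (at t within {0..T})"
      if "t \<in> {0..T}"
        "\<forall>s\<in>{0..T}. \<forall>x\<in>{a..b}. ((\<lambda>s. W s x) has_real_derivative Wt s x) (at s within {0..T})"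
        "continuous_on ({0..T} \<times> {a..b}) (\<lambda>(s, x). Wt s x)"
        "\<forall>s\<in>{0..T}. continuous_on {a..b} (W s)" "x \<in> {a..b}" for T W Wt t x
      using that by (rule dt)
  qed simp
qed

lemma cell_projector_mono:
  assumes "cell_projector k C a b exl exr Q" "C \<le> C'" "exl' \<longrightarrow> exl" "exr' \<longrightarrow> exr"
    "exl \<and> exr \<longrightarrow> exl' \<and> exr'" "a < b"
  shows "cell_projector k C' a b exl' exr' Q"
proof -
  have "\<bar>poly (Q g) x\<bar> \<le> C' * S"
    if "continuous_on {a..b} g" "\<forall>x\<in>{a..b}. \<bar>g x\<bar> \<le> S" "x \<in> {a..b}" for g S x
  proof -
    have "0 \<le> S" using that by force
    then have "C * S \<le> C' * S" using assms(2) by (rule mult_right_mono[rotated])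
    moreover have "\<bar>poly (Q g) x\<bar> \<le> C * S" using assms(1) that unfolding cell_projector_def by blast
    ultimately show ?thesis by linarith
  qed
  then show ?thesis using assms unfolding cell_projector_def by blast
qed

text \<open>If no exactness is demanded, the projection exact at the right end serves, since its error is
  orthogonal to the polynomials of degree less than \<open>k\<close>.\<close>

lemma cell_projector_exists:
  assumes "1 \<le> k"
  shows "\<exists>C\<ge>1. \<forall>a b exl exr. a < b \<longrightarrow> (\<exists>Q. cell_projector k C a b exl exr Q)"
proof -
  obtain C where C: "C \<ge> 1" "\<And>a b. a < b \<Longrightarrow> \<exists>\<phi>. cell_basis k C a b \<phi>"
    using cell_basis_exists[of k] by blast
  define D where "D = k * C\<^sup>2 + (1 + k * C\<^sup>2) * C\<^sup>2"
  have D: "0 \<le> D" by (simp add: D_def)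
  have "\<exists>Q. cell_projector k (1 + 2 * D) a b exl exr Q" if ab: "a < b" for a b exl exr
  proof -
    obtain \<phi> where \<phi>: "cell_basis k C a b \<phi>" using C(2)[OF ab] by blast
    have L: "cell_projector k D a b True False (radau k a b \<phi> a)"
      using cell_projector_radau[OF \<phi> ab C(1), of a] ab by (simp add: D_def)
    have R: "cell_projector k D a b False True (radau k a b \<phi> b)"
      using cell_projector_radau[OF \<phi> ab C(1), of b] ab by (simp add: D_def)
    consider "exl" "exr" | "exl" "\<not> exr" | "\<not> exl" by blast
    then show ?thesis
    proof cases
      case 1
      then show ?thesis using cell_projector_both_ends[OF R ab assms D] by auto
    next
      case 2
      then show ?thesis using cell_projector_mono[OF L, of "1 + 2 * D" exl exr] D ab by auto
    next
      case 3
      then show ?thesis using cell_projector_mono[OF R, of "1 + 2 * D" exl exr] D ab by auto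
    qed
  qed
  moreover have "1 \<le> 1 + 2 * D" using D by simp
  ultimately show ?thesis by blast
qed

text \<open>Polynomials of degree \<open>k\<close> are reproduced, so the error of \<open>g\<close> is that of \<open>g - p\<close>.\<close>

lemma cell_projector_error:
  assumes Q: "cell_projector k C a b exl exr Q" and C: "0 \<le> C"
    and g: "continuous_on {a..b} g" and p: "degree p \<le> k"
    and S: "\<And>x. x \<in> {a..b} \<Longrightarrow> \<bar>g x - poly p x\<bar> \<le> S" and x: "x \<in> {a..b}"
  shows "\<bar>g x - poly (Q g) x\<bar> \<le> (1 + C) * S"
proof -
  have c: "continuous_on {a..b} (poly p)" by (intro continuous_intros)
  have "Q (\<lambda>x. g x - poly p x) = Q g - p"
    using Q g c p unfolding cell_projector_def by metis
  moreover have "\<bar>poly (Q (\<lambda>x. g x - poly p x)) x\<bar> \<le> C * S"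
    using Q S x continuous_on_diff[OF g c] unfolding cell_projector_def by blast
  ultimately have "\<bar>poly (Q g) x - poly p x\<bar> \<le> C * S" by simp
  then show ?thesis using S[OF x] by (simp add: algebra_simps abs_le_iff)
qed

section \<open>Node estimates\<close>

lemma continuous_antiderivative:
  fixes f :: "real \<Rightarrow> real"
  assumes "continuous_on UNIV f"
  shows "\<exists>\<Phi>. \<forall>x\<in>{- R..R}. (\<Phi> has_real_derivative f x) (at x)"
proof -
  have c: "continuous_on {- R - 1..R + 1} f" using assms continuous_on_subset by blast
  have "((\<lambda>u. integral {- R - 1..u} f) has_real_derivative f x) (at x)" if x: "x \<in> {- R..R}" for x
  proof -
    have "((\<lambda>u. integral {- R - 1..u} f) has_real_derivative f x) (at x within {- R - 1..R + 1})"
      using x by (intro integral_has_real_derivative c) auto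
    moreover have "x \<in> interior {- R - 1..R + 1}" using x by simp
    ultimately show ?thesis by (simp only: at_within_interior)
  qed
  then show ?thesis by blast
qed

lemma mvt_segment:
  fixes \<Phi> :: "real \<Rightarrow> real"
  assumes "\<And>x. x \<in> closed_segment p q \<Longrightarrow> (\<Phi> has_real_derivative f x) (at x)"
  shows "\<exists>\<xi>\<in>closed_segment p q. \<Phi> q - \<Phi> p = (q - p) * f \<xi>"
proof -
  consider "p < q" | "p = q" | "q < p" by linarith
  then show ?thesis
  proof cases
    case 1
    with MVT2[of p q \<Phi> f] assms show ?thesis
      by (force simp: closed_segment_eq_real_ivl)
  next
    case 2
    then show ?thesis by auto
  next
    case 3
    with MVT2[of q p \<Phi> f] assms obtain z where "q < z" "z < p" "\<Phi> p - \<Phi> q = (p - q) * f z"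
      by (auto simp: closed_segment_eq_real_ivl)
    then show ?thesis using 3 by (intro bexI[of _ z]) (auto simp: closed_segment_eq_real_ivl algebra_simps)
  qed
qed

lemma segment_subset_interval:
  fixes p q R :: real
  assumes "p \<in> {- R..R}" "q \<in> {- R..R}" "x \<in> closed_segment p q"
  shows "x \<in> {- R..R}"
  using assms by (auto simp: closed_segment_eq_real_ivl split: if_splits)

text \<open>The quantity is the integral of \<open>F - f\<close> from \<open>y1\<close> to \<open>y2\<close>. The integrand is nonpositive between
  \<open>u1\<close> and \<open>u2\<close>, the two remaining pieces have length at most \<open>\<eta>\<close>, and on them the integrand is at most
  \<open>L \<eta>\<close>. If \<open>y1\<close> and \<open>y2\<close> are within \<open>4 \<eta>\<close>, so that the pieces might overlap, the length and the
  integrand are both \<open>O(\<eta>)\<close> anyway.\<close>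

lemma entropy_flux_node:
  fixes f \<Phi> :: "real \<Rightarrow> real"
  assumes \<Phi>: "\<And>x. x \<in> {- R..R} \<Longrightarrow> (\<Phi> has_real_derivative f x) (at x)"
    and fL: "\<And>x y. x \<in> {- R..R} \<Longrightarrow> y \<in> {- R..R} \<Longrightarrow> \<bar>f x - f y\<bar> \<le> L * \<bar>x - y\<bar>"
    and L: "0 \<le> L"
    and FL: "\<And>s. s \<in> {- R..R} \<Longrightarrow> \<bar>F - f s\<bar> \<le> L * (\<bar>u1 - s\<bar> + \<bar>u2 - s\<bar>)"
    and E: "\<And>s. u1 \<le> s \<Longrightarrow> s \<le> u2 \<Longrightarrow> F \<le> f s"
    and y: "y1 < y2" "y1 \<in> {- R..R}" "y2 \<in> {- R..R}"
    and u: "u1 \<in> {- R..R}" "u2 \<in> {- R..R}" "\<bar>u1 - y1\<bar> \<le> \<eta>" "\<bar>u2 - y2\<bar> \<le> \<eta>"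
  shows "F * (y2 - y1) - (\<Phi> y2 - \<Phi> y1) \<le> 40 * L * \<eta>\<^sup>2"
proof -
  have \<eta>0: "0 \<le> \<eta>" using u by linarith
  show ?thesis
  proof (cases "y2 - y1 \<le> 4 * \<eta>")
    case True
    obtain \<xi> where \<xi>: "y1 < \<xi>" "\<xi> < y2" "\<Phi> y2 - \<Phi> y1 = (y2 - y1) * f \<xi>"
      using MVT2[of y1 y2 \<Phi> f] \<Phi> y by auto
    have "\<bar>F - f \<xi>\<bar> \<le> L * (\<bar>u1 - \<xi>\<bar> + \<bar>u2 - \<xi>\<bar>)" using FL \<xi> y by auto
    also have "\<dots> \<le> L * (10 * \<eta>)" using True \<xi> u L by (intro mult_left_mono) auto
    finally have "(F - f \<xi>) * (y2 - y1) \<le> (L * (10 * \<eta>)) * (4 * \<eta>)"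
      using True y L \<eta>0 by (intro mult_mono) auto
    then show ?thesis using \<xi>(3) by (simp add: power2_eq_square algebra_simps)
  next
    case False
    have low: "\<Phi> q - \<Phi> p \<ge> m * (q - p)"
      if "p \<le> q" "p \<in> {- R..R}" "q \<in> {- R..R}" "\<And>s. p \<le> s \<Longrightarrow> s \<le> q \<Longrightarrow> m \<le> f s" for p q m
    proof (cases "p = q")
      case False
      then have "p < q" using that by simp
      moreover have "(\<Phi> has_real_derivative f x) (at x)" if "p \<le> x" "x \<le> q" for x
        using that \<open>p \<in> {- R..R}\<close> \<open>q \<in> {- R..R}\<close> by (intro \<Phi>) auto
      ultimately obtain \<xi> where \<xi>: "p < \<xi>" "\<xi> < q" "\<Phi> q - \<Phi> p = (q - p) * f \<xi>"
        using MVT2[of p q \<Phi> f] by blast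
      then have "m * (q - p) \<le> f \<xi> * (q - p)" using that by (intro mult_right_mono) auto
      then show ?thesis using \<xi> by (simp add: mult.commute)
    qed auto
    define c where "c = max u1 y1"
    define d where "d = min u2 y2"
    have cd: "y1 \<le> c" "c \<le> y1 + \<eta>" "c \<le> d" "d \<le> y2" "y2 - \<eta> \<le> d" "u1 \<le> c" "d \<le> u2"
        "c \<in> {- R..R}" "d \<in> {- R..R}"
      using u y False by (auto simp: c_def d_def)
    have 1: "\<Phi> d - \<Phi> c \<ge> F * (d - c)" using cd by (intro low E) auto
    have near: "F - L * \<eta> \<le> f s" if "s \<in> {- R..R}" "z \<in> {c, d}" "\<bar>s - z\<bar> \<le> \<eta>" for s z
    proof -
      have "F \<le> f z" using that cd by (intro E) auto
      moreover have "\<bar>f z - f s\<bar> \<le> L * \<bar>z - s\<bar>" using that cd by (intro fL) auto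
      moreover have "L * \<bar>z - s\<bar> \<le> L * \<eta>" using that L by (intro mult_left_mono) auto
      ultimately show ?thesis by linarith
    qed
    have 2: "\<Phi> c - \<Phi> y1 \<ge> (F - L * \<eta>) * (c - y1)"
      using cd y by (intro low near[of _ c]) auto
    have 3: "\<Phi> y2 - \<Phi> d \<ge> (F - L * \<eta>) * (y2 - d)"
      using cd y by (intro low near[of _ d]) auto
    have "L * \<eta> * ((c - y1) + (y2 - d)) \<le> L * \<eta> * (2 * \<eta>)"
      using cd L \<eta>0 by (intro mult_left_mono) auto
    then have "F * (y2 - y1) - (\<Phi> y2 - \<Phi> y1) \<le> L * \<eta> * (2 * \<eta>)"
      using 1 2 3 by (simp add: algebra_simps)
    also have "\<dots> \<le> 40 * L * \<eta>\<^sup>2" using L by (simp add: power2_eq_square mult_right_mono)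
    finally show ?thesis .
  qed
qed

text \<open>A consistent monotone flux satisfies \<open>fh u1 u2 \<le> fh s u2 \<le> fh s s = f s\<close> for \<open>u1 \<le> s \<le> u2\<close>, so the
  preceding lemma applies; if \<open>y2 < y1\<close>, it is applied to \<open>- f\<close> with the two sides exchanged.\<close>

lemma monotone_flux_node:
  fixes f \<Phi> :: "real \<Rightarrow> real"
  assumes mono: "monotone_flux f fh"
    and \<Phi>: "\<And>x. x \<in> {- R..R} \<Longrightarrow> (\<Phi> has_real_derivative f x) (at x)"
    and fL: "\<And>x y. x \<in> {- R..R} \<Longrightarrow> y \<in> {- R..R} \<Longrightarrow> \<bar>f x - f y\<bar> \<le> L * \<bar>x - y\<bar>"
    and fhL: "\<And>x y x' y'. x \<in> {- R..R} \<Longrightarrow> y \<in> {- R..R} \<Longrightarrow> x' \<in> {- R..R} \<Longrightarrow> y' \<in> {- R..R} \<Longrightarrow>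
        \<bar>fh x y - fh x' y'\<bar> \<le> L * (\<bar>x - x'\<bar> + \<bar>y - y'\<bar>)"
    and L: "0 \<le> L"
    and y: "y1 \<in> {- R..R}" "y2 \<in> {- R..R}"
    and u: "u1 \<in> {- R..R}" "u2 \<in> {- R..R}" "\<bar>u1 - y1\<bar> \<le> \<eta>" "\<bar>u2 - y2\<bar> \<le> \<eta>"
  shows "fh u1 u2 * (y2 - y1) - (\<Phi> y2 - \<Phi> y1) \<le> 40 * L * \<eta>\<^sup>2"
proof -
  have m1: "\<And>x x' z. x \<le> x' \<Longrightarrow> fh x z \<le> fh x' z" and m2: "\<And>x x' z. x \<le> x' \<Longrightarrow> fh z x' \<le> fh z x"
    and cons: "\<And>z. fh z z = f z"
    using mono unfolding monotone_flux_def numerical_flux_def mono_def antimono_def by auto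
  have FL: "\<bar>fh u1 u2 - f s\<bar> \<le> L * (\<bar>u1 - s\<bar> + \<bar>u2 - s\<bar>)" if "s \<in> {- R..R}" for s
    using fhL[OF u(1,2) that that] cons by simp
  consider "y1 < y2" | "y1 = y2" | "y2 < y1" by linarith
  then show ?thesis
  proof cases
    case 1
    have "fh u1 u2 \<le> f s" if "u1 \<le> s" "s \<le> u2" for s
      using m1[OF that(1), of u2] m2[OF that(2), of s] cons[of s] by linarith
    from entropy_flux_node[OF \<Phi> fL L FL this 1 y u] show ?thesis .
  next
    case 2
    then show ?thesis using L by simp
  next
    case 3
    have E: "- fh u1 u2 \<le> - f s" if "u2 \<le> s" "s \<le> u1" for s
      using m1[OF that(2), of u2] m2[OF that(1), of s] cons[of s] by linarith
    have "- fh u1 u2 * (y1 - y2) - (- \<Phi> y1 - - \<Phi> y2) \<le> 40 * L * \<eta>\<^sup>2"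
    proof (rule entropy_flux_node[where f = "\<lambda>x. - f x" and R = R])
      show "((\<lambda>x. - \<Phi> x) has_real_derivative - f x) (at x)" if "x \<in> {- R..R}" for x
        using \<Phi>[OF that] by (rule DERIV_minus)
      show "\<bar>- f x - - f y\<bar> \<le> L * \<bar>x - y\<bar>" if "x \<in> {- R..R}" "y \<in> {- R..R}" for x y
        using fL[OF that] by linarith
      show "\<bar>- fh u1 u2 - - f s\<bar> \<le> L * (\<bar>u2 - s\<bar> + \<bar>u1 - s\<bar>)" if "s \<in> {- R..R}" for s
        using FL[OF that] by (simp add: add.commute abs_minus_commute)
    qed (use E 3 L y u in auto)
    then show ?thesis by (simp add: algebra_simps)
  qed
qed

text \<open>If the upwind trace is exact, the flux is \<open>f y1\<close>, and two applications of the mean value theorem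
  turn the quantity into \<open>- (\<xi> - y1) (y2 - y1) f' \<zeta>\<close> with \<open>\<zeta>\<close> between \<open>y1\<close> and \<open>y2\<close>. The first
  product is nonnegative, and \<open>f'\<close> is at least \<open>- L \<eta>\<close> there, because \<open>\<zeta>\<close> is within \<open>\<eta>\<close> of the
  segment on which \<open>f'\<close> is nonnegative.\<close>

lemma upwind_node_exact_trace:
  fixes f f' \<Phi> :: "real \<Rightarrow> real"
  assumes \<Phi>: "\<And>x. x \<in> {- R..R} \<Longrightarrow> (\<Phi> has_real_derivative f x) (at x)"
    and f': "\<And>x. x \<in> {- R..R} \<Longrightarrow> (f has_real_derivative f' x) (at x)"
    and fL: "\<And>x y. x \<in> {- R..R} \<Longrightarrow> y \<in> {- R..R} \<Longrightarrow> \<bar>f' x - f' y\<bar> \<le> L * \<bar>x - y\<bar>"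
    and L: "0 \<le> L"
    and pos: "\<And>s. s \<in> closed_segment y1 u2 \<Longrightarrow> 0 \<le> f' s"
    and y: "y1 \<in> {- R..R}" "y2 \<in> {- R..R}" "u2 \<in> {- R..R}" "\<bar>u2 - y2\<bar> \<le> \<eta>"
  shows "f y1 * (y2 - y1) - (\<Phi> y2 - \<Phi> y1) \<le> L * \<eta> * (y2 - y1)\<^sup>2"
proof -
  have \<eta>0: "0 \<le> \<eta>" using y by linarith
  obtain \<xi> where \<xi>: "\<xi> \<in> closed_segment y1 y2" "\<Phi> y2 - \<Phi> y1 = (y2 - y1) * f \<xi>"
    using mvt_segment[of y1 y2 \<Phi> f] \<Phi> segment_subset_interval[OF y(1,2)] by blast
  have \<xi>R: "\<xi> \<in> {- R..R}" using segment_subset_interval[OF y(1,2) \<xi>(1)] .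
  obtain \<zeta> where \<zeta>: "\<zeta> \<in> closed_segment y1 \<xi>" "f \<xi> - f y1 = (\<xi> - y1) * f' \<zeta>"
    using mvt_segment[of y1 \<xi> f f'] f' segment_subset_interval[OF y(1) \<xi>R] by blast
  have \<zeta>2: "\<zeta> \<in> closed_segment y1 y2"
    using \<xi>(1) \<zeta>(1) by (auto simp: closed_segment_eq_real_ivl split: if_splits)
  then obtain \<theta> where \<theta>: "0 \<le> \<theta>" "\<theta> \<le> 1" "\<zeta> = (1 - \<theta>) * y1 + \<theta> * y2"
    by (auto simp: closed_segment_def)
  \<comment> \<open>The point of the segment from \<open>y1\<close> to \<open>u2\<close> that corresponds to \<open>\<zeta>\<close>.\<close>
  define s where "s = (1 - \<theta>) * y1 + \<theta> * u2"
  have s: "s \<in> closed_segment y1 u2" using \<theta> by (auto simp: closed_segment_def s_def)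
  have sR: "s \<in> {- R..R}" "\<zeta> \<in> {- R..R}"
    using segment_subset_interval[OF y(1,3) s] segment_subset_interval[OF y(1,2) \<zeta>2] .
  have "\<zeta> - s = \<theta> * (y2 - u2)" unfolding s_def \<theta>(3) by (simp add: algebra_simps)
  then have "\<bar>\<zeta> - s\<bar> = \<theta> * \<bar>u2 - y2\<bar>" using \<theta>(1) by (simp add: abs_mult abs_minus_commute)
  also have "\<dots> \<le> 1 * \<eta>" using \<theta> y \<eta>0 by (intro mult_mono) auto
  finally have "L * \<bar>\<zeta> - s\<bar> \<le> L * \<eta>" using L by (intro mult_left_mono) auto
  then have low: "- (L * \<eta>) \<le> f' \<zeta>"
    using fL[OF sR(2,1)] pos[OF s] by linarith
  have pr: "0 \<le> (\<xi> - y1) * (y2 - y1)" "(\<xi> - y1) * (y2 - y1) \<le> (y2 - y1)\<^sup>2"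
  proof -
    obtain r where r: "0 \<le> r" "r \<le> 1" "\<xi> = (1 - r) * y1 + r * y2"
      using \<xi>(1) by (auto simp: closed_segment_def)
    have e: "(\<xi> - y1) * (y2 - y1) = r * (y2 - y1)\<^sup>2"
      unfolding r(3) by (simp add: power2_eq_square algebra_simps)
    show "0 \<le> (\<xi> - y1) * (y2 - y1)" "(\<xi> - y1) * (y2 - y1) \<le> (y2 - y1)\<^sup>2"
      unfolding e using r by (auto intro: mult_left_le_one_le)
  qed
  have "f y1 * (y2 - y1) - (\<Phi> y2 - \<Phi> y1) = ((\<xi> - y1) * (y2 - y1)) * (- f' \<zeta>)"
  proof -
    have "f y1 * (y2 - y1) - (\<Phi> y2 - \<Phi> y1) = - ((y2 - y1) * (f \<xi> - f y1))"
      unfolding \<xi>(2) by (simp add: algebra_simps)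
    then show ?thesis unfolding \<zeta>(2) by (simp add: mult_ac)
  qed
  also have "\<dots> \<le> ((\<xi> - y1) * (y2 - y1)) * (L * \<eta>)"
    using pr(1) low by (intro mult_left_mono) auto
  also have "\<dots> \<le> (y2 - y1)\<^sup>2 * (L * \<eta>)"
    using pr L \<eta>0 by (intro mult_right_mono) auto
  finally show ?thesis by (simp add: mult_ac)
qed

text \<open>Here \<open>w\<close> is the exact solution at the node, \<open>e1\<close>, \<open>e2\<close> are the traces of the error and \<open>\<eta>1\<close>, \<open>\<eta>2\<close>
  those of the projection error. If both vanish, the bound for monotone fluxes with \<open>\<eta> = 0\<close> suffices. If
  only the upwind one vanishes and \<open>f'\<close> has one sign between the traces of \<open>u\<close>, the flux is evaluated
  exactly. Otherwise \<open>f'\<close> differs by at least \<open>c\<close> from its value at \<open>w\<close> somewhere between the traces;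
  as \<open>L \<eta> \<le> c / 2\<close>, the traces of \<open>e\<close> must account for half of this, so that
  \<open>e1\<^sup>2 + e2\<^sup>2 \<ge> c\<^sup>2 / (8 L\<^sup>2)\<close>, and the bound \<open>40 L \<eta>\<^sup>2\<close> for monotone fluxes can be multiplied by
  \<open>8 L\<^sup>2 (e1\<^sup>2 + e2\<^sup>2) / c\<^sup>2 \<ge> 1\<close>.\<close>

lemma upwind_flux_node:
  fixes f \<Phi> :: "real \<Rightarrow> real"
  assumes up: "upwind_flux f fh"
    and \<Phi>: "\<And>x. x \<in> {- R..R} \<Longrightarrow> (\<Phi> has_real_derivative f x) (at x)"
    and f': "\<And>x. (f has_real_derivative deriv f x) (at x)"
    and fL: "\<And>x y. x \<in> {- R..R} \<Longrightarrow> y \<in> {- R..R} \<Longrightarrow> \<bar>f x - f y\<bar> \<le> L * \<bar>x - y\<bar>"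
    and f'L: "\<And>x y. x \<in> {- R..R} \<Longrightarrow> y \<in> {- R..R} \<Longrightarrow> \<bar>deriv f x - deriv f y\<bar> \<le> L * \<bar>x - y\<bar>"
    and fhL: "\<And>x y x' y'. x \<in> {- R..R} \<Longrightarrow> y \<in> {- R..R} \<Longrightarrow> x' \<in> {- R..R} \<Longrightarrow> y' \<in> {- R..R} \<Longrightarrow>
        \<bar>fh x y - fh x' y'\<bar> \<le> L * (\<bar>x - x'\<bar> + \<bar>y - y'\<bar>)"
    and L: "0 \<le> L" and w: "w \<in> {- R..R}"
    and y: "w + e1 \<in> {- R..R}" "w + e2 \<in> {- R..R}"
    and u: "w + e1 - \<eta>1 \<in> {- R..R}" "w + e2 - \<eta>2 \<in> {- R..R}" "\<bar>\<eta>1\<bar> \<le> \<eta>" "\<bar>\<eta>2\<bar> \<le> \<eta>"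
    and c: "0 < c" "2 * L * \<eta> \<le> c"
    and cases: "(\<eta>1 = 0 \<and> \<eta>2 = 0) \<or> (\<eta>1 = 0 \<and> c \<le> deriv f w) \<or> (\<eta>2 = 0 \<and> deriv f w \<le> - c)"
  shows "fh (w + e1 - \<eta>1) (w + e2 - \<eta>2) * (e2 - e1) - (\<Phi> (w + e2) - \<Phi> (w + e1))
    \<le> (2 * L * \<eta> + 320 * L ^ 3 * \<eta>\<^sup>2 / c\<^sup>2) * (e1\<^sup>2 + e2\<^sup>2)"
proof -
  define u1 where "u1 = w + e1 - \<eta>1"
  define u2 where "u2 = w + e2 - \<eta>2"
  define T where "T = fh u1 u2 * (e2 - e1) - (\<Phi> (w + e2) - \<Phi> (w + e1))"
  have \<eta>0: "0 \<le> \<eta>" using u by linarith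
  have mono: "monotone_flux f fh" using up by (simp add: upwind_flux_def)
  have u': "u1 \<in> {- R..R}" "u2 \<in> {- R..R}" using u by (auto simp: u1_def u2_def)
  have gen: "T \<le> 40 * L * \<rho>\<^sup>2" if "\<bar>\<eta>1\<bar> \<le> \<rho>" "\<bar>\<eta>2\<bar> \<le> \<rho>" for \<rho>
    using monotone_flux_node[OF mono \<Phi> fL fhL L y u', of \<rho>] that by (simp add: T_def u1_def u2_def)
  have sq: "(e2 - e1)\<^sup>2 \<le> 2 * (e1\<^sup>2 + e2\<^sup>2)"
    using zero_le_power2[of "e1 + e2"] by (simp add: power2_eq_square algebra_simps)
  have good: "T \<le> (2 * L * \<eta> + 320 * L ^ 3 * \<eta>\<^sup>2 / c\<^sup>2) * (e1\<^sup>2 + e2\<^sup>2)" if "T \<le> L * \<eta> * (e2 - e1)\<^sup>2"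
  proof -
    have "L * \<eta> * (e2 - e1)\<^sup>2 \<le> L * \<eta> * (2 * (e1\<^sup>2 + e2\<^sup>2))"
      using sq L \<eta>0 by (intro mult_left_mono) auto
    moreover have "0 \<le> 320 * L ^ 3 * \<eta>\<^sup>2 / c\<^sup>2 * (e1\<^sup>2 + e2\<^sup>2)" using L by simp
    ultimately show ?thesis using that by (simp add: algebra_simps)
  qed
  have bad: "T \<le> (2 * L * \<eta> + 320 * L ^ 3 * \<eta>\<^sup>2 / c\<^sup>2) * (e1\<^sup>2 + e2\<^sup>2)"
    if s: "s \<in> closed_segment u1 u2" and cs: "c \<le> \<bar>deriv f w - deriv f s\<bar>" for s
  proof -
    have sR: "s \<in> {- R..R}" by (rule segment_subset_interval[OF u' s])
    have "\<bar>w - s\<bar> \<le> \<bar>e1\<bar> + \<bar>e2\<bar> + \<eta>"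
      using s u(3,4) by (auto simp: closed_segment_eq_real_ivl u1_def u2_def split: if_splits)
    then have "L * \<bar>w - s\<bar> \<le> L * (\<bar>e1\<bar> + \<bar>e2\<bar> + \<eta>)" using L by (rule mult_left_mono)
    then have "c \<le> L * (\<bar>e1\<bar> + \<bar>e2\<bar>) + L * \<eta>"
      using cs f'L[OF w sR] by (simp add: algebra_simps)
    then have "c \<le> 2 * L * (\<bar>e1\<bar> + \<bar>e2\<bar>)" using c by linarith
    then have "c\<^sup>2 \<le> (2 * L * (\<bar>e1\<bar> + \<bar>e2\<bar>))\<^sup>2" using c by (intro power_mono) auto
    also have "\<dots> = 4 * L\<^sup>2 * (\<bar>e1\<bar> + \<bar>e2\<bar>)\<^sup>2" by (simp add: power_mult_distrib)
    also have "\<dots> \<le> 4 * L\<^sup>2 * (2 * (e1\<^sup>2 + e2\<^sup>2))"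
      using zero_le_power2[of "\<bar>e1\<bar> - \<bar>e2\<bar>"]
      by (intro mult_left_mono) (auto simp: power2_eq_square algebra_simps abs_mult[symmetric])
    finally have "c\<^sup>2 \<le> 8 * L\<^sup>2 * (e1\<^sup>2 + e2\<^sup>2)" by (simp add: algebra_simps)
    then have "1 \<le> 8 * L\<^sup>2 * (e1\<^sup>2 + e2\<^sup>2) / c\<^sup>2" using c(1) by (simp add: le_divide_eq)
    then have "40 * L * \<eta>\<^sup>2 * 1 \<le> 40 * L * \<eta>\<^sup>2 * (8 * L\<^sup>2 * (e1\<^sup>2 + e2\<^sup>2) / c\<^sup>2)"
      using L by (intro mult_left_mono) auto
    also have "\<dots> = 320 * L ^ 3 * \<eta>\<^sup>2 / c\<^sup>2 * (e1\<^sup>2 + e2\<^sup>2)"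
      by (simp add: power2_eq_square power3_eq_cube)
    finally have "T \<le> 320 * L ^ 3 * \<eta>\<^sup>2 / c\<^sup>2 * (e1\<^sup>2 + e2\<^sup>2)" using gen[OF u(3,4)] by linarith
    moreover have "0 \<le> 2 * L * \<eta> * (e1\<^sup>2 + e2\<^sup>2)" using L \<eta>0 by simp
    ultimately show ?thesis by (simp add: algebra_simps)
  qed
  from cases consider "\<eta>1 = 0" "\<eta>2 = 0" | "\<eta>1 = 0" "c \<le> deriv f w" | "\<eta>2 = 0" "deriv f w \<le> - c"
    by blast
  then have "T \<le> (2 * L * \<eta> + 320 * L ^ 3 * \<eta>\<^sup>2 / c\<^sup>2) * (e1\<^sup>2 + e2\<^sup>2)"
  proof cases
    case 1
    then have "T \<le> 0" using gen[of 0] by simp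
    also have "0 \<le> L * \<eta> * (e2 - e1)\<^sup>2" using L \<eta>0 by simp
    finally show ?thesis by (rule good)
  next
    case 2
    show ?thesis
    proof (cases "\<forall>s\<in>closed_segment u1 u2. 0 \<le> deriv f s")
      case True
      then have F: "fh u1 u2 = f u1" using up by (simp add: upwind_flux_def)
      have u1: "u1 = w + e1" using 2 by (simp add: u1_def)
      have "f (w + e1) * ((w + e2) - (w + e1)) - (\<Phi> (w + e2) - \<Phi> (w + e1)) \<le> L * \<eta> * ((w + e2) - (w + e1))\<^sup>2"
        using True u u' by (intro upwind_node_exact_trace[OF \<Phi> f' f'L L _ y u'(2)]) (auto simp: u1 u2_def)
      then show ?thesis using F by (intro good) (simp add: T_def u1)
    next
      case False
      then obtain s where "s \<in> closed_segment u1 u2" "deriv f s < 0" by force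
      then show ?thesis using bad[of s] 2 by auto
    qed
  next
    case 3
    show ?thesis
    proof (cases "\<forall>s\<in>closed_segment u1 u2. deriv f s < 0")
      case True
      then have F: "fh u1 u2 = f u2" using up by (simp add: upwind_flux_def)
      have u2: "u2 = w + e2" using 3 by (simp add: u2_def)
      have "- f (w + e2) * ((w + e1) - (w + e2)) - (- \<Phi> (w + e1) - - \<Phi> (w + e2)) \<le> L * \<eta> * ((w + e1) - (w + e2))\<^sup>2"
      proof (rule upwind_node_exact_trace[where f = "\<lambda>x. - f x" and f' = "\<lambda>x. - deriv f x" and R = R and ?u2.0 = u1])
        show "((\<lambda>x. - \<Phi> x) has_real_derivative - f x) (at x)" if "x \<in> {- R..R}" for x
          using \<Phi>[OF that] by (rule DERIV_minus)
        show "((\<lambda>x. - f x) has_real_derivative - deriv f x) (at x)" for x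
          using f' by (rule DERIV_minus)
        show "\<bar>- deriv f x - - deriv f y\<bar> \<le> L * \<bar>x - y\<bar>" if "x \<in> {- R..R}" "y \<in> {- R..R}" for x y
          using f'L[OF that] by linarith
        show "0 \<le> - deriv f s" if "s \<in> closed_segment (w + e2) u1" for s
        proof -
          have "s \<in> closed_segment u1 u2" using that unfolding u2[symmetric] closed_segment_commute[of u2 u1] .
          then show ?thesis using True by force
        qed
      qed (use L y u u' in \<open>auto simp: u1_def\<close>)
      then have "T \<le> L * \<eta> * (e2 - e1)\<^sup>2"
        unfolding T_def F unfolding u2 by (simp add: algebra_simps power2_commute)
      then show ?thesis by (rule good)
    next
      case False
      then obtain s where "s \<in> closed_segment u1 u2" "0 \<le> deriv f s" by force
      then show ?thesis using bad[of s] 3 by auto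
    qed
  qed
  then show ?thesis by (simp add: T_def u1_def u2_def)
qed

section \<open>Gronwall with a bootstrap\<close>

text \<open>The differential inequality is available only while \<open>E\<close> is below \<open>B\<close>. On every interval on which
  this holds, Gronwall's bound is valid, and it is strictly less than \<open>B\<close>. Hence there is no first time
  at which \<open>E\<close> reaches \<open>B\<close>.\<close>

lemma gronwall_bootstrap:
  fixes E E' :: "real \<Rightarrow> real"
  assumes der: "\<And>t. t \<in> {0..T} \<Longrightarrow> (E has_real_derivative E' t) (at t within {0..T})"
    and ineq: "\<And>t. t \<in> {0..T} \<Longrightarrow> E t \<le> B \<Longrightarrow> E' t \<le> c * E t + d"
    and E0: "0 \<le> E 0" and c: "0 < c" and d: "0 \<le> d"
    and small: "(E 0 + d / c) * exp (c * T) < B"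
    and t: "t \<in> {0..T}"
  shows "E t \<le> (E 0 + d / c) * exp (c * T)"
proof -
  let ?K = "(E 0 + d / c) * exp (c * T)"
  have dc: "0 \<le> d / c" using c d by simp
  have T0: "0 \<le> T" using t by auto
  have claim: "E s \<le> ?K" if s: "s \<in> {0..T}" and le: "\<And>r. r \<in> {0..s} \<Longrightarrow> E r \<le> B" for s
  proof -
    \<comment> \<open>This function is nonincreasing by the differential inequality.\<close>
    define Y where "Y r = (E r + d / c) * exp (- c * r)" for r
    have "Y s \<le> Y 0"
    proof (cases "s = 0")
      case False
      then have s0: "0 < s" using s by auto
      have dY: "(Y has_real_derivative (E' r - c * E r - d) * exp (- c * r)) (at r within {0..s})"
        if r: "0 \<le> r" "r \<le> s" for r
      proof -
        have "(E has_real_derivative E' r) (at r within {0..s})"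
          by (rule DERIV_subset[OF der[of r]]) (use r s in auto)
        then have dE: "((\<lambda>r. E r + d / c) has_real_derivative E' r) (at r within {0..s})"
          using DERIV_add[of E "E' r" r "{0..s}" "\<lambda>_. d / c" 0] by simp
        have "((\<lambda>r. exp (- c * r)) has_real_derivative exp (- c * r) * (- c)) (at r within {0..s})"
          by (auto intro!: derivative_eq_intros)
        from DERIV_mult[OF dE this]
        have "(Y has_real_derivative E' r * exp (- c * r) + exp (- c * r) * (- c) * (E r + d / c)) (at r within {0..s})"
          by (simp only: Y_def[abs_def])
        moreover have "E' r * exp (- c * r) + exp (- c * r) * (- c) * (E r + d / c) = (E' r - c * E r - d) * exp (- c * r)"
          using c by (simp add: algebra_simps)
        ultimately show ?thesis by simp
      qed
      have dY': "(Y has_derivative (\<lambda>h. h * ((E' r - c * E r - d) * exp (- c * r)))) (at r within {0..s})"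
        if "0 \<le> r" "r \<le> s" for r
        using dY[OF that] by (simp add: has_field_derivative_def mult_commute_abs)
      obtain r where r: "0 < r" "r < s" "Y s - Y 0 = s * ((E' r - c * E r - d) * exp (- c * r))"
        using mvt_simple[OF s0 dY'] by auto
      have "E' r \<le> c * E r + d" using r s le[of r] by (intro ineq) auto
      then have "(E' r - c * E r - d) * exp (- c * r) \<le> 0" by (intro mult_nonpos_nonneg) auto
      then have "s * ((E' r - c * E r - d) * exp (- c * r)) \<le> 0"
        by (rule mult_nonneg_nonpos[OF less_imp_le[OF s0]])
      then show ?thesis using r by linarith
    qed simp
    then have "(E s + d / c) * exp (- c * s) * exp (c * s) \<le> (E 0 + d / c) * exp (c * s)"
      by (intro mult_right_mono) (auto simp: Y_def)
    then have "E s + d / c \<le> (E 0 + d / c) * exp (c * s)"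
      by (simp add: mult.assoc exp_add[symmetric])
    also have "\<dots> \<le> ?K" using s c E0 dc by (intro mult_left_mono) auto
    finally show ?thesis using dc by linarith
  qed
  have cont: "continuous_on {0..T} E"
    by (rule DERIV_continuous_on[OF der])
  have "1 \<le> exp (c * T)" using c T0 by simp
  then have "(E 0 + d / c) * 1 \<le> ?K" using E0 dc by (intro mult_left_mono) auto
  moreover have "E 0 \<le> (E 0 + d / c) * 1" using dc by simp
  ultimately have K0: "E 0 \<le> ?K" by (rule order_trans[rotated])
  have below: "E r \<le> B" if r: "r \<in> {0..T}" for r
  proof (rule ccontr)
    assume "\<not> E r \<le> B"
    define K where "K = {r \<in> {0..T}. B \<le> E r}"
    have neK: "K \<noteq> {}" using r \<open>\<not> E r \<le> B\<close> by (force simp: K_def)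
    have cK: "compact K"
    proof -
      have "closed ({0..T} \<inter> E -` {B..})"
        by (intro continuous_closed_preimage cont) auto
      moreover have "K = {0..T} \<inter> ({0..T} \<inter> E -` {B..})" by (auto simp: K_def)
      ultimately show ?thesis using compact_Int_closed[OF compact_Icc] by metis
    qed
    \<comment> \<open>The first time at which \<open>E\<close> is at least \<open>B\<close>; there \<open>E = B\<close> by continuity.\<close>
    from compact_attains_inf[OF cK neK] obtain s where s: "s \<in> K" "\<And>z. z \<in> K \<Longrightarrow> s \<le> z"
      by blast
    have sT: "s \<in> {0..T}" "B \<le> E s" using s by (auto simp: K_def)
    have "continuous_on {0..s} E" using cont sT by (auto intro: continuous_on_subset)
    then obtain z where z: "0 \<le> z" "z \<le> s" "E z = B"
      using IVT'[of E 0 B s] K0 small sT by auto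
    then have "z \<in> K" using sT by (auto simp: K_def)
    then have Es: "E s = B" using s(2)[of z] z by auto
    have "E z' \<le> B" if "z' \<in> {0..s}" for z'
    proof (rule ccontr)
      assume "\<not> E z' \<le> B"
      then have "z' \<in> K" using that sT by (auto simp: K_def)
      then show False using s(2)[of z'] that Es \<open>\<not> E z' \<le> B\<close> by auto
    qed
    then have "E s \<le> ?K" using sT by (intro claim) auto
    then show False using Es small by simp
  qed
  show ?thesis using t by (intro claim below) auto
qed

section \<open>Taylor polynomials\<close>

text \<open>The family \<open>d\<close> lists a function and its successive derivatives, starting with \<open>d 0\<close>.\<close>

definition taylor :: "nat \<Rightarrow> (nat \<Rightarrow> real \<Rightarrow> real) \<Rightarrow> real \<Rightarrow> real poly" where
  "taylor n d a = (\<Sum>m\<le>n. smult (d m a / fact m) ([:- a, 1:] ^ m))"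

lemma degree_taylor: "degree (taylor n d a) \<le> n"
  unfolding taylor_def
  by (intro degree_sum_le) (auto intro!: order_trans[OF degree_smult_le] simp: degree_linear_power)

lemma poly_taylor: "poly (taylor n d a) x = (\<Sum>m\<le>n. d m a / fact m * (x - a) ^ m)"
  by (simp add: taylor_def poly_sum poly_power)

lemma pderiv_taylor: "pderiv (taylor (Suc n) d a) = taylor n (\<lambda>m. d (Suc m)) a"
proof -
  have "pderiv (taylor (Suc n) d a) = (\<Sum>m\<le>Suc n. smult (d m a / fact m) (pderiv ([:- a, 1:] ^ m)))"
    unfolding taylor_def by (rule pderiv_sum_smult)
  also have "\<dots> = (\<Sum>m\<le>n. smult (d (Suc m) a / fact (Suc m)) (pderiv ([:- a, 1:] ^ Suc m)))"
    by (subst sum.atMost_Suc_shift) simp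
  also have "\<dots> = taylor n (\<lambda>m. d (Suc m)) a"
    unfolding taylor_def
  proof (rule sum.cong)
    fix m
    have l: "pderiv [:- a, 1:] = 1" by (simp add: pderiv_pCons)
    have "d (Suc m) a / fact (Suc m) * of_nat (Suc m) = d (Suc m) a / (fact m :: real)"
      unfolding fact_Suc by (simp del: of_nat_Suc)
    then show "smult (d (Suc m) a / fact (Suc m)) (pderiv ([:- a, 1:] ^ Suc m))
        = smult (d (Suc m) a / fact m) ([:- a, 1:] ^ m)"
      unfolding pderiv_power_Suc l by (simp del: of_nat_Suc fact_Suc)
  qed simp
  finally show ?thesis .
qed

text \<open>Induction on \<open>n\<close>: the derivative of the remainder is the remainder of order one less for the
  derivative, and the remainder vanishes at \<open>a\<close>.\<close>

lemma taylor_error: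
  assumes "a \<le> x" "x \<le> b"
    and "\<And>m x. m < n \<Longrightarrow> x \<in> {a..b} \<Longrightarrow> (d m has_real_derivative d (Suc m) x) (at x within {a..b})"
    and "\<And>x. x \<in> {a..b} \<Longrightarrow> \<bar>d n x - d n a\<bar> \<le> S"
  shows "\<bar>d 0 x - poly (taylor n d a) x\<bar> \<le> (b - a) ^ n * S"
  using assms
proof (induction n arbitrary: d x)
  case 0
  then show ?case by (simp add: poly_taylor)
next
  case (Suc n)
  have S0: "0 \<le> S" using Suc.prems(4)[of x] Suc.prems(1,2) by force
  define r where "r x = d 0 x - poly (taylor (Suc n) d a) x" for x
  have ra: "r a = 0" by (simp add: r_def poly_taylor zero_power sum.atMost_Suc_shift)
  have r': "(r has_real_derivative d 1 x - poly (taylor n (\<lambda>m. d (Suc m)) a) x) (at x within {a..b})"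
    if "x \<in> {a..b}" for x
    unfolding r_def using Suc.prems(3)[of 0 x] that
    by (auto intro!: derivative_intros simp: pderiv_taylor[symmetric] intro: has_field_derivative_at_within)
  have bd: "\<bar>d 1 y - poly (taylor n (\<lambda>m. d (Suc m)) a) y\<bar> \<le> (b - a) ^ n * S" if "y \<in> {a..b}" for y
    using Suc.IH[of y "\<lambda>m. d (Suc m)"] Suc.prems that by auto
  show ?case
  proof (cases "x = a")
    case True
    then show ?thesis using ra S0 Suc.prems by (simp add: r_def)
  next
    case False
    then have ax: "a < x" using Suc.prems by simp
    obtain z where z: "a < z" "z < x" "r x - r a = (x - a) * (d 1 z - poly (taylor n (\<lambda>m. d (Suc m)) a) z)"
    proof -
      have "(r has_derivative (\<lambda>h. h * (d 1 y - poly (taylor n (\<lambda>m. d (Suc m)) a) y))) (at y within {a..x})"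
        if "a \<le> y" "y \<le> x" for y
      proof -
        have "(r has_real_derivative d 1 y - poly (taylor n (\<lambda>m. d (Suc m)) a) y) (at y within {a..x})"
          by (rule DERIV_subset[OF r'[of y]]) (use that Suc.prems in auto)
        then show ?thesis by (simp add: has_field_derivative_def mult_commute_abs)
      qed
      from mvt_simple[OF ax this] show ?thesis using that by auto
    qed
    then have "\<bar>r x\<bar> = (x - a) * \<bar>d 1 z - poly (taylor n (\<lambda>m. d (Suc m)) a) z\<bar>"
      using ra ax by (simp add: abs_mult)
    also have "\<dots> \<le> (b - a) * ((b - a) ^ n * S)"
      using bd[of z] z Suc.prems S0 by (intro mult_mono) auto
    finally show ?thesis by (simp add: r_def mult_ac)
  qed
qed

lemma taylor_bound:
  assumes "a \<le> x" "x \<le> b" "b - a \<le> 1" "\<And>m. m \<le> n \<Longrightarrow> \<bar>d m a\<bar> \<le> M"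
  shows "\<bar>poly (taylor n d a) x\<bar> \<le> (n + 1) * M"
proof -
  have M0: "0 \<le> M" using assms(4)[of 0] by simp
  have "\<bar>poly (taylor n d a) x\<bar> \<le> (\<Sum>m\<le>n. \<bar>d m a / fact m * (x - a) ^ m\<bar>)"
    unfolding poly_taylor by (rule sum_abs)
  also have "\<dots> \<le> (\<Sum>m\<le>n. M)"
  proof (rule sum_mono)
    fix m assume m: "m \<in> {..n}"
    have "\<bar>d m a / fact m * (x - a) ^ m\<bar> = \<bar>d m a\<bar> * (1 / fact m * (x - a) ^ m)"
      using assms by (simp add: abs_mult abs_divide)
    also have "\<dots> \<le> M * (1 * 1)"
      using m assms M0 by (intro mult_mono power_le_one) (auto simp: divide_le_eq)
    finally show "\<bar>d m a / fact m * (x - a) ^ m\<bar> \<le> M" by simp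
  qed
  finally show ?thesis by (simp add: add.commute)
qed

section \<open>Higher derivatives of the flux along a polynomial\<close>

lemma C_class_derivative:
  assumes "C_class m f" "i < m"
  shows "((deriv ^^ i) f has_real_derivative (deriv ^^ Suc i) f x) (at x)"
  using assms field_differentiable_derivI[of "(deriv ^^ i) f" x] unfolding C_class_def by simp

lemma C_class_continuous:
  assumes "C_class m f" "i \<le> m"
  shows "continuous_on UNIV ((deriv ^^ i) f)"
proof (cases "i = m")
  case True
  then show ?thesis using assms unfolding C_class_def by simp
next
  case False
  then have "i < m" using assms by simp
  then show ?thesis
    using C_class_derivative[OF assms(1)] by (meson DERIV_isCont continuous_at_imp_continuous_on)
qed

lemma C_class_bounded:
  assumes "C_class m f"
  shows "\<exists>G\<ge>0. \<forall>i\<le>m. \<forall>x\<in>{- R..R}. \<bar>(deriv ^^ i) f x\<bar> \<le> G"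
proof -
  have "\<exists>G. \<forall>x\<in>{- R..R}. \<bar>(deriv ^^ i) f x\<bar> \<le> G" if "i \<le> m" for i
  proof -
    have "compact ((deriv ^^ i) f ` {- R..R})"
      using C_class_continuous[OF assms that] continuous_on_subset
      by (intro compact_continuous_image) auto
    then show ?thesis
      using bounded_real[of "(deriv ^^ i) f ` {- R..R}"] compact_imp_bounded by auto
  qed
  then obtain g where g: "\<forall>i\<le>m. \<forall>x\<in>{- R..R}. \<bar>(deriv ^^ i) f x\<bar> \<le> g i" by metis
  have "\<bar>(deriv ^^ i) f x\<bar> \<le> (\<Sum>i\<le>m. \<bar>g i\<bar>)" if "i \<le> m" "x \<in> {- R..R}" for i x
  proof -
    have "\<bar>(deriv ^^ i) f x\<bar> \<le> \<bar>g i\<bar>" using g that by force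
    also have "\<dots> \<le> (\<Sum>i\<le>m. \<bar>g i\<bar>)" by (rule member_le_sum) (use that in auto)
    finally show ?thesis .
  qed
  moreover have "0 \<le> (\<Sum>i\<le>m. \<bar>g i\<bar>)" by (intro sum_nonneg) auto
  ultimately show ?thesis by blast
qed

text \<open>The polynomial that multiplies the \<open>i\<close>-th derivative of \<open>f\<close>, taken at \<open>p\<close>, in the \<open>n\<close>-th derivative
  of \<open>f \<circ> p\<close> (a Bell polynomial in the derivatives of \<open>p\<close>).\<close>

fun chain_coeff :: "real poly \<Rightarrow> nat \<Rightarrow> nat \<Rightarrow> real poly" where
  "chain_coeff p 0 i = (if i = 0 then 1 else 0)"
| "chain_coeff p (Suc n) i = pderiv (chain_coeff p n i) +
     (case i of 0 \<Rightarrow> 0 | Suc i' \<Rightarrow> chain_coeff p n i' * pderiv p)"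

lemma chain_coeff_eq_0: "n < i \<Longrightarrow> chain_coeff p n i = 0"
  by (induction n arbitrary: i) (auto split: nat.splits)

lemma higher_deriv_comp_poly:
  assumes "C_class m f" "n \<le> m"
  shows "(deriv ^^ n) (\<lambda>y. f (poly p y)) = (\<lambda>y. \<Sum>i\<le>n. (deriv ^^ i) f (poly p y) * poly (chain_coeff p n i) y)"
  using assms(2)
proof (induction n)
  case 0
  then show ?case by simp
next
  case (Suc n)
  let ?c = "chain_coeff p"
  have "((\<lambda>y. \<Sum>i\<le>n. (deriv ^^ i) f (poly p y) * poly (?c n i) y) has_real_derivative
      (\<Sum>i\<le>Suc n. (deriv ^^ i) f (poly p y) * poly (?c (Suc n) i) y)) (at y)" for y
  proof -
    have "((\<lambda>y. (deriv ^^ i) f (poly p y) * poly (?c n i) y) has_real_derivative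
        ((deriv ^^ Suc i) f (poly p y) * poly (pderiv p) y) * poly (?c n i) y +
        poly (pderiv (?c n i)) y * (deriv ^^ i) f (poly p y)) (at y)" if "i \<le> n" for i
      using that Suc.prems
      by (intro DERIV_mult DERIV_chain2[OF C_class_derivative[OF assms(1)]] poly_DERIV) auto
    then have "((\<lambda>y. \<Sum>i\<le>n. (deriv ^^ i) f (poly p y) * poly (?c n i) y) has_real_derivative
      (\<Sum>i\<le>n. ((deriv ^^ Suc i) f (poly p y) * poly (pderiv p) y) * poly (?c n i) y +
        poly (pderiv (?c n i)) y * (deriv ^^ i) f (poly p y))) (at y)"
      by (intro DERIV_sum) auto
    moreover have "(\<Sum>i\<le>Suc n. (deriv ^^ i) f (poly p y) * poly (?c (Suc n) i) y)
      = (\<Sum>i\<le>n. ((deriv ^^ Suc i) f (poly p y) * poly (pderiv p) y) * poly (?c n i) y +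
        poly (pderiv (?c n i)) y * (deriv ^^ i) f (poly p y))"
    proof -
      define A where "A i = (deriv ^^ i) f (poly p y) * poly (pderiv (?c n i)) y" for i
      define B where "B i = (deriv ^^ i) f (poly p y) * poly (case i of 0 \<Rightarrow> 0 | Suc i' \<Rightarrow> ?c n i' * pderiv p) y" for i
      have "(\<Sum>i\<le>Suc n. (deriv ^^ i) f (poly p y) * poly (?c (Suc n) i) y) = (\<Sum>i\<le>Suc n. A i) + (\<Sum>i\<le>Suc n. B i)"
        unfolding sum.distrib[symmetric] by (intro sum.cong) (auto simp: A_def B_def distrib_left)
      also have "(\<Sum>i\<le>Suc n. A i) = (\<Sum>i\<le>n. A i)"
        by (simp add: A_def chain_coeff_eq_0 del: funpow.simps)
      also have "(\<Sum>i\<le>Suc n. B i) = (\<Sum>i\<le>n. B (Suc i))"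
        by (subst sum.atMost_Suc_shift) (simp add: B_def)
      also have "(\<Sum>i\<le>n. A i) + (\<Sum>i\<le>n. B (Suc i)) = (\<Sum>i\<le>n. B (Suc i) + A i)"
        by (simp add: sum.distrib)
      finally show ?thesis by (simp add: A_def B_def mult_ac del: funpow.simps)
    qed
    ultimately show ?thesis by simp
  qed
  then have "deriv (\<lambda>y. \<Sum>i\<le>n. (deriv ^^ i) f (poly p y) * poly (?c n i) y)
      = (\<lambda>y. \<Sum>i\<le>Suc n. (deriv ^^ i) f (poly p y) * poly (?c (Suc n) i) y)"
    by (intro ext DERIV_imp_deriv)
  moreover have "(deriv ^^ Suc n) (\<lambda>y. f (poly p y)) = deriv (\<lambda>y. \<Sum>i\<le>n. (deriv ^^ i) f (poly p y) * poly (?c n i) y)"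
    using Suc by simp
  ultimately show ?case by simp
qed

lemma higher_deriv_comp_poly_derivative:
  assumes "C_class m f" "n < m"
  shows "((deriv ^^ n) (\<lambda>y. f (poly p y)) has_real_derivative (deriv ^^ Suc n) (\<lambda>y. f (poly p y)) x) (at x)"
proof -
  have "(deriv ^^ n) (\<lambda>y. f (poly p y)) field_differentiable at x"
  proof -
    have "(\<lambda>y. \<Sum>i\<le>n. (deriv ^^ i) f (poly p y) * poly (chain_coeff p n i) y) field_differentiable at x"
    proof (intro field_differentiable_sum field_differentiable_mult)
      fix i assume "i \<in> {..n}"
      then have "((deriv ^^ i) f has_real_derivative (deriv ^^ Suc i) f (poly p x)) (at (poly p x))"
        using assms by (intro C_class_derivative) auto
      from DERIV_chain2[OF this poly_DERIV]
      show "(\<lambda>y. (deriv ^^ i) f (poly p y)) field_differentiable at x"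
        unfolding field_differentiable_def by blast
      show "poly (chain_coeff p n i) field_differentiable at x"
        unfolding field_differentiable_def using poly_DERIV by blast
    qed
    then show ?thesis using higher_deriv_comp_poly[OF assms(1), of n p] assms(2) by simp
  qed
  from field_differentiable_derivI[OF this] show ?thesis by simp
qed

lemma higher_deriv_comp_poly_continuous:
  assumes "C_class m f" "n \<le> m"
  shows "continuous_on S ((deriv ^^ n) (\<lambda>y. f (poly p y)))"
proof -
  have "continuous_on S (\<lambda>y. (deriv ^^ i) f (poly p y))" if "i \<le> m" for i
  proof -
    have "continuous_on S (\<lambda>y. poly p y)" by (intro continuous_intros)
    from continuous_on_compose2[OF C_class_continuous[OF assms(1) that] this] show ?thesis by simp
  qed
  then show ?thesis
    unfolding higher_deriv_comp_poly[OF assms] using assms(2)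
    by (intro continuous_intros) auto
qed

text \<open>The derivatives of \<open>p\<close> at \<open>x\<close> are those of the \<open>m\<close>-th derivative of a function that is, on a cell of
  length \<open>H\<close>, a smooth function perturbed by a polynomial of size \<open>\<epsilon>\<close>.\<close>

definition poly_scaling :: "real \<Rightarrow> real \<Rightarrow> real \<Rightarrow> real poly \<Rightarrow> nat \<Rightarrow> (nat \<Rightarrow> real) \<Rightarrow> bool" where
  "poly_scaling x H \<epsilon> p m K \<longleftrightarrow> (\<forall>j. \<bar>poly ((pderiv ^^ j) p) x\<bar> \<le> K j * (1 + \<epsilon> / H ^ (j + m)))"

lemma pderiv_funpow_add: "(pderiv ^^ j) (p + q) = (pderiv ^^ j) p + (pderiv ^^ j) (q :: real poly)"
  by (induction j arbitrary: p q) (auto simp: funpow_Suc_right pderiv_add simp del: funpow.simps)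

lemma poly_scaling_add:
  assumes "poly_scaling x H \<epsilon> p m K" "poly_scaling x H \<epsilon> q m K'"
  shows "poly_scaling x H \<epsilon> (p + q) m (\<lambda>j. K j + K' j)"
  unfolding poly_scaling_def
proof
  fix j
  have "\<bar>poly ((pderiv ^^ j) (p + q)) x\<bar> \<le> \<bar>poly ((pderiv ^^ j) p) x\<bar> + \<bar>poly ((pderiv ^^ j) q) x\<bar>"
    by (simp add: pderiv_funpow_add)
  also have "\<dots> \<le> K j * (1 + \<epsilon> / H ^ (j + m)) + K' j * (1 + \<epsilon> / H ^ (j + m))"
    using assms unfolding poly_scaling_def by (intro add_mono) auto
  finally show "\<bar>poly ((pderiv ^^ j) (p + q)) x\<bar> \<le> (K j + K' j) * (1 + \<epsilon> / H ^ (j + m))"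
    by (simp add: distrib_right)
qed

lemma poly_scaling_pderiv:
  assumes "poly_scaling x H \<epsilon> p m K"
  shows "poly_scaling x H \<epsilon> (pderiv p) (Suc m) (\<lambda>j. K (Suc j))"
  unfolding poly_scaling_def
proof
  fix j
  show "\<bar>poly ((pderiv ^^ j) (pderiv p)) x\<bar> \<le> K (Suc j) * (1 + \<epsilon> / H ^ (j + Suc m))"
    using assms unfolding poly_scaling_def by (metis add_Suc add_Suc_right funpow_simps_right(2) o_apply)
qed

text \<open>The constants that come out of applying the product rule \<open>j\<close> times.\<close>

fun product_scaling :: "nat \<Rightarrow> (nat \<Rightarrow> real) \<Rightarrow> (nat \<Rightarrow> real) \<Rightarrow> real" where
  "product_scaling 0 K K' = 3 * K 0 * K' 0"
| "product_scaling (Suc j) K K' = product_scaling j (\<lambda>i. K (Suc i)) K' + product_scaling j K (\<lambda>i. K' (Suc i))"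

text \<open>The class is closed under products because \<open>\<epsilon>\<^sup>2 \<le> \<epsilon>\<close>: without derivatives,
  \<open>(1 + \<epsilon> / H^m) (1 + \<epsilon> / H^l) \<le> 3 (1 + \<epsilon> / H^(m + l))\<close>. The product rule does the rest.\<close>

lemma poly_scaling_mult:
  assumes H: "0 < H" "H \<le> 1" and \<epsilon>: "0 \<le> \<epsilon>" "\<epsilon> \<le> 1"
    and "poly_scaling x H \<epsilon> p m K" "poly_scaling x H \<epsilon> q l K'"
  shows "poly_scaling x H \<epsilon> (p * q) (m + l) (\<lambda>j. product_scaling j K K')"
proof -
  have "\<bar>poly ((pderiv ^^ j) (p * q)) x\<bar> \<le> product_scaling j K K' * (1 + \<epsilon> / H ^ (j + (m + l)))" for j
    using assms(5,6)
  proof (induction j arbitrary: p q m l K K')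
    case 0
    have p: "\<bar>poly p x\<bar> \<le> K 0 * (1 + \<epsilon> / H ^ m)" and q: "\<bar>poly q x\<bar> \<le> K' 0 * (1 + \<epsilon> / H ^ l)"
      using spec[OF 0(1)[unfolded poly_scaling_def], of 0] spec[OF 0(2)[unfolded poly_scaling_def], of 0] by auto
    have pos: "0 < 1 + \<epsilon> / H ^ m" "0 < 1 + \<epsilon> / H ^ l" using H \<epsilon> by (auto intro: add_pos_nonneg)
    have K0: "0 \<le> K 0 * (1 + \<epsilon> / H ^ m)" "0 \<le> K' 0 * (1 + \<epsilon> / H ^ l)" using p q by linarith+
    then have K: "0 \<le> K 0" "0 \<le> K' 0" using pos by (auto simp: zero_le_mult_iff)
    have inv: "1 \<le> 1 / H ^ s" "1 / H ^ s \<le> 1 / H ^ (s + t)" for s t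
      using H by (auto simp: power_add divide_simps power_le_one mult_left_le)
    have e: "(1 + \<epsilon> / H ^ m) * (1 + \<epsilon> / H ^ l) \<le> 3 * (1 + \<epsilon> / H ^ (m + l))"
    proof -
      have 1: "\<epsilon> * (1 / H ^ m) \<le> \<epsilon> * (1 / H ^ (m + l))" "\<epsilon> * (1 / H ^ l) \<le> \<epsilon> * (1 / H ^ (m + l))"
        using mult_left_mono[OF inv(2)[of m l] \<epsilon>(1)] mult_left_mono[OF inv(2)[of l m] \<epsilon>(1)]
        by (simp_all add: add.commute)
      have "\<epsilon> * \<epsilon> * (1 / H ^ (m + l)) \<le> 1 * \<epsilon> * (1 / H ^ (m + l))"
        using \<epsilon> H by (intro mult_right_mono) auto
      moreover have "(1 + \<epsilon> / H ^ m) * (1 + \<epsilon> / H ^ l)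
        = 1 + \<epsilon> * (1 / H ^ m) + \<epsilon> * (1 / H ^ l) + \<epsilon> * \<epsilon> * (1 / H ^ (m + l))"
        by (simp add: power_add algebra_simps)
      ultimately show ?thesis using 1 by simp
    qed
    have "\<bar>poly (p * q) x\<bar> \<le> (K 0 * (1 + \<epsilon> / H ^ m)) * (K' 0 * (1 + \<epsilon> / H ^ l))"
      unfolding poly_mult abs_mult using p q K0 by (intro mult_mono) auto
    also have "\<dots> = (K 0 * K' 0) * ((1 + \<epsilon> / H ^ m) * (1 + \<epsilon> / H ^ l))" by (simp add: mult_ac)
    also have "\<dots> \<le> (K 0 * K' 0) * (3 * (1 + \<epsilon> / H ^ (m + l)))" using e K by (intro mult_left_mono) auto
    finally show ?case by (simp add: mult_ac)
  next
    case (Suc j)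
    have e: "(pderiv ^^ Suc j) (p * q) = (pderiv ^^ j) (p * pderiv q) + (pderiv ^^ j) (pderiv p * q)"
      by (simp add: funpow_Suc_right pderiv_mult pderiv_funpow_add mult.commute del: funpow.simps)
    have 1: "\<bar>poly ((pderiv ^^ j) (p * pderiv q)) x\<bar> \<le> product_scaling j K (\<lambda>i. K' (Suc i)) * (1 + \<epsilon> / H ^ (j + (m + Suc l)))"
      using Suc by (intro Suc.IH poly_scaling_pderiv) auto
    have 2: "\<bar>poly ((pderiv ^^ j) (pderiv p * q)) x\<bar> \<le> product_scaling j (\<lambda>i. K (Suc i)) K' * (1 + \<epsilon> / H ^ (j + (Suc m + l)))"
      using Suc by (intro Suc.IH poly_scaling_pderiv) auto
    have "\<bar>poly ((pderiv ^^ Suc j) (p * q)) x\<bar>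
      \<le> \<bar>poly ((pderiv ^^ j) (p * pderiv q)) x\<bar> + \<bar>poly ((pderiv ^^ j) (pderiv p * q)) x\<bar>"
      unfolding e by simp
    also have "\<dots> \<le> product_scaling (Suc j) K K' * (1 + \<epsilon> / H ^ (Suc j + (m + l)))"
      using add_mono[OF 1 2] by (simp add: algebra_simps)
    finally show ?case .
  qed
  then show ?thesis unfolding poly_scaling_def by blast
qed

fun chain_scaling :: "(nat \<Rightarrow> real) \<Rightarrow> nat \<Rightarrow> nat \<Rightarrow> nat \<Rightarrow> real" where
  "chain_scaling K 0 i j = 1"
| "chain_scaling K (Suc n) i j = chain_scaling K n i (Suc j) +
     (case i of 0 \<Rightarrow> 0 | Suc i' \<Rightarrow> product_scaling j (chain_scaling K n i') (\<lambda>i. K (Suc i)))"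

lemma poly_scaling_chain_coeff:
  assumes H: "0 < H" "H \<le> 1" and \<epsilon>: "0 \<le> \<epsilon>" "\<epsilon> \<le> 1" and p: "poly_scaling x H \<epsilon> p 0 K"
  shows "poly_scaling x H \<epsilon> (chain_coeff p n i) n (chain_scaling K n i)"
proof (induction n arbitrary: i)
  case 0
  have z: "(pderiv ^^ j) (0 :: real poly) = 0" for j by (induction j) auto
  have o: "(pderiv ^^ j) (1 :: real poly) = (if j = 0 then 1 else 0)" for j
    by (cases j) (simp_all add: funpow_Suc_right z del: funpow.simps)
  have "0 \<le> \<epsilon> / H ^ j" for j using H \<epsilon> by simp
  then show ?case
    using \<epsilon> by (auto simp: poly_scaling_def z o intro: add_nonneg_nonneg)
next
  case (Suc n)
  have 1: "poly_scaling x H \<epsilon> (pderiv (chain_coeff p n i)) (Suc n) (\<lambda>j. chain_scaling K n i (Suc j))"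
    by (rule poly_scaling_pderiv[OF Suc])
  show ?case
  proof (cases i)
    case 0
    then show ?thesis using 1 by (simp add: poly_scaling_def)
  next
    case (Suc i')
    have "poly_scaling x H \<epsilon> (chain_coeff p n i' * pderiv p) (n + Suc 0)
        (\<lambda>j. product_scaling j (chain_scaling K n i') (\<lambda>i. K (Suc i)))"
      by (rule poly_scaling_mult[OF H \<epsilon> Suc.IH poly_scaling_pderiv[OF p]])
    then have "poly_scaling x H \<epsilon> (chain_coeff p n i' * pderiv p) (Suc n)
        (\<lambda>j. product_scaling j (chain_scaling K n i') (\<lambda>i. K (Suc i)))" by simp
    from poly_scaling_add[OF 1 this] show ?thesis using Suc by (simp add: poly_scaling_def)
  qed
qed

text \<open>Every term of the chain rule for the \<open>n\<close>-th derivative contains \<open>n\<close> differentiations of \<open>p\<close> in total,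
  so all of them scale like a single \<open>n\<close>-th derivative.\<close>

lemma higher_deriv_comp_poly_bound:
  assumes "C_class m f" "n \<le> m" and H: "0 < H" "H \<le> 1" and \<epsilon>: "0 \<le> \<epsilon>" "\<epsilon> \<le> 1"
    and p: "poly_scaling x H \<epsilon> p 0 K"
    and G: "\<And>i. i \<le> m \<Longrightarrow> \<bar>(deriv ^^ i) f (poly p x)\<bar> \<le> G"
  shows "\<bar>(deriv ^^ n) (\<lambda>y. f (poly p y)) x\<bar> \<le> (\<Sum>i\<le>n. G * chain_scaling K n i 0) * (1 + \<epsilon> / H ^ n)"
proof -
  have G0: "0 \<le> G" using G[of 0] by force
  have c: "\<bar>poly (chain_coeff p n i) x\<bar> \<le> chain_scaling K n i 0 * (1 + \<epsilon> / H ^ n)" for i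
  proof -
    have "poly_scaling x H \<epsilon> (chain_coeff p n i) n (chain_scaling K n i)"
      by (rule poly_scaling_chain_coeff[OF H \<epsilon> p])
    then have "\<bar>poly ((pderiv ^^ 0) (chain_coeff p n i)) x\<bar> \<le> chain_scaling K n i 0 * (1 + \<epsilon> / H ^ (0 + n))"
      unfolding poly_scaling_def by blast
    then show ?thesis by simp
  qed
  have "\<bar>(deriv ^^ n) (\<lambda>y. f (poly p y)) x\<bar>
      \<le> (\<Sum>i\<le>n. \<bar>(deriv ^^ i) f (poly p x) * poly (chain_coeff p n i) x\<bar>)"
    unfolding higher_deriv_comp_poly[OF assms(1,2)] by (rule sum_abs)
  also have "\<dots> \<le> (\<Sum>i\<le>n. G * (chain_scaling K n i 0 * (1 + \<epsilon> / H ^ n)))"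
    unfolding abs_mult using G c G0 assms(2) by (intro sum_mono mult_mono) auto
  finally show ?thesis by (simp add: sum_distrib_right mult.assoc)
qed

section \<open>Signs of the constants\<close>

lemma L2norm_nonneg: "0 \<le> L2norm a b g"
  unfolding L2norm_def by (cases "(\<lambda>x. (g x)\<^sup>2) integrable_on {a..b}")
    (auto intro!: integral_nonneg simp: not_integrable_integral)

lemma L2norm_le_sup:
  assumes "a \<le> b" "continuous_on {a..b} g" "\<And>x. x \<in> {a..b} \<Longrightarrow> \<bar>g x\<bar> \<le> S"
  shows "L2norm a b g \<le> sqrt (b - a) * S"
proof -
  have S: "0 \<le> S" using assms(1) assms(3)[of a] by force
  have "\<bar>integral {a..b} (\<lambda>x. (g x)\<^sup>2)\<bar> \<le> S\<^sup>2 * (b - a)"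
  proof (rule abs_integral_le_sup[OF assms(1)])
    show "continuous_on {a..b} (\<lambda>x. (g x)\<^sup>2)" by (intro continuous_intros assms)
    show "\<bar>(g x)\<^sup>2\<bar> \<le> S\<^sup>2" if "x \<in> {a..b}" for x
      using power_mono[OF assms(3)[OF that], of 2] by simp
  qed
  then have "L2norm a b g \<le> sqrt (S\<^sup>2 * (b - a))"
    unfolding L2norm_def by (intro real_sqrt_le_mono) linarith
  also have "\<dots> = sqrt (b - a) * S" using S by (simp add: real_sqrt_mult)
  finally show ?thesis .
qed

text \<open>The infimum of a set of nonnegative reals is nonnegative once the set is nonempty, so an
  inequality with some constant has to be proved. Here it follows from the bound of the supremum of
  \<open>p\<^sup>2\<close> by the integral of \<open>p\<^sup>2\<close>.\<close>

lemma CL4_nonneg: "0 \<le> CL4 k"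
proof -
  obtain C where C: "C \<ge> 1" "\<And>a b. a < b \<Longrightarrow> \<exists>\<phi>. cell_basis k C a b \<phi>"
    using cell_basis_exists[of k] by blast
  define c where "c = C * (k + 1)"
  have c: "0 \<le> c" using C by (simp add: c_def)
  have "L4norm a b (poly p) \<le> sqrt c * (b - a) powr (- 1 / 4) * L2norm a b (poly p)"
    if ab: "a < b" and p: "degree p \<le> k" for a b p
  proof -
    obtain \<phi> where \<phi>: "cell_basis k C a b \<phi>" using C(2)[OF ab] by blast
    define I where "I = integral {a..b} (\<lambda>x. (poly p x)\<^sup>2)"
    have I: "0 \<le> I" unfolding I_def
      by (intro integral_nonneg integrable_continuous_interval continuous_intros) auto
    have i4: "integral {a..b} (\<lambda>x. (poly p x) ^ 4) \<le> c\<^sup>2 / (b - a) * I * I"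
    proof -
      define D where "D = c\<^sup>2 / (b - a) * I"
      have int: "(\<lambda>x. d * poly p x ^ n) integrable_on {a..b}" for d n
        by (intro integrable_continuous_interval continuous_intros)
      have "integral {a..b} (\<lambda>x. (poly p x) ^ 4) \<le> integral {a..b} (\<lambda>x. D * (poly p x)\<^sup>2)"
      proof (rule integral_le)
        show "(\<lambda>x. (poly p x) ^ 4) integrable_on {a..b}" using int[of 1 4] by simp
        show "(\<lambda>x. D * (poly p x)\<^sup>2) integrable_on {a..b}" by (rule int)
        fix x assume "x \<in> {a..b}"
        then have "(poly p x)\<^sup>2 \<le> D"
          using cell_basis_sup_inverse(1)[OF \<phi> ab C(1) p] by (simp add: c_def I_def D_def)
        then have le: "(poly p x)\<^sup>2 * (poly p x)\<^sup>2 \<le> D * (poly p x)\<^sup>2"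
          by (intro mult_right_mono) auto
        have eq: "(poly p x) ^ 4 = (poly p x)\<^sup>2 * (poly p x)\<^sup>2"
          by (simp add: power2_eq_square power4_eq_xxxx mult.assoc)
        show "(poly p x) ^ 4 \<le> D * (poly p x)\<^sup>2" unfolding eq by (rule le)
      qed
      then show ?thesis by (simp add: I_def[symmetric] D_def)
    qed
    let ?z = "sqrt c * (b - a) powr (- 1 / 4) * sqrt I"
    have "?z ^ 4 = (sqrt c) ^ 4 * ((b - a) powr (- 1 / 4)) ^ 4 * (sqrt I) ^ 4"
      by (simp add: power_mult_distrib)
    also have "(sqrt c) ^ 4 = c\<^sup>2" using c power_mult[of "sqrt c" 2 2] by simp
    also have "(sqrt I) ^ 4 = I * I" using I power_mult[of "sqrt I" 2 2] by (simp add: power2_eq_square)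
    also have "((b - a) powr (- 1 / 4)) ^ 4 = 1 / (b - a)"
    proof -
      have "((b - a) powr (- 1 / 4)) ^ 4 = ((b - a) powr (- 1 / 4)) powr real 4"
        using ab by (intro powr_realpow[symmetric]) auto
      also have "\<dots> = (b - a) powr (- 1)" by (simp add: powr_powr)
      finally show ?thesis using ab by (simp add: powr_minus_divide)
    qed
    finally have z4: "?z ^ 4 = c\<^sup>2 / (b - a) * I * I" by simp
    have "L4norm a b (poly p) \<le> root 4 (?z ^ 4)"
      unfolding L4norm_def z4 using i4 by (intro real_root_le_mono) auto
    also have "\<dots> = ?z" using c I by (intro real_root_power_cancel) auto
    finally show ?thesis by (simp add: L2norm_def I_def)
  qed
  then have "c \<in> {c. 0 \<le> c \<and> (\<forall>a b p. a < b \<longrightarrow> degree p \<le> k \<longrightarrow>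
        L4norm a b (poly p) \<le> sqrt c * (b - a) powr (- 1 / 4) * L2norm a b (poly p))}"
    using c by blast
  then show ?thesis unfolding CL4_def
    by (rule cInf_greatest[OF ex_in_conv[THEN iffD1, OF exI]]) simp
qed

text \<open>The Cauchy-Schwarz inequality against the constant function, from
  \<open>0 \<le> \<integral> (|v| - c)\<^sup>2\<close> with \<open>c\<close> the mean of \<open>|v|\<close>.\<close>

lemma integral_abs_le_L2norm:
  assumes ab: "a < b" and v: "continuous_on {a..b} v"
  shows "integral {a..b} (\<lambda>x. \<bar>v x\<bar>) \<le> sqrt (b - a) * L2norm a b v"
proof -
  define A where "A = integral {a..b} (\<lambda>x. \<bar>v x\<bar>)"
  define c where "c = A / (b - a)"
  have int: "g integrable_on {a..b}" if "continuous_on {a..b} g" for g :: "real \<Rightarrow> real"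
    using that by (rule integrable_continuous_interval)
  have "0 \<le> integral {a..b} (\<lambda>x. (\<bar>v x\<bar> - c)\<^sup>2)"
    by (intro integral_nonneg int continuous_intros v) auto
  also have "\<dots> = integral {a..b} (\<lambda>x. (v x)\<^sup>2 - 2 * c * \<bar>v x\<bar> + c\<^sup>2)"
    by (intro integral_cong) (simp add: power2_diff)
  also have "\<dots> = integral {a..b} (\<lambda>x. (v x)\<^sup>2) - 2 * c * A + c\<^sup>2 * (b - a)"
    unfolding A_def using ab
    by (subst integral_add integral_diff, (intro int continuous_intros v)+)+ simp
  also have "2 * c * A = 2 * (A\<^sup>2 / (b - a))" by (simp add: c_def power2_eq_square)
  also have "c\<^sup>2 * (b - a) = A\<^sup>2 / (b - a)" using ab by (simp add: c_def power2_eq_square)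
  finally have "A\<^sup>2 / (b - a) \<le> integral {a..b} (\<lambda>x. (v x)\<^sup>2)" by simp
  then have "A\<^sup>2 \<le> (b - a) * integral {a..b} (\<lambda>x. (v x)\<^sup>2)" using ab by (simp add: field_simps)
  then have "sqrt (A\<^sup>2) \<le> sqrt ((b - a) * integral {a..b} (\<lambda>x. (v x)\<^sup>2))" by (rule real_sqrt_le_mono)
  then show ?thesis by (simp add: A_def L2norm_def real_sqrt_mult)
qed

lemma L2norm_L2proj_le_sup:
  assumes "a < b" "continuous_on {a..b} g" "degree p \<le> k" "\<And>x. x \<in> {a..b} \<Longrightarrow> \<bar>g x - poly p x\<bar> \<le> S"
  shows "L2norm a b (\<lambda>x. g x - poly (L2proj k a b g) x) \<le> sqrt (b - a) * S"
proof -
  have "L2norm a b (\<lambda>x. g x - poly (L2proj k a b g) x) \<le> L2norm a b (\<lambda>x. g x - poly p x)"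
    unfolding L2norm_def by (intro real_sqrt_le_mono L2proj_best assms)
  also have "\<dots> \<le> sqrt (b - a) * S"
    using assms by (intro L2norm_le_sup continuous_intros) auto
  finally show ?thesis .
qed

text \<open>Again an admissible constant must be exhibited. The projection is at least as good as the Taylor
  polynomial of degree \<open>r - 2 \<le> k\<close> of \<open>g_x\<close> at \<open>a\<close>, and the constant \<open>1\<close> results.\<close>

lemma Cproj_nonneg:
  assumes "1 \<le> k" "r \<in> {k + 1, k + 2}"
  shows "0 \<le> Cproj k r"
proof -
  have "L2norm a b (\<lambda>x. deriv g x - poly (L2proj k a b (deriv g)) x)
      \<le> 1 * (b - a) ^ (r - 1) * L2norm a b ((deriv ^^ r) g)"
    if ab: "a < b" and g: "\<And>m. C_class m g" for a b g
  proof -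
    define d where "d m = (deriv ^^ Suc m) g" for m
    define n where "n = r - 2"
    have n: "n \<le> k" "r = Suc (Suc n)" using assms by (auto simp: n_def)
    have dd: "(d m has_real_derivative d (Suc m) x) (at x)" for m x
      unfolding d_def by (rule C_class_derivative[OF g[of "Suc (Suc m)"]]) simp
    have dc: "continuous_on S (d m)" for m S
      using dd by (meson DERIV_isCont continuous_at_imp_continuous_on)
    define S where "S = sqrt (b - a) * L2norm a b (d (Suc n))"
    have base: "\<bar>d n x - d n a\<bar> \<le> S" if x: "x \<in> {a..b}" for x
    proof -
      have "((d (Suc n)) has_integral (d n x - d n a)) {a..x}"
        using x dd by (intro fundamental_theorem_of_calculus)
          (auto simp: has_real_derivative_iff_has_vector_derivative[symmetric] intro: has_field_derivative_at_within)
      then have "d n x - d n a = integral {a..x} (d (Suc n))" by (simp add: integral_unique)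
      also have "\<bar>\<dots>\<bar> \<le> integral {a..x} (\<lambda>x. \<bar>d (Suc n) x\<bar>)"
        using integral_norm_bound_integral[of "d (Suc n)" "{a..x}" "\<lambda>x. \<bar>d (Suc n) x\<bar>"]
        by (auto intro!: integrable_continuous_interval continuous_intros dc)
      also have "\<dots> \<le> integral {a..b} (\<lambda>x. \<bar>d (Suc n) x\<bar>)"
        using x by (intro integral_subset_le integrable_continuous_interval continuous_intros dc) auto
      also have "\<dots> \<le> S" unfolding S_def by (intro integral_abs_le_L2norm ab dc)
      finally show ?thesis .
    qed
    have "\<bar>d 0 x - poly (taylor n d a) x\<bar> \<le> (b - a) ^ n * S" if "x \<in> {a..b}" for x
      using that base dd by (intro taylor_error) (auto intro: has_field_derivative_at_within)
    then have "L2norm a b (\<lambda>x. deriv g x - poly (L2proj k a b (deriv g)) x) \<le> sqrt (b - a) * ((b - a) ^ n * S)"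
      using n(1) degree_taylor[of n d a] dc[of _ 0]
      by (intro L2norm_L2proj_le_sup[where p = "taylor n d a"] ab) (auto simp: d_def)
    also have "\<dots> = (sqrt (b - a) * sqrt (b - a)) * (b - a) ^ n * L2norm a b (d (Suc n))"
      by (simp add: S_def mult_ac)
    also have "sqrt (b - a) * sqrt (b - a) = b - a" using ab by simp
    finally show ?thesis using n by (simp add: d_def)
  qed
  then have "1 \<in> {c. 0 \<le> c \<and> (\<forall>a b g. a < b \<longrightarrow> (\<forall>m. C_class m g) \<longrightarrow>
        L2norm a b (\<lambda>x. deriv g x - poly (L2proj k a b (deriv g)) x)
          \<le> c * (b - a) ^ (r - 1) * L2norm a b ((deriv ^^ r) g))}"
    by auto
  then show ?thesis unfolding Cproj_def
    by (rule cInf_greatest[OF ex_in_conv[THEN iffD1, OF exI]]) simp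
qed

lemma deriv_cube:
  "(deriv ^^ 0) (\<lambda>x :: real. x ^ 3) = (\<lambda>x. x ^ 3)"
  "(deriv ^^ Suc 0) (\<lambda>x :: real. x ^ 3) = (\<lambda>x. 3 * x\<^sup>2)"
  "(deriv ^^ Suc (Suc 0)) (\<lambda>x :: real. x ^ 3) = (\<lambda>x. 6 * x)"
  "(deriv ^^ Suc (Suc (Suc 0))) (\<lambda>x :: real. x ^ 3) = (\<lambda>x. 6)"
proof -
  show 0: "(deriv ^^ 0) (\<lambda>x :: real. x ^ 3) = (\<lambda>x. x ^ 3)" by simp
  show 1: "(deriv ^^ Suc 0) (\<lambda>x :: real. x ^ 3) = (\<lambda>x. 3 * x\<^sup>2)"
    by (auto intro!: ext DERIV_imp_deriv derivative_eq_intros)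
  have "deriv (\<lambda>x :: real. 3 * x\<^sup>2) = (\<lambda>x. 6 * x)"
    by (auto intro!: ext DERIV_imp_deriv derivative_eq_intros)
  then show 2: "(deriv ^^ Suc (Suc 0)) (\<lambda>x :: real. x ^ 3) = (\<lambda>x. 6 * x)" using 1 by simp
  have "deriv (\<lambda>x :: real. 6 * x) = (\<lambda>x. 6)"
    by (auto intro!: ext DERIV_imp_deriv derivative_eq_intros)
  then show "(deriv ^^ Suc (Suc (Suc 0))) (\<lambda>x :: real. x ^ 3) = (\<lambda>x. 6)" using 2 by simp
qed

text \<open>The defining inequality for \<open>U(x) = x\<^sup>3\<close> and \<open>p(x) = x\<close> on the unit interval has a nonnegative left
  side, and \<open>\<beta>\<close> times a positive number on the right.\<close>

lemma beta_admissible_nonneg: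
  assumes "1 \<le> k" "beta_admissible k \<beta>"
  shows "0 \<le> \<beta>"
proof -
  have d3: "(deriv ^^ 3) (\<lambda>x :: real. x ^ 3) = (\<lambda>x. 6)"
    using deriv_cube(4) by (simp only: numeral_3_eq_3)
  have C: "C_class 3 (\<lambda>x :: real. x ^ 3)"
    unfolding C_class_def
  proof (intro conjI allI impI)
    fix i :: nat and x :: real assume "i < 3"
    then consider "i = 0" | "i = Suc 0" | "i = Suc (Suc 0)" by linarith
    then show "(deriv ^^ i) (\<lambda>x :: real. x ^ 3) field_differentiable at x"
      by cases (simp_all only: deriv_cube, auto intro!: derivative_intros simp: field_differentiable_power)
  next
    show "continuous_on UNIV ((deriv ^^ 3) (\<lambda>x :: real. x ^ 3))"
      unfolding d3 by simp
  qed
  define p where "p = [:0, 1 :: real:]"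
  define c where "c = avg 0 1 (poly p)"
  define I where "I = integral {0..1} (\<lambda>x. \<bar>poly p x - c\<bar>\<^sup>2)"
  have "0 < integral {0..1} (\<lambda>x. 1 * (poly [:- c, 1:] x)\<^sup>2)"
    by (rule integral_weighted_square_pos) auto
  then have I: "0 < I" by (simp add: I_def p_def)
  have "degree p \<le> k" using assms(1) by (simp add: p_def)
  with assms(2) C have "\<bar>poly (L2proj k 0 1 (\<lambda>x. deriv (\<lambda>x. x ^ 3) (poly p x) - deriv (\<lambda>x. x ^ 3) (poly p 0))) 0\<bar>
      \<le> \<beta> / (2 * (1 - 0)) * (SUP x\<in>{0..1}. \<bar>(deriv ^^ 3) (\<lambda>x. x ^ 3) (poly p x)\<bar>) * I"
    unfolding beta_admissible_def I_def c_def by (meson insertI1 zero_less_one)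
  then have "0 \<le> \<beta> / (2 * (1 - 0)) * (SUP x\<in>{0..1 :: real}. \<bar>(deriv ^^ 3) (\<lambda>x. x ^ 3) (poly p x)\<bar>) * I"
    by linarith
  then have "0 \<le> \<beta> / 2 * 6 * I" unfolding d3 by simp
  then show ?thesis using I by (simp add: zero_le_mult_iff)
qed

section \<open>The damping coefficient\<close>

text \<open>On the compact range \<open>{- R..R}\<close> the third derivative of \<open>U\<close> is bounded and the second derivative has a
  positive minimum. For negative \<open>R\<close> no \<open>v\<close> satisfies the hypothesis.\<close>

lemma q_coeff_bound:
  assumes U: "C_class 3 U" "\<forall>w. 0 < (deriv ^^ 2) U w"
  shows "\<exists>c\<ge>0. \<forall>X v j. X (j - 1) \<le> X j \<longrightarrow> (\<forall>x\<in>{X (j - 1)..X j}. \<bar>poly (v j) x\<bar> \<le> R) \<longrightarrow>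
    0 \<le> q_coeff U X v j \<and> q_coeff U X v j \<le> c"
proof (cases "0 \<le> R")
  case True
  obtain G where G: "G \<ge> 0" "\<And>i x. i \<le> 3 \<Longrightarrow> x \<in> {- R..R} \<Longrightarrow> \<bar>(deriv ^^ i) U x\<bar> \<le> G"
    using C_class_bounded[OF U(1), of R] by blast
  have c2: "continuous_on {- R..R} ((deriv ^^ 2) U)"
    using C_class_continuous[OF U(1), of 2] by (auto intro: continuous_on_subset)
  obtain z where z: "z \<in> {- R..R}" "\<And>x. x \<in> {- R..R} \<Longrightarrow> (deriv ^^ 2) U z \<le> (deriv ^^ 2) U x"
    using continuous_attains_inf[OF compact_Icc _ c2] True by auto
  define \<mu> where "\<mu> = (deriv ^^ 2) U z"
  have \<mu>: "0 < \<mu>" using U(2) by (simp add: \<mu>_def)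
  have "0 \<le> q_coeff U X v j \<and> q_coeff U X v j \<le> G / \<mu>"
    if X: "X (j - 1) \<le> X j" and v: "\<forall>x\<in>{X (j - 1)..X j}. \<bar>poly (v j) x\<bar> \<le> R" for X v j
  proof -
    have vR: "poly (v j) x \<in> {- R..R}" if "x \<in> {X (j - 1)..X j}" for x
      using v that by (force simp: abs_le_iff)
    have ne: "{X (j - 1)..X j} \<noteq> {}" using X by simp
    have s1: "(SUP x\<in>{X (j - 1)..X j}. \<bar>(deriv ^^ 3) U (poly (v j) x)\<bar>) \<le> G"
      using vR by (intro cSUP_least ne G(2)) auto
    have bdd: "bdd_above ((\<lambda>x. \<bar>(deriv ^^ 3) U (poly (v j) x)\<bar>) ` {X (j - 1)..X j})"
      using vR by (intro bdd_aboveI[of _ G]) (auto intro!: G(2))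
    have s2: "0 \<le> (SUP x\<in>{X (j - 1)..X j}. \<bar>(deriv ^^ 3) U (poly (v j) x)\<bar>)"
      by (rule cSUP_upper2[OF bdd, of "X j"]) (use X in auto)
    have i1: "\<mu> \<le> (INF x\<in>{X (j - 1)..X j}. \<bar>(deriv ^^ 2) U (poly (v j) x)\<bar>)"
    proof (rule cINF_greatest[OF ne])
      fix x assume "x \<in> {X (j - 1)..X j}"
      then show "\<mu> \<le> \<bar>(deriv ^^ 2) U (poly (v j) x)\<bar>" using z(2)[OF vR] unfolding \<mu>_def by force
    qed
    show ?thesis
      unfolding q_coeff_def using s1 s2 i1 \<mu> by (auto intro!: frac_le divide_nonneg_nonneg)
  qed
  moreover have "0 \<le> G / \<mu>" using G \<mu> by simp
  ultimately show ?thesis by blast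
next
  case False
  have "\<not> (\<forall>x\<in>{X (j - 1)..X j}. \<bar>poly (v j) x\<bar> \<le> R)" if "X (j - 1) \<le> X j" for X j and v :: "nat \<Rightarrow> real poly"
    using that False by (auto intro!: bexI[of _ "X j"])
  then show ?thesis by blast
qed

text \<open>The powers of \<open>b - a\<close> add up to \<open>r\<close>: the norm contributes a half, and one more comes from the
  final factor. This cancels \<open>1 / (b - a)^r\<close>, and \<open>r \<ge> k + 1\<close> covers the smooth part.\<close>

lemma damping_smooth_part:
  assumes "1 \<le> k" "C_class m f" "k + 2 \<le> m" "r \<in> {k + 1, k + 2}" and ab: "a < b" "b - a \<le> 1" and "0 \<le> \<epsilon>"
    and K: "\<And>x. x \<in> {a..b} \<Longrightarrow> \<bar>(deriv ^^ r) (\<lambda>y. f (poly p y)) x\<bar> \<le> K * (1 + \<epsilon> / (b - a) ^ r)" and K0: "0 \<le> K"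
  shows "(b - a) powr (real r - 3 / 2) * L2norm a b ((deriv ^^ r) (\<lambda>y. f (poly p y))) * (b - a)
    \<le> K * ((b - a) ^ (k + 1) + \<epsilon>)"
proof -
  define H where "H = b - a"
  have H: "0 < H" "H \<le> 1" using ab by (auto simp: H_def)
  have "L2norm a b ((deriv ^^ r) (\<lambda>y. f (poly p y))) \<le> sqrt H * (K * (1 + \<epsilon> / H ^ r))"
    unfolding H_def using assms by (intro L2norm_le_sup higher_deriv_comp_poly_continuous[of m] K) auto
  then have "H powr (real r - 3 / 2) * L2norm a b ((deriv ^^ r) (\<lambda>y. f (poly p y))) * H
      \<le> H powr (real r - 3 / 2) * (sqrt H * (K * (1 + \<epsilon> / H ^ r))) * H"
    using H by (intro mult_right_mono mult_left_mono) auto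
  also have "\<dots> = (H powr (real r - 3 / 2) * H powr (1 / 2) * H powr 1) * (K * (1 + \<epsilon> / H ^ r))"
    using H by (simp add: powr_half_sqrt mult_ac)
  also have "H powr (real r - 3 / 2) * H powr (1 / 2) * H powr 1 = H ^ r"
  proof -
    have "H powr (real r - 3 / 2) * H powr (1 / 2) * H powr 1 = H powr (real r - 3 / 2 + 1 / 2 + 1)"
      by (simp only: powr_add)
    also have "\<dots> = H powr real r" by simp
    finally show ?thesis using H by (simp only: powr_realpow)
  qed
  also have "H ^ r * (K * (1 + \<epsilon> / H ^ r)) = K * (H ^ r + \<epsilon>)" using H by (simp add: field_simps)
  also have "\<dots> \<le> K * (H ^ (k + 1) + \<epsilon>)"
    using H K0 assms(4) by (intro mult_left_mono add_right_mono power_decreasing) auto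
  finally show ?thesis by (simp add: H_def)
qed

text \<open>The projection of \<open>g = f(p)_x\<close> is compared with the Taylor polynomial of \<open>g\<close> of degree \<open>k - 1\<close>. The
  derivative of \<open>g\<close> of order \<open>k\<close>, which bounds the remainder, is one of order \<open>k + 1\<close> of \<open>f(p)\<close>.\<close>

lemma damping_projection_part:
  assumes "1 \<le> k" "C_class m f" "k + 2 \<le> m" and ab: "a < b" "b - a \<le> 1" and "0 \<le> \<epsilon>"
    and K: "\<And>x. x \<in> {a..b} \<Longrightarrow> \<bar>(deriv ^^ (k + 1)) (\<lambda>y. f (poly p y)) x\<bar> \<le> K * (1 + \<epsilon> / (b - a) ^ (k + 1))"
  defines "g \<equiv> deriv (\<lambda>y. f (poly p y))"
  shows "L2norm a b (\<lambda>x. g x - poly (L2proj k a b g) x) / sqrt (b - a) * (b - a)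
    \<le> K * ((b - a) ^ (k + 1) + \<epsilon>)"
proof -
  define H where "H = b - a"
  have H: "0 < H" "H \<le> 1" using ab by (auto simp: H_def)
  define d where "d i = (deriv ^^ Suc i) (\<lambda>y. f (poly p y))" for i
  have g: "g = d 0" by (simp add: g_def d_def)
  define S where "S = H * (K * (1 + \<epsilon> / H ^ (k + 1)))"
  have dd: "(d i has_real_derivative d (Suc i) x) (at x)" if "i < k" for i x
    unfolding d_def by (rule higher_deriv_comp_poly_derivative[OF assms(2)]) (use that assms(3) in simp)
  obtain k' where k': "k = Suc k'" using assms(1) by (cases k) auto
  have base: "\<bar>d k' x - d k' a\<bar> \<le> S" if x: "x \<in> {a..b}" for x
  proof (cases "x = a")
    case True
    have "0 \<le> K * (1 + \<epsilon> / (b - a) ^ (k + 1))" using K[of a] ab by force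
    then show ?thesis using True H by (simp add: S_def H_def)
  next
    case False
    then have ax: "a < x" using x by simp
    from MVT2[OF this, of "d k'" "d (Suc k')"] dd[of k'] k'
    obtain z where z: "a < z" "z < x" "d k' x - d k' a = (x - a) * d (Suc k') z" by auto
    have "\<bar>d k' x - d k' a\<bar> = (x - a) * \<bar>d (Suc k') z\<bar>" using z ax by (simp add: abs_mult)
    also have "\<dots> \<le> H * (K * (1 + \<epsilon> / H ^ (k + 1)))"
      using K[of z] z x H by (intro mult_mono) (auto simp: d_def k' H_def)
    finally show ?thesis by (simp add: S_def)
  qed
  have "\<bar>d 0 x - poly (taylor k' d a) x\<bar> \<le> H ^ k' * S" if "x \<in> {a..b}" for x
    unfolding H_def using that base dd k' by (intro taylor_error) (auto intro: has_field_derivative_at_within)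
  then have "L2norm a b (\<lambda>x. g x - poly (L2proj k a b g) x) \<le> sqrt H * (H ^ k' * S)"
    unfolding H_def
  proof (intro L2norm_L2proj_le_sup[where p = "taylor k' d a"] ab)
    show "continuous_on {a..b} g"
      unfolding g d_def by (rule higher_deriv_comp_poly_continuous[OF assms(2)]) (use assms(3) in simp)
    show "degree (taylor k' d a) \<le> k" using degree_taylor[of k' d a] k' by simp
  qed (simp add: g H_def)
  then have "L2norm a b (\<lambda>x. g x - poly (L2proj k a b g) x) / sqrt H * H \<le> (sqrt H * (H ^ k' * S)) / sqrt H * H"
    using H by (intro mult_right_mono divide_right_mono) auto
  also have "\<dots> = H ^ (k + 1) * (K * (1 + \<epsilon> / H ^ (k + 1)))" using H by (simp add: S_def k')
  also have "\<dots> = K * (H ^ (k + 1) + \<epsilon>)" using H by (simp add: field_simps)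
  finally show ?thesis by (simp add: H_def)
qed

text \<open>The bound \<open>\<sigma> h \<le> C (h^(k+1) + \<epsilon> + jumps)\<close>, with a constant that is uniform in the mesh and in all
  piecewise polynomials \<open>v\<close> that are bounded by \<open>R\<close> and satisfy the chain rule bound with constant
  \<open>K\<close>.\<close>

definition damping_bound :: "nat \<Rightarrow> real \<Rightarrow> (real \<Rightarrow> real) \<Rightarrow> (real \<Rightarrow> real \<Rightarrow> real) \<Rightarrow> scheme \<Rightarrow>
    real \<Rightarrow> real \<Rightarrow> real \<Rightarrow> bool" where
  "damping_bound k \<beta> f fh S R K C \<longleftrightarrow> (\<forall>bc N X v j \<epsilon>.
     0 < cell_size X j \<longrightarrow> cell_size X j \<le> 1 \<longrightarrow> 0 \<le> \<epsilon> \<longrightarrow>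
     (\<forall>x\<in>{X (j - 1)..X j}. \<bar>poly (v j) x\<bar> \<le> R) \<longrightarrow>
     (\<forall>i\<in>{j - 1, j}. trace_left bc N X v i \<in> {- R..R} \<and> trace_right bc N X v i \<in> {- R..R}) \<longrightarrow>
     (\<forall>r\<in>{k + 1, k + 2}. \<forall>x\<in>{X (j - 1)..X j}.
        \<bar>(deriv ^^ r) (\<lambda>y. f (poly (v j) y)) x\<bar> \<le> K * (1 + \<epsilon> / cell_size X j ^ r)) \<longrightarrow>
     0 \<le> sigma k \<beta> bc f fh N X S v j \<and>
     sigma k \<beta> bc f fh N X S v j * cell_size X j
       \<le> C * (cell_size X j ^ (k + 1) + \<epsilon> + \<bar>jump bc N X v (j - 1)\<bar> + \<bar>jump bc N X v j\<bar>))"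

lemma damping_combine:
  fixes q c P F P0 F0 x y H :: real
  assumes "0 \<le> q" "q \<le> c" "0 \<le> P" "0 \<le> F" "P * H \<le> P0 * x" "F * H \<le> F0 * y" "0 < H"
    and "0 \<le> x" "0 \<le> y" "0 \<le> P0" "0 \<le> F0"
  shows "0 \<le> q * (P + F) \<and> q * (P + F) * H \<le> c * (P0 + F0) * (x + y)"
proof -
  have "q * (P + F) * H = q * (P * H + F * H)" by (simp add: algebra_simps)
  also have "\<dots> \<le> c * (P * H + F * H)" using assms by (intro mult_right_mono) auto
  also have "\<dots> \<le> c * (P0 * x + F0 * y)" using assms by (intro mult_left_mono add_mono) auto
  also have "\<dots> \<le> c * ((P0 + F0) * (x + y))"
  proof (rule mult_left_mono)
    have "0 \<le> P0 * y + F0 * x" using assms by simp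
    then show "P0 * x + F0 * y \<le> (P0 + F0) * (x + y)" by (simp add: algebra_simps)
  qed (use assms in simp)
  finally show ?thesis using assms by (simp add: mult_ac)
qed

text \<open>The flux differences \<open>H_plus\<close>, \<open>H_minus\<close> are bounded by the jumps, because the flux is Lipschitz
  continuous and consistent. The norms were treated above, and the factor \<open>q_coeff\<close> is bounded.\<close>

lemma sigma_bound:
  assumes k: "1 \<le> k" and \<beta>: "beta_admissible k \<beta>" and f: "C_class m f" "k + 2 \<le> m"
    and S: "scheme_admissible k S" and L: "0 \<le> L"
    and cons: "\<And>z. fh z z = f z"
    and fhL: "\<And>x y x' y'. x \<in> {- R..R} \<Longrightarrow> y \<in> {- R..R} \<Longrightarrow> x' \<in> {- R..R} \<Longrightarrow> y' \<in> {- R..R} \<Longrightarrow>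
        \<bar>fh x y - fh x' y'\<bar> \<le> L * (\<bar>x - x'\<bar> + \<bar>y - y'\<bar>)"
    and K: "0 \<le> K"
  shows "\<exists>C\<ge>0. damping_bound k \<beta> f fh S R K C"
proof -
  have \<beta>0: "0 \<le> \<beta>" by (rule beta_admissible_nonneg[OF k \<beta>])
  have flux: "\<bar>H_plus bc f fh N X v i\<bar> \<le> L * \<bar>jump bc N X v i\<bar> \<and> \<bar>H_minus bc f fh N X v i\<bar> \<le> L * \<bar>jump bc N X v i\<bar>"
    if "trace_left bc N X v i \<in> {- R..R}" "trace_right bc N X v i \<in> {- R..R}" for bc N X v i
    using fhL[OF that that(2) that(2)] fhL[OF that that(1) that(1)]
    by (simp add: H_plus_def H_minus_def flux_at_def jump_def cons abs_minus_commute)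
  have fluxpart: "0 \<le> \<beta> / (2 * H) * (\<bar>A\<bar> + \<bar>B\<bar>) \<and> \<beta> / (2 * H) * (\<bar>A\<bar> + \<bar>B\<bar>) * H \<le> \<beta> * L * (\<bar>J1\<bar> + \<bar>J2\<bar>)"
    if "\<bar>A\<bar> \<le> L * \<bar>J1\<bar>" "\<bar>B\<bar> \<le> L * \<bar>J2\<bar>" "0 < H" for A B J1 J2 H :: real
  proof -
    have "\<beta> / (2 * H) * (\<bar>A\<bar> + \<bar>B\<bar>) * H = \<beta> / 2 * (\<bar>A\<bar> + \<bar>B\<bar>)" using that by simp
    also have "\<dots> \<le> \<beta> * (L * \<bar>J1\<bar> + L * \<bar>J2\<bar>)" using that \<beta>0 by (intro mult_mono) auto
    finally show ?thesis using \<beta>0 that by (simp add: algebra_simps)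
  qed
  show ?thesis
  proof (cases S)
    case (SchemeB U)
    then have U: "C_class 3 U" "\<forall>w. 0 < (deriv ^^ 2) U w" using S by simp_all
    from q_coeff_bound[OF this, of R]
    obtain c where c: "c \<ge> 0" "\<And>X v j. X (j - 1) \<le> X j \<Longrightarrow> (\<forall>x\<in>{X (j - 1)..X j}. \<bar>poly (v j) x\<bar> \<le> R) \<Longrightarrow>
      0 \<le> q_coeff U X v j \<and> q_coeff U X v j \<le> c"
      by blast
    define C where "C = c * (CL4 k / 2 * K + \<beta> * L)"
    have C0: "0 \<le> C" using c CL4_nonneg[of k] K \<beta>0 L by (simp add: C_def)
    show ?thesis
      unfolding damping_bound_def
    proof (rule exI[of _ C], intro conjI C0 allI impI)
      fix bc N X v j \<epsilon>
      assume H: "0 < cell_size X j" "cell_size X j \<le> 1" and \<epsilon>: "0 \<le> \<epsilon>"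
        and R: "\<forall>x\<in>{X (j - 1)..X j}. \<bar>poly (v j) x\<bar> \<le> R"
        and tr: "\<forall>i\<in>{j - 1, j}. trace_left bc N X v i \<in> {- R..R} \<and> trace_right bc N X v i \<in> {- R..R}"
        and dK: "\<forall>r\<in>{k + 1, k + 2}. \<forall>x\<in>{X (j - 1)..X j}.
          \<bar>(deriv ^^ r) (\<lambda>y. f (poly (v j) y)) x\<bar> \<le> K * (1 + \<epsilon> / cell_size X j ^ r)"
      let ?a = "X (j - 1)" and ?b = "X j" and ?H = "cell_size X j"
      have ab: "?a < ?b" "?b - ?a \<le> 1" using H by (auto simp: cell_size_def)
      define g where "g = deriv (\<lambda>y. f (poly (v j) y))"
      define P where "P = CL4 k / (2 * sqrt ?H) * L2norm ?a ?b (\<lambda>x. g x - poly (L2proj k ?a ?b g) x)"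
      define F where "F = \<beta> / (2 * ?H) * (\<bar>H_plus bc f fh N X v (j - 1)\<bar> + \<bar>H_minus bc f fh N X v j\<bar>)"
      have sg: "sigma k \<beta> bc f fh N X S v j = q_coeff U X v j * (P + F)"
        by (simp add: SchemeB P_def F_def g_def Let_def)
      have pp: "L2norm ?a ?b (\<lambda>x. g x - poly (L2proj k ?a ?b g) x) / sqrt ?H * ?H \<le> K * (?H ^ (k + 1) + \<epsilon>)"
        unfolding g_def cell_size_def
        by (rule damping_projection_part[OF k f ab \<epsilon>]) (use dK in \<open>auto simp: cell_size_def\<close>)
      have "P * ?H = CL4 k / 2 * (L2norm ?a ?b (\<lambda>x. g x - poly (L2proj k ?a ?b g) x) / sqrt ?H * ?H)"
        by (simp add: P_def)
      also have "\<dots> \<le> CL4 k / 2 * (K * (?H ^ (k + 1) + \<epsilon>))"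
        using pp CL4_nonneg[of k] by (intro mult_left_mono) auto
      finally have PH: "P * ?H \<le> CL4 k / 2 * K * (?H ^ (k + 1) + \<epsilon>)" by (simp add: mult_ac)
      have P0: "0 \<le> P" using CL4_nonneg[of k] L2norm_nonneg H by (auto simp: P_def)
      have F: "0 \<le> F \<and> F * ?H \<le> \<beta> * L * (\<bar>jump bc N X v (j - 1)\<bar> + \<bar>jump bc N X v j\<bar>)"
      proof -
        have "\<bar>H_plus bc f fh N X v (j - 1)\<bar> \<le> L * \<bar>jump bc N X v (j - 1)\<bar>"
          "\<bar>H_minus bc f fh N X v j\<bar> \<le> L * \<bar>jump bc N X v j\<bar>"
          using flux[of bc N X v "j - 1"] flux[of bc N X v j] tr by simp_all
        from fluxpart[OF this H(1)] show ?thesis unfolding F_def .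
      qed
      have "0 \<le> q_coeff U X v j * (P + F) \<and> q_coeff U X v j * (P + F) * ?H
          \<le> c * (CL4 k / 2 * K + \<beta> * L) * ((?H ^ (k + 1) + \<epsilon>) + (\<bar>jump bc N X v (j - 1)\<bar> + \<bar>jump bc N X v j\<bar>))"
        by (rule damping_combine) (use c(2)[of X j v, OF less_imp_le[OF ab(1)] R] P0 PH F H \<epsilon> CL4_nonneg[of k] K \<beta>0 L in simp_all)
      then show "0 \<le> sigma k \<beta> bc f fh N X S v j"
        "sigma k \<beta> bc f fh N X S v j * ?H
          \<le> C * (?H ^ (k + 1) + \<epsilon> + \<bar>jump bc N X v (j - 1)\<bar> + \<bar>jump bc N X v j\<bar>)"
        unfolding sg C_def by (simp_all only: add.assoc)
    qed
  next
    case (SchemeC U r)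
    then have U: "C_class 3 U" "\<forall>w. 0 < (deriv ^^ 2) U w" using S by simp_all
    from q_coeff_bound[OF this, of R]
    obtain c where c: "c \<ge> 0" "\<And>X v j. X (j - 1) \<le> X j \<Longrightarrow> (\<forall>x\<in>{X (j - 1)..X j}. \<bar>poly (v j) x\<bar> \<le> R) \<Longrightarrow>
      0 \<le> q_coeff U X v j \<and> q_coeff U X v j \<le> c"
      by blast
    have r: "r \<in> {k + 1, k + 2}" using S SchemeC by simp
    have CC: "0 \<le> CL4 k * Cproj k r" using CL4_nonneg Cproj_nonneg[OF k r] by simp
    define C where "C = c * (CL4 k * Cproj k r / 2 * K + \<beta> * L)"
    have C0: "0 \<le> C" using c CC K \<beta>0 L by (simp add: C_def)
    show ?thesis
      unfolding damping_bound_def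
    proof (rule exI[of _ C], intro conjI C0 allI impI)
      fix bc N X v j \<epsilon>
      assume H: "0 < cell_size X j" "cell_size X j \<le> 1" and \<epsilon>: "0 \<le> \<epsilon>"
        and R: "\<forall>x\<in>{X (j - 1)..X j}. \<bar>poly (v j) x\<bar> \<le> R"
        and tr: "\<forall>i\<in>{j - 1, j}. trace_left bc N X v i \<in> {- R..R} \<and> trace_right bc N X v i \<in> {- R..R}"
        and dK: "\<forall>r\<in>{k + 1, k + 2}. \<forall>x\<in>{X (j - 1)..X j}.
          \<bar>(deriv ^^ r) (\<lambda>y. f (poly (v j) y)) x\<bar> \<le> K * (1 + \<epsilon> / cell_size X j ^ r)"
      let ?a = "X (j - 1)" and ?b = "X j" and ?H = "cell_size X j"
      have ab: "?a < ?b" "?b - ?a \<le> 1" using H by (auto simp: cell_size_def)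
      define Z where "Z = L2norm ?a ?b ((deriv ^^ r) (\<lambda>y. f (poly (v j) y)))"
      define P where "P = CL4 k * Cproj k r * ?H powr (real r - 3 / 2) / 2 * Z"
      define F where "F = \<beta> / (2 * ?H) * (\<bar>H_plus bc f fh N X v (j - 1)\<bar> + \<bar>H_minus bc f fh N X v j\<bar>)"
      have sg: "sigma k \<beta> bc f fh N X S v j = q_coeff U X v j * (P + F)"
        by (simp add: SchemeC P_def F_def Z_def)
      have pp: "?H powr (real r - 3 / 2) * Z * ?H \<le> K * (?H ^ (k + 1) + \<epsilon>)"
        unfolding Z_def cell_size_def
        by (rule damping_smooth_part[OF k f r ab \<epsilon> _ K]) (use dK r in \<open>auto simp: cell_size_def\<close>)
      have "P * ?H = CL4 k * Cproj k r / 2 * (?H powr (real r - 3 / 2) * Z * ?H)"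
        by (simp add: P_def)
      also have "\<dots> \<le> CL4 k * Cproj k r / 2 * (K * (?H ^ (k + 1) + \<epsilon>))"
        using pp CC by (intro mult_left_mono) auto
      finally have PH: "P * ?H \<le> CL4 k * Cproj k r / 2 * K * (?H ^ (k + 1) + \<epsilon>)" by (simp add: mult_ac)
      have P0: "0 \<le> P" using CC L2norm_nonneg H by (auto simp: P_def Z_def)
      have F: "0 \<le> F \<and> F * ?H \<le> \<beta> * L * (\<bar>jump bc N X v (j - 1)\<bar> + \<bar>jump bc N X v j\<bar>)"
      proof -
        have "\<bar>H_plus bc f fh N X v (j - 1)\<bar> \<le> L * \<bar>jump bc N X v (j - 1)\<bar>"
          "\<bar>H_minus bc f fh N X v j\<bar> \<le> L * \<bar>jump bc N X v j\<bar>"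
          using flux[of bc N X v "j - 1"] flux[of bc N X v j] tr by simp_all
        from fluxpart[OF this H(1)] show ?thesis unfolding F_def .
      qed
      have "0 \<le> q_coeff U X v j * (P + F) \<and> q_coeff U X v j * (P + F) * ?H
          \<le> c * (CL4 k * Cproj k r / 2 * K + \<beta> * L) * ((?H ^ (k + 1) + \<epsilon>) + (\<bar>jump bc N X v (j - 1)\<bar> + \<bar>jump bc N X v j\<bar>))"
        by (rule damping_combine) (use c(2)[of X j v, OF less_imp_le[OF ab(1)] R] P0 PH F H \<epsilon> CC K \<beta>0 L in simp_all)
      then show "0 \<le> sigma k \<beta> bc f fh N X S v j"
        "sigma k \<beta> bc f fh N X S v j * ?H
          \<le> C * (?H ^ (k + 1) + \<epsilon> + \<bar>jump bc N X v (j - 1)\<bar> + \<bar>jump bc N X v j\<bar>)"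
        unfolding sg C_def by (simp_all only: add.assoc)
    qed
  next
    case (SchemeD r e1 e2)
    have r: "r \<in> {k + 1, k + 2}" and e: "0 < e1" "0 < e2" using S SchemeD by auto
    define C where "C = 1 * (e1 * K + e2)"
    have C0: "0 \<le> C" using e K by (simp add: C_def)
    show ?thesis
      unfolding damping_bound_def
    proof (rule exI[of _ C], intro conjI C0 allI impI)
      fix bc N X v j \<epsilon>
      assume H: "0 < cell_size X j" "cell_size X j \<le> 1" and \<epsilon>: "0 \<le> \<epsilon>"
        and R: "\<forall>x\<in>{X (j - 1)..X j}. \<bar>poly (v j) x\<bar> \<le> R"
        and tr: "\<forall>i\<in>{j - 1, j}. trace_left bc N X v i \<in> {- R..R} \<and> trace_right bc N X v i \<in> {- R..R}"
        and dK: "\<forall>r\<in>{k + 1, k + 2}. \<forall>x\<in>{X (j - 1)..X j}.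
          \<bar>(deriv ^^ r) (\<lambda>y. f (poly (v j) y)) x\<bar> \<le> K * (1 + \<epsilon> / cell_size X j ^ r)"
      let ?a = "X (j - 1)" and ?b = "X j" and ?H = "cell_size X j"
      have ab: "?a < ?b" "?b - ?a \<le> 1" using H by (auto simp: cell_size_def)
      define Z where "Z = L2norm ?a ?b ((deriv ^^ r) (\<lambda>y. f (poly (v j) y)))"
      define P where "P = e1 * ?H powr (real r - 3 / 2) * Z"
      define F where "F = e2 * (\<bar>jump bc N X v (j - 1)\<bar> + \<bar>jump bc N X v j\<bar>) / ?H"
      have sg: "sigma k \<beta> bc f fh N X S v j = 1 * (P + F)"
        by (simp add: SchemeD P_def F_def Z_def)
      have pp: "?H powr (real r - 3 / 2) * Z * ?H \<le> K * (?H ^ (k + 1) + \<epsilon>)"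
        unfolding Z_def cell_size_def
        by (rule damping_smooth_part[OF k f r ab \<epsilon> _ K]) (use dK r in \<open>auto simp: cell_size_def\<close>)
      have "P * ?H = e1 * (?H powr (real r - 3 / 2) * Z * ?H)"
        by (simp add: P_def)
      also have "\<dots> \<le> e1 * (K * (?H ^ (k + 1) + \<epsilon>))"
        using pp e by (intro mult_left_mono) auto
      finally have PH: "P * ?H \<le> e1 * K * (?H ^ (k + 1) + \<epsilon>)" by (simp add: mult_ac)
      have P0: "0 \<le> P" using e L2norm_nonneg H by (auto simp: P_def Z_def)
      have F: "0 \<le> F \<and> F * ?H \<le> e2 * (\<bar>jump bc N X v (j - 1)\<bar> + \<bar>jump bc N X v j\<bar>)"
        using e H by (simp add: F_def)
      have "0 \<le> 1 * (P + F) \<and> 1 * (P + F) * ?H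
          \<le> 1 * (e1 * K + e2) * ((?H ^ (k + 1) + \<epsilon>) + (\<bar>jump bc N X v (j - 1)\<bar> + \<bar>jump bc N X v j\<bar>))"
        by (rule damping_combine) (use P0 PH F H \<epsilon> e K in simp_all)
      then show "0 \<le> sigma k \<beta> bc f fh N X S v j"
        "sigma k \<beta> bc f fh N X S v j * ?H
          \<le> C * (?H ^ (k + 1) + \<epsilon> + \<bar>jump bc N X v (j - 1)\<bar> + \<bar>jump bc N X v j\<bar>)"
        unfolding sg C_def by (simp_all only: add.assoc)
    qed
  qed
qed

section \<open>The energy inequality on one cell\<close>

lemma avg_near:
  assumes "a < b" "continuous_on {a..b} g" "\<And>x. x \<in> {a..b} \<Longrightarrow> \<bar>g x - c\<bar> \<le> d"
  shows "\<bar>avg a b g - c\<bar> \<le> d"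
proof -
  have "integral {a..b} (\<lambda>x. g x - c) = integral {a..b} g - c * (b - a)"
    using assms by (subst integral_diff) (auto intro: integrable_continuous_interval)
  moreover have "\<bar>integral {a..b} (\<lambda>x. g x - c)\<bar> \<le> d * (b - a)"
    using assms by (intro abs_integral_le_sup continuous_intros) auto
  ultimately have "\<bar>integral {a..b} g - c * (b - a)\<bar> \<le> d * (b - a)" by simp
  moreover have "avg a b g - c = (integral {a..b} g - c * (b - a)) / (b - a)"
    using assms(1) by (simp add: avg_def diff_divide_distrib)
  ultimately show ?thesis using assms(1) by (simp add: abs_divide divide_le_eq)
qed

text \<open>For \<open>u = q + e\<close>, the mean value of \<open>u - u_avg\<close> is zero, so \<open>e\<close> may be replaced by \<open>e - e_avg\<close> in the
  integral. This leaves the nonnegative square of \<open>e - e_avg\<close> and the product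
  \<open>(q - q_avg) (e - e_avg)\<close>.\<close>

lemma damping_term_bound:
  fixes q e :: "real poly"
  assumes ab: "a < b" and \<epsilon>: "\<And>x. x \<in> {a..b} \<Longrightarrow> \<bar>poly e x\<bar> \<le> \<epsilon>"
    and d: "\<And>x. x \<in> {a..b} \<Longrightarrow> \<bar>poly q x - c\<bar> \<le> d"
  shows "- (4 * d * \<epsilon> * (b - a)) \<le> integral {a..b} (\<lambda>x. (poly (q + e) x - avg a b (poly (q + e))) * poly e x)"
proof -
  define qa where "qa = avg a b (poly q)"
  define ea where "ea = avg a b (poly e)"
  have \<epsilon>0: "0 \<le> \<epsilon>" using \<epsilon>[of a] ab by force
  have int: "g integrable_on {a..b}" if "continuous_on {a..b} g" for g :: "real \<Rightarrow> real"
    using that by (rule integrable_continuous_interval)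
  have cp: "continuous_on {a..b} (\<lambda>x. poly p x)" for p :: "real poly" by (intro continuous_intros)
  have av: "avg a b (poly (q + e)) = qa + ea"
  proof -
    have "poly (q + e) = (\<lambda>x. poly q x + poly e x)" by (rule ext) simp
    then show ?thesis
      unfolding qa_def ea_def avg_def using integral_add[OF int[OF cp[of q]] int[OF cp[of e]]]
      by (simp add: add_divide_distrib)
  qed
  have mean0: "integral {a..b} (\<lambda>x. poly p x - avg a b (poly p)) = 0" for p :: "real poly"
    using ab integral_diff[OF int[OF cp[of p]] integrable_const_ivl[of "avg a b (poly p)"]] by (simp add: avg_def)
  have ea: "\<bar>ea\<bar> \<le> \<epsilon>" using avg_near[OF ab, of "poly e" 0 \<epsilon>] cp \<epsilon> by (simp add: ea_def)
  have qa: "\<bar>qa - c\<bar> \<le> d" unfolding qa_def using avg_near[OF ab cp d] by simp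
  have "integral {a..b} (\<lambda>x. (poly (q + e) x - avg a b (poly (q + e))) * poly e x)
    = integral {a..b} (\<lambda>x. (poly e x - ea)\<^sup>2 + (poly q x - qa) * (poly e x - ea)
        + ea * (poly (q + e) x - avg a b (poly (q + e))))"
    by (intro integral_cong) (simp only: av poly_add, simp add: power2_eq_square algebra_simps)
  also have "\<dots> = integral {a..b} (\<lambda>x. (poly e x - ea)\<^sup>2 + (poly q x - qa) * (poly e x - ea))
      + integral {a..b} (\<lambda>x. ea * (poly (q + e) x - avg a b (poly (q + e))))"
    by (intro integral_add int continuous_intros)
  also have "integral {a..b} (\<lambda>x. ea * (poly (q + e) x - avg a b (poly (q + e)))) = 0"
    using mean0[of "q + e"] by simp
  also have "integral {a..b} (\<lambda>x. (poly e x - ea)\<^sup>2 + (poly q x - qa) * (poly e x - ea))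
    = integral {a..b} (\<lambda>x. (poly e x - ea)\<^sup>2) + integral {a..b} (\<lambda>x. (poly q x - qa) * (poly e x - ea))"
    by (intro integral_add int continuous_intros)
  finally have eq: "integral {a..b} (\<lambda>x. (poly (q + e) x - avg a b (poly (q + e))) * poly e x)
    = integral {a..b} (\<lambda>x. (poly e x - ea)\<^sup>2) + integral {a..b} (\<lambda>x. (poly q x - qa) * (poly e x - ea))"
    by (simp only: add_0_right)
  have 1: "0 \<le> integral {a..b} (\<lambda>x. (poly e x - ea)\<^sup>2)"
    by (intro integral_nonneg int continuous_intros) auto
  have 2: "\<bar>integral {a..b} (\<lambda>x. (poly q x - qa) * (poly e x - ea))\<bar> \<le> (2 * d) * (2 * \<epsilon>) * (b - a)"
  proof (intro abs_integral_le_sup continuous_intros)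
    fix x assume x: "x \<in> {a..b}"
    have "\<bar>poly q x - qa\<bar> \<le> 2 * d" using d[OF x] qa by linarith
    moreover have "\<bar>poly e x - ea\<bar> \<le> 2 * \<epsilon>" using \<epsilon>[OF x] ea by linarith
    ultimately show "\<bar>(poly q x - qa) * (poly e x - ea)\<bar> \<le> (2 * d) * (2 * \<epsilon>)"
      unfolding abs_mult by (intro mult_mono) auto
  qed (use ab in auto)
  have "(2 * d) * (2 * \<epsilon>) * (b - a) = 4 * d * \<epsilon> * (b - a)" by simp
  then show ?thesis unfolding eq using 1 2 by linarith
qed

lemma second_order_remainder:
  fixes f :: "real \<Rightarrow> real"
  assumes f1: "\<And>x. (f has_real_derivative f1 x) (at x)"
    and L: "\<And>x y. x \<in> {- R..R} \<Longrightarrow> y \<in> {- R..R} \<Longrightarrow> \<bar>f1 x - f1 y\<bar> \<le> L * \<bar>x - y\<bar>"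
    and x: "x \<in> {- R..R}" "x + d \<in> {- R..R}" "z \<in> {- R..R}"
    and \<delta>: "\<bar>x - z\<bar> + \<bar>d\<bar> \<le> \<delta>" and "0 \<le> L"
  shows "\<bar>f (x + d) - f x - f1 z * d\<bar> \<le> L * \<delta> * \<bar>d\<bar>"
proof -
  obtain \<xi> where \<xi>: "\<xi> \<in> closed_segment x (x + d)" "f (x + d) - f x = (x + d - x) * f1 \<xi>"
    using mvt_segment[of x "x + d" f f1] f1 by blast
  have R: "\<xi> \<in> {- R..R}" by (rule segment_subset_interval[OF x(1,2) \<xi>(1)])
  have "\<bar>\<xi> - z\<bar> \<le> \<delta>"
    using \<xi>(1) \<delta> by (auto simp: closed_segment_eq_real_ivl split: if_splits)
  then have "L * \<bar>\<xi> - z\<bar> \<le> L * \<delta>" using \<open>0 \<le> L\<close> by (rule mult_left_mono)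
  then have l: "\<bar>f1 \<xi> - f1 z\<bar> \<le> L * \<delta>" using L[OF R x(3)] by linarith
  have "f (x + d) - f x - f1 z * d = (f1 \<xi> - f1 z) * d" unfolding \<xi>(2) by (simp add: algebra_simps)
  then show ?thesis using mult_right_mono[OF l, of "\<bar>d\<bar>"] by (simp add: abs_mult)
qed

lemma product_le_sum_squares: "x * y \<le> x\<^sup>2 + (y :: real)\<^sup>2"
  using sum_squares_bound[of x y] zero_le_power2[of x] zero_le_power2[of y] by linarith

text \<open>The energy balance of one cell. The exact solution satisfies
  \<open>\<integral> w_t e = - \<integral> f(w)_x e\<close>, and the difference between this and the scheme is split so that the only
  term with \<open>e_x\<close> and without \<open>\<eta>\<close> occurs in the derivative of \<open>\<Phi>(w + e) - \<Phi>(w)\<close>. The numbers \<open>F0\<close>,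
  \<open>F1\<close> are the fluxes at the two ends, \<open>\<theta>\<close> stands for \<open>h_j^(k+1)\<close> and \<open>\<epsilon>\<close> for the supremum of \<open>e\<close>. The
  hypothesis \<open>alt\<close> offers the two ways of controlling \<open>f'(w) \<eta> e_x\<close>.\<close>

lemma cell_energy_inequality:
  fixes f \<Phi> W Wx Wt :: "real \<Rightarrow> real" and e q ut qt :: "real poly"
  assumes ab: "a < b" and \<Phi>: "\<And>x. x \<in> {- R..R} \<Longrightarrow> (\<Phi> has_real_derivative f x) (at x)"
    and f1: "\<And>x. (f has_real_derivative f1 x) (at x)" and cf1: "continuous_on UNIV f1"
    and L: "\<And>x y. x \<in> {- R..R} \<Longrightarrow> y \<in> {- R..R} \<Longrightarrow> \<bar>f1 x - f1 y\<bar> \<le> L * \<bar>x - y\<bar>" and L0: "0 \<le> L"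
    and R: "R = M + 2"
    and W: "\<And>x. x \<in> {a..b} \<Longrightarrow> (W has_real_derivative Wx x) (at x)"
    and cWx: "continuous_on {a..b} Wx" and cWt: "continuous_on {a..b} Wt"
    and pde: "\<And>x. x \<in> {a..b} \<Longrightarrow> Wt x = - f1 (W x) * Wx x"
    and WM: "\<And>x. x \<in> {a..b} \<Longrightarrow> \<bar>W x\<bar> \<le> M" and WxM: "\<And>x. x \<in> {a..b} \<Longrightarrow> \<bar>Wx x\<bar> \<le> M"
    and \<epsilon>: "\<And>x. x \<in> {a..b} \<Longrightarrow> \<bar>poly e x\<bar> \<le> \<epsilon>" "\<epsilon> \<le> 1"
    and ex: "\<And>x. x \<in> {a..b} \<Longrightarrow> \<bar>poly (pderiv e) x\<bar> \<le> Ci * \<epsilon> / (b - a)" and Ci: "0 \<le> Ci"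
    and \<eta>: "\<And>x. x \<in> {a..b} \<Longrightarrow> \<bar>W x - poly q x\<bar> \<le> Ce * \<theta>"
    and \<eta>t: "\<And>x. x \<in> {a..b} \<Longrightarrow> \<bar>Wt x - poly qt x\<bar> \<le> Ce * \<theta>"
    and Ce: "0 \<le> Ce" and \<theta>: "0 \<le> \<theta>" "\<theta> \<le> b - a" "Ce * \<theta> \<le> 1"
    and alt: "integral {a..b} (\<lambda>x. (W x - poly q x) * poly (pderiv e) x) = 0 \<or> (\<forall>x\<in>{a..b}. \<bar>f1 (W x)\<bar> \<le> A * (b - a))"
    and A: "0 \<le> A" and \<sigma>: "0 \<le> \<sigma>"
    and scheme: "integral {a..b} (\<lambda>x. poly ut x * poly e x)
        - integral {a..b} (\<lambda>x. f (poly (q + e) x) * poly (pderiv e) x) + F1 * poly e b - F0 * poly e a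
      = - \<sigma> * integral {a..b} (\<lambda>x. (poly (q + e) x - avg a b (poly (q + e))) * poly e x)"
  shows "integral {a..b} (\<lambda>x. poly (ut - qt) x * poly e x)
    \<le> (\<Phi> (W b + poly e b) - \<Phi> (W b) - F1 * poly e b) - (\<Phi> (W a + poly e a) - \<Phi> (W a) - F0 * poly e a)
      + (L * M + L * Ci * Ce * (1 + Ce) + (L * M + A) * Ci * Ce + Ce) * ((b - a) * (\<epsilon>\<^sup>2 + \<theta>\<^sup>2))
      + 4 * (M + Ce) * ((b - a) * \<epsilon>) * (\<sigma> * (b - a))"
proof -
  define H where "H = b - a"
  have H: "0 < H" using ab by (simp add: H_def)
  have aI: "a \<in> {a..b}" using ab by simp
  have \<epsilon>0: "0 \<le> \<epsilon>" using \<epsilon>(1)[OF aI] by linarith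
  have M0: "0 \<le> M" using WM[OF aI] by linarith
  have cf: "continuous_on UNIV f" using f1 by (meson DERIV_isCont continuous_at_imp_continuous_on)
  have cW: "continuous_on {a..b} W" using W by (meson DERIV_isCont continuous_at_imp_continuous_on)
  have cfc: "continuous_on {a..b} (\<lambda>x. f (g x))" and cf1c: "continuous_on {a..b} (\<lambda>x. f1 (g x))"
    if "continuous_on {a..b} g" for g
    using continuous_on_compose2[OF cf that] continuous_on_compose2[OF cf1 that] by auto
  note cont = continuous_intros cW cWx cWt cfc cf1c
  have int: "g integrable_on {a..b}" if "continuous_on {a..b} g" for g :: "real \<Rightarrow> real"
    using that by (rule integrable_continuous_interval)
  have rng: "W x \<in> {- R..R}" "W x + poly e x \<in> {- R..R}" "poly (q + e) x \<in> {- R..R}" if "x \<in> {a..b}" for x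
    using WM[OF that] \<epsilon>(1)[OF that] \<epsilon>(2) \<eta>[OF that] \<theta>(3) R by auto
  have Wlip: "\<bar>W x - W a\<bar> \<le> H * M" if x: "x \<in> {a..b}" for x
  proof -
    have "(W has_real_derivative Wx y) (at y)" if "y \<in> closed_segment a x" for y
      using that x by (intro W) (auto simp: closed_segment_eq_real_ivl)
    from mvt_segment[OF this] obtain \<xi> where \<xi>: "\<xi> \<in> closed_segment a x" "W x - W a = (x - a) * Wx \<xi>"
      by blast
    have "\<xi> \<in> {a..b}" using \<xi>(1) x by (auto simp: closed_segment_eq_real_ivl)
    then show ?thesis
      unfolding \<xi>(2) abs_mult using x WxM H by (intro mult_mono) (auto simp: H_def)
  qed
  have G: "((\<lambda>x. f (W x + poly e x) * (Wx x + poly (pderiv e) x) - f (W x) * Wx x) has_integral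
      (\<Phi> (W b + poly e b) - \<Phi> (W b)) - (\<Phi> (W a + poly e a) - \<Phi> (W a))) {a..b}"
  proof (rule fundamental_theorem_of_calculus)
    fix x assume x: "x \<in> {a..b}"
    have "((\<lambda>x. \<Phi> (W x + poly e x) - \<Phi> (W x)) has_real_derivative
        f (W x + poly e x) * (Wx x + poly (pderiv e) x) - f (W x) * Wx x) (at x)"
      by (intro DERIV_diff DERIV_chain2[OF \<Phi>] DERIV_add W poly_DERIV rng x)
    then show "((\<lambda>x. \<Phi> (W x + poly e x) - \<Phi> (W x)) has_vector_derivative
        f (W x + poly e x) * (Wx x + poly (pderiv e) x) - f (W x) * Wx x) (at x within {a..b})"
      by (simp add: has_real_derivative_iff_has_vector_derivative[symmetric] has_field_derivative_at_within)
  qed (use ab in auto)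
  let ?ex = "\<lambda>x. poly (pderiv e) x"
  \<comment> \<open>The second order remainder in \<open>e\<close>, which carries \<open>w_x\<close> instead of \<open>e_x\<close>.\<close>
  define I1 where "I1 = integral {a..b} (\<lambda>x. (f (W x + poly e x) - f (W x) - f1 (W x) * poly e x) * Wx x)"
  \<comment> \<open>The second order remainder in \<open>\<eta>\<close>; the factor \<open>\<eta>\<close> pays for \<open>e_x\<close>.\<close>
  define I2 where "I2 = integral {a..b} (\<lambda>x. (f (poly (q + e) x) - f (W x + poly e x) + f1 (W x) * (W x - poly q x)) * ?ex x)"
  \<comment> \<open>The linear term in \<open>\<eta>\<close>.\<close>
  define I3 where "I3 = integral {a..b} (\<lambda>x. f1 (W x) * (W x - poly q x) * ?ex x)"
  \<comment> \<open>The projection error of the time derivative.\<close>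
  define I4 where "I4 = integral {a..b} (\<lambda>x. (Wt x - poly qt x) * poly e x)"
  \<comment> \<open>The damping term.\<close>
  define I5 where "I5 = integral {a..b} (\<lambda>x. (poly (q + e) x - avg a b (poly (q + e))) * poly e x)"
  \<comment> \<open>The exact derivative.\<close>
  define GG where "GG = integral {a..b} (\<lambda>x. f (W x + poly e x) * (Wx x + ?ex x) - f (W x) * Wx x)"
  define U where "U = integral {a..b} (\<lambda>x. poly ut x * poly e x)"
  define V where "V = integral {a..b} (\<lambda>x. f (poly (q + e) x) * ?ex x)"
  define Qt where "Qt = integral {a..b} (\<lambda>x. poly qt x * poly e x)"
  have identity: "integral {a..b} (\<lambda>x. poly (ut - qt) x * poly e x) = U - Qt"
    unfolding U_def Qt_def by (subst integral_diff[symmetric]) (auto intro!: int cont simp: algebra_simps)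
  have "V - Qt = integral {a..b} (\<lambda>x. f (poly (q + e) x) * ?ex x - poly qt x * poly e x)"
    unfolding V_def Qt_def by (rule integral_diff[symmetric]) (intro int cont)+
  also have "\<dots> = integral {a..b} (\<lambda>x. ((((f (W x + poly e x) * (Wx x + ?ex x) - f (W x) * Wx x)
      - (f (W x + poly e x) - f (W x) - f1 (W x) * poly e x) * Wx x)
      + (f (poly (q + e) x) - f (W x + poly e x) + f1 (W x) * (W x - poly q x)) * ?ex x)
      - f1 (W x) * (W x - poly q x) * ?ex x)
      + (Wt x - poly qt x) * poly e x)"
    by (intro integral_cong) (simp add: pde algebra_simps)
  also have "\<dots> = GG - I1 + I2 - I3 + I4"
    unfolding GG_def I1_def I2_def I3_def I4_def
    by (subst integral_add integral_diff, (intro int cont)+)+ simp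
  finally have VQ: "V - Qt = GG - I1 + I2 - I3 + I4" .
  have GGe: "GG = (\<Phi> (W b + poly e b) - \<Phi> (W b)) - (\<Phi> (W a + poly e a) - \<Phi> (W a))"
    unfolding GG_def by (rule integral_unique[OF G])
  have sch: "U = V - F1 * poly e b + F0 * poly e a - \<sigma> * I5"
    using scheme unfolding U_def V_def I5_def by linarith
  have b1: "\<bar>I1\<bar> \<le> (L * \<epsilon> * \<epsilon> * M) * H"
    unfolding I1_def H_def
  proof (rule abs_integral_le_sup)
    fix x assume x: "x \<in> {a..b}"
    have "\<bar>f (W x + poly e x) - f (W x) - f1 (W x) * poly e x\<bar> \<le> L * \<epsilon> * \<bar>poly e x\<bar>"
      by (rule second_order_remainder[OF f1 L]) (use rng[OF x] \<epsilon>(1)[OF x] L0 in auto)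
    also have "\<dots> \<le> L * \<epsilon> * \<epsilon>" using \<epsilon>(1)[OF x] L0 \<epsilon>0 by (intro mult_left_mono) auto
    finally show "\<bar>(f (W x + poly e x) - f (W x) - f1 (W x) * poly e x) * Wx x\<bar> \<le> L * \<epsilon> * \<epsilon> * M"
      unfolding abs_mult using WxM[OF x] L0 \<epsilon>0 by (intro mult_mono) auto
  qed (use ab in \<open>auto intro!: cont\<close>)
  have b2: "\<bar>I2\<bar> \<le> (L * (\<epsilon> + Ce * \<theta>) * (Ce * \<theta>) * (Ci * \<epsilon> / H)) * H"
    unfolding I2_def H_def
  proof (rule abs_integral_le_sup)
    fix x assume x: "x \<in> {a..b}"
    define d where "d = - (W x - poly q x)"
    have u: "poly (q + e) x = (W x + poly e x) + d" by (simp add: d_def)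
    have ad: "\<bar>d\<bar> \<le> Ce * \<theta>" using \<eta>[OF x] by (simp add: d_def)
    have "\<bar>f ((W x + poly e x) + d) - f (W x + poly e x) - f1 (W x) * d\<bar> \<le> L * (\<epsilon> + Ce * \<theta>) * \<bar>d\<bar>"
      by (rule second_order_remainder[OF f1 L]) (use rng[OF x] \<epsilon>(1)[OF x] ad L0 u in auto)
    also have "\<dots> \<le> L * (\<epsilon> + Ce * \<theta>) * (Ce * \<theta>)" using ad L0 \<epsilon>0 Ce \<theta> by (intro mult_left_mono) auto
    finally have "\<bar>f (poly (q + e) x) - f (W x + poly e x) + f1 (W x) * (W x - poly q x)\<bar>
        \<le> L * (\<epsilon> + Ce * \<theta>) * (Ce * \<theta>)"
      unfolding u by (simp add: d_def algebra_simps)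
    then show "\<bar>(f (poly (q + e) x) - f (W x + poly e x) + f1 (W x) * (W x - poly q x)) * ?ex x\<bar>
        \<le> L * (\<epsilon> + Ce * \<theta>) * (Ce * \<theta>) * (Ci * \<epsilon> / (b - a))"
      unfolding abs_mult using ex[OF x] L0 \<epsilon>0 Ce \<theta> by (intro mult_mono) auto
  qed (use ab in \<open>auto intro!: cont\<close>)
  have b3: "\<bar>I3\<bar> \<le> ((L * M + A) * H * (Ce * \<theta>) * (Ci * \<epsilon> / H)) * H"
  proof -
    \<comment> \<open>The constant is \<open>c = f1 (W a)\<close> if \<open>\<eta>\<close> is orthogonal to \<open>e_x\<close>, and zero if \<open>f1 (W x)\<close> is small.\<close>
    have main: "\<bar>integral {a..b} (\<lambda>x. (f1 (W x) - c) * (W x - poly q x) * ?ex x)\<bar>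
        \<le> ((L * M + A) * H * (Ce * \<theta>) * (Ci * \<epsilon> / H)) * H"
      if c: "\<And>x. x \<in> {a..b} \<Longrightarrow> \<bar>f1 (W x) - c\<bar> \<le> (L * M + A) * H" for c
      unfolding H_def
    proof (rule abs_integral_le_sup)
      fix x assume x: "x \<in> {a..b}"
      have "0 \<le> L * M + A" using L0 M0 A by simp
      then show "\<bar>(f1 (W x) - c) * (W x - poly q x) * ?ex x\<bar>
          \<le> (L * M + A) * (b - a) * (Ce * \<theta>) * (Ci * \<epsilon> / (b - a))"
        unfolding abs_mult using ex[OF x] c[OF x] \<eta>[OF x] Ce \<theta> by (intro mult_mono mult_nonneg_nonneg) (use H in \<open>auto simp: H_def\<close>)
    qed (use ab in \<open>auto intro!: cont\<close>)
    from alt show ?thesis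
    proof
      assume o: "integral {a..b} (\<lambda>x. (W x - poly q x) * ?ex x) = 0"
      have "integral {a..b} (\<lambda>x. (f1 (W x) - f1 (W a)) * (W x - poly q x) * ?ex x)
          = integral {a..b} (\<lambda>x. f1 (W x) * (W x - poly q x) * ?ex x - f1 (W a) * ((W x - poly q x) * ?ex x))"
        by (intro integral_cong) (simp add: algebra_simps)
      also have "\<dots> = I3 - integral {a..b} (\<lambda>x. f1 (W a) * ((W x - poly q x) * ?ex x))"
        unfolding I3_def by (rule integral_diff) (intro int cont)+
      also have "\<dots> = I3" using o by simp
      finally have e: "integral {a..b} (\<lambda>x. (f1 (W x) - f1 (W a)) * (W x - poly q x) * ?ex x) = I3" .
      have "\<bar>f1 (W x) - f1 (W a)\<bar> \<le> (L * M + A) * H" if x: "x \<in> {a..b}" for x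
      proof -
        have "\<bar>W x - W a\<bar> \<le> H * M" by (rule Wlip[OF x])
        then have "L * \<bar>W x - W a\<bar> \<le> L * (H * M)" using L0 by (rule mult_left_mono)
        then have "\<bar>f1 (W x) - f1 (W a)\<bar> \<le> L * (H * M)"
          using L[OF rng(1)[OF x] rng(1)[OF aI]] by linarith
        also have "\<dots> \<le> (L * M + A) * H" using A H by (simp add: algebra_simps)
        finally show ?thesis .
      qed
      from main[OF this] show ?thesis unfolding e .
    next
      assume s: "\<forall>x\<in>{a..b}. \<bar>f1 (W x)\<bar> \<le> A * (b - a)"
      have "\<bar>f1 (W x) - 0\<bar> \<le> (L * M + A) * H" if "x \<in> {a..b}" for x
      proof -
        have "\<bar>f1 (W x) - 0\<bar> \<le> A * H" using s that by (simp add: H_def)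
        also have "\<dots> \<le> (L * M + A) * H" using L0 M0 H by (intro mult_right_mono) auto
        finally show ?thesis .
      qed
      from main[OF this] show ?thesis by (simp add: I3_def)
    qed
  qed
  have b4: "\<bar>I4\<bar> \<le> ((Ce * \<theta>) * \<epsilon>) * H"
    unfolding I4_def H_def
  proof (rule abs_integral_le_sup)
    fix x assume x: "x \<in> {a..b}"
    show "\<bar>(Wt x - poly qt x) * poly e x\<bar> \<le> (Ce * \<theta>) * \<epsilon>"
      unfolding abs_mult using \<eta>t[OF x] \<epsilon>(1)[OF x] Ce \<theta> by (intro mult_mono) auto
  qed (use ab in \<open>auto intro!: cont\<close>)
  have b5: "- (4 * ((M + Ce) * H) * \<epsilon> * H) \<le> I5"
    unfolding I5_def H_def
  proof (rule damping_term_bound[OF ab \<epsilon>(1)])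
    fix x assume x: "x \<in> {a..b}"
    have "\<bar>W x - W a\<bar> \<le> H * M" by (rule Wlip[OF x])
    moreover have "Ce * \<theta> \<le> Ce * H" using \<theta> Ce by (intro mult_left_mono) (auto simp: H_def)
    ultimately have "\<bar>poly q x - W a\<bar> \<le> H * M + Ce * H" using \<eta>[OF x] by linarith
    then show "\<bar>poly q x - W a\<bar> \<le> (M + Ce) * (b - a)" by (simp add: H_def algebra_simps)
  qed
  have y: "\<epsilon> * \<theta> \<le> \<epsilon>\<^sup>2 + \<theta>\<^sup>2" "\<epsilon> * \<epsilon> \<le> \<epsilon>\<^sup>2 + \<theta>\<^sup>2"
    using product_le_sum_squares[of \<epsilon> \<theta>] by (auto simp: power2_eq_square)
  let ?Y = "H * (\<epsilon>\<^sup>2 + \<theta>\<^sup>2)"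
  have c1: "\<bar>I1\<bar> \<le> L * M * ?Y"
  proof -
    have "(L * \<epsilon> * \<epsilon> * M) * H = L * M * H * (\<epsilon> * \<epsilon>)" by simp
    also have "\<dots> \<le> L * M * H * (\<epsilon>\<^sup>2 + \<theta>\<^sup>2)" using y L0 M0 H by (intro mult_left_mono) auto
    finally show ?thesis using b1 by (simp add: mult_ac)
  qed
  have c2: "\<bar>I2\<bar> \<le> L * Ci * Ce * (1 + Ce) * ?Y"
  proof -
    have "(L * (\<epsilon> + Ce * \<theta>) * (Ce * \<theta>) * (Ci * \<epsilon> / H)) * H = L * Ci * Ce * \<theta> * (\<epsilon> * \<epsilon> + Ce * (\<epsilon> * \<theta>))"
      using H by (simp add: algebra_simps)
    also have "\<dots> \<le> L * Ci * Ce * H * ((\<epsilon>\<^sup>2 + \<theta>\<^sup>2) + Ce * (\<epsilon>\<^sup>2 + \<theta>\<^sup>2))"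
      using y L0 Ci Ce \<theta> \<epsilon>0 H by (intro mult_mono mult_nonneg_nonneg add_mono mult_left_mono) (auto simp: H_def)
    also have "\<dots> = L * Ci * Ce * (1 + Ce) * ?Y" by (simp add: algebra_simps)
    finally show ?thesis using b2 by linarith
  qed
  have c3: "\<bar>I3\<bar> \<le> (L * M + A) * Ci * Ce * ?Y"
  proof -
    have "((L * M + A) * H * (Ce * \<theta>) * (Ci * \<epsilon> / H)) * H = (L * M + A) * Ci * Ce * H * (\<epsilon> * \<theta>)"
      using H by simp
    also have "\<dots> \<le> (L * M + A) * Ci * Ce * H * (\<epsilon>\<^sup>2 + \<theta>\<^sup>2)"
      using y L0 M0 A Ci Ce H by (intro mult_left_mono) auto
    finally show ?thesis using b3 by (simp add: mult_ac)
  qed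
  have c4: "\<bar>I4\<bar> \<le> Ce * ?Y"
  proof -
    have "((Ce * \<theta>) * \<epsilon>) * H = Ce * H * (\<epsilon> * \<theta>)" by simp
    also have "\<dots> \<le> Ce * H * (\<epsilon>\<^sup>2 + \<theta>\<^sup>2)" using y Ce H by (intro mult_left_mono) auto
    finally show ?thesis using b4 by (simp add: mult_ac)
  qed
  have c5: "- (\<sigma> * I5) \<le> 4 * (M + Ce) * (H * \<epsilon>) * (\<sigma> * H)"
    using mult_left_mono[OF b5 \<sigma>] by (simp add: algebra_simps)
  have "U - Qt = (V - Qt) - F1 * poly e b + F0 * poly e a - \<sigma> * I5" using sch by simp
  also have "\<dots> \<le> GG - F1 * poly e b + F0 * poly e a
      + (L * M * ?Y + L * Ci * Ce * (1 + Ce) * ?Y + (L * M + A) * Ci * Ce * ?Y + Ce * ?Y)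
      + 4 * (M + Ce) * (H * \<epsilon>) * (\<sigma> * H)"
    unfolding VQ using c1 c2 c3 c4 c5 by linarith
  also have "L * M * ?Y + L * Ci * Ce * (1 + Ce) * ?Y + (L * M + A) * Ci * Ce * ?Y + Ce * ?Y
      = (L * M + L * Ci * Ce * (1 + Ce) + (L * M + A) * Ci * Ce + Ce) * ?Y" by (simp only: distrib_right)
  finally show ?thesis unfolding identity GGe H_def by linarith
qed

section \<open>Summation over the mesh\<close>

lemma mesh_nodes:
  assumes "is_mesh a b N X"
  shows "i \<le> j \<Longrightarrow> j \<le> N \<Longrightarrow> X i \<le> X j"
    and "i \<le> N \<Longrightarrow> X i \<in> {a..b}"
    and "j \<in> {1..N} \<Longrightarrow> {X (j - 1)..X j} \<subseteq> {a..b}"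
    and "j \<in> {1..N} \<Longrightarrow> 0 < cell_size X j"
    and "(\<Sum>j\<in>{1..N}. cell_size X j) = b - a"
proof -
  have step: "X i < X (Suc i)" if "i < N" for i
    using assms that unfolding is_mesh_def by (metis Suc_le_eq atLeastAtMost_iff diff_Suc_1 le_add1 plus_1_eq_Suc)
  show mono: "X i \<le> X j" if "i \<le> j" "j \<le> N" for i j
    using that(1) that(2)
  proof (induction j rule: dec_induct)
    case (step n)
    then show ?case using \<open>\<And>i. i < N \<Longrightarrow> X i < X (Suc i)\<close>[of n] by simp
  qed simp
  have ends: "X 0 = a" "X N = b" using assms unfolding is_mesh_def by auto
  show node: "X i \<in> {a..b}" if "i \<le> N" for i
    using mono[of 0 i] mono[of i N] that ends by auto
  show "{X (j - 1)..X j} \<subseteq> {a..b}" if "j \<in> {1..N}" for j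
    using node[of "j - 1"] node[of j] that by auto
  show "0 < cell_size X j" if "j \<in> {1..N}" for j
    using assms that unfolding is_mesh_def cell_size_def by simp
  have "(\<Sum>j\<in>{1..n}. cell_size X j) = X n - X 0" for n
    by (induction n) (auto simp: cell_size_def)
  then show "(\<Sum>j\<in>{1..N}. cell_size X j) = b - a" using ends by simp
qed

lemma mesh_size_bounds:
  assumes "is_mesh a b N X" "quasi_uniform \<kappa> N X" "j \<in> {1..N}"
  shows "cell_size X j \<le> mesh_size N X" "mesh_size N X \<le> \<kappa> * cell_size X j" "0 < mesh_size N X" "0 < \<kappa>"
proof -
  have fin: "finite (cell_size X ` {1..N})" "cell_size X ` {1..N} \<noteq> {}" using assms(3) by auto
  have pos: "0 < cell_size X i" if "i \<in> {1..N}" for i using mesh_nodes(4)[OF assms(1) that] .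
  show 1: "cell_size X j \<le> mesh_size N X"
    unfolding mesh_size_def using fin assms(3) by (intro Max_ge) auto
  then show 2: "0 < mesh_size N X" using pos[OF assms(3)] by linarith
  have m: "0 < Min (cell_size X ` {1..N})" using fin pos by (subst Min_gr_iff) auto
  have q: "mesh_size N X \<le> \<kappa> * Min (cell_size X ` {1..N})" using assms(2) unfolding quasi_uniform_def .
  then have "0 < \<kappa> * Min (cell_size X ` {1..N})" using 2 by linarith
  then show \<kappa>: "0 < \<kappa>" using m by (simp add: zero_less_mult_iff)
  have "Min (cell_size X ` {1..N}) \<le> cell_size X j" using fin assms(3) by (intro Min_le) auto
  then have "\<kappa> * Min (cell_size X ` {1..N}) \<le> \<kappa> * cell_size X j" using \<kappa> by (intro mult_left_mono) auto
  then show "mesh_size N X \<le> \<kappa> * cell_size X j" using q by linarith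
qed

lemma sum_shift_pred: "(\<Sum>j\<in>{1..N :: nat}. g (j - 1)) = (\<Sum>i<N. g i :: real)"
  by (induction N) auto

lemma sum_atMost_split_first: "(\<Sum>i\<le>N :: nat. g i) = g 0 + (\<Sum>i\<in>{1..N}. g i :: real)"
  by (induction N) auto

lemma sum_atMost_split_last: "(\<Sum>i\<le>N :: nat. g i) = (\<Sum>i<N. g i) + (g N :: real)"
  by (simp add: lessThan_Suc_atMost[symmetric])

text \<open>Summation of the cell inequalities, written for abstract sequences: \<open>r j\<close> is half the energy rate of
  cell \<open>j\<close>, \<open>el i\<close> and \<open>er i\<close> are the traces of \<open>e\<close> at node \<open>i\<close>, \<open>P i z = \<Phi>(w + z) - \<Phi>(w) - F z\<close> with the
  exact solution \<open>w\<close> and the flux \<open>F\<close> at that node, \<open>s j = \<sigma>_j h_j\<close>, and \<open>J i\<close> is a jump of \<open>u\<close>.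
  Rearranged by nodes, the values of \<open>P\<close> become \<open>P i (el i) - P i (er i)\<close>. The boundary conditions make
  this work at the two ends: the end nodes are identified in the periodic case, and the exterior
  trace contributes nothing otherwise. Each of the at most \<open>2 \<kappa> l / h\<close> nodes costs
  \<open>h \<tau>\<^sup>2\<close>, and the squares of the traces are bounded by the suprema of \<open>e\<close> on the adjacent cells.\<close>

lemma mesh_energy_rate:
  fixes H \<epsilon> r s :: "nat \<Rightarrow> real" and P :: "nat \<Rightarrow> real \<Rightarrow> real"
  assumes N: "1 \<le> N" and H: "\<And>j. j \<in> {1..N} \<Longrightarrow> 0 < H j" "\<And>j. j \<in> {1..N} \<Longrightarrow> H j \<le> h"
      "\<And>j. j \<in> {1..N} \<Longrightarrow> h \<le> \<kappa> * H j"
    and \<kappa>: "0 < \<kappa>" and len: "(\<Sum>j\<in>{1..N}. H j) = l"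
    and \<epsilon>: "\<And>j. j \<in> {1..N} \<Longrightarrow> 0 \<le> \<epsilon> j" and \<theta>: "\<And>j. j \<in> {1..N} \<Longrightarrow> 0 \<le> \<theta> j \<and> \<theta> j \<le> \<tau>"
    and cell: "\<And>j. j \<in> {1..N} \<Longrightarrow> r j \<le> P j (el j) - P (j - 1) (er (j - 1))
        + C1 * (H j * ((\<epsilon> j)\<^sup>2 + (\<theta> j)\<^sup>2)) + D * (H j * \<epsilon> j) * s j"
    and s: "\<And>j. j \<in> {1..N} \<Longrightarrow> s j \<le> Cs * (\<theta> j + \<epsilon> j + \<bar>J (j - 1)\<bar> + \<bar>J j\<bar>)"
    and tr: "\<And>j. j \<in> {1..N} \<Longrightarrow> \<bar>el j\<bar> \<le> \<epsilon> j" "\<And>j. j \<in> {1..N} \<Longrightarrow> \<bar>er (j - 1)\<bar> \<le> \<epsilon> j"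
      "\<bar>el 0\<bar> \<le> \<epsilon> N" "\<bar>er N\<bar> \<le> \<epsilon> 1"
    and bc: "(P 0 = P N \<and> el 0 = el N \<and> er N = er 0) \<or> (el 0 = 0 \<and> er N = 0 \<and> P 0 0 = 0 \<and> P N 0 = 0)"
    and node: "\<And>i. i \<le> N \<Longrightarrow> P i (el i) - P i (er i) \<le> B * h * ((el i)\<^sup>2 + (er i)\<^sup>2 + \<tau>\<^sup>2)"
    and J: "\<And>i. i \<le> N \<Longrightarrow> \<bar>J i\<bar> \<le> \<bar>el i\<bar> + \<bar>er i\<bar> + 2 * Ce * \<tau>"
    and nn: "0 \<le> C1" "0 \<le> D" "0 \<le> Cs" "0 \<le> B" "0 \<le> Ce"
  shows "(\<Sum>j\<in>{1..N}. r j) \<le> (C1 + 4 * \<kappa> * B + D * Cs * (6 + 4 * Ce + 8 * \<kappa>)) * (\<Sum>j\<in>{1..N}. H j * (\<epsilon> j)\<^sup>2)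
      + l * (C1 + 2 * \<kappa> * B + D * Cs * (1 + 4 * Ce)) * \<tau>\<^sup>2"
proof -
  define Z where "Z = (\<Sum>j\<in>{1..N}. H j * (\<epsilon> j)\<^sup>2)"
  define y where "y i = (el i)\<^sup>2 + (er i)\<^sup>2" for i
  have one: "1 \<in> {1..N}" "N \<in> {1..N}" using N by auto
  have h0: "0 < h" using H(1,2)[OF one(1)] by linarith
  have hE: "h * (\<Sum>j\<in>{1..N}. (\<epsilon> j)\<^sup>2) \<le> \<kappa> * Z"
  proof -
    have "h * (\<Sum>j\<in>{1..N}. (\<epsilon> j)\<^sup>2) = (\<Sum>j\<in>{1..N}. h * (\<epsilon> j)\<^sup>2)" by (rule sum_distrib_left)
    also have "\<dots> \<le> (\<Sum>j\<in>{1..N}. (\<kappa> * H j) * (\<epsilon> j)\<^sup>2)"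
      using H(3) by (intro sum_mono mult_right_mono) auto
    also have "\<dots> = \<kappa> * Z" by (simp add: Z_def sum_distrib_left mult.assoc)
    finally show ?thesis .
  qed
  have sq: "x\<^sup>2 \<le> z\<^sup>2" if "\<bar>x\<bar> \<le> z" for x z :: real
    using power_mono[OF that, of 2] by simp
  have Y: "(\<Sum>i\<le>N. y i) \<le> 4 * (\<Sum>j\<in>{1..N}. (\<epsilon> j)\<^sup>2)"
  proof -
    have "(\<Sum>i\<le>N. (el i)\<^sup>2) = (el 0)\<^sup>2 + (\<Sum>i\<in>{1..N}. (el i)\<^sup>2)" by (rule sum_atMost_split_first)
    also have "\<dots> \<le> (\<epsilon> N)\<^sup>2 + (\<Sum>i\<in>{1..N}. (\<epsilon> i)\<^sup>2)"
      using sq tr by (intro add_mono sum_mono) auto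
    also have "(\<epsilon> N)\<^sup>2 \<le> (\<Sum>i\<in>{1..N}. (\<epsilon> i)\<^sup>2)" by (rule member_le_sum[OF one(2)]) auto
    finally have 1: "(\<Sum>i\<le>N. (el i)\<^sup>2) \<le> 2 * (\<Sum>i\<in>{1..N}. (\<epsilon> i)\<^sup>2)" by simp
    have "(\<Sum>i\<le>N. (er i)\<^sup>2) = (\<Sum>i<N. (er i)\<^sup>2) + (er N)\<^sup>2" by (rule sum_atMost_split_last)
    also have "(\<Sum>i<N. (er i)\<^sup>2) = (\<Sum>j\<in>{1..N}. (er (j - 1))\<^sup>2)" by (rule sum_shift_pred[symmetric])
    also have "\<dots> + (er N)\<^sup>2 \<le> (\<Sum>j\<in>{1..N}. (\<epsilon> j)\<^sup>2) + (\<epsilon> 1)\<^sup>2"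
      using sq tr by (intro add_mono sum_mono) auto
    also have "(\<epsilon> 1)\<^sup>2 \<le> (\<Sum>i\<in>{1..N}. (\<epsilon> i)\<^sup>2)" by (rule member_le_sum[OF one(1)]) auto
    finally have 2: "(\<Sum>i\<le>N. (er i)\<^sup>2) \<le> 2 * (\<Sum>i\<in>{1..N}. (\<epsilon> i)\<^sup>2)" by simp
    show ?thesis using 1 2 by (simp add: y_def sum.distrib)
  qed
  have y0: "0 \<le> y i" for i by (simp add: y_def)
  have hY: "h * (\<Sum>i\<le>N. y i) \<le> 4 * \<kappa> * Z"
  proof -
    have "h * (\<Sum>i\<le>N. y i) \<le> h * (4 * (\<Sum>j\<in>{1..N}. (\<epsilon> j)\<^sup>2))" using Y h0 by (intro mult_left_mono) auto
    then show ?thesis using hE by simp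
  qed
  have Nh: "real (N + 1) * h \<le> 2 * \<kappa> * l"
  proof -
    have "real N * h = (\<Sum>j\<in>{1..N}. h)" by simp
    also have "\<dots> \<le> (\<Sum>j\<in>{1..N}. \<kappa> * H j)" using H(3) by (intro sum_mono) auto
    also have "\<dots> = \<kappa> * l" using len by (simp add: sum_distrib_left[symmetric])
    finally have "real N * h \<le> \<kappa> * l" .
    moreover have "real (N + 1) * h \<le> (2 * real N) * h" using N h0 by (intro mult_right_mono) auto
    ultimately show ?thesis by linarith
  qed
  have nodes: "(\<Sum>j\<in>{1..N}. P j (el j) - P (j - 1) (er (j - 1))) \<le> 4 * \<kappa> * B * Z + 2 * \<kappa> * B * l * \<tau>\<^sup>2"
  proof -
    have e0: "(\<Sum>j\<in>{1..N}. P j (el j) - P (j - 1) (er (j - 1)))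
        = (\<Sum>j\<in>{1..N}. P j (el j)) - (\<Sum>i<N. P i (er i))"
      using sum_shift_pred[of "\<lambda>i. P i (er i)" N] by (simp add: sum_subtractf)
    have Bn: "0 \<le> B * h * (y i + \<tau>\<^sup>2)" for i using nn h0 y0 by simp
    have node': "P i (el i) - P i (er i) \<le> B * h * (y i + \<tau>\<^sup>2)" if "i \<le> N" for i
      using node[OF that] by (simp add: y_def)
    have "(\<Sum>j\<in>{1..N}. P j (el j)) - (\<Sum>i<N. P i (er i)) \<le> (\<Sum>i\<le>N. B * h * (y i + \<tau>\<^sup>2))"
      using bc
    proof
      assume p: "P 0 = P N \<and> el 0 = el N \<and> er N = er 0"
      have "(\<Sum>i<N. P i (er i)) = (\<Sum>i\<in>{1..N}. P i (er i))"
        using sum_atMost_split_first[of "\<lambda>i. P i (er i)" N] sum_atMost_split_last[of "\<lambda>i. P i (er i)" N] p by simp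
      then have "(\<Sum>j\<in>{1..N}. P j (el j)) - (\<Sum>i<N. P i (er i)) = (\<Sum>i\<in>{1..N}. P i (el i) - P i (er i))"
        by (simp add: sum_subtractf)
      also have "\<dots> \<le> (\<Sum>i\<in>{1..N}. B * h * (y i + \<tau>\<^sup>2))" using node' by (intro sum_mono) auto
      also have "\<dots> \<le> (\<Sum>i\<le>N. B * h * (y i + \<tau>\<^sup>2))" using Bn by (intro sum_mono2) auto
      finally show ?thesis .
    next
      assume p: "el 0 = 0 \<and> er N = 0 \<and> P 0 0 = 0 \<and> P N 0 = 0"
      have "(\<Sum>j\<in>{1..N}. P j (el j)) - (\<Sum>i<N. P i (er i)) = (\<Sum>i\<le>N. P i (el i) - P i (er i))"
        using sum_atMost_split_first[of "\<lambda>i. P i (el i)" N] sum_atMost_split_last[of "\<lambda>i. P i (er i)" N] p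
        by (simp add: sum_subtractf)
      also have "\<dots> \<le> (\<Sum>i\<le>N. B * h * (y i + \<tau>\<^sup>2))" using node' by (intro sum_mono) auto
      finally show ?thesis .
    qed
    also have "\<dots> = B * (h * (\<Sum>i\<le>N. y i)) + B * \<tau>\<^sup>2 * (real (N + 1) * h)"
      by (simp add: sum_distrib_left[symmetric] sum.distrib algebra_simps)
    also have "\<dots> \<le> B * (4 * \<kappa> * Z) + B * \<tau>\<^sup>2 * (2 * \<kappa> * l)"
      using hY Nh nn by (intro add_mono mult_left_mono) auto
    finally show ?thesis unfolding e0 by (simp add: mult_ac)
  qed
  have damp: "D * (H j * \<epsilon> j) * s j
      \<le> D * Cs * ((6 + 4 * Ce) * (H j * (\<epsilon> j)\<^sup>2) + (1 + 4 * Ce) * \<tau>\<^sup>2 * H j + h * y (j - 1) + h * y j)"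
    if j: "j \<in> {1..N}" for j
  proof -
    have jN: "j - 1 \<le> N" "j \<le> N" using j by auto
    have a: "0 \<le> \<bar>el i\<bar>" for i by simp
    have y1: "\<epsilon> j * \<bar>el i\<bar> \<le> (\<epsilon> j)\<^sup>2 + (el i)\<^sup>2" "\<epsilon> j * \<bar>er i\<bar> \<le> (\<epsilon> j)\<^sup>2 + (er i)\<^sup>2" for i
      using product_le_sum_squares[of "\<epsilon> j" "\<bar>el i\<bar>"] product_le_sum_squares[of "\<epsilon> j" "\<bar>er i\<bar>"] by auto
    have y2: "\<epsilon> j * \<tau> \<le> (\<epsilon> j)\<^sup>2 + \<tau>\<^sup>2" by (rule product_le_sum_squares)
    have y3: "4 * Ce * (\<epsilon> j * \<tau>) \<le> 4 * Ce * ((\<epsilon> j)\<^sup>2 + \<tau>\<^sup>2)" using y2 nn by (intro mult_left_mono) auto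
    have "\<epsilon> j * (\<theta> j + \<epsilon> j + \<bar>J (j - 1)\<bar> + \<bar>J j\<bar>)
        \<le> \<epsilon> j * (\<tau> + \<epsilon> j + (\<bar>el (j - 1)\<bar> + \<bar>er (j - 1)\<bar> + 2 * Ce * \<tau>) + (\<bar>el j\<bar> + \<bar>er j\<bar> + 2 * Ce * \<tau>))"
      using J[OF jN(1)] J[OF jN(2)] \<theta>[OF j] \<epsilon>[OF j] by (intro mult_left_mono) auto
    also have "\<dots> = \<epsilon> j * \<tau> + (\<epsilon> j)\<^sup>2 + \<epsilon> j * \<bar>el (j - 1)\<bar> + \<epsilon> j * \<bar>er (j - 1)\<bar> + \<epsilon> j * \<bar>el j\<bar> + \<epsilon> j * \<bar>er j\<bar>
        + 4 * Ce * (\<epsilon> j * \<tau>)" by (simp add: power2_eq_square algebra_simps)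
    also have "\<dots> \<le> ((\<epsilon> j)\<^sup>2 + \<tau>\<^sup>2) + (\<epsilon> j)\<^sup>2 + ((\<epsilon> j)\<^sup>2 + (el (j - 1))\<^sup>2) + ((\<epsilon> j)\<^sup>2 + (er (j - 1))\<^sup>2)
        + ((\<epsilon> j)\<^sup>2 + (el j)\<^sup>2) + ((\<epsilon> j)\<^sup>2 + (er j)\<^sup>2) + 4 * Ce * ((\<epsilon> j)\<^sup>2 + \<tau>\<^sup>2)"
      using y1[of "j - 1"] y1[of j] y2 y3 by linarith
    also have "\<dots> = (6 + 4 * Ce) * (\<epsilon> j)\<^sup>2 + (1 + 4 * Ce) * \<tau>\<^sup>2 + y (j - 1) + y j"
      by (simp add: y_def algebra_simps)
    finally have q: "\<epsilon> j * (\<theta> j + \<epsilon> j + \<bar>J (j - 1)\<bar> + \<bar>J j\<bar>)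
        \<le> (6 + 4 * Ce) * (\<epsilon> j)\<^sup>2 + (1 + 4 * Ce) * \<tau>\<^sup>2 + y (j - 1) + y j" .
    have "D * (H j * \<epsilon> j) * s j \<le> D * (H j * \<epsilon> j) * (Cs * (\<theta> j + \<epsilon> j + \<bar>J (j - 1)\<bar> + \<bar>J j\<bar>))"
      using s[OF j] nn H(1)[OF j] \<epsilon>[OF j] by (intro mult_left_mono) auto
    also have "\<dots> = D * Cs * (H j * (\<epsilon> j * (\<theta> j + \<epsilon> j + \<bar>J (j - 1)\<bar> + \<bar>J j\<bar>)))" by (simp add: mult_ac)
    also have "\<dots> \<le> D * Cs * (H j * ((6 + 4 * Ce) * (\<epsilon> j)\<^sup>2 + (1 + 4 * Ce) * \<tau>\<^sup>2 + y (j - 1) + y j))"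
      using q nn H(1)[OF j] by (intro mult_left_mono) auto
    also have "H j * ((6 + 4 * Ce) * (\<epsilon> j)\<^sup>2 + (1 + 4 * Ce) * \<tau>\<^sup>2 + y (j - 1) + y j)
        = (6 + 4 * Ce) * (H j * (\<epsilon> j)\<^sup>2) + (1 + 4 * Ce) * \<tau>\<^sup>2 * H j + H j * y (j - 1) + H j * y j"
      by (simp add: algebra_simps)
    also have "D * Cs * \<dots> \<le> D * Cs * ((6 + 4 * Ce) * (H j * (\<epsilon> j)\<^sup>2) + (1 + 4 * Ce) * \<tau>\<^sup>2 * H j + h * y (j - 1) + h * y j)"
      using nn H(2)[OF j] y0 by (intro mult_left_mono add_mono mult_right_mono order_refl) auto
    finally show ?thesis .
  qed
  have smooth: "C1 * (H j * ((\<epsilon> j)\<^sup>2 + (\<theta> j)\<^sup>2)) \<le> C1 * (H j * (\<epsilon> j)\<^sup>2 + H j * \<tau>\<^sup>2)" if j: "j \<in> {1..N}" for j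
  proof -
    have "(\<theta> j)\<^sup>2 \<le> \<tau>\<^sup>2" using \<theta>[OF j] by (intro power_mono) auto
    then have "H j * (\<theta> j)\<^sup>2 \<le> H j * \<tau>\<^sup>2" using H(1)[OF j] by (intro mult_left_mono) auto
    then show ?thesis using nn by (intro mult_left_mono) (auto simp: distrib_left)
  qed
  have yy: "(\<Sum>j\<in>{1..N}. y (j - 1)) \<le> (\<Sum>i\<le>N. y i)" "(\<Sum>j\<in>{1..N}. y j) \<le> (\<Sum>i\<le>N. y i)"
    using sum_shift_pred[of y N] sum_atMost_split_first[of y N] sum_atMost_split_last[of y N] y0[of 0] y0[of N] by auto
  have "(\<Sum>j\<in>{1..N}. r j) \<le> (\<Sum>j\<in>{1..N}. (P j (el j) - P (j - 1) (er (j - 1)))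
      + C1 * (H j * (\<epsilon> j)\<^sup>2 + H j * \<tau>\<^sup>2)
      + D * Cs * ((6 + 4 * Ce) * (H j * (\<epsilon> j)\<^sup>2) + (1 + 4 * Ce) * \<tau>\<^sup>2 * H j + h * y (j - 1) + h * y j))"
  proof (rule sum_mono)
    fix j assume j: "j \<in> {1..N}"
    show "r j \<le> (P j (el j) - P (j - 1) (er (j - 1)))
      + C1 * (H j * (\<epsilon> j)\<^sup>2 + H j * \<tau>\<^sup>2)
      + D * Cs * ((6 + 4 * Ce) * (H j * (\<epsilon> j)\<^sup>2) + (1 + 4 * Ce) * \<tau>\<^sup>2 * H j + h * y (j - 1) + h * y j)"
      using cell[OF j] smooth[OF j] damp[OF j] by linarith
  qed
  also have "\<dots> = (\<Sum>j\<in>{1..N}. P j (el j) - P (j - 1) (er (j - 1))) + C1 * (Z + l * \<tau>\<^sup>2)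
      + D * Cs * ((6 + 4 * Ce) * Z + (1 + 4 * Ce) * \<tau>\<^sup>2 * l + h * (\<Sum>j\<in>{1..N}. y (j - 1)) + h * (\<Sum>j\<in>{1..N}. y j))"
    unfolding sum.distrib sum_distrib_left[symmetric] sum_distrib_right[symmetric] len Z_def[symmetric] ..
  also have "\<dots> \<le> (4 * \<kappa> * B * Z + 2 * \<kappa> * B * l * \<tau>\<^sup>2) + C1 * (Z + l * \<tau>\<^sup>2)
      + D * Cs * ((6 + 4 * Ce) * Z + (1 + 4 * Ce) * \<tau>\<^sup>2 * l + 4 * \<kappa> * Z + 4 * \<kappa> * Z)"
  proof -
    have "h * (\<Sum>j\<in>{1..N}. y (j - 1)) \<le> 4 * \<kappa> * Z" "h * (\<Sum>j\<in>{1..N}. y j) \<le> 4 * \<kappa> * Z"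
      using mult_left_mono[OF yy(1) less_imp_le[OF h0]] mult_left_mono[OF yy(2) less_imp_le[OF h0]] hY by linarith+
    then show ?thesis using nodes nn by (intro add_mono mult_left_mono order_refl) auto
  qed
  also have "\<dots> = (C1 + 4 * \<kappa> * B + D * Cs * (6 + 4 * Ce + 8 * \<kappa>)) * Z
      + l * (C1 + 2 * \<kappa> * B + D * Cs * (1 + 4 * Ce)) * \<tau>\<^sup>2" by (simp add: algebra_simps)
  finally show ?thesis by (simp add: Z_def)
qed

section \<open>Derivatives of the numerical solution\<close>

text \<open>Iterate the inverse inequality for the derivative.\<close>

lemma pderiv_funpow_bound:
  fixes a b Ci :: real
  assumes inv: "\<And>p S x. degree p \<le> k \<Longrightarrow> (\<And>x. x \<in> {a..b} \<Longrightarrow> \<bar>poly p x\<bar> \<le> S) \<Longrightarrow> x \<in> {a..b} \<Longrightarrow>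
      \<bar>poly (pderiv p) x\<bar> \<le> Ci * S / (b - a)"
    and "degree p \<le> k" "\<And>x. x \<in> {a..b} \<Longrightarrow> \<bar>poly p x\<bar> \<le> S" "x \<in> {a..b}"
  shows "\<bar>poly ((pderiv ^^ j) p) x\<bar> \<le> (Ci / (b - a)) ^ j * S"
  using assms(2-4)
proof (induction j arbitrary: p S x)
  case 0
  then show ?case by simp
next
  case (Suc j)
  have "\<bar>poly ((pderiv ^^ j) (pderiv p)) x\<bar> \<le> (Ci / (b - a)) ^ j * (Ci * S / (b - a))"
  proof (rule Suc.IH)
    show "degree (pderiv p) \<le> k" using Suc.prems(1) by (simp add: degree_pderiv)
  qed (use Suc.prems inv in auto)
  then show ?case by (simp add: funpow_Suc_right mult_ac del: funpow.simps)
qed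

lemma pderiv_funpow_taylor: "i \<le> n \<Longrightarrow> (pderiv ^^ i) (taylor n d a) = taylor (n - i) (\<lambda>m. d (m + i)) a"
proof (induction i)
  case (Suc i)
  then have "n - i = Suc (n - Suc i)" by simp
  then show ?case using Suc pderiv_taylor[of "n - Suc i" "\<lambda>m. d (m + i)" a] by simp
qed simp

lemma pderiv_funpow_eq_0: "degree (p :: real poly) < i \<Longrightarrow> (pderiv ^^ i) p = 0"
proof (induction i arbitrary: p)
  case (Suc i)
  show ?case
  proof (cases "degree p = 0")
    case True
    then have "pderiv p = 0" by (simp add: pderiv_eq_0_iff)
    moreover have "(pderiv ^^ i) (0 :: real poly) = 0" by (induction i) auto
    ultimately show ?thesis by (simp add: funpow_Suc_right del: funpow.simps)
  next
    case False
    then have "degree (pderiv p) < i" using Suc.prems by (simp add: degree_pderiv)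
    then show ?thesis using Suc.IH by (simp add: funpow_Suc_right del: funpow.simps)
  qed
qed simp

text \<open>Split \<open>u\<close> into a Taylor polynomial of the exact solution, whose derivatives are bounded, and a
  polynomial of size \<open>\<epsilon> + O(h^(k+1))\<close>, to which the inverse inequality applies. Derivatives of order greater
  than \<open>k\<close> vanish, so \<open>h^(k+1)\<close> compensates all powers of \<open>1/h\<close> that occur.\<close>

lemma poly_scaling_near_smooth:
  assumes ab: "a < b" "b - a \<le> 1"
    and inv: "\<And>p S x. degree p \<le> k \<Longrightarrow> (\<And>x. x \<in> {a..b} \<Longrightarrow> \<bar>poly p x\<bar> \<le> S) \<Longrightarrow> x \<in> {a..b} \<Longrightarrow>
      \<bar>poly (pderiv p) x\<bar> \<le> Ci * S / (b - a)"
    and Ci: "0 \<le> Ci" and u: "degree u \<le> k" and d: "\<And>m. m \<le> k \<Longrightarrow> \<bar>d m a\<bar> \<le> M"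
    and near: "\<And>x. x \<in> {a..b} \<Longrightarrow> \<bar>poly u x - poly (taylor k d a) x\<bar> \<le> \<epsilon> + C4 * (b - a) ^ (k + 1)"
    and \<epsilon>: "0 \<le> \<epsilon>" and C4: "0 \<le> C4" and x: "x \<in> {a..b}"
  shows "poly_scaling x (b - a) \<epsilon> u 0 (\<lambda>j. (real k + 1) * M + Ci ^ j * (1 + C4))"
  unfolding poly_scaling_def
proof
  fix j
  define H where "H = b - a"
  have H: "0 < H" "H \<le> 1" using ab by (auto simp: H_def)
  have M0: "0 \<le> M" using d[of 0] by simp
  have K0: "0 \<le> (real k + 1) * M + Ci ^ j * (1 + C4)" using M0 Ci C4 by simp
  have eH: "0 \<le> \<epsilon> / H ^ j" using \<epsilon> H by simp
  show "\<bar>poly ((pderiv ^^ j) u) x\<bar> \<le> ((real k + 1) * M + Ci ^ j * (1 + C4)) * (1 + \<epsilon> / (b - a) ^ (j + 0))"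
  proof (cases "j \<le> k")
    case False
    then have "(pderiv ^^ j) u = 0" using u by (intro pderiv_funpow_eq_0) auto
    then show ?thesis using K0 eH by (simp add: H_def)
  next
    case True
    let ?t = "taylor k d a"
    have e: "u = (u - ?t) + ?t" by simp
    have "degree (u - ?t) \<le> k" using u degree_taylor by (rule degree_diff_le)
    then have 1: "\<bar>poly ((pderiv ^^ j) (u - ?t)) x\<bar> \<le> (Ci / (b - a)) ^ j * (\<epsilon> + C4 * (b - a) ^ (k + 1))"
      using near x by (intro pderiv_funpow_bound[OF inv]) auto
    have "(Ci / H) ^ j * (\<epsilon> + C4 * H ^ (k + 1)) = Ci ^ j * (\<epsilon> / H ^ j + C4 * (H ^ (k + 1) / H ^ j))"
      by (simp add: power_divide algebra_simps)
    also have "\<dots> \<le> Ci ^ j * (\<epsilon> / H ^ j + C4 * 1)"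
    proof -
      have "H ^ (k + 1) \<le> H ^ j" using H True by (intro power_decreasing) auto
      then have "H ^ (k + 1) / H ^ j \<le> 1" using H by simp
      then show ?thesis using Ci C4 by (intro mult_left_mono add_left_mono) auto
    qed
    also have "\<dots> \<le> Ci ^ j * ((1 + C4) * (1 + \<epsilon> / H ^ j))"
    proof (intro mult_left_mono)
      have "0 \<le> C4 * (\<epsilon> / H ^ j)" using C4 eH by (rule mult_nonneg_nonneg)
      moreover have "(1 + C4) * (1 + z) = 1 + C4 + z + C4 * z" for z by (simp add: algebra_simps)
      ultimately show "\<epsilon> / H ^ j + C4 * 1 \<le> (1 + C4) * (1 + \<epsilon> / H ^ j)" by simp
    qed (use Ci in simp)
    finally have 1: "\<bar>poly ((pderiv ^^ j) (u - ?t)) x\<bar> \<le> Ci ^ j * (1 + C4) * (1 + \<epsilon> / H ^ j)"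
      using 1 by (simp add: H_def mult_ac)
    have "\<bar>poly (taylor (k - j) (\<lambda>m. d (m + j)) a) x\<bar> \<le> (real (k - j) + 1) * M"
      using taylor_bound[of a x b "k - j" "\<lambda>m. d (m + j)" M] x ab d True by (simp add: algebra_simps)
    also have "\<dots> \<le> (real k + 1) * M * (1 + \<epsilon> / H ^ j)"
    proof -
      have "(real (k - j) + 1) * M \<le> (real k + 1) * M * 1" using M0 by (simp add: mult_right_mono)
      also have "\<dots> \<le> (real k + 1) * M * (1 + \<epsilon> / H ^ j)" using eH M0 by (intro mult_left_mono) auto
      finally show ?thesis .
    qed
    finally have 2: "\<bar>poly ((pderiv ^^ j) ?t) x\<bar> \<le> (real k + 1) * M * (1 + \<epsilon> / H ^ j)"
      using True by (simp add: pderiv_funpow_taylor)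
    have "\<bar>poly ((pderiv ^^ j) u) x\<bar> \<le> \<bar>poly ((pderiv ^^ j) (u - ?t)) x\<bar> + \<bar>poly ((pderiv ^^ j) ?t) x\<bar>"
      by (subst e, subst pderiv_funpow_add) simp
    then have "\<bar>poly ((pderiv ^^ j) u) x\<bar> \<le> Ci ^ j * (1 + C4) * (1 + \<epsilon> / H ^ j) + (real k + 1) * M * (1 + \<epsilon> / H ^ j)"
      using 1 2 by linarith
    then show ?thesis by (simp add: H_def distrib_right)
  qed
qed

section \<open>The error estimate for a given choice of projections\<close>

text \<open>\<open>D i j\<close> is the derivative of the exact solution of order \<open>i\<close> in \<open>x\<close> and \<open>j\<close> in \<open>t\<close>.\<close>

definition smooth_tower ::
  "nat \<Rightarrow> real \<Rightarrow> real \<Rightarrow> real \<Rightarrow> real \<Rightarrow> (nat \<Rightarrow> nat \<Rightarrow> real \<Rightarrow> real \<Rightarrow> real) \<Rightarrow> bool" where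
  "smooth_tower m a b T M D \<longleftrightarrow>
     (\<forall>i j. i + j < m \<longrightarrow> (\<forall>x. \<forall>t\<in>{0..T}.
        ((\<lambda>y. D i j y t) has_real_derivative D (Suc i) j x t) (at x) \<and>
        ((\<lambda>s. D i j x s) has_real_derivative D i (Suc j) x t) (at t within {0..T}))) \<and>
     (\<forall>i j. i + j \<le> m \<longrightarrow>
        continuous_on (UNIV \<times> {0..T}) (\<lambda>(x, t). D i j x t) \<and>
        (\<forall>x\<in>{a..b}. \<forall>t\<in>{0..T}. \<bar>D i j x t\<bar> \<le> M))"

text \<open>The constants of the error estimate, all independent of the mesh and of the solutions: \<open>M\<close> bounds the
  exact solution and its derivatives, \<open>R = M + 2\<close> the values of \<open>u\<close> while the error is at most one, \<open>L\<close> is the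
  Lipschitz constant of \<open>f'\<close> on \<open>{- R..R}\<close>, \<open>Ci\<close> belongs to the inverse inequalities, \<open>Cp\<close> and \<open>Ce\<close> to
  the stability and the accuracy of the local projections, \<open>K\<close> to the chain rule and \<open>Cs\<close> to the damping
  coefficient. The parameters \<open>A\<close> (size of \<open>f'(w) / h\<close> on the cells with projections exact at both ends)
  and \<open>B\<close> (node estimate) are what distinguishes the two kinds of fluxes.\<close>

locale dg_constants =
  fixes k m :: nat and \<beta> a b T \<kappa> :: real and f :: "real \<Rightarrow> real" and fh :: "real \<Rightarrow> real \<Rightarrow> real"
    and S :: scheme and M R L Ci Cp Ce Cs A B K :: real and \<Phi> :: "real \<Rightarrow> real"
  assumes k: "1 \<le> k" and ab: "a < b" and T: "0 < T" and \<kappa>: "0 < \<kappa>"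
    and f: "C_class m f" "k + 4 \<le> m"
    and L0: "0 \<le> L"
    and f1L: "\<And>x y. x \<in> {- R..R} \<Longrightarrow> y \<in> {- R..R} \<Longrightarrow> \<bar>deriv f x - deriv f y\<bar> \<le> L * \<bar>x - y\<bar>"
    and \<Phi>: "\<And>x. x \<in> {- R..R} \<Longrightarrow> (\<Phi> has_real_derivative f x) (at x)"
    and R: "R = M + 2" and M0: "0 \<le> M" and Cp: "0 \<le> Cp" and Ce: "Ce = (1 + Cp) * M"
    and Ci: "1 \<le> Ci"
    and inv_sup: "\<And>c d p x. c < d \<Longrightarrow> degree p \<le> k \<Longrightarrow> x \<in> {c..d} \<Longrightarrow>
      (poly p x)\<^sup>2 \<le> Ci / (d - c) * integral {c..d} (\<lambda>x. (poly p x)\<^sup>2)"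
    and inv_deriv: "\<And>c d p E x. c < d \<Longrightarrow> degree p \<le> k \<Longrightarrow> (\<And>x. x \<in> {c..d} \<Longrightarrow> \<bar>poly p x\<bar> \<le> E) \<Longrightarrow> x \<in> {c..d} \<Longrightarrow>
      \<bar>poly (pderiv p) x\<bar> \<le> Ci * E / (d - c)"
    and K: "\<And>x H \<epsilon> p r. 0 < H \<Longrightarrow> H \<le> 1 \<Longrightarrow> 0 \<le> \<epsilon> \<Longrightarrow> \<epsilon> \<le> 1 \<Longrightarrow>
      poly_scaling x H \<epsilon> p 0 (\<lambda>j. (real k + 1) * M + Ci ^ j * (1 + (Ce + M))) \<Longrightarrow> poly p x \<in> {- R..R} \<Longrightarrow>
      r \<in> {k + 1, k + 2} \<Longrightarrow> \<bar>(deriv ^^ r) (\<lambda>y. f (poly p y)) x\<bar> \<le> K * (1 + \<epsilon> / H ^ r)"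
    and Cs: "0 \<le> Cs" "damping_bound k \<beta> f fh S R K Cs"
    and AB: "0 \<le> A" "0 \<le> B"
begin

definition cell_const :: real where
  "cell_const = L * M + L * Ci * Ce * (1 + Ce) + (L * M + A * \<kappa>) * Ci * Ce + Ce"

text \<open>The energy satisfies \<open>E' \<le> growth E + source \<tau>\<^sup>2\<close>. Adding \<open>1\<close> makes the rate positive, as Gronwall's
  bound divides by it.\<close>

definition growth :: real where
  "growth = 2 * ((cell_const + 4 * \<kappa> * B + 4 * (M + Ce) * Cs * (6 + 4 * Ce + 8 * \<kappa>)) * Ci) + 1"

definition source :: real where
  "source = 2 * ((b - a) * (cell_const + 2 * \<kappa> * B + 4 * (M + Ce) * Cs * (1 + 4 * Ce)))"

definition energy_const :: real where
  "energy_const = (4 * Ce\<^sup>2 * (b - a) + source / growth) * exp (growth * T)"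

lemma damping:
  assumes "0 < cell_size X j" "cell_size X j \<le> 1" "0 \<le> \<epsilon>"
    and "\<forall>x\<in>{X (j - 1)..X j}. \<bar>poly (v j) x\<bar> \<le> R"
    and "\<forall>i\<in>{j - 1, j}. trace_left bc N X v i \<in> {- R..R} \<and> trace_right bc N X v i \<in> {- R..R}"
    and "\<forall>r\<in>{k + 1, k + 2}. \<forall>x\<in>{X (j - 1)..X j}.
        \<bar>(deriv ^^ r) (\<lambda>y. f (poly (v j) y)) x\<bar> \<le> K * (1 + \<epsilon> / cell_size X j ^ r)"
  shows "0 \<le> sigma k \<beta> bc f fh N X S v j \<and>
     sigma k \<beta> bc f fh N X S v j * cell_size X j
       \<le> Cs * (cell_size X j ^ (k + 1) + \<epsilon> + \<bar>jump bc N X v (j - 1)\<bar> + \<bar>jump bc N X v j\<bar>)"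
  using Cs(2)[unfolded damping_bound_def, rule_format, of X j \<epsilon> v bc N] assms by blast

lemma Ce0: "0 \<le> Ce" using Ce Cp M0 by simp

lemma cell_const0: "0 \<le> cell_const"
  using L0 M0 Ci Ce0 AB \<kappa> by (simp add: cell_const_def)

lemma growth0: "0 < growth" and source0: "0 \<le> source" and energy_const0: "0 \<le> energy_const"
proof -
  show g: "0 < growth"
    using cell_const0 Ci Ce0 AB \<kappa> M0 Cs(1) by (auto simp: growth_def intro!: add_nonneg_pos mult_nonneg_nonneg add_nonneg_nonneg)
  show s: "0 \<le> source"
    using cell_const0 Ce0 AB \<kappa> M0 Cs(1) ab by (auto simp: source_def intro!: mult_nonneg_nonneg add_nonneg_nonneg)
  show "0 \<le> energy_const"
    using g s ab by (auto simp: energy_const_def intro!: mult_nonneg_nonneg add_nonneg_nonneg divide_nonneg_pos)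
qed

end

text \<open>One numerical solution on one mesh, together with a choice of local projections \<open>Q\<close>. The assumption
  \<open>node\<close> is the node estimate; in it, the projection error on either side may be taken to vanish if
  the projection of the adjacent cell is exact there. At the end nodes the adjacent cell is the one at
  the opposite end in the periodic case, while for compact support the exterior trace is exact. The
  smallness assumption on \<open>energy_const * Ci * \<kappa> * h\<^sup>2\<close> closes the bootstrap.\<close>

locale dg_run = dg_constants +
  fixes bc :: boundary and D :: "nat \<Rightarrow> nat \<Rightarrow> real \<Rightarrow> real \<Rightarrow> real" and N :: nat and X :: "nat \<Rightarrow> real" and w0 :: "real \<Rightarrow> real"
    and u :: "real \<Rightarrow> nat \<Rightarrow> real poly" and Q :: "nat \<Rightarrow> (real \<Rightarrow> real) \<Rightarrow> real poly"
    and exl exr :: "nat \<Rightarrow> bool" and \<tau> h :: real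
  assumes tower: "smooth_tower (k + 2) a b T M D"
    and pde: "\<And>x t. t \<in> {0..T} \<Longrightarrow> D 0 1 x t = - deriv f (D 0 0 x t) * D 1 0 x t"
    and bcW: "\<And>t. t \<in> {0..T} \<Longrightarrow> (bc = Periodic \<and> D 0 0 a t = D 0 0 b t) \<or>
        (bc = Compact_support \<and> D 0 0 a t = 0 \<and> D 0 0 b t = 0)"
    and init: "\<And>x. x \<in> {a..b} \<Longrightarrow> D 0 0 x 0 = w0 x"
    and mesh: "is_mesh a b N X" and quasi: "quasi_uniform \<kappa> N X"
    and sol: "numerical_solution k \<beta> bc f fh S T N X w0 u"
    and proj: "\<And>j. j \<in> {1..N} \<Longrightarrow> cell_projector k Cp (X (j - 1)) (X j) (exl j) (exr j) (Q j)"
    and h: "h = mesh_size N X"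
    and both: "\<And>j t x. j \<in> {1..N} \<Longrightarrow> exl j \<Longrightarrow> exr j \<Longrightarrow> t \<in> {0..T} \<Longrightarrow> x \<in> {X (j - 1)..X j} \<Longrightarrow>
        \<bar>deriv f (D 0 0 x t)\<bar> \<le> A * h"
    and small: "h \<le> 1" "Ce * h \<le> 1" "energy_const * Ci * \<kappa> * h\<^sup>2 < 1"
    and \<tau>: "h ^ (k + 1) \<le> \<tau>" "\<tau>\<^sup>2 \<le> h ^ 3"
    and node: "\<And>t i e1 e2 \<eta>1 \<eta>2. t \<in> {0..T} \<Longrightarrow> i \<le> N \<Longrightarrow> \<bar>e1\<bar> \<le> 1 \<Longrightarrow> \<bar>e2\<bar> \<le> 1 \<Longrightarrow>
        \<bar>\<eta>1\<bar> \<le> Ce * h ^ (k + 1) \<Longrightarrow> \<bar>\<eta>2\<bar> \<le> Ce * h ^ (k + 1) \<Longrightarrow>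
        ((if 1 \<le> i then exr i else bc = Compact_support \<or> exr N) \<Longrightarrow> \<eta>1 = 0) \<Longrightarrow>
        ((if i < N then exl (Suc i) else bc = Compact_support \<or> exl 1) \<Longrightarrow> \<eta>2 = 0) \<Longrightarrow>
        fh (D 0 0 (X i) t + e1 - \<eta>1) (D 0 0 (X i) t + e2 - \<eta>2) * (e2 - e1)
          - (\<Phi> (D 0 0 (X i) t + e2) - \<Phi> (D 0 0 (X i) t + e1)) \<le> B * h * (e1\<^sup>2 + e2\<^sup>2 + \<tau>\<^sup>2)"
begin

abbreviation H where "H \<equiv> cell_size X"
abbreviation q where "q t j \<equiv> Q j (\<lambda>x. D 0 0 x t)"
abbreviation qt where "qt t j \<equiv> Q j (\<lambda>x. D 0 1 x t)"

definition e :: "real \<Rightarrow> nat \<Rightarrow> real poly" where "e t j = u t j - q t j"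

definition E :: "real \<Rightarrow> real" where
  "E t = (\<Sum>j\<in>{1..N}. integral {X (j - 1)..X j} (\<lambda>x. (poly (e t j) x)\<^sup>2))"

text \<open>The bound of the supremum of \<open>e\<close> on a cell that the inverse inequality provides. It is kept in
  place of the supremum because its squares, weighted by the cell sizes, add up to a multiple of the
  energy.\<close>

definition eps :: "real \<Rightarrow> nat \<Rightarrow> real" where
  "eps t j = sqrt (Ci / H j * integral {X (j - 1)..X j} (\<lambda>x. (poly (e t j) x)\<^sup>2))"

lemma N1: "1 \<le> N" using mesh by (simp add: is_mesh_def)

lemma cellH: "j \<in> {1..N} \<Longrightarrow> 0 < H j" "j \<in> {1..N} \<Longrightarrow> H j \<le> h" "j \<in> {1..N} \<Longrightarrow> h \<le> \<kappa> * H j"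
  "j \<in> {1..N} \<Longrightarrow> X (j - 1) < X j" "j \<in> {1..N} \<Longrightarrow> H j \<le> 1" "H j = X j - X (j - 1)"
  using mesh_nodes(4)[OF mesh, of j] mesh_size_bounds[OF mesh quasi, of j] h small(1)
  by (auto simp: cell_size_def)

lemma h0: "0 < h" using mesh_size_bounds(3)[OF mesh quasi, of 1] N1 h by simp

lemma cell_sub: "j \<in> {1..N} \<Longrightarrow> x \<in> {X (j - 1)..X j} \<Longrightarrow> x \<in> {a..b}"
  using mesh_nodes(3)[OF mesh] by blast

lemma node_in: "i \<le> N \<Longrightarrow> X i \<in> {a..b}"
  using mesh_nodes(2)[OF mesh] .

lemma \<tau>0: "0 < \<tau>" using \<tau>(1) h0 by (meson less_le_trans zero_less_power)

lemma Hpow: "j \<in> {1..N} \<Longrightarrow> H j ^ (k + 1) \<le> h ^ (k + 1)"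
  using cellH(1,2) by (intro power_mono) (auto intro: less_imp_le)

lemma Ceh: "Ce * h ^ (k + 1) \<le> 1"
proof -
  have "h ^ (k + 1) \<le> h ^ 1" using h0 small(1) by (intro power_decreasing) auto
  then have "Ce * h ^ (k + 1) \<le> Ce * h" using Ce0 by (intro mult_left_mono) auto
  then show ?thesis using small(2) by linarith
qed

lemma Dx: "i + j < k + 2 \<Longrightarrow> t \<in> {0..T} \<Longrightarrow> ((\<lambda>y. D i j y t) has_real_derivative D (Suc i) j x t) (at x)"
  using tower unfolding smooth_tower_def by blast

lemma Dt: "i + j < k + 2 \<Longrightarrow> t \<in> {0..T} \<Longrightarrow> ((\<lambda>s. D i j x s) has_real_derivative D i (Suc j) x t) (at t within {0..T})"
  using tower unfolding smooth_tower_def by blast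

lemma DM: "i + j \<le> k + 2 \<Longrightarrow> x \<in> {a..b} \<Longrightarrow> t \<in> {0..T} \<Longrightarrow> \<bar>D i j x t\<bar> \<le> M"
  using tower unfolding smooth_tower_def by blast

lemma Dc: "i + j \<le> k + 2 \<Longrightarrow> t \<in> {0..T} \<Longrightarrow> continuous_on V (\<lambda>x. D i j x t)"
proof -
  assume "i + j \<le> k + 2" "t \<in> {0..T}"
  then have c: "continuous_on (UNIV \<times> {0..T}) (\<lambda>(x, t). D i j x t)"
    using tower unfolding smooth_tower_def by blast
  have "continuous_on V (\<lambda>x. (\<lambda>(x, t). D i j x t) (x, t))"
    by (rule continuous_on_compose2[OF c]) (use \<open>t \<in> {0..T}\<close> in \<open>auto intro!: continuous_intros\<close>)
  then show ?thesis by simp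
qed

lemma taylor_near:
  assumes j: "j \<in> {1..N}" and x: "x \<in> {X (j - 1)..X j}" and t: "t \<in> {0..T}" and s: "s \<le> 1"
  shows "\<bar>D 0 s x t - poly (taylor k (\<lambda>i x. D i s x t) (X (j - 1))) x\<bar> \<le> M * H j ^ (k + 1)"
proof -
  have base: "\<bar>D k s y t - D k s (X (j - 1)) t\<bar> \<le> H j * M" if y: "y \<in> {X (j - 1)..X j}" for y
  proof -
    obtain \<xi> where \<xi>: "\<xi> \<in> closed_segment (X (j - 1)) y" "D k s y t - D k s (X (j - 1)) t = (y - X (j - 1)) * D (Suc k) s \<xi> t"
      using mvt_segment[of "X (j - 1)" y "\<lambda>y. D k s y t" "\<lambda>y. D (Suc k) s y t"] Dx[of k s t] s t by auto
    have "\<xi> \<in> {X (j - 1)..X j}" using \<xi>(1) y by (auto simp: closed_segment_eq_real_ivl)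
    then have "\<bar>D (Suc k) s \<xi> t\<bar> \<le> M" using DM[of "Suc k" s \<xi> t] cell_sub[OF j] s t by auto
    then show ?thesis
      unfolding \<xi>(2) abs_mult using y cellH(6) by (intro mult_mono) auto
  qed
  have "\<bar>(\<lambda>i x. D i s x t) 0 x - poly (taylor k (\<lambda>i x. D i s x t) (X (j - 1))) x\<bar> \<le> (X j - X (j - 1)) ^ k * (H j * M)"
    using x base Dx[of _ s t] s t by (intro taylor_error) (auto intro: has_field_derivative_at_within)
  then show ?thesis unfolding cellH(6)[symmetric] by (simp add: mult_ac)
qed

text \<open>Used for the solution (\<open>s = 0\<close>) and for its time derivative (\<open>s = 1\<close>).\<close>

lemma eta:
  assumes j: "j \<in> {1..N}" and x: "x \<in> {X (j - 1)..X j}" and t: "t \<in> {0..T}" and s: "s \<le> 1"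
  shows "\<bar>D 0 s x t - poly (Q j (\<lambda>x. D 0 s x t)) x\<bar> \<le> Ce * H j ^ (k + 1)"
proof -
  have "\<bar>D 0 s x t - poly (Q j (\<lambda>x. D 0 s x t)) x\<bar> \<le> (1 + Cp) * (M * H j ^ (k + 1))"
    by (rule cell_projector_error[OF proj[OF j] Cp Dc degree_taylor taylor_near])
      (use j x t s in auto)
  then show ?thesis by (simp add: Ce mult_ac)
qed

lemma eta_h:
  assumes "j \<in> {1..N}" "x \<in> {X (j - 1)..X j}" "t \<in> {0..T}" "s \<le> 1"
  shows "\<bar>D 0 s x t - poly (Q j (\<lambda>x. D 0 s x t)) x\<bar> \<le> Ce * h ^ (k + 1)"
  using eta[OF assms] mult_left_mono[OF Hpow[OF assms(1)] Ce0] by linarith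

lemma degq: "j \<in> {1..N} \<Longrightarrow> degree (Q j g) \<le> k"
  using proj unfolding cell_projector_def by blast

lemma degu: "j \<in> {1..N} \<Longrightarrow> t \<in> {0..T} \<Longrightarrow> degree (u t j) \<le> k"
  using sol unfolding numerical_solution_def Vspace_def by blast

lemma dege: "j \<in> {1..N} \<Longrightarrow> t \<in> {0..T} \<Longrightarrow> degree (e t j) \<le> k"
  unfolding e_def by (intro degree_diff_le degu degq)

lemma q_has_derivative:
  assumes j: "j \<in> {1..N}" and x: "x \<in> {X (j - 1)..X j}" and t: "t \<in> {0..T}"
  shows "((\<lambda>s. poly (q s j) x) has_real_derivative poly (qt t j) x) (at t within {0..T})"
proof -
  have "continuous_on (UNIV \<times> {0..T}) (\<lambda>(x, t). D 0 1 x t)"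
    using tower unfolding smooth_tower_def by auto
  then have "continuous_on ({0..T} \<times> {X (j - 1)..X j}) (\<lambda>z. (\<lambda>(x, t). D 0 1 x t) (snd z, fst z))"
    by (rule continuous_on_compose2) (auto intro!: continuous_intros)
  then have c: "continuous_on ({0..T} \<times> {X (j - 1)..X j}) (\<lambda>(s, x). D 0 1 x s)"
    by (simp add: case_prod_unfold)
  have d: "\<forall>s\<in>{0..T}. \<forall>x\<in>{X (j - 1)..X j}. ((\<lambda>s. (\<lambda>s x. D 0 0 x s) s x) has_real_derivative (\<lambda>s x. D 0 1 x s) s x) (at s within {0..T})"
    using Dt[of 0 0] by auto
  have w: "\<forall>s\<in>{0..T}. continuous_on {X (j - 1)..X j} ((\<lambda>s x. D 0 0 x s) s)"
    using Dc[of 0 0] by auto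
  from proj[OF j] have "\<forall>T W Wt t. t \<in> {0..T} \<longrightarrow>
        (\<forall>s\<in>{0..T}. \<forall>x\<in>{X (j - 1)..X j}. ((\<lambda>s. W s x) has_real_derivative Wt s x) (at s within {0..T})) \<longrightarrow>
        continuous_on ({0..T} \<times> {X (j - 1)..X j}) (\<lambda>(s, x). Wt s x) \<longrightarrow>
        (\<forall>s\<in>{0..T}. continuous_on {X (j - 1)..X j} (W s)) \<longrightarrow>
        (\<forall>x\<in>{X (j - 1)..X j}. ((\<lambda>s. poly (Q j (W s)) x) has_real_derivative poly (Q j (Wt t)) x) (at t within {0..T}))"
    unfolding cell_projector_def by (elim conjE) assumption
  from this[rule_format, of t T "\<lambda>s x. D 0 0 x s" "\<lambda>s x. D 0 1 x s" x] t d c w x show ?thesis by auto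
qed

lemma eps_props:
  assumes j: "j \<in> {1..N}" and t: "t \<in> {0..T}"
  shows "0 \<le> eps t j" "H j * (eps t j)\<^sup>2 = Ci * integral {X (j - 1)..X j} (\<lambda>x. (poly (e t j) x)\<^sup>2)"
    and "x \<in> {X (j - 1)..X j} \<Longrightarrow> \<bar>poly (e t j) x\<bar> \<le> eps t j"
    and "x \<in> {X (j - 1)..X j} \<Longrightarrow> \<bar>poly (pderiv (e t j)) x\<bar> \<le> Ci * eps t j / (X j - X (j - 1))"
proof -
  have I: "0 \<le> integral {X (j - 1)..X j} (\<lambda>x. (poly (e t j) x)\<^sup>2)"
    by (intro integral_nonneg integrable_continuous_interval continuous_intros) auto
  have nn: "0 \<le> Ci / H j * integral {X (j - 1)..X j} (\<lambda>x. (poly (e t j) x)\<^sup>2)"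
    using I Ci cellH(1)[OF j] by simp
  show "0 \<le> eps t j" unfolding eps_def using nn by simp
  have sq: "(eps t j)\<^sup>2 = Ci / H j * integral {X (j - 1)..X j} (\<lambda>x. (poly (e t j) x)\<^sup>2)"
    unfolding eps_def using nn by simp
  then show "H j * (eps t j)\<^sup>2 = Ci * integral {X (j - 1)..X j} (\<lambda>x. (poly (e t j) x)\<^sup>2)"
    using cellH(1)[OF j] by simp
  show bd: "\<bar>poly (e t j) x\<bar> \<le> eps t j" if "x \<in> {X (j - 1)..X j}" for x
  proof -
    have "(poly (e t j) x)\<^sup>2 \<le> Ci / H j * integral {X (j - 1)..X j} (\<lambda>x. (poly (e t j) x)\<^sup>2)"
      using inv_sup[OF cellH(4)[OF j] dege[OF j t] that] by (simp add: cellH(6))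
    from real_sqrt_le_mono[OF this] show ?thesis by (simp add: eps_def)
  qed
  show "\<bar>poly (pderiv (e t j)) x\<bar> \<le> Ci * eps t j / (X j - X (j - 1))" if "x \<in> {X (j - 1)..X j}"
    by (rule inv_deriv[OF cellH(4)[OF j] dege[OF j t] bd that])
qed

text \<open>The traces of \<open>u = w + e - \<eta>\<close>, including the conventions at the two boundary nodes.\<close>

lemma traces:
  assumes i: "i \<le> N" and t: "t \<in> {0..T}"
  defines "\<eta>l \<equiv> D 0 0 (X i) t - trace_left bc N X (q t) i"
    and "\<eta>r \<equiv> D 0 0 (X i) t - trace_right bc N X (q t) i"
  shows "trace_left bc N X (u t) i = D 0 0 (X i) t + trace_left bc N X (e t) i - \<eta>l"
    and "trace_right bc N X (u t) i = D 0 0 (X i) t + trace_right bc N X (e t) i - \<eta>r"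
    and "\<bar>\<eta>l\<bar> \<le> Ce * h ^ (k + 1)" "\<bar>\<eta>r\<bar> \<le> Ce * h ^ (k + 1)"
    and "(if 1 \<le> i then exr i else bc = Compact_support \<or> exr N) \<Longrightarrow> \<eta>l = 0"
    and "(if i < N then exl (Suc i) else bc = Compact_support \<or> exl 1) \<Longrightarrow> \<eta>r = 0"
proof -
  show "trace_left bc N X (u t) i = D 0 0 (X i) t + trace_left bc N X (e t) i - \<eta>l"
    by (cases bc) (auto simp: trace_left_def \<eta>l_def e_def)
  show "trace_right bc N X (u t) i = D 0 0 (X i) t + trace_right bc N X (e t) i - \<eta>r"
    by (cases bc) (auto simp: trace_right_def \<eta>r_def e_def)
  have ends: "X 0 = a" "X N = b" using mesh by (auto simp: is_mesh_def)
  have jR: "\<bar>D 0 0 (X j) t - poly (q t j) (X j)\<bar> \<le> Ce * h ^ (k + 1)"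
    "exr j \<Longrightarrow> D 0 0 (X j) t - poly (q t j) (X j) = 0" if j: "j \<in> {1..N}" for j
  proof -
    show "\<bar>D 0 0 (X j) t - poly (q t j) (X j)\<bar> \<le> Ce * h ^ (k + 1)"
      using cellH(4)[OF j] by (intro eta_h j t) auto
    show "D 0 0 (X j) t - poly (q t j) (X j) = 0" if "exr j"
      using proj[OF j] that unfolding cell_projector_def by simp
  qed
  have jL: "\<bar>D 0 0 (X (j - 1)) t - poly (q t j) (X (j - 1))\<bar> \<le> Ce * h ^ (k + 1)"
    "exl j \<Longrightarrow> D 0 0 (X (j - 1)) t - poly (q t j) (X (j - 1)) = 0" if j: "j \<in> {1..N}" for j
  proof -
    show "\<bar>D 0 0 (X (j - 1)) t - poly (q t j) (X (j - 1))\<bar> \<le> Ce * h ^ (k + 1)"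
      using cellH(4)[OF j] by (intro eta_h j t) auto
    show "D 0 0 (X (j - 1)) t - poly (q t j) (X (j - 1)) = 0" if "exl j"
      using proj[OF j] that unfolding cell_projector_def by simp
  qed
  have Ch: "0 \<le> Ce * h ^ (k + 1)" using Ce0 h0 by simp
  have "\<bar>\<eta>l\<bar> \<le> Ce * h ^ (k + 1) \<and> ((if 1 \<le> i then exr i else bc = Compact_support \<or> exr N) \<longrightarrow> \<eta>l = 0)"
  proof (cases "1 \<le> i")
    case True
    then show ?thesis using jR[of i] i by (simp add: \<eta>l_def trace_left_def)
  next
    case False
    then have i0: "i = 0" by simp
    from bcW[OF t] show ?thesis
    proof
      assume "bc = Periodic \<and> D 0 0 a t = D 0 0 b t"
      then show ?thesis using jR[of N] N1 ends i0 by (simp add: \<eta>l_def trace_left_def)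
    next
      assume "bc = Compact_support \<and> D 0 0 a t = 0 \<and> D 0 0 b t = 0"
      then show ?thesis using ends i0 Ch by (simp add: \<eta>l_def trace_left_def)
    qed
  qed
  then show "\<bar>\<eta>l\<bar> \<le> Ce * h ^ (k + 1)" "(if 1 \<le> i then exr i else bc = Compact_support \<or> exr N) \<Longrightarrow> \<eta>l = 0"
    by auto
  have "\<bar>\<eta>r\<bar> \<le> Ce * h ^ (k + 1) \<and> ((if i < N then exl (Suc i) else bc = Compact_support \<or> exl 1) \<longrightarrow> \<eta>r = 0)"
  proof (cases "i < N")
    case True
    then show ?thesis using jL[of "Suc i"] by (simp add: \<eta>r_def trace_right_def)
  next
    case False
    then have iN: "i = N" using i by simp
    from bcW[OF t] show ?thesis
    proof
      assume "bc = Periodic \<and> D 0 0 a t = D 0 0 b t"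
      then show ?thesis using jL[of 1] N1 ends iN by (simp add: \<eta>r_def trace_right_def)
    next
      assume "bc = Compact_support \<and> D 0 0 a t = 0 \<and> D 0 0 b t = 0"
      then show ?thesis using ends iN Ch by (simp add: \<eta>r_def trace_right_def)
    qed
  qed
  then show "\<bar>\<eta>r\<bar> \<le> Ce * h ^ (k + 1)" "(if i < N then exl (Suc i) else bc = Compact_support \<or> exl 1) \<Longrightarrow> \<eta>r = 0"
    by auto
qed

lemma error_traces:
  assumes t: "t \<in> {0..T}"
  shows "j \<in> {1..N} \<Longrightarrow> trace_left bc N X (e t) j = poly (e t j) (X j)"
    "j \<in> {1..N} \<Longrightarrow> trace_right bc N X (e t) (j - 1) = poly (e t j) (X (j - 1))"
    "j \<in> {1..N} \<Longrightarrow> \<bar>trace_left bc N X (e t) j\<bar> \<le> eps t j"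
    "j \<in> {1..N} \<Longrightarrow> \<bar>trace_right bc N X (e t) (j - 1)\<bar> \<le> eps t j"
    "\<bar>trace_left bc N X (e t) 0\<bar> \<le> eps t N" "\<bar>trace_right bc N X (e t) N\<bar> \<le> eps t 1"
proof -
  show l: "trace_left bc N X (e t) j = poly (e t j) (X j)" if "j \<in> {1..N}" for j
    using that by (simp add: trace_left_def)
  show r: "trace_right bc N X (e t) (j - 1) = poly (e t j) (X (j - 1))" if "j \<in> {1..N}" for j
  proof -
    have "j - 1 < N" "Suc (j - 1) = j" using that by auto
    then show ?thesis by (simp add: trace_right_def)
  qed
  have pl: "\<bar>poly (e t j) (X j)\<bar> \<le> eps t j" "\<bar>poly (e t j) (X (j - 1))\<bar> \<le> eps t j" if j: "j \<in> {1..N}" for j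
    using cellH(4)[OF j] by (auto intro!: eps_props(3)[OF j t])
  show "\<bar>trace_left bc N X (e t) j\<bar> \<le> eps t j" "\<bar>trace_right bc N X (e t) (j - 1)\<bar> \<le> eps t j" if "j \<in> {1..N}" for j
    using l[OF that] r[OF that] pl[OF that] by auto
  have one: "1 \<in> {1..N}" "N \<in> {1..N}" using N1 by auto
  show "\<bar>trace_left bc N X (e t) 0\<bar> \<le> eps t N"
    using pl(1)[OF one(2)] eps_props(1)[OF one(2) t] by (cases bc) (auto simp: trace_left_def)
  show "\<bar>trace_right bc N X (e t) N\<bar> \<le> eps t 1"
    using pl(2)[OF one(1)] eps_props(1)[OF one(1) t] by (cases bc) (auto simp: trace_right_def)
qed


text \<open>The bootstrap hypothesis on the energy implies that the error is at most one everywhere.\<close>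

lemma eps_le_1:
  assumes j: "j \<in> {1..N}" and t: "t \<in> {0..T}" and Et: "E t \<le> h / (Ci * \<kappa>)"
  shows "eps t j \<le> 1"
proof -
  let ?I = "\<lambda>j. integral {X (j - 1)..X j} (\<lambda>x. (poly (e t j) x)\<^sup>2)"
  have "?I j \<le> E t" unfolding E_def
    by (rule member_le_sum[OF j]) (auto intro!: integral_nonneg integrable_continuous_interval continuous_intros)
  then have "Ci * ?I j \<le> Ci * (h / (Ci * \<kappa>))" using Et Ci by (intro mult_left_mono) auto
  also have "\<dots> = h / \<kappa>" using Ci by simp
  also have "\<dots> \<le> H j" using cellH(3)[OF j] \<kappa> by (simp add: divide_le_eq mult.commute)
  finally have "H j * (eps t j)\<^sup>2 \<le> H j * 1" using eps_props(2)[OF j t] by simp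
  then have "(eps t j)\<^sup>2 \<le> 1\<^sup>2" using cellH(1)[OF j] by (simp add: mult_le_cancel_left_pos)
  then show ?thesis by (rule power2_le_imp_le) simp
qed

lemma W_range:
  assumes "i \<le> N" "t \<in> {0..T}" "\<bar>z\<bar> \<le> 2"
  shows "D 0 0 (X i) t + z \<in> {- R..R}"
  using DM[of 0 0 "X i" t] node_in[OF assms(1)] assms R by auto

text \<open>The cell inequalities, the node estimate and the bound of the damping coefficient are put together,
  under the bootstrap hypothesis.\<close>

lemma energy_rate:
  assumes t: "t \<in> {0..T}" and Et: "E t \<le> h / (Ci * \<kappa>)"
    and scheme: "\<And>v j. v \<in> Vspace k N \<Longrightarrow> j \<in> {1..N} \<Longrightarrow>
           integral {X (j - 1)..X j} (\<lambda>x. poly (ut j) x * poly (v j) x)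
           - integral {X (j - 1)..X j} (\<lambda>x. f (poly (u t j) x) * poly (pderiv (v j)) x)
           + flux_at bc fh N X (u t) j * poly (v j) (X j)
           - flux_at bc fh N X (u t) (j - 1) * poly (v j) (X (j - 1))
           = - sigma k \<beta> bc f fh N X S (u t) j *
               integral {X (j - 1)..X j}
                 (\<lambda>x. (poly (u t j) x - avg (X (j - 1)) (X j) (poly (u t j))) * poly (v j) x)"
  shows "(\<Sum>j\<in>{1..N}. 2 * integral {X (j - 1)..X j} (\<lambda>x. poly (ut j - qt t j) x * poly (e t j) x))
    \<le> growth * E t + source * \<tau>\<^sup>2"
proof -
  note eps1 = eps_le_1[OF _ t Et]
  define el where "el i = trace_left bc N X (e t) i" for i
  define er where "er i = trace_right bc N X (e t) i" for i
  define F where "F i = flux_at bc fh N X (u t) i" for i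
  define P where "P i z = \<Phi> (D 0 0 (X i) t + z) - \<Phi> (D 0 0 (X i) t) - F i * z" for i z
  define J where "J i = jump bc N X (u t) i" for i
  define \<sigma> where "\<sigma> j = sigma k \<beta> bc f fh N X S (u t) j" for j
  have one: "1 \<in> {1..N}" "N \<in> {1..N}" using N1 by auto
  have ends: "X 0 = a" "X N = b" using mesh by (auto simp: is_mesh_def)
  have ue: "u t j = q t j + e t j" for j by (simp add: e_def)
  have el1: "\<bar>el i\<bar> \<le> 1" if i: "i \<le> N" for i
  proof (cases "i = 0")
    case True
    then show ?thesis using error_traces(5)[OF t] eps1[OF one(2)] by (simp add: el_def)
  next
    case False
    then have "i \<in> {1..N}" using i by simp
    then show ?thesis using error_traces(3)[OF t, of i] eps1[of i] by (simp add: el_def)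
  qed
  have er1: "\<bar>er i\<bar> \<le> 1" if i: "i \<le> N" for i
  proof (cases "i = N")
    case True
    then show ?thesis using error_traces(6)[OF t] eps1[OF one(1)] by (simp add: er_def)
  next
    case False
    then have "Suc i \<in> {1..N}" using i by simp
    then show ?thesis using error_traces(4)[OF t, of "Suc i"] eps1[of "Suc i"] by (simp add: er_def)
  qed
  have tr_u: "trace_left bc N X (u t) i \<in> {- R..R}" "trace_right bc N X (u t) i \<in> {- R..R}" if i: "i \<le> N" for i
  proof -
    have "\<bar>el i - (D 0 0 (X i) t - trace_left bc N X (q t) i)\<bar> \<le> 2"
      using el1[OF i] traces(3)[OF i t] Ceh by linarith
    from W_range[OF i t this] show "trace_left bc N X (u t) i \<in> {- R..R}"
      unfolding traces(1)[OF i t] el_def by (simp add: algebra_simps)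
    have "\<bar>er i - (D 0 0 (X i) t - trace_right bc N X (q t) i)\<bar> \<le> 2"
      using er1[OF i] traces(4)[OF i t] Ceh by linarith
    from W_range[OF i t this] show "trace_right bc N X (u t) i \<in> {- R..R}"
      unfolding traces(2)[OF i t] er_def by (simp add: algebra_simps)
  qed
  have nodes: "P i (el i) - P i (er i) \<le> B * h * ((el i)\<^sup>2 + (er i)\<^sup>2 + \<tau>\<^sup>2)" if i: "i \<le> N" for i
  proof -
    have Fi: "F i = fh (D 0 0 (X i) t + el i - (D 0 0 (X i) t - trace_left bc N X (q t) i))
        (D 0 0 (X i) t + er i - (D 0 0 (X i) t - trace_right bc N X (q t) i))"
      unfolding F_def flux_at_def traces(1)[OF i t] traces(2)[OF i t] el_def er_def ..
    have "F i * (er i - el i) - (\<Phi> (D 0 0 (X i) t + er i) - \<Phi> (D 0 0 (X i) t + el i))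
        \<le> B * h * ((el i)\<^sup>2 + (er i)\<^sup>2 + \<tau>\<^sup>2)"
      unfolding Fi
      by (rule node[OF t i el1[OF i] er1[OF i] traces(3)[OF i t] traces(4)[OF i t]])
        (use traces(5,6)[OF i t] in blast)+
    then show ?thesis by (simp add: P_def algebra_simps)
  qed
  have Jb: "\<bar>J i\<bar> \<le> \<bar>el i\<bar> + \<bar>er i\<bar> + 2 * Ce * \<tau>" if i: "i \<le> N" for i
  proof -
    have "Ce * h ^ (k + 1) \<le> Ce * \<tau>" using \<tau>(1) Ce0 by (rule mult_left_mono)
    then show ?thesis
      unfolding J_def jump_def traces(1)[OF i t] traces(2)[OF i t] el_def er_def
      using traces(3)[OF i t] traces(4)[OF i t] by linarith
  qed
  have bcs: "(P 0 = P N \<and> el 0 = el N \<and> er N = er 0) \<or> (el 0 = 0 \<and> er N = 0 \<and> P 0 0 = 0 \<and> P N 0 = 0)"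
    using bcW[OF t]
  proof
    assume p: "bc = Periodic \<and> D 0 0 a t = D 0 0 b t"
    then have "el 0 = el N" "er N = er 0" "F 0 = F N"
      using N1 by (auto simp: el_def er_def F_def flux_at_def trace_left_def trace_right_def)
    then show ?thesis using p ends by (auto simp: P_def fun_eq_iff)
  next
    assume p: "bc = Compact_support \<and> D 0 0 a t = 0 \<and> D 0 0 b t = 0"
    then show ?thesis by (auto simp: el_def er_def P_def trace_left_def trace_right_def)
  qed
  have u_cell: "poly (u t j) x \<in> {- R..R}" if j: "j \<in> {1..N}" and x: "x \<in> {X (j - 1)..X j}" for j x
  proof -
    have "\<bar>D 0 0 x t\<bar> \<le> M" using DM[of 0 0 x t] cell_sub[OF j x] t by simp
    moreover have "\<bar>D 0 0 x t - poly (q t j) x\<bar> \<le> 1" using eta_h[OF j x t, of 0] Ceh by simp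
    moreover have "\<bar>poly (e t j) x\<bar> \<le> 1" using eps_props(3)[OF j t x] eps1[OF j] by linarith
    moreover have "poly (u t j) x = poly (q t j) x + poly (e t j) x" by (simp add: ue)
    ultimately show ?thesis using R by auto
  qed
  have sig: "0 \<le> \<sigma> j \<and> \<sigma> j * H j \<le> Cs * (H j ^ (k + 1) + eps t j + \<bar>J (j - 1)\<bar> + \<bar>J j\<bar>)" if j: "j \<in> {1..N}" for j
    unfolding \<sigma>_def J_def
  proof (rule damping[OF cellH(1)[OF j] cellH(5)[OF j] eps_props(1)[OF j t]])
    show "\<forall>x\<in>{X (j - 1)..X j}. \<bar>poly (u t j) x\<bar> \<le> R"
    proof
      fix x assume "x \<in> {X (j - 1)..X j}"
      from u_cell[OF j this] show "\<bar>poly (u t j) x\<bar> \<le> R" by auto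
    qed
    show "\<forall>i\<in>{j - 1, j}. trace_left bc N X (u t) i \<in> {- R..R} \<and> trace_right bc N X (u t) i \<in> {- R..R}"
      using tr_u[of "j - 1"] tr_u[of j] j by auto
    show "\<forall>r\<in>{k + 1, k + 2}. \<forall>x\<in>{X (j - 1)..X j}.
        \<bar>(deriv ^^ r) (\<lambda>y. f (poly (u t j) y)) x\<bar> \<le> K * (1 + eps t j / H j ^ r)"
    proof (intro ballI)
      fix r x assume r: "r \<in> {k + 1, k + 2}" and x: "x \<in> {X (j - 1)..X j}"
      have near: "\<bar>poly (u t j) y - poly (taylor k (\<lambda>i x. D i 0 x t) (X (j - 1))) y\<bar>
          \<le> eps t j + (Ce + M) * (X j - X (j - 1)) ^ (k + 1)" if y: "y \<in> {X (j - 1)..X j}" for y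
      proof -
        have "\<bar>D 0 0 y t - poly (q t j) y\<bar> \<le> Ce * H j ^ (k + 1)" by (rule eta[OF j y t]) simp
        moreover have "\<bar>D 0 0 y t - poly (taylor k (\<lambda>i x. D i 0 x t) (X (j - 1))) y\<bar> \<le> M * H j ^ (k + 1)"
          by (rule taylor_near[OF j y t]) simp
        moreover have "poly (u t j) y = poly (q t j) y + poly (e t j) y" by (simp add: ue)
        moreover have "\<bar>poly (e t j) y\<bar> \<le> eps t j" by (rule eps_props(3)[OF j t y])
        moreover have "(Ce + M) * (X j - X (j - 1)) ^ (k + 1) = Ce * H j ^ (k + 1) + M * H j ^ (k + 1)"
          by (simp only: cellH(6)[symmetric] distrib_right)
        ultimately show ?thesis by linarith
      qed
      have "poly_scaling x (X j - X (j - 1)) (eps t j) (u t j) 0 (\<lambda>i. (real k + 1) * M + Ci ^ i * (1 + (Ce + M)))"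
      proof (rule poly_scaling_near_smooth[OF cellH(4)[OF j] _ inv_deriv[OF cellH(4)[OF j]] _ degu[OF j t] _ near])
        show "X j - X (j - 1) \<le> 1" using cellH(5)[OF j] cellH(6) by simp
        show "\<bar>D i 0 (X (j - 1)) t\<bar> \<le> M" if "i \<le> k" for i
          using DM[of i 0 "X (j - 1)" t] node_in[of "j - 1"] j that t by auto
      qed (use Ci Ce0 M0 x eps_props(1)[OF j t] in auto)
      then show "\<bar>(deriv ^^ r) (\<lambda>y. f (poly (u t j) y)) x\<bar> \<le> K * (1 + eps t j / H j ^ r)"
        unfolding cellH(6)[symmetric]
        by (rule K[OF cellH(1)[OF j] cellH(5)[OF j] eps_props(1)[OF j t] eps1[OF j] _ u_cell[OF j x] r])
    qed
  qed
  have eV: "e t \<in> Vspace k N" using dege t by (simp add: Vspace_def)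
  have f': "(f has_real_derivative deriv f x) (at x)" for x
    using C_class_derivative[OF f(1), of 0] f(2) by simp
  have cf': "continuous_on UNIV (deriv f)"
    using C_class_continuous[OF f(1), of 1] f(2) by simp
  have cell: "integral {X (j - 1)..X j} (\<lambda>x. poly (ut j - qt t j) x * poly (e t j) x)
      \<le> P j (el j) - P (j - 1) (er (j - 1)) + cell_const * (H j * ((eps t j)\<^sup>2 + (H j ^ (k + 1))\<^sup>2))
        + 4 * (M + Ce) * (H j * eps t j) * (\<sigma> j * H j)" if j: "j \<in> {1..N}" for j
  proof -
    have el: "el j = poly (e t j) (X j)" "er (j - 1) = poly (e t j) (X (j - 1))"
      using error_traces(1,2)[OF t j] by (auto simp: el_def er_def)
    have dx: "((\<lambda>x. D 0 0 x t) has_real_derivative D 1 0 x t) (at x)" for x using Dx[of 0 0 t] t by simp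
    have Hk: "H j ^ (k + 1) \<le> H j"
      using power_decreasing[of 1 "k + 1" "H j"] cellH(1,5)[OF j] by simp
    have alt: "integral {X (j - 1)..X j} (\<lambda>x. (D 0 0 x t - poly (q t j) x) * poly (pderiv (e t j)) x) = 0 \<or>
        (\<forall>x\<in>{X (j - 1)..X j}. \<bar>deriv f (D 0 0 x t)\<bar> \<le> (A * \<kappa>) * (X j - X (j - 1)))"
    proof (cases "exl j \<and> exr j")
      case True
      have "\<bar>deriv f (D 0 0 x t)\<bar> \<le> (A * \<kappa>) * (X j - X (j - 1))" if x: "x \<in> {X (j - 1)..X j}" for x
      proof -
        have "\<bar>deriv f (D 0 0 x t)\<bar> \<le> A * h" using True by (intro both[OF j _ _ t x]) auto
        also have "\<dots> \<le> A * (\<kappa> * H j)" using cellH(3)[OF j] AB by (intro mult_left_mono) auto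
        finally show ?thesis by (simp add: cellH(6) mult.assoc)
      qed
      then show ?thesis by blast
    next
      case False
      have "degree (pderiv (e t j)) < k" using dege[OF j t] k by (simp add: degree_pderiv)
      then show ?thesis
        using proj[OF j] False Dc[of 0 0 t] t unfolding cell_projector_def by auto
    qed
    have sch: "integral {X (j - 1)..X j} (\<lambda>x. poly (ut j) x * poly (e t j) x)
        - integral {X (j - 1)..X j} (\<lambda>x. f (poly (q t j + e t j) x) * poly (pderiv (e t j)) x)
        + F j * poly (e t j) (X j) - F (j - 1) * poly (e t j) (X (j - 1))
      = - \<sigma> j * integral {X (j - 1)..X j} (\<lambda>x. (poly (q t j + e t j) x
          - avg (X (j - 1)) (X j) (poly (q t j + e t j))) * poly (e t j) x)"
      using scheme[OF eV j] unfolding ue[symmetric] F_def \<sigma>_def .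
    have "integral {X (j - 1)..X j} (\<lambda>x. poly (ut j - qt t j) x * poly (e t j) x)
      \<le> (\<Phi> (D 0 0 (X j) t + poly (e t j) (X j)) - \<Phi> (D 0 0 (X j) t) - F j * poly (e t j) (X j))
        - (\<Phi> (D 0 0 (X (j - 1)) t + poly (e t j) (X (j - 1))) - \<Phi> (D 0 0 (X (j - 1)) t)
            - F (j - 1) * poly (e t j) (X (j - 1)))
        + (L * M + L * Ci * Ce * (1 + Ce) + (L * M + A * \<kappa>) * Ci * Ce + Ce)
            * ((X j - X (j - 1)) * ((eps t j)\<^sup>2 + (H j ^ (k + 1))\<^sup>2))
        + 4 * (M + Ce) * ((X j - X (j - 1)) * eps t j) * (\<sigma> j * (X j - X (j - 1)))"
    proof (rule cell_energy_inequality[OF cellH(4)[OF j] \<Phi> f' cf' f1L L0 R dx Dc Dc pde _ _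
          eps_props(3)[OF j t] eps1[OF j] eps_props(4)[OF j t] _ eta[OF j _ t] eta[OF j _ t] Ce0 _ _ _ alt _ _ sch])
      show "\<bar>D 0 0 x t\<bar> \<le> M" "\<bar>D 1 0 x t\<bar> \<le> M" if "x \<in> {X (j - 1)..X j}" for x
        using DM[of 0 0 x t] DM[of 1 0 x t] cell_sub[OF j that] t by auto
      show "0 \<le> H j ^ (k + 1)" using cellH(1)[OF j] by simp
      show "H j ^ (k + 1) \<le> X j - X (j - 1)" using Hk cellH(6) by simp
      show "Ce * H j ^ (k + 1) \<le> 1" using mult_left_mono[OF Hpow[OF j] Ce0] Ceh by linarith
      show "0 \<le> A * \<kappa>" using AB \<kappa> by simp
      show "0 \<le> \<sigma> j" using sig[OF j] by blast
    qed (use t Ci in auto)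
    then show ?thesis
      unfolding P_def el cell_const_def cellH(6)[symmetric] .
  qed
  define Z where "Z = (\<Sum>j\<in>{1..N}. H j * (eps t j)\<^sup>2)"
  have ZE: "Z = Ci * E t"
    unfolding Z_def E_def sum_distrib_left by (intro sum.cong eps_props(2)[OF _ t]) auto
  have "(\<Sum>j\<in>{1..N}. integral {X (j - 1)..X j} (\<lambda>x. poly (ut j - qt t j) x * poly (e t j) x))
    \<le> (cell_const + 4 * \<kappa> * B + 4 * (M + Ce) * Cs * (6 + 4 * Ce + 8 * \<kappa>)) * Z
      + (b - a) * (cell_const + 2 * \<kappa> * B + 4 * (M + Ce) * Cs * (1 + 4 * Ce)) * \<tau>\<^sup>2"
    unfolding Z_def
  proof (rule mesh_energy_rate[where P = P and el = el and er = er and s = "\<lambda>j. \<sigma> j * H j" and \<theta> = "\<lambda>j. H j ^ (k + 1)" and J = J and h = h])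
    show "0 \<le> H j ^ (k + 1) \<and> H j ^ (k + 1) \<le> \<tau>" if "j \<in> {1..N}" for j
      using Hpow[OF that] \<tau>(1) cellH(1)[OF that] by auto
    show "(\<Sum>j\<in>{1..N}. H j) = b - a" by (rule mesh_nodes(5)[OF mesh])
    show "\<sigma> j * H j \<le> Cs * (H j ^ (k + 1) + eps t j + \<bar>J (j - 1)\<bar> + \<bar>J j\<bar>)" if "j \<in> {1..N}" for j
      using sig[OF that] by blast
    show "\<bar>el j\<bar> \<le> eps t j" "\<bar>er (j - 1)\<bar> \<le> eps t j" if "j \<in> {1..N}" for j
      using error_traces(3,4)[OF t that] by (auto simp: el_def er_def)
    show "\<bar>el 0\<bar> \<le> eps t N" "\<bar>er N\<bar> \<le> eps t 1" using error_traces(5,6)[OF t] by (auto simp: el_def er_def)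
  qed (use N1 cellH(1-3) \<kappa> eps_props(1)[OF _ t] cell bcs nodes Jb cell_const0 M0 Ce0 Cs(1) AB in auto)
  then have "(\<Sum>j\<in>{1..N}. 2 * integral {X (j - 1)..X j} (\<lambda>x. poly (ut j - qt t j) x * poly (e t j) x))
    \<le> (growth - 1) * E t + source * \<tau>\<^sup>2"
    unfolding sum_distrib_left[symmetric] ZE growth_def source_def by (simp add: algebra_simps)
  moreover have "0 \<le> E t" unfolding E_def
    by (intro sum_nonneg integral_nonneg integrable_continuous_interval continuous_intros) auto
  ultimately show ?thesis by (simp add: algebra_simps)
qed

lemma square_triangle: "(x - y)\<^sup>2 \<le> 2 * (z - x)\<^sup>2 + 2 * (z - y :: real)\<^sup>2"
  using zero_le_power2[of "(z - x) + (z - y)"] by (simp add: power2_eq_square algebra_simps)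

lemma eta_L2:
  assumes j: "j \<in> {1..N}" and t: "t \<in> {0..T}"
  shows "integral {X (j - 1)..X j} (\<lambda>x. (D 0 0 x t - poly (q t j) x)\<^sup>2) \<le> Ce\<^sup>2 * \<tau>\<^sup>2 * H j"
proof -
  have c: "continuous_on {X (j - 1)..X j} (\<lambda>x. (D 0 0 x t - poly (q t j) x)\<^sup>2)"
    using Dc[of 0 0 t] t by (intro continuous_intros) auto
  have "\<bar>integral {X (j - 1)..X j} (\<lambda>x. (D 0 0 x t - poly (q t j) x)\<^sup>2)\<bar> \<le> (Ce * \<tau>)\<^sup>2 * (X j - X (j - 1))"
  proof (rule abs_integral_le_sup[OF less_imp_le[OF cellH(4)[OF j]] c])
    fix x assume x: "x \<in> {X (j - 1)..X j}"
    have "\<bar>D 0 0 x t - poly (q t j) x\<bar> \<le> Ce * h ^ (k + 1)" by (rule eta_h[OF j x t]) simp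
    also have "\<dots> \<le> Ce * \<tau>" using \<tau>(1) Ce0 by (rule mult_left_mono)
    finally have "\<bar>D 0 0 x t - poly (q t j) x\<bar>\<^sup>2 \<le> (Ce * \<tau>)\<^sup>2" by (intro power_mono) auto
    then show "\<bar>(D 0 0 x t - poly (q t j) x)\<^sup>2\<bar> \<le> (Ce * \<tau>)\<^sup>2" by simp
  qed
  then show ?thesis by (simp add: cellH(6) power_mult_distrib)
qed

text \<open>Initially \<open>u\<close> is the best approximation of \<open>w\<close> in the \<open>L\<^sup>2\<close> norm, hence at least as close as \<open>q\<close>.\<close>

lemma initial_energy: "E 0 \<le> 4 * Ce\<^sup>2 * (b - a) * \<tau>\<^sup>2"
proof -
  have t: "0 \<in> {0..T}" using T by simp
  have cell: "integral {X (j - 1)..X j} (\<lambda>x. (poly (e 0 j) x)\<^sup>2) \<le> 4 * Ce\<^sup>2 * \<tau>\<^sup>2 * H j" if j: "j \<in> {1..N}" for j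
  proof -
    let ?I = "{X (j - 1)..X j}"
    let ?w = "\<lambda>x. D 0 0 x 0"
    let ?p = "L2proj k (X (j - 1)) (X j) ?w"
    have "u 0 j = L2proj k (X (j - 1)) (X j) w0" using sol j unfolding numerical_solution_def by blast
    also have "\<dots> = ?p" using init cell_sub[OF j] by (intro L2proj_cong) simp
    finally have u0: "u 0 j = ?p" .
    have cw: "continuous_on V ?w" for V using Dc[of 0 0 0] t by simp
    note int = integrable_continuous_interval
    have "integral ?I (\<lambda>x. (poly (e 0 j) x)\<^sup>2) \<le> integral ?I (\<lambda>x. 2 * (?w x - poly ?p x)\<^sup>2 + 2 * (?w x - poly (q 0 j) x)\<^sup>2)"
    proof (rule integral_le)
      show "(\<lambda>x. (poly (e 0 j) x)\<^sup>2) integrable_on ?I" by (intro int continuous_intros)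
      show "(\<lambda>x. 2 * (?w x - poly ?p x)\<^sup>2 + 2 * (?w x - poly (q 0 j) x)\<^sup>2) integrable_on ?I"
        by (intro int continuous_intros cw)
      show "(poly (e 0 j) x)\<^sup>2 \<le> 2 * (?w x - poly ?p x)\<^sup>2 + 2 * (?w x - poly (q 0 j) x)\<^sup>2" for x
        using square_triangle[of "poly ?p x" "poly (q 0 j) x" "?w x"] by (simp add: e_def u0)
    qed
    also have "\<dots> = 2 * integral ?I (\<lambda>x. (?w x - poly ?p x)\<^sup>2) + 2 * integral ?I (\<lambda>x. (?w x - poly (q 0 j) x)\<^sup>2)"
      by (subst integral_add, (intro int continuous_intros cw)+) simp
    also have "\<dots> \<le> 4 * integral ?I (\<lambda>x. (?w x - poly (q 0 j) x)\<^sup>2)"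
      using L2proj_best[OF cellH(4)[OF j] cw degq[OF j]] by simp
    also have "\<dots> \<le> 4 * (Ce\<^sup>2 * \<tau>\<^sup>2 * H j)" using eta_L2[OF j t] by simp
    finally show ?thesis by simp
  qed
  have "E 0 \<le> (\<Sum>j\<in>{1..N}. 4 * Ce\<^sup>2 * \<tau>\<^sup>2 * H j)" unfolding E_def by (intro sum_mono cell)
  also have "\<dots> = 4 * Ce\<^sup>2 * \<tau>\<^sup>2 * (b - a)" using mesh_nodes(5)[OF mesh] by (simp add: sum_distrib_left[symmetric])
  finally show ?thesis by (simp add: mult_ac)
qed

text \<open>Gronwall's bound is below the threshold \<open>h / (Ci * \<kappa>)\<close> of the bootstrap since \<open>\<tau>\<^sup>2 \<le> h^3\<close>.\<close>

lemma energy_bound: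
  assumes t: "t \<in> {0..T}"
  shows "E t \<le> energy_const * \<tau>\<^sup>2"
proof -
  have "\<forall>t\<in>{0..T}. \<exists>ut\<in>Vspace k N.
        (\<forall>j\<in>{1..N}. \<forall>x\<in>{X (j - 1)..X j}.
           ((\<lambda>s. poly (u s j) x) has_real_derivative poly (ut j) x) (at t within {0..T})) \<and>
        (\<forall>v\<in>Vspace k N. \<forall>j\<in>{1..N}.
           integral {X (j - 1)..X j} (\<lambda>x. poly (ut j) x * poly (v j) x)
           - integral {X (j - 1)..X j} (\<lambda>x. f (poly (u t j) x) * poly (pderiv (v j)) x)
           + flux_at bc fh N X (u t) j * poly (v j) (X j)
           - flux_at bc fh N X (u t) (j - 1) * poly (v j) (X (j - 1))
           = - sigma k \<beta> bc f fh N X S (u t) j *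
               integral {X (j - 1)..X j}
                 (\<lambda>x. (poly (u t j) x - avg (X (j - 1)) (X j) (poly (u t j))) * poly (v j) x))"
    using sol unfolding numerical_solution_def by blast
  from bchoice[OF this[unfolded Bex_def]] obtain ut where
    utV: "\<And>t. t \<in> {0..T} \<Longrightarrow> ut t \<in> Vspace k N" and
    utd: "\<And>t j x. t \<in> {0..T} \<Longrightarrow> j \<in> {1..N} \<Longrightarrow> x \<in> {X (j - 1)..X j} \<Longrightarrow>
      ((\<lambda>s. poly (u s j) x) has_real_derivative poly (ut t j) x) (at t within {0..T})" and
    uts: "\<And>t v j. t \<in> {0..T} \<Longrightarrow> v \<in> Vspace k N \<Longrightarrow> j \<in> {1..N} \<Longrightarrow>
           integral {X (j - 1)..X j} (\<lambda>x. poly (ut t j) x * poly (v j) x)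
           - integral {X (j - 1)..X j} (\<lambda>x. f (poly (u t j) x) * poly (pderiv (v j)) x)
           + flux_at bc fh N X (u t) j * poly (v j) (X j)
           - flux_at bc fh N X (u t) (j - 1) * poly (v j) (X (j - 1))
           = - sigma k \<beta> bc f fh N X S (u t) j *
               integral {X (j - 1)..X j}
                 (\<lambda>x. (poly (u t j) x - avg (X (j - 1)) (X j) (poly (u t j))) * poly (v j) x)"
    by blast
  define E' where "E' t = (\<Sum>j\<in>{1..N}. 2 * integral {X (j - 1)..X j} (\<lambda>x. poly (ut t j - qt t j) x * poly (e t j) x))" for t
  have der: "(E has_real_derivative E' t) (at t within {0..T})" if t: "t \<in> {0..T}" for t
    unfolding E_def[abs_def] E'_def
  proof (rule DERIV_sum)
    fix j assume j: "j \<in> {1..N}"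
    show "((\<lambda>s. integral {X (j - 1)..X j} (\<lambda>x. (poly (e s j) x)\<^sup>2)) has_real_derivative
        2 * integral {X (j - 1)..X j} (\<lambda>x. poly (ut t j - qt t j) x * poly (e t j) x)) (at t within {0..T})"
    proof (rule has_derivative_integral_poly_square[OF cellH(4)[OF j] t])
      show "degree (e s j) \<le> k" if "s \<in> {0..T}" for s by (rule dege[OF j that])
      show "degree (ut t j - qt t j) \<le> k"
        using utV[OF t] j by (intro degree_diff_le degq) (auto simp: Vspace_def)
      show "((\<lambda>s. poly (e s j) x) has_real_derivative poly (ut t j - qt t j) x) (at t within {0..T})"
        if x: "x \<in> {X (j - 1)..X j}" for x
        unfolding e_def poly_diff by (intro DERIV_diff utd[OF t j x] q_has_derivative[OF j x t])
    qed
  qed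
  have E0: "0 \<le> E t" for t unfolding E_def
    by (intro sum_nonneg integral_nonneg integrable_continuous_interval continuous_intros) auto
  define d where "d = source * \<tau>\<^sup>2"
  have d0: "0 \<le> d" using source0 by (simp add: d_def)
  have b1: "(E 0 + d / growth) * exp (growth * T) \<le> energy_const * \<tau>\<^sup>2"
  proof -
    have "(E 0 + d / growth) * exp (growth * T) \<le> (4 * Ce\<^sup>2 * (b - a) * \<tau>\<^sup>2 + d / growth) * exp (growth * T)"
      using initial_energy by (intro mult_right_mono add_right_mono) auto
    also have "\<dots> = energy_const * \<tau>\<^sup>2" by (simp add: energy_const_def d_def algebra_simps)
    finally show ?thesis .
  qed
  have b2: "energy_const * \<tau>\<^sup>2 < h / (Ci * \<kappa>)"
  proof -
    have "energy_const * h ^ 3 * (Ci * \<kappa>) < h"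
    proof -
      have "energy_const * h ^ 3 * (Ci * \<kappa>) = (energy_const * Ci * \<kappa> * h\<^sup>2) * h"
        by (simp add: power2_eq_square power3_eq_cube)
      also have "\<dots> < 1 * h" using small(3) h0 by (intro mult_strict_right_mono) auto
      finally show ?thesis by simp
    qed
    moreover have "0 < Ci * \<kappa>" using Ci \<kappa> by simp
    ultimately have "energy_const * h ^ 3 < h / (Ci * \<kappa>)" by (simp add: less_divide_eq)
    then show ?thesis
      using mult_left_mono[OF \<tau>(2) energy_const0] by (rule le_less_trans[rotated])
  qed
  have "E t \<le> (E 0 + d / growth) * exp (growth * T)"
  proof (rule gronwall_bootstrap[OF der _ E0 growth0 d0 _ t])
    show "E' t \<le> growth * E t + d" if "t \<in> {0..T}" "E t \<le> h / (Ci * \<kappa>)" for t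
      unfolding E'_def d_def
    proof (rule energy_rate[OF that, of "ut t"], goal_cases)
      case (1 v j)
      then show ?case by (rule uts[OF that(1), of v j])
    qed
    show "(E 0 + d / growth) * exp (growth * T) < h / (Ci * \<kappa>)" using b1 b2 by linarith
  qed
  then show ?thesis using b1 by linarith
qed

lemma error_bound:
  assumes t: "t \<in> {0..T}"
  shows "L2dist_broken N X (\<lambda>x. D 0 0 x t) (u t) \<le> sqrt (2 * Ce\<^sup>2 * (b - a) + 2 * energy_const) * \<tau>"
proof -
  have cw: "continuous_on V (\<lambda>x. D 0 0 x t)" for V using Dc[of 0 0 t] t by simp
  note int = integrable_continuous_interval
  have cell: "integral {X (j - 1)..X j} (\<lambda>x. (D 0 0 x t - poly (u t j) x)\<^sup>2)
      \<le> 2 * (Ce\<^sup>2 * \<tau>\<^sup>2 * H j) + 2 * integral {X (j - 1)..X j} (\<lambda>x. (poly (e t j) x)\<^sup>2)" if j: "j \<in> {1..N}" for j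
  proof -
    let ?I = "{X (j - 1)..X j}"
    have "integral ?I (\<lambda>x. (D 0 0 x t - poly (u t j) x)\<^sup>2)
        \<le> integral ?I (\<lambda>x. 2 * (D 0 0 x t - poly (q t j) x)\<^sup>2 + 2 * (poly (e t j) x)\<^sup>2)"
    proof (rule integral_le)
      show "(\<lambda>x. (D 0 0 x t - poly (u t j) x)\<^sup>2) integrable_on ?I" by (intro int continuous_intros cw)
      show "(\<lambda>x. 2 * (D 0 0 x t - poly (q t j) x)\<^sup>2 + 2 * (poly (e t j) x)\<^sup>2) integrable_on ?I"
        by (intro int continuous_intros cw)
      show "(D 0 0 x t - poly (u t j) x)\<^sup>2 \<le> 2 * (D 0 0 x t - poly (q t j) x)\<^sup>2 + 2 * (poly (e t j) x)\<^sup>2" for x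
        using square_triangle[of "D 0 0 x t" "poly (u t j) x" "poly (q t j) x"]
        by (simp add: e_def power2_commute)
    qed
    also have "\<dots> = 2 * integral ?I (\<lambda>x. (D 0 0 x t - poly (q t j) x)\<^sup>2) + 2 * integral ?I (\<lambda>x. (poly (e t j) x)\<^sup>2)"
      by (subst integral_add, (intro int continuous_intros cw)+) simp
    finally show ?thesis using eta_L2[OF j t] by linarith
  qed
  have "(\<Sum>j\<in>{1..N}. integral {X (j - 1)..X j} (\<lambda>x. (D 0 0 x t - poly (u t j) x)\<^sup>2))
      \<le> (\<Sum>j\<in>{1..N}. 2 * (Ce\<^sup>2 * \<tau>\<^sup>2 * H j) + 2 * integral {X (j - 1)..X j} (\<lambda>x. (poly (e t j) x)\<^sup>2))"
    by (rule sum_mono[OF cell])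
  also have "\<dots> = 2 * (Ce\<^sup>2 * \<tau>\<^sup>2 * (b - a)) + 2 * E t"
    unfolding E_def sum.distrib sum_distrib_left[symmetric] mesh_nodes(5)[OF mesh] ..
  also have "\<dots> \<le> 2 * (Ce\<^sup>2 * \<tau>\<^sup>2 * (b - a)) + 2 * (energy_const * \<tau>\<^sup>2)"
    using energy_bound[OF t] by simp
  also have "\<dots> = (2 * Ce\<^sup>2 * (b - a) + 2 * energy_const) * \<tau>\<^sup>2" by (simp add: algebra_simps)
  finally have "L2dist_broken N X (\<lambda>x. D 0 0 x t) (u t) \<le> sqrt ((2 * Ce\<^sup>2 * (b - a) + 2 * energy_const) * \<tau>\<^sup>2)"
    unfolding L2dist_broken_def by (rule real_sqrt_le_mono)
  also have "\<dots> = sqrt (2 * Ce\<^sup>2 * (b - a) + 2 * energy_const) * \<tau>"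
    using \<tau>0 by (simp add: real_sqrt_mult)
  finally show ?thesis .
qed

end

section \<open>The characteristic speed keeps its sign at a fixed point\<close>

text \<open>By means of the integrating factor \<open>exp (\<integral> c)\<close>, which lies between \<open>exp (- C T)\<close> and \<open>exp (C T)\<close>.\<close>

lemma linear_ode_sign:
  fixes g c :: "real \<Rightarrow> real"
  assumes c: "continuous_on {0..T} c" "\<And>t. t \<in> {0..T} \<Longrightarrow> \<bar>c t\<bar> \<le> C"
    and g: "\<And>t. t \<in> {0..T} \<Longrightarrow> (g has_real_derivative - c t * g t) (at t within {0..T})"
    and t: "t \<in> {0..T}"
  shows "\<exists>s. exp (- (C * T)) \<le> s \<and> s \<le> exp (C * T) \<and> g t = s * g 0"
proof -
  define I where "I t = integral {0..t} c" for t
  have C0: "0 \<le> C" using c(2)[OF t] by linarith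
  have dI: "(I has_real_derivative c r) (at r within {0..T})" if "r \<in> {0..T}" for r
    unfolding I_def by (rule integral_has_real_derivative[OF c(1) that])
  have "((\<lambda>r. g r * exp (I r)) has_real_derivative 0) (at r within {0..T})" if r: "r \<in> {0..T}" for r
  proof -
    have "((\<lambda>r. exp (I r)) has_real_derivative exp (I r) * c r) (at r within {0..T})"
      by (rule DERIV_chain'[OF dI[OF r] DERIV_exp])
    from DERIV_mult[OF g[OF r] this] show ?thesis by (simp add: mult_ac)
  qed
  then obtain y where y: "\<And>r. r \<in> {0..T} \<Longrightarrow> g r * exp (I r) = y"
    using has_field_derivative_zero_constant[of "{0..T}" "\<lambda>r. g r * exp (I r)"] by auto
  have "g t * exp (I t) = g 0 * exp (I 0)" using y[OF t] y[of 0] t by simp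
  then have gt: "g t = exp (- I t) * g 0" by (simp add: I_def exp_minus field_simps)
  have "\<bar>I t\<bar> \<le> C * (t - 0)"
    unfolding I_def using t c by (intro abs_integral_le_sup) (auto intro: continuous_on_subset)
  also have "\<dots> \<le> C * T" using t C0 by (intro mult_left_mono) auto
  finally have "- (C * T) \<le> - I t" "- I t \<le> C * T" by linarith+
  then show ?thesis using gt by (intro exI[of _ "exp (- I t)"]) auto
qed

section \<open>Existence of the constants\<close>

lemma flux_lipschitz:
  assumes "numerical_flux f fh"
  shows "\<exists>L\<ge>0. \<forall>x y x' y'. x \<in> {- R..R} \<longrightarrow> y \<in> {- R..R} \<longrightarrow> x' \<in> {- R..R} \<longrightarrow> y' \<in> {- R..R} \<longrightarrow>
    \<bar>fh x y - fh x' y'\<bar> \<le> L * (\<bar>x - x'\<bar> + \<bar>y - y'\<bar>)"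
proof -
  obtain L where L: "L-lipschitz_on ({- R..R} \<times> {- R..R}) (\<lambda>(ul, ur). fh ul ur)"
    using assms unfolding numerical_flux_def by blast
  have L0: "0 \<le> L" by (rule lipschitz_on_nonneg[OF L])
  have "\<bar>fh x y - fh x' y'\<bar> \<le> L * (\<bar>x - x'\<bar> + \<bar>y - y'\<bar>)"
    if "x \<in> {- R..R}" "y \<in> {- R..R}" "x' \<in> {- R..R}" "y' \<in> {- R..R}" for x y x' y'
  proof -
    have "\<bar>fh x y - fh x' y'\<bar> \<le> L * dist (x, y) (x', y')"
      using lipschitz_onD[OF L, of "(x, y)" "(x', y')"] that by (simp add: dist_real_def)
    also have "dist (x, y) (x', y') \<le> \<bar>x - x'\<bar> + \<bar>y - y'\<bar>"
      unfolding dist_Pair_Pair dist_real_def using sqrt_sum_squares_le_sum_abs[of "\<bar>x - x'\<bar>" "\<bar>y - y'\<bar>"] by simp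
    finally show ?thesis using L0 by (simp add: mult_left_mono)
  qed
  then show ?thesis using L0 by blast
qed

lemma lipschitz_from_derivative_bound:
  fixes g :: "real \<Rightarrow> real"
  assumes "\<And>x. (g has_real_derivative g' x) (at x)" "\<And>x. x \<in> {- R..R} \<Longrightarrow> \<bar>g' x\<bar> \<le> L"
    and "x \<in> {- R..R}" "y \<in> {- R..R}"
  shows "\<bar>g x - g y\<bar> \<le> L * \<bar>x - y\<bar>"
proof -
  obtain \<xi> where \<xi>: "\<xi> \<in> closed_segment y x" "g x - g y = (x - y) * g' \<xi>"
    using mvt_segment[of y x g g'] assms(1) by blast
  have "\<bar>g' \<xi>\<bar> \<le> L" using assms(2) segment_subset_interval[OF assms(4,3) \<xi>(1)] by blast
  then show ?thesis unfolding \<xi>(2) abs_mult by (simp add: mult.commute mult_right_mono)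
qed

text \<open>The constants do not depend on \<open>\<kappa>\<close>, \<open>A\<close>, \<open>B\<close>, which can therefore be chosen afterwards in terms of
  them.\<close>

lemma dg_constants_exist:
  assumes k: "1 \<le> k" and \<beta>: "beta_admissible k \<beta>" and ab: "a < b" "0 < T" and f: "C_class (k + 4) f"
    and S: "scheme_admissible k S" and num: "numerical_flux f fh" and M: "0 \<le> M" and R: "R = M + 2"
  shows "\<exists>L Ci Cp Ce Cs K \<Phi>.
    (\<forall>x\<in>{- R..R}. (\<Phi> has_real_derivative f x) (at x)) \<and>
    (\<forall>x\<in>{- R..R}. \<forall>y\<in>{- R..R}. \<bar>f x - f y\<bar> \<le> L * \<bar>x - y\<bar>) \<and>
    (\<forall>x\<in>{- R..R}. \<bar>(deriv ^^ 2) f x\<bar> \<le> L) \<and>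
    (\<forall>x y x' y'. x \<in> {- R..R} \<longrightarrow> y \<in> {- R..R} \<longrightarrow> x' \<in> {- R..R} \<longrightarrow>
      y' \<in> {- R..R} \<longrightarrow> \<bar>fh x y - fh x' y'\<bar> \<le> L * (\<bar>x - x'\<bar> + \<bar>y - y'\<bar>)) \<and>
    (\<forall>a b exl exr. a < b \<longrightarrow> (\<exists>Q. cell_projector k Cp a b exl exr Q)) \<and>
    (\<forall>\<kappa>>0. \<forall>A\<ge>0. \<forall>B\<ge>0. dg_constants k (k + 4) \<beta> a b T \<kappa> f fh S M R L Ci Cp Ce Cs A B K \<Phi>)"
proof -
  obtain L1 where L1: "L1 \<ge> 0" "\<And>x y x' y'. x \<in> {- R..R} \<Longrightarrow> y \<in> {- R..R} \<Longrightarrow> x' \<in> {- R..R} \<Longrightarrow> y' \<in> {- R..R} \<Longrightarrow>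
    \<bar>fh x y - fh x' y'\<bar> \<le> L1 * (\<bar>x - x'\<bar> + \<bar>y - y'\<bar>)"
    using flux_lipschitz[OF num, of R] by blast
  obtain G where G: "G \<ge> 0" "\<And>i x. i \<le> k + 4 \<Longrightarrow> x \<in> {- R..R} \<Longrightarrow> \<bar>(deriv ^^ i) f x\<bar> \<le> G"
    using C_class_bounded[OF f, of R] by blast
  define L where "L = L1 + G"
  have L: "0 \<le> L" "L1 \<le> L" "G \<le> L" using L1 G by (auto simp: L_def)
  have fder: "((deriv ^^ i) f has_real_derivative (deriv ^^ Suc i) f x) (at x)" if "i < k + 4" for i x
    by (rule C_class_derivative[OF f that])
  have fL: "\<bar>(deriv ^^ i) f x - (deriv ^^ i) f y\<bar> \<le> L * \<bar>x - y\<bar>"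
    if "i < k + 4" "x \<in> {- R..R}" "y \<in> {- R..R}" for i x y
    by (rule lipschitz_from_derivative_bound[OF fder _ that(2,3)]) (use that G(2)[of "Suc i"] L in \<open>auto intro: order_trans\<close>)
  have fhL: "\<bar>fh x y - fh x' y'\<bar> \<le> L * (\<bar>x - x'\<bar> + \<bar>y - y'\<bar>)"
    if "x \<in> {- R..R}" "y \<in> {- R..R}" "x' \<in> {- R..R}" "y' \<in> {- R..R}" for x y x' y'
  proof -
    have "L1 * (\<bar>x - x'\<bar> + \<bar>y - y'\<bar>) \<le> L * (\<bar>x - x'\<bar> + \<bar>y - y'\<bar>)" using L by (intro mult_right_mono) auto
    then show ?thesis using L1(2)[OF that] by linarith
  qed
  have cf: "continuous_on UNIV f" using C_class_continuous[OF f, of 0] by simp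
  obtain \<Phi> where \<Phi>: "\<forall>x\<in>{- R..R}. (\<Phi> has_real_derivative f x) (at x)"
    using continuous_antiderivative[OF cf, of R] by blast
  obtain C where C: "C \<ge> 1" "\<And>a b. a < b \<Longrightarrow> \<exists>\<phi>. cell_basis k C a b \<phi>"
    using cell_basis_exists[of k] by blast
  define Ci where "Ci = (C * (real k + 1))\<^sup>2"
  have "1 \<le> C * (real k + 1)" using mult_mono[of 1 C 1 "real k + 1"] C(1) by simp
  then have Ci: "1 \<le> Ci" unfolding Ci_def by (rule one_le_power)
  have inv1: "(poly p x)\<^sup>2 \<le> Ci / (d - c) * integral {c..d} (\<lambda>x. (poly p x)\<^sup>2)"
    if cd: "c < d" "degree p \<le> k" "x \<in> {c..d}" for c d p x
  proof -
    obtain \<phi> where "cell_basis k C c d \<phi>" using C(2)[OF cd(1)] by blast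
    from cell_basis_sup_inverse(1)[OF this cd(1) C(1) cd(2,3)] show ?thesis by (simp add: Ci_def add.commute)
  qed
  have inv2: "\<bar>poly (pderiv p) x\<bar> \<le> Ci * E / (d - c)"
    if cd: "c < d" "degree p \<le> k" "\<And>x. x \<in> {c..d} \<Longrightarrow> \<bar>poly p x\<bar> \<le> E" "x \<in> {c..d}" for c d p E x
  proof -
    obtain \<phi> where "cell_basis k C c d \<phi>" using C(2)[OF cd(1)] by blast
    from cell_basis_sup_inverse(2)[OF this cd(1) C(1) cd(2,4,3)]
    have "\<bar>poly (pderiv p) x\<bar> \<le> C\<^sup>2 * (real k + 1) * E / (d - c)" by (simp add: add.commute)
    also have "\<dots> \<le> Ci * E / (d - c)"
    proof (intro divide_right_mono mult_right_mono)
      have "C\<^sup>2 * (real k + 1) * 1 \<le> C\<^sup>2 * (real k + 1) * (real k + 1)" by (intro mult_left_mono) auto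
      then show "C\<^sup>2 * (real k + 1) \<le> Ci" by (simp add: Ci_def power_mult_distrib power2_eq_square mult_ac)
      show "0 \<le> E" using cd(3)[OF cd(4)] by linarith
    qed (use cd in simp)
    finally show ?thesis .
  qed
  obtain Cp where Cp: "Cp \<ge> 1" "\<forall>a b exl exr. a < b \<longrightarrow> (\<exists>Q. cell_projector k Cp a b exl exr Q)"
    using cell_projector_exists[OF k] by blast
  define Ce where "Ce = (1 + Cp) * M"
  define Kj where "Kj = (\<lambda>j. (real k + 1) * M + Ci ^ j * (1 + (Ce + M)))"
  define K where "K = (\<Sum>r\<in>{k + 1, k + 2}. \<bar>\<Sum>i\<le>r. G * chain_scaling Kj r i 0\<bar>)"
  have K0: "0 \<le> K" unfolding K_def by (intro sum_nonneg) auto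
  have K: "\<bar>(deriv ^^ r) (\<lambda>y. f (poly p y)) x\<bar> \<le> K * (1 + \<epsilon> / H ^ r)"
    if H: "0 < H" "H \<le> 1" and \<epsilon>: "0 \<le> \<epsilon>" "\<epsilon> \<le> 1" and p: "poly_scaling x H \<epsilon> p 0 Kj" "poly p x \<in> {- R..R}"
      and r: "r \<in> {k + 1, k + 2}" for x H \<epsilon> p r
  proof -
    have "\<bar>(deriv ^^ r) (\<lambda>y. f (poly p y)) x\<bar> \<le> (\<Sum>i\<le>r. G * chain_scaling Kj r i 0) * (1 + \<epsilon> / H ^ r)"
      using r G(2) p(2) by (intro higher_deriv_comp_poly_bound[OF f _ H \<epsilon> p(1)]) auto
    also have "\<dots> \<le> K * (1 + \<epsilon> / H ^ r)"
    proof (rule mult_right_mono)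
      have "(\<Sum>i\<le>r. G * chain_scaling Kj r i 0) \<le> \<bar>\<Sum>i\<le>r. G * chain_scaling Kj r i 0\<bar>" by simp
      also have "\<dots> \<le> K" unfolding K_def by (rule member_le_sum[OF r]) auto
      finally show "(\<Sum>i\<le>r. G * chain_scaling Kj r i 0) \<le> K" .
    qed (use H \<epsilon> in simp)
    finally show ?thesis .
  qed
  have cons: "fh z z = f z" for z using num unfolding numerical_flux_def by blast
  have km: "k + 2 \<le> k + 4" by simp
  obtain Cs where Cs: "0 \<le> Cs" "damping_bound k \<beta> f fh S R K Cs"
    using sigma_bound[OF k \<beta> f km S L(1) cons fhL K0] by blast
  have f1L: "\<bar>deriv f x - deriv f y\<bar> \<le> L * \<bar>x - y\<bar>" if "x \<in> {- R..R}" "y \<in> {- R..R}" for x y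
    using fL[of 1 x y] that by simp
  have Cp0: "0 \<le> Cp" using Cp(1) by simp
  have dg: "dg_constants k (k + 4) \<beta> a b T \<kappa> f fh S M R L Ci Cp Ce Cs A B K \<Phi>"
    if "0 < \<kappa>" "0 \<le> A" "0 \<le> B" for \<kappa> A B
    by (rule dg_constants.intro[OF k ab that(1) f order_refl L(1) f1L \<Phi>[rule_format] R M Cp0 Ce_def Ci inv1 inv2
          K[unfolded Kj_def] Cs that(2,3)])
  have f2: "\<bar>(deriv ^^ 2) f x\<bar> \<le> L" if "x \<in> {- R..R}" for x
    using G(2)[of 2 x] that L(3) by simp
  have f0: "\<bar>f x - f y\<bar> \<le> L * \<bar>x - y\<bar>" if "x \<in> {- R..R}" "y \<in> {- R..R}" for x y
    using fL[of 0 x y] that by simp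
  show ?thesis
  proof (rule exI[of _ L], rule exI[of _ Ci], rule exI[of _ Cp], rule exI[of _ Ce], rule exI[of _ Cs],
      rule exI[of _ K], rule exI[of _ \<Phi>], intro conjI)
    show "\<forall>x\<in>{- R..R}. (\<Phi> has_real_derivative f x) (at x)" by (rule \<Phi>)
    show "\<forall>x\<in>{- R..R}. \<forall>y\<in>{- R..R}. \<bar>f x - f y\<bar> \<le> L * \<bar>x - y\<bar>" by (intro ballI f0)
    show "\<forall>x\<in>{- R..R}. \<bar>(deriv ^^ 2) f x\<bar> \<le> L" by (intro ballI f2)
    show "\<forall>x y x' y'. x \<in> {- R..R} \<longrightarrow> y \<in> {- R..R} \<longrightarrow> x' \<in> {- R..R} \<longrightarrow>
      y' \<in> {- R..R} \<longrightarrow> \<bar>fh x y - fh x' y'\<bar> \<le> L * (\<bar>x - x'\<bar> + \<bar>y - y'\<bar>)" by (intro allI impI fhL)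
    show "\<forall>a b exl exr. a < b \<longrightarrow> (\<exists>Q. cell_projector k Cp a b exl exr Q)" by (rule Cp(2))
    show "\<forall>\<kappa>>0. \<forall>A\<ge>0. \<forall>B\<ge>0. dg_constants k (k + 4) \<beta> a b T \<kappa> f fh S M R L Ci Cp Ce Cs A B K \<Phi>"
      by (intro allI impI dg)
  qed
qed

section \<open>The exact solution\<close>

lemma smooth_tower_mono:
  assumes "smooth_tower m a b T M D" "n \<le> m"
  shows "smooth_tower n a b T M D"
  using assms unfolding smooth_tower_def by (meson less_le_trans order_trans)

text \<open>The derivatives that express smoothness of the exact solution satisfy the differential equation in
  the form \<open>w_t = - f'(w) w_x\<close>, because derivatives are unique.\<close>

lemma exact_solution_tower:
  assumes T: "0 < T" and sm: "smooth_with_bound m a b T M w" and m: "2 \<le> m"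
    and ex: "exact_solution bc f a b T w0 w" and f: "\<And>x. (f has_real_derivative deriv f x) (at x)"
    and ab: "a < b"
  shows "\<exists>D. smooth_tower m a b T M D \<and> (\<forall>x. \<forall>t\<in>{0..T}. D 0 0 x t = w x t) \<and>
    (\<forall>x. \<forall>t\<in>{0..T}. D 0 1 x t = - deriv f (D 0 0 x t) * D 1 0 x t) \<and>
    (\<forall>t\<in>{0..T}. (bc = Periodic \<and> D 0 0 a t = D 0 0 b t) \<or> (bc = Compact_support \<and> D 0 0 a t = 0 \<and> D 0 0 b t = 0)) \<and>
    (\<forall>x\<in>{a..b}. D 0 0 x 0 = w0 x)"
proof -
  from sm obtain D where D: "\<forall>x. \<forall>t\<in>{0..T}. D 0 0 x t = w x t" "smooth_tower m a b T M D"
    unfolding smooth_with_bound_def smooth_tower_def by blast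
  have dx: "((\<lambda>y. D 0 0 y t) has_real_derivative D 1 0 x t) (at x)"
    and dt: "((\<lambda>s. D 0 0 x s) has_real_derivative D 0 1 x t) (at t within {0..T})" if "t \<in> {0..T}" for x t
    using D(2) that m unfolding smooth_tower_def by auto
  have pde: "D 0 1 x t = - deriv f (D 0 0 x t) * D 1 0 x t" if t: "t \<in> {0..T}" for x t
  proof -
    from ex t obtain fx where fx: "((\<lambda>y. f (w y t)) has_real_derivative fx) (at x)"
      "((\<lambda>s. w x s) has_real_derivative (- fx)) (at t within {0..T})"
      unfolding exact_solution_def by blast
    have w: "(\<lambda>y. f (w y t)) = (\<lambda>y. f (D 0 0 y t))" using D(1) t by auto
    have "((\<lambda>y. f (D 0 0 y t)) has_real_derivative deriv f (D 0 0 x t) * D 1 0 x t) (at x)"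
      by (rule DERIV_chain2[OF f dx[OF t]])
    then have e: "fx = deriv f (D 0 0 x t) * D 1 0 x t" using fx(1) unfolding w by (rule DERIV_unique[rotated])
    have "((\<lambda>s. D 0 0 x s) has_real_derivative (- fx)) (at t within {0..T})"
      by (rule has_field_derivative_transform_within[OF fx(2) zero_less_one t]) (use D(1) in auto)
    then have "D 0 1 x t = - fx"
      using vector_derivative_unique_within_closed_interval[OF T, of t "\<lambda>s. D 0 0 x s" "D 0 1 x t" "- fx"] dt[OF t, of x] t
      by (auto simp: has_real_derivative_iff_has_vector_derivative)
    then show ?thesis using e by simp
  qed
  have bcw: "boundary_condition bc a b T w" using ex unfolding exact_solution_def by blast
  have bcs: "(bc = Periodic \<and> D 0 0 a t = D 0 0 b t) \<or> (bc = Compact_support \<and> D 0 0 a t = 0 \<and> D 0 0 b t = 0)"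
    if t: "t \<in> {0..T}" for t
  proof (cases bc)
    case Periodic
    then have "\<forall>t\<in>{0..T}. \<forall>x. w (x + (b - a)) t = w x t" using bcw by simp
    from this[rule_format, OF t, of a] have "w b t = w a t" by simp
    then show ?thesis using Periodic D(1) t by simp
  next
    case Compact_support
    then have "closure {x. w x t \<noteq> 0} \<subseteq> {a<..<b}" using bcw t by auto
    then have "{x. w x t \<noteq> 0} \<subseteq> {a<..<b}" by (rule order_trans[OF closure_subset])
    then have "w a t = 0" "w b t = 0" by auto
    then show ?thesis using Compact_support D(1) t by simp
  qed
  have "\<forall>x\<in>{a..b}. D 0 0 x 0 = w0 x" using D(1) ex T unfolding exact_solution_def by auto
  then show ?thesis
    using D(1) by (intro exI[of _ D] conjI D(2) allI ballI pde bcs) auto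
qed

section \<open>The error estimates for monotone and upwind fluxes\<close>

context dg_constants
begin

lemma small_mesh:
  "\<exists>h1>0. \<forall>h. 0 < h \<longrightarrow> h \<le> h1 \<longrightarrow> h \<le> 1 \<and> Ce * h \<le> 1 \<and> energy_const * Ci * \<kappa> * h\<^sup>2 < 1"
proof -
  define Y where "Y = energy_const * Ci * \<kappa>"
  have Y0: "0 \<le> Y" using energy_const0 Ci \<kappa> by (simp add: Y_def)
  define h1 where "h1 = 1 / (1 + Ce + Y)"
  have h1: "0 < h1" using Ce0 Y0 by (simp add: h1_def)
  have "h \<le> 1 \<and> Ce * h \<le> 1 \<and> Y * h\<^sup>2 < 1" if h: "0 < h" "h \<le> h1" for h
  proof -
    have s: "h + Ce * h + Y * h \<le> 1"
    proof -
      have "(1 + Ce + Y) * h \<le> (1 + Ce + Y) * h1" using h Ce0 Y0 by (intro mult_left_mono) auto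
      also have "\<dots> = 1" using Ce0 Y0 by (simp add: h1_def)
      finally show ?thesis by (simp add: algebra_simps)
    qed
    have p: "0 \<le> Ce * h" "0 \<le> Y * h" using Ce0 Y0 h by auto
    have "Y * h\<^sup>2 = Y * h * h" by (simp add: power2_eq_square)
    also have "\<dots> \<le> Y * h * 1" using p s by (intro mult_left_mono) auto
    also have "\<dots> < 1" using s p h by linarith
    finally show ?thesis using s p h by auto
  qed
  then show ?thesis using h1 unfolding Y_def by blast
qed

end

text \<open>All cells use the Gauss-Radau projection that is exact at the right end; any fixed choice would do.
  The node estimate loses \<open>\<eta>\<^sup>2 = O(h^(2k+2))\<close> per node, which is \<open>h \<tau>\<^sup>2\<close> for
  \<open>\<tau> = h^(k+1/2)\<close>.\<close>

lemma monotone_error: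
  assumes k: "1 \<le> k" and \<beta>: "beta_admissible k \<beta>" and ab: "a < b" "0 < T" and f: "C_class (k + 4) f"
    and S: "scheme_admissible k S" and mono: "monotone_flux f fh" and M: "0 \<le> M" and \<kappa>: "0 < \<kappa>"
  shows "\<exists>C>0. \<exists>h0>0. \<forall>w0 w N X u.
      exact_solution bc f a b T w0 w \<longrightarrow> smooth_with_bound (k + 4) a b T M w \<longrightarrow>
      is_mesh a b N X \<longrightarrow> quasi_uniform \<kappa> N X \<longrightarrow> mesh_size N X \<le> h0 \<longrightarrow>
      numerical_solution k \<beta> bc f fh S T N X w0 u \<longrightarrow>
      (\<forall>t\<in>{0..T}. L2dist_broken N X (\<lambda>x. w x t) (u t) \<le> C * mesh_size N X powr (real k + 1 / 2))"
proof -
  have num: "numerical_flux f fh" using mono by (simp add: monotone_flux_def)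
  define R where "R = M + 2"
  from dg_constants_exist[OF k \<beta> ab f S num M R_def]
  obtain L Ci Cp Ce Cs K \<Phi> where
    \<Phi>: "\<forall>x\<in>{- R..R}. (\<Phi> has_real_derivative f x) (at x)" and
    fL: "\<forall>x\<in>{- R..R}. \<forall>y\<in>{- R..R}. \<bar>f x - f y\<bar> \<le> L * \<bar>x - y\<bar>" and
    fhL: "\<forall>x y x' y'. x \<in> {- R..R} \<longrightarrow> y \<in> {- R..R} \<longrightarrow> x' \<in> {- R..R} \<longrightarrow>
      y' \<in> {- R..R} \<longrightarrow> \<bar>fh x y - fh x' y'\<bar> \<le> L * (\<bar>x - x'\<bar> + \<bar>y - y'\<bar>)" and
    Qex: "\<forall>a b exl exr. a < b \<longrightarrow> (\<exists>Q. cell_projector k Cp a b exl exr Q)" and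
    dg: "\<forall>\<kappa>>0. \<forall>A\<ge>0. \<forall>B\<ge>0. dg_constants k (k + 4) \<beta> a b T \<kappa> f fh S M R L Ci Cp Ce Cs A B K \<Phi>"
    by (elim exE conjE) (rule that)
  have "dg_constants k (k + 4) \<beta> a b T \<kappa> f fh S M R L Ci Cp Ce Cs 0 0 K \<Phi>" using dg \<kappa> by simp
  then have L0: "0 \<le> L" by (rule dg_constants.L0)
  define B where "B = 40 * L * Ce\<^sup>2"
  have B0: "0 \<le> B" using L0 by (simp add: B_def)
  interpret c: dg_constants k "k + 4" \<beta> a b T \<kappa> f fh S M R L Ci Cp Ce Cs 0 B K \<Phi>
    using dg \<kappa> B0 by simp
  obtain h0 where h0: "0 < h0" "\<And>h. 0 < h \<Longrightarrow> h \<le> h0 \<Longrightarrow> h \<le> 1 \<and> Ce * h \<le> 1 \<and> c.energy_const * Ci * \<kappa> * h\<^sup>2 < 1"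
    using c.small_mesh by blast
  define C where "C = sqrt (2 * Ce\<^sup>2 * (b - a) + 2 * c.energy_const) + 1"
  have sq0: "0 \<le> sqrt (2 * Ce\<^sup>2 * (b - a) + 2 * c.energy_const)"
    using c.energy_const0 ab by simp
  have C0: "0 < C" using sq0 unfolding C_def by linarith
  show ?thesis
  proof (rule exI[of _ C], intro conjI C0, rule exI[of _ h0], intro conjI h0(1) allI impI ballI)
    fix w0 w N X u t
    assume ex: "exact_solution bc f a b T w0 w" and sm: "smooth_with_bound (k + 4) a b T M w"
      and mesh: "is_mesh a b N X" and quasi: "quasi_uniform \<kappa> N X" and hs: "mesh_size N X \<le> h0"
      and sol: "numerical_solution k \<beta> bc f fh S T N X w0 u" and t: "t \<in> {0..T}"
    define h where "h = mesh_size N X"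
    define \<tau> where "\<tau> = h powr (real k + 1 / 2)"
    have N1: "1 \<le> N" using mesh by (simp add: is_mesh_def)
    have h: "0 < h" using mesh_size_bounds(3)[OF mesh quasi, of 1] N1 by (simp add: h_def)
    have small: "h \<le> 1" "Ce * h \<le> 1" "c.energy_const * Ci * \<kappa> * h\<^sup>2 < 1"
      using h0(2)[OF h] hs by (auto simp: h_def)
    have f': "(f has_real_derivative deriv f x) (at x)" for x
      using C_class_derivative[OF f, of 0] by simp
    obtain D where D: "smooth_tower (k + 4) a b T M D" "\<forall>x. \<forall>t\<in>{0..T}. D 0 0 x t = w x t"
      "\<forall>x. \<forall>t\<in>{0..T}. D 0 1 x t = - deriv f (D 0 0 x t) * D 1 0 x t"
      "\<forall>t\<in>{0..T}. (bc = Periodic \<and> D 0 0 a t = D 0 0 b t) \<or> (bc = Compact_support \<and> D 0 0 a t = 0 \<and> D 0 0 b t = 0)"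
      "\<forall>x\<in>{a..b}. D 0 0 x 0 = w0 x"
      using exact_solution_tower[OF ab(2) sm _ ex f' ab(1)] by auto
    have "\<forall>j\<in>{1..N}. \<exists>Qj. cell_projector k Cp (X (j - 1)) (X j) False True Qj"
      using Qex mesh unfolding is_mesh_def by blast
    from bchoice[OF this] obtain Q where Q: "\<forall>j\<in>{1..N}. cell_projector k Cp (X (j - 1)) (X j) False True (Q j)"
      by blast
    have \<tau>2: "\<tau>\<^sup>2 = h ^ (2 * k + 1)"
    proof -
      have "\<tau>\<^sup>2 = h powr (real (2 * k + 1))"
        unfolding \<tau>_def power2_eq_square by (simp add: powr_add[symmetric] add.commute)
      also have "\<dots> = h ^ (2 * k + 1)" using h by (rule powr_realpow)
      finally show ?thesis .
    qed
    have sq: "h * \<tau>\<^sup>2 = (h ^ (k + 1))\<^sup>2"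
    proof -
      have "Suc (2 * k + 1) = (k + 1) * 2" by simp
      then show ?thesis unfolding \<tau>2 by (metis power_Suc power_mult)
    qed
    have r: "dg_run k (k + 4) \<beta> a b T \<kappa> f fh S M R L Ci Cp Ce Cs 0 B K \<Phi> bc D N X w0 u Q (\<lambda>_. False) (\<lambda>_. True) \<tau> h"
    proof (rule dg_run.intro[OF c.dg_constants_axioms], rule dg_run_axioms.intro)
      show "smooth_tower (k + 2) a b T M D" by (rule smooth_tower_mono[OF D(1)]) simp
      show "D 0 1 x t = - deriv f (D 0 0 x t) * D 1 0 x t" if "t \<in> {0..T}" for x t using D(3) that by blast
      show "(bc = Periodic \<and> D 0 0 a t = D 0 0 b t) \<or> (bc = Compact_support \<and> D 0 0 a t = 0 \<and> D 0 0 b t = 0)"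
        if "t \<in> {0..T}" for t using D(4) that by blast
      show "D 0 0 x 0 = w0 x" if "x \<in> {a..b}" for x using D(5) that by blast
      show "cell_projector k Cp (X (j - 1)) (X j) False True (Q j)" if "j \<in> {1..N}" for j using Q that by blast
      show "h ^ (k + 1) \<le> \<tau>"
      proof -
        have "h powr (real (k + 1)) \<le> h powr (real k + 1 / 2)"
          using h small(1) by (intro powr_mono') auto
        then show ?thesis using powr_realpow[OF h, of "k + 1"] by (simp add: \<tau>_def)
      qed
      show "\<tau>\<^sup>2 \<le> h ^ 3" unfolding \<tau>2 using k h small(1) by (intro power_decreasing) auto
      fix t :: real and i :: nat and e1 e2 \<eta>1 \<eta>2 :: real
      assume t: "t \<in> {0..T}" and i: "i \<le> N" and e: "\<bar>e1\<bar> \<le> 1" "\<bar>e2\<bar> \<le> 1"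
        and \<eta>: "\<bar>\<eta>1\<bar> \<le> Ce * h ^ (k + 1)" "\<bar>\<eta>2\<bar> \<le> Ce * h ^ (k + 1)"
      let ?w = "D 0 0 (X i) t"
      have w: "\<bar>?w\<bar> \<le> M"
        using D(1) t mesh_nodes(2)[OF mesh i] unfolding smooth_tower_def by simp
      have "Ce * h ^ (k + 1) \<le> Ce * h ^ 1"
        using c.Ce0 h small(1) by (intro mult_left_mono power_decreasing) auto
      then have \<eta>1: "\<bar>\<eta>1\<bar> \<le> 1" "\<bar>\<eta>2\<bar> \<le> 1" using \<eta> small(2) by auto
      have "fh (?w + e1 - \<eta>1) (?w + e2 - \<eta>2) * ((?w + e2) - (?w + e1)) - (\<Phi> (?w + e2) - \<Phi> (?w + e1))
          \<le> 40 * L * (Ce * h ^ (k + 1))\<^sup>2"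
        using w e \<eta> \<eta>1 \<Phi> fL fhL L0 by (intro monotone_flux_node[OF mono, of R]) (auto simp: R_def abs_le_iff)
      also have "\<dots> = B * h * \<tau>\<^sup>2" unfolding B_def power_mult_distrib sq[symmetric] by simp
      also have "\<dots> \<le> B * h * (e1\<^sup>2 + e2\<^sup>2 + \<tau>\<^sup>2)" using B0 h by (intro mult_left_mono) auto
      finally show "fh (?w + e1 - \<eta>1) (?w + e2 - \<eta>2) * (e2 - e1) - (\<Phi> (?w + e2) - \<Phi> (?w + e1))
          \<le> B * h * (e1\<^sup>2 + e2\<^sup>2 + \<tau>\<^sup>2)" by simp
    qed (use mesh quasi sol small h_def in auto)
    have "L2dist_broken N X (\<lambda>x. w x t) (u t) = L2dist_broken N X (\<lambda>x. D 0 0 x t) (u t)"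
      using D(2) t by simp
    also have "\<dots> \<le> sqrt (2 * Ce\<^sup>2 * (b - a) + 2 * c.energy_const) * \<tau>"
      by (rule dg_run.error_bound[OF r t])
    also have "\<dots> \<le> C * \<tau>" unfolding C_def by (intro mult_right_mono) (auto simp: \<tau>_def)
    finally show "L2dist_broken N X (\<lambda>x. w x t) (u t) \<le> C * mesh_size N X powr (real k + 1 / 2)"
      by (simp add: \<tau>_def h_def)
  qed
qed

text \<open>Here \<open>\<tau> = h^(k+1)\<close>. The speed \<open>g x t = f'(w x t)\<close> is determined by its initial value up to a factor
  between \<open>1 / \<Lambda>\<close> and \<open>\<Lambda>\<close>, and the initial speed varies by at most \<open>Kn h\<close> over a cell. The projection on
  a cell is exact at the right end unless the initial speed at that end is below \<open>- 2 Kn h\<close>, and exact at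
  the left end unless it is above \<open>2 Kn h\<close>. So, on cells with a projection exact at both ends, the
  speed is \<open>O(h)\<close> at all times. At a node with initial speed above \<open>Kn h\<close> the left trace is exact, at one
  with initial speed below \<open>- Kn h\<close> the right trace is exact, and otherwise both are. The gap between
  \<open>Kn h\<close> and \<open>2 Kn h\<close> is needed since the speed at the node is compared with that at the right end of
  the next cell.\<close>

lemma upwind_error:
  assumes k: "1 \<le> k" and \<beta>: "beta_admissible k \<beta>" and ab: "a < b" "0 < T" and f: "C_class (k + 4) f"
    and S: "scheme_admissible k S" and up: "upwind_flux f fh" and M: "0 \<le> M" and \<kappa>: "0 < \<kappa>"
  shows "\<exists>C>0. \<exists>h0>0. \<forall>w0 w N X u.
      exact_solution bc f a b T w0 w \<longrightarrow> smooth_with_bound (k + 4) a b T M w \<longrightarrow>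
      is_mesh a b N X \<longrightarrow> quasi_uniform \<kappa> N X \<longrightarrow> mesh_size N X \<le> h0 \<longrightarrow>
      numerical_solution k \<beta> bc f fh S T N X w0 u \<longrightarrow>
      (\<forall>t\<in>{0..T}. L2dist_broken N X (\<lambda>x. w x t) (u t) \<le> C * mesh_size N X ^ (k + 1))"
proof -
  have num: "numerical_flux f fh" using up by (simp add: upwind_flux_def monotone_flux_def)
  define R where "R = M + 2"
  from dg_constants_exist[OF k \<beta> ab f S num M R_def]
  obtain L Ci Cp Ce Cs K \<Phi> where
    \<Phi>: "\<forall>x\<in>{- R..R}. (\<Phi> has_real_derivative f x) (at x)" and
    fL: "\<forall>x\<in>{- R..R}. \<forall>y\<in>{- R..R}. \<bar>f x - f y\<bar> \<le> L * \<bar>x - y\<bar>" and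
    f2: "\<forall>x\<in>{- R..R}. \<bar>(deriv ^^ 2) f x\<bar> \<le> L" and
    fhL: "\<forall>x y x' y'. x \<in> {- R..R} \<longrightarrow> y \<in> {- R..R} \<longrightarrow> x' \<in> {- R..R} \<longrightarrow>
      y' \<in> {- R..R} \<longrightarrow> \<bar>fh x y - fh x' y'\<bar> \<le> L * (\<bar>x - x'\<bar> + \<bar>y - y'\<bar>)" and
    Qex: "\<forall>a b exl exr. a < b \<longrightarrow> (\<exists>Q. cell_projector k Cp a b exl exr Q)" and
    dg: "\<forall>\<kappa>>0. \<forall>A\<ge>0. \<forall>B\<ge>0. dg_constants k (k + 4) \<beta> a b T \<kappa> f fh S M R L Ci Cp Ce Cs A B K \<Phi>"
    by (elim exE conjE) (rule that)
  have f': "(f has_real_derivative deriv f x) (at x)" for x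
    using C_class_derivative[OF f, of 0] by simp
  have f'': "(deriv f has_real_derivative (deriv ^^ 2) f x) (at x)" for x
    using C_class_derivative[OF f, of 1] by (simp add: numeral_2_eq_2)
  have cf'': "continuous_on UNIV ((deriv ^^ 2) f)" using C_class_continuous[OF f, of 2] by simp
  have "dg_constants k (k + 4) \<beta> a b T \<kappa> f fh S M R L Ci Cp Ce Cs 0 0 K \<Phi>" using dg \<kappa> by simp
  then interpret c0: dg_constants k "k + 4" \<beta> a b T \<kappa> f fh S M R L Ci Cp Ce Cs 0 0 K \<Phi> .
  note L0 = c0.L0 and Ce0 = c0.Ce0 and f'L = c0.f1L
  define \<Lambda> where "\<Lambda> = exp (L * M * T)"
  have \<Lambda>: "1 \<le> \<Lambda>" using L0 M ab by (simp add: \<Lambda>_def)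
  define Kn where "Kn = L * M + 1"
  have Kn: "1 \<le> Kn" "L * M \<le> Kn" using L0 M by (auto simp: Kn_def)
  define A where "A = \<Lambda> * (3 * Kn)"
  define B where "B = 2 * L * Ce + 320 * L ^ 3 * Ce\<^sup>2 * \<Lambda>\<^sup>2"
  have AB: "0 \<le> A" "0 \<le> B" using \<Lambda> Kn L0 Ce0 by (auto simp: A_def B_def)
  interpret c: dg_constants k "k + 4" \<beta> a b T \<kappa> f fh S M R L Ci Cp Ce Cs A B K \<Phi>
    using dg \<kappa> AB by simp
  obtain h1 where h1: "0 < h1" "\<And>h. 0 < h \<Longrightarrow> h \<le> h1 \<Longrightarrow> h \<le> 1 \<and> Ce * h \<le> 1 \<and> c.energy_const * Ci * \<kappa> * h\<^sup>2 < 1"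
    using c.small_mesh by blast
  \<comment> \<open>The second bound ensures \<open>2 L \<eta> \<le> c\<close> in the node estimate.\<close>
  define h0 where "h0 = min h1 (1 / (1 + 2 * L * Ce * \<Lambda>))"
  have pos: "0 \<le> 2 * L * Ce * \<Lambda>" using L0 Ce0 \<Lambda> by simp
  have pos1: "0 < 1 + 2 * L * Ce * \<Lambda>" using pos by linarith
  have h0: "0 < h0" using h1(1) pos1 by (simp add: h0_def)
  define C where "C = sqrt (2 * Ce\<^sup>2 * (b - a) + 2 * c.energy_const) + 1"
  have sq0: "0 \<le> sqrt (2 * Ce\<^sup>2 * (b - a) + 2 * c.energy_const)"
    using c.energy_const0 ab by simp
  have C0: "0 < C" using sq0 unfolding C_def by linarith
  show ?thesis
  proof (rule exI[of _ C], intro conjI C0, rule exI[of _ h0], intro conjI h0 allI impI ballI)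
    fix w0 w N X u t
    assume ex: "exact_solution bc f a b T w0 w" and sm: "smooth_with_bound (k + 4) a b T M w"
      and mesh: "is_mesh a b N X" and quasi: "quasi_uniform \<kappa> N X" and hs: "mesh_size N X \<le> h0"
      and sol: "numerical_solution k \<beta> bc f fh S T N X w0 u" and t: "t \<in> {0..T}"
    define h where "h = mesh_size N X"
    define \<tau> where "\<tau> = h ^ (k + 1)"
    have N1: "1 \<le> N" using mesh by (simp add: is_mesh_def)
    have h: "0 < h" using mesh_size_bounds(3)[OF mesh quasi, of 1] N1 by (simp add: h_def)
    have small: "h \<le> 1" "Ce * h \<le> 1" "c.energy_const * Ci * \<kappa> * h\<^sup>2 < 1"
      using h1(2)[OF h] hs by (auto simp: h_def h0_def)
    have Lh: "2 * L * Ce * \<Lambda> * h \<le> 1"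
    proof -
      have "2 * L * Ce * \<Lambda> * h \<le> (1 + 2 * L * Ce * \<Lambda>) * (1 / (1 + 2 * L * Ce * \<Lambda>))"
        using pos pos1 h hs by (intro mult_mono) (auto simp: h_def h0_def)
      also have "\<dots> = 1" using pos1 by simp
      finally show ?thesis .
    qed
    obtain D where D: "smooth_tower (k + 4) a b T M D" "\<forall>x. \<forall>t\<in>{0..T}. D 0 0 x t = w x t"
      "\<forall>x. \<forall>t\<in>{0..T}. D 0 1 x t = - deriv f (D 0 0 x t) * D 1 0 x t"
      "\<forall>t\<in>{0..T}. (bc = Periodic \<and> D 0 0 a t = D 0 0 b t) \<or> (bc = Compact_support \<and> D 0 0 a t = 0 \<and> D 0 0 b t = 0)"
      "\<forall>x\<in>{a..b}. D 0 0 x 0 = w0 x"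
      using exact_solution_tower[OF ab(2) sm _ ex f' ab(1)] by auto
    have t0: "0 \<in> {0..T}" using ab by simp
    have DM: "\<bar>D i j x t\<bar> \<le> M" if "i + j \<le> k + 4" "x \<in> {a..b}" "t \<in> {0..T}" for i j x t
      using D(1) that unfolding smooth_tower_def by blast
    have Dt: "((\<lambda>s. D i j x s) has_real_derivative D i (Suc j) x t) (at t within {0..T})"
      if "i + j < k + 4" "t \<in> {0..T}" for i j x t
      using D(1) that unfolding smooth_tower_def by blast
    have Dx: "((\<lambda>y. D i j y t) has_real_derivative D (Suc i) j x t) (at x)"
      if "i + j < k + 4" "t \<in> {0..T}" for i j x t
      using D(1) that unfolding smooth_tower_def by blast
    define g where "g x t = deriv f (D 0 0 x t)" for x t
    have inR: "D 0 0 x t \<in> {- R..R}" if "x \<in> {a..b}" "t \<in> {0..T}" for x t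
      using DM[of 0 0 x t] that by (auto simp: R_def)
    have speed: "\<exists>s. 1 / \<Lambda> \<le> s \<and> s \<le> \<Lambda> \<and> g x t = s * g x 0" if x: "x \<in> {a..b}" and t: "t \<in> {0..T}" for x t
    proof -
      define cc where "cc r = (deriv ^^ 2) f (D 0 0 x r) * D 1 0 x r" for r
      have "continuous_on {0..T} (\<lambda>r. D 0 0 x r)" by (rule DERIV_continuous_on[OF Dt]) auto
      then have c1: "continuous_on {0..T} (\<lambda>r. (deriv ^^ 2) f (D 0 0 x r))"
        by (rule continuous_on_compose2[OF cf'']) simp
      have c2: "continuous_on {0..T} (\<lambda>r. D 1 0 x r)" by (rule DERIV_continuous_on[OF Dt]) auto
      have "\<exists>s. exp (- (L * M * T)) \<le> s \<and> s \<le> exp (L * M * T) \<and> g x t = s * g x 0"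
      proof (rule linear_ode_sign[OF _ _ _ t])
        show "continuous_on {0..T} cc" unfolding cc_def by (intro continuous_intros c1 c2)
        show "\<bar>cc r\<bar> \<le> L * M" if "r \<in> {0..T}" for r
          unfolding cc_def abs_mult using f2 inR[OF x that] DM[of 1 0 x r] x that L0
          by (intro mult_mono) auto
        show "((\<lambda>r. g x r) has_real_derivative - cc r * g x r) (at r within {0..T})" if r: "r \<in> {0..T}" for r
        proof -
          have "((\<lambda>r. D 0 0 x r) has_real_derivative D 0 1 x r) (at r within {0..T})" using Dt[of 0 0 r x] r by simp
          from DERIV_chain'[OF this f'']
          have "((\<lambda>r. deriv f (D 0 0 x r)) has_real_derivative (deriv ^^ 2) f (D 0 0 x r) * D 0 1 x r) (at r within {0..T})" .
          moreover have "(deriv ^^ 2) f (D 0 0 x r) * D 0 1 x r = - cc r * g x r"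
            using D(3) r by (simp add: cc_def g_def mult_ac)
          ultimately show ?thesis unfolding g_def by simp
        qed
      qed
      then show ?thesis by (simp add: \<Lambda>_def exp_minus inverse_eq_divide)
    qed
    have gx: "\<bar>g x 0 - g y 0\<bar> \<le> L * M * \<bar>x - y\<bar>" if x: "x \<in> {a..b}" and y: "y \<in> {a..b}" for x y
    proof -
      have "\<exists>\<xi>\<in>closed_segment y x. D 0 0 x 0 - D 0 0 y 0 = (x - y) * D 1 0 \<xi> 0"
        by (rule mvt_segment) (use Dx[of 0 0 0] t0 in auto)
      then obtain \<xi> where \<xi>: "\<xi> \<in> closed_segment y x" "D 0 0 x 0 - D 0 0 y 0 = (x - y) * D 1 0 \<xi> 0" by blast
      have "\<xi> \<in> {a..b}" using \<xi>(1) x y by (auto simp: closed_segment_eq_real_ivl split: if_splits)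
      then have "\<bar>D 1 0 \<xi> 0\<bar> \<le> M" using DM[of 1 0 \<xi> 0] t0 by simp
      then have "\<bar>D 0 0 x 0 - D 0 0 y 0\<bar> \<le> M * \<bar>x - y\<bar>"
        unfolding \<xi>(2) abs_mult using mult_left_mono[of "\<bar>D 1 0 \<xi> 0\<bar>" M "\<bar>x - y\<bar>"] by (simp add: mult.commute)
      then have "L * \<bar>D 0 0 x 0 - D 0 0 y 0\<bar> \<le> L * (M * \<bar>x - y\<bar>)" using L0 by (rule mult_left_mono)
      then show ?thesis using f'L[OF inR[OF x t0] inR[OF y t0]] by (simp add: g_def)
    qed
    define exl where "exl j \<longleftrightarrow> g (X j) 0 \<le> 2 * Kn * h" for j
    define exr where "exr j \<longleftrightarrow> - (2 * Kn * h) \<le> g (X j) 0" for j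
    have Kh: "0 < Kn * h" using Kn h by simp
    have Xin: "X i \<in> {a..b}" if "i \<le> N" for i by (rule mesh_nodes(2)[OF mesh that])
    have cellg: "\<bar>g x 0 - g y 0\<bar> \<le> Kn * h"
      if j: "j \<in> {1..N}" and x: "x \<in> {X (j - 1)..X j}" "y \<in> {X (j - 1)..X j}" for j x y
    proof -
      have "\<bar>x - y\<bar> \<le> h" using x mesh_size_bounds(1)[OF mesh quasi j] by (auto simp: cell_size_def h_def)
      then have "L * M * \<bar>x - y\<bar> \<le> Kn * h" using Kn L0 M h by (intro mult_mono) auto
      then show ?thesis using gx[of x y] mesh_nodes(3)[OF mesh j] x by (meson order_trans subsetD)
    qed
    have ends: "X 0 = a" "X N = b" using mesh by (auto simp: is_mesh_def)
    have perX: "g (X 0) 0 = g (X N) 0" if "bc = Periodic"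
      using D(4) t0 that ends by (auto simp: g_def)
    have flagl: "if 1 \<le> i then exr i else bc = Compact_support \<or> exr N"
      if i: "i \<le> N" and gi: "- (Kn * h) \<le> g (X i) 0" for i
    proof (cases "1 \<le> i")
      case True
      then show ?thesis using gi Kh by (simp add: exr_def)
    next
      case False
      then have "bc = Compact_support \<or> exr N"
        using gi Kh perX by (cases bc) (auto simp: exr_def not_less_eq_eq)
      then show ?thesis using False by simp
    qed
    have flagr: "if i < N then exl (Suc i) else bc = Compact_support \<or> exl 1"
      if i: "i \<le> N" and gi: "g (X i) 0 \<le> Kn * h" for i
    proof -
      have nxt: "g (X (Suc l)) 0 \<le> g (X l) 0 + Kn * h" if l: "l < N" for l
      proof -
        have j: "Suc l \<in> {1..N}" using l by auto
        have "X l \<le> X (Suc l)" using mesh_nodes(1)[OF mesh, of l "Suc l"] l by simp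
        then show ?thesis using cellg[OF j, of "X (Suc l)" "X l"] by auto
      qed
      show ?thesis
      proof (cases "i < N")
        case True
        then show ?thesis using nxt[OF True] gi by (simp add: exl_def)
      next
        case False
        then have "i = N" using i by simp
        then have "bc = Compact_support \<or> exl 1"
          using nxt[of 0] N1 gi perX by (cases bc) (auto simp: exl_def)
        then show ?thesis using False by simp
      qed
    qed
    have "\<forall>j\<in>{1..N}. \<exists>Qj. cell_projector k Cp (X (j - 1)) (X j) (exl j) (exr j) Qj"
      using Qex mesh unfolding is_mesh_def by blast
    from bchoice[OF this] obtain Q where Q: "\<forall>j\<in>{1..N}. cell_projector k Cp (X (j - 1)) (X j) (exl j) (exr j) (Q j)"
      by blast
    have r: "dg_run k (k + 4) \<beta> a b T \<kappa> f fh S M R L Ci Cp Ce Cs A B K \<Phi> bc D N X w0 u Q exl exr \<tau> h"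
    proof (rule dg_run.intro[OF c.dg_constants_axioms], rule dg_run_axioms.intro)
      show "smooth_tower (k + 2) a b T M D" by (rule smooth_tower_mono[OF D(1)]) simp
      show "D 0 1 x t = - deriv f (D 0 0 x t) * D 1 0 x t" if "t \<in> {0..T}" for x t using D(3) that by blast
      show "(bc = Periodic \<and> D 0 0 a t = D 0 0 b t) \<or> (bc = Compact_support \<and> D 0 0 a t = 0 \<and> D 0 0 b t = 0)"
        if "t \<in> {0..T}" for t using D(4) that by blast
      show "D 0 0 x 0 = w0 x" if "x \<in> {a..b}" for x using D(5) that by blast
      show "cell_projector k Cp (X (j - 1)) (X j) (exl j) (exr j) (Q j)" if "j \<in> {1..N}" for j using Q that by blast
      show "h ^ (k + 1) \<le> \<tau>" by (simp add: \<tau>_def)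
      show "\<tau>\<^sup>2 \<le> h ^ 3" unfolding \<tau>_def power_mult[symmetric]
        using k h small(1) by (intro power_decreasing) auto
      show "\<bar>deriv f (D 0 0 x t)\<bar> \<le> A * h"
        if j: "j \<in> {1..N}" and e: "exl j" "exr j" and t: "t \<in> {0..T}" and x: "x \<in> {X (j - 1)..X j}" for j t x
      proof -
        have xI: "x \<in> {a..b}" using mesh_nodes(3)[OF mesh j] x by blast
        have "X j \<in> {X (j - 1)..X j}" using x by auto
        then have "\<bar>g x 0\<bar> \<le> 3 * Kn * h" using cellg[OF j x, of "X j"] e by (auto simp: exl_def exr_def)
        moreover obtain s where s: "1 / \<Lambda> \<le> s" "s \<le> \<Lambda>" "g x t = s * g x 0" using speed[OF xI t] by blast
        moreover have "0 \<le> s" using s(1) \<Lambda> by (meson order_trans zero_le_divide_1_iff zero_le_one)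
        ultimately have "\<bar>g x t\<bar> \<le> \<Lambda> * (3 * Kn * h)"
          unfolding s(3) abs_mult using \<Lambda> by (intro mult_mono) auto
        then show ?thesis by (simp add: A_def g_def mult_ac)
      qed
      fix t :: real and i :: nat and e1 e2 \<eta>1 \<eta>2 :: real
      assume t: "t \<in> {0..T}" and i: "i \<le> N" and e: "\<bar>e1\<bar> \<le> 1" "\<bar>e2\<bar> \<le> 1"
        and \<eta>: "\<bar>\<eta>1\<bar> \<le> Ce * h ^ (k + 1)" "\<bar>\<eta>2\<bar> \<le> Ce * h ^ (k + 1)"
        and zl: "(if 1 \<le> i then exr i else bc = Compact_support \<or> exr N) \<Longrightarrow> \<eta>1 = 0"
        and zr: "(if i < N then exl (Suc i) else bc = Compact_support \<or> exl 1) \<Longrightarrow> \<eta>2 = 0"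
      let ?w = "D 0 0 (X i) t"
      define \<eta> where "\<eta> = Ce * h ^ (k + 1)"
      \<comment> \<open>A lower bound of the speed, at time \<open>t\<close>, at nodes where the initial speed exceeds \<open>Kn h\<close>.\<close>
      define cs where "cs = Kn * h / \<Lambda>"
      have w: "\<bar>?w\<bar> \<le> M" using DM[of 0 0 "X i" t] Xin[OF i] t by simp
      have hk: "h ^ (k + 1) \<le> h\<^sup>2" "h\<^sup>2 \<le> h"
        using power_decreasing[of 2 "k + 1" h] power_decreasing[of 1 2 h] k h small(1) by auto
      have \<eta>h: "\<eta> \<le> Ce * h\<^sup>2" unfolding \<eta>_def using hk Ce0 by (intro mult_left_mono) auto
      have "Ce * h\<^sup>2 \<le> Ce * h" using hk Ce0 by (intro mult_left_mono) auto
      then have \<eta>1: "\<bar>\<eta>1\<bar> \<le> 1" "\<bar>\<eta>2\<bar> \<le> 1" using \<eta> \<eta>h small(2) by (auto simp: \<eta>_def)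
      have \<eta>0: "0 \<le> \<eta>" using Ce0 h by (simp add: \<eta>_def)
      have cs0: "0 < cs" using Kh \<Lambda> by (simp add: cs_def)
      have csl: "h / \<Lambda> \<le> cs" unfolding cs_def using Kn h \<Lambda> by (intro divide_right_mono) auto
      have cond: "2 * L * \<eta> \<le> cs"
      proof -
        have "2 * L * \<eta> \<le> 2 * L * (Ce * h\<^sup>2)" using \<eta>h L0 by (intro mult_left_mono) auto
        also have "\<dots> = (2 * L * Ce * \<Lambda> * h) * (h / \<Lambda>)" using \<Lambda> by (simp add: power2_eq_square)
        also have "\<dots> \<le> 1 * (h / \<Lambda>)" using Lh h \<Lambda> by (intro mult_right_mono) auto
        finally show ?thesis using csl by simp
      qed
      obtain s where s: "1 / \<Lambda> \<le> s" "s \<le> \<Lambda>" "g (X i) t = s * g (X i) 0" using speed[OF Xin[OF i] t] by blast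
      have s0: "0 \<le> s" using s(1) \<Lambda> by (meson order_trans zero_le_divide_1_iff zero_le_one)
      have sc: "cs \<le> s * z" if "Kn * h \<le> z" for z
      proof -
        have "1 / \<Lambda> * (Kn * h) \<le> s * z" using s(1) s0 that Kh by (intro mult_mono) auto
        then show ?thesis by (simp add: cs_def)
      qed
      have cases: "(\<eta>1 = 0 \<and> \<eta>2 = 0) \<or> (\<eta>1 = 0 \<and> cs \<le> deriv f ?w) \<or> (\<eta>2 = 0 \<and> deriv f ?w \<le> - cs)"
      proof -
        consider "\<bar>g (X i) 0\<bar> \<le> Kn * h" | "Kn * h < g (X i) 0" | "g (X i) 0 < - (Kn * h)" by linarith
        then show ?thesis
        proof cases
          case 1
          then show ?thesis using zl[OF flagl[OF i]] zr[OF flagr[OF i]] by auto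
        next
          case 2
          then have "\<eta>1 = 0" using zl[OF flagl[OF i]] Kh by auto
          moreover have "cs \<le> g (X i) t" unfolding s(3) using 2 by (intro sc) auto
          ultimately show ?thesis by (simp add: g_def)
        next
          case 3
          then have "\<eta>2 = 0" using zr[OF flagr[OF i]] Kh by auto
          moreover have "g (X i) t \<le> - cs" unfolding s(3) using sc[of "- g (X i) 0"] 3 by auto
          ultimately show ?thesis by (simp add: g_def)
        qed
      qed
      have rng: "?w \<in> {- R..R}" "?w + e1 \<in> {- R..R}" "?w + e2 \<in> {- R..R}"
          "?w + e1 - \<eta>1 \<in> {- R..R}" "?w + e2 - \<eta>2 \<in> {- R..R}"
        using w e \<eta>1 by (auto simp: R_def)
      have "fh (?w + e1 - \<eta>1) (?w + e2 - \<eta>2) * (e2 - e1) - (\<Phi> (?w + e2) - \<Phi> (?w + e1))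
          \<le> (2 * L * \<eta> + 320 * L ^ 3 * \<eta>\<^sup>2 / cs\<^sup>2) * (e1\<^sup>2 + e2\<^sup>2)"
      proof (rule upwind_flux_node[OF up _ f' _ f'L _ L0 rng _ _ cs0 cond cases])
        show "\<bar>\<eta>1\<bar> \<le> \<eta>" "\<bar>\<eta>2\<bar> \<le> \<eta>" using \<eta> by (auto simp: \<eta>_def)
      qed (use \<Phi> fL fhL in auto)
      also have "\<dots> \<le> (B * h) * (e1\<^sup>2 + e2\<^sup>2)"
      proof (rule mult_right_mono)
        have "2 * L * \<eta> \<le> 2 * L * (Ce * h)"
          using \<eta>h \<open>Ce * h\<^sup>2 \<le> Ce * h\<close> L0 by (intro mult_left_mono) auto
        moreover have "320 * L ^ 3 * \<eta>\<^sup>2 / cs\<^sup>2 \<le> 320 * L ^ 3 * Ce\<^sup>2 * \<Lambda>\<^sup>2 * h"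
        proof -
          have "\<eta>\<^sup>2 / cs\<^sup>2 \<le> (Ce * h\<^sup>2)\<^sup>2 / (h / \<Lambda>)\<^sup>2"
            using \<eta>h \<eta>0 csl h \<Lambda> by (intro frac_le power_mono) auto
          also have "\<dots> = Ce\<^sup>2 * \<Lambda>\<^sup>2 * h\<^sup>2"
            using h \<Lambda> by (simp add: power_mult_distrib power_divide power2_eq_square)
          also have "\<dots> \<le> Ce\<^sup>2 * \<Lambda>\<^sup>2 * h" using hk by (intro mult_left_mono) auto
          finally have "320 * L ^ 3 * (\<eta>\<^sup>2 / cs\<^sup>2) \<le> 320 * L ^ 3 * (Ce\<^sup>2 * \<Lambda>\<^sup>2 * h)"
            using L0 by (intro mult_left_mono) auto
          then show ?thesis by (simp add: mult_ac)
        qed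
        ultimately show "2 * L * \<eta> + 320 * L ^ 3 * \<eta>\<^sup>2 / cs\<^sup>2 \<le> B * h"
          by (simp add: B_def algebra_simps)
      qed simp
      also have "\<dots> \<le> B * h * (e1\<^sup>2 + e2\<^sup>2 + \<tau>\<^sup>2)" using AB h by (intro mult_left_mono) auto
      finally show "fh (?w + e1 - \<eta>1) (?w + e2 - \<eta>2) * (e2 - e1) - (\<Phi> (?w + e2) - \<Phi> (?w + e1))
          \<le> B * h * (e1\<^sup>2 + e2\<^sup>2 + \<tau>\<^sup>2)" .
    qed (use mesh quasi sol small h_def in auto)
    have "L2dist_broken N X (\<lambda>x. w x t) (u t) = L2dist_broken N X (\<lambda>x. D 0 0 x t) (u t)"
      using D(2) t by simp
    also have "\<dots> \<le> sqrt (2 * Ce\<^sup>2 * (b - a) + 2 * c.energy_const) * \<tau>"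
      by (rule dg_run.error_bound[OF r t])
    also have "\<dots> \<le> C * \<tau>" unfolding C_def using h by (intro mult_right_mono) (auto simp: \<tau>_def)
    finally show "L2dist_broken N X (\<lambda>x. w x t) (u t) \<le> C * mesh_size N X ^ (k + 1)"
      by (simp add: \<tau>_def h_def)
  qed
qed

theorem theorem6p1:
  fixes k :: nat
  assumes "1 \<le> k"
  shows "\<exists>m :: nat. \<forall>(\<beta> :: real) (a :: real) (b :: real) (T :: real) (\<kappa> :: real) (f :: real \<Rightarrow> real)
      (fh :: real \<Rightarrow> real \<Rightarrow> real) (bc :: boundary) (S :: scheme).
    beta_admissible k \<beta> \<and> a < b \<and> 0 < T \<and> C_class m f \<and> scheme_admissible k S \<longrightarrow>
      (upwind_flux f fh \<longrightarrow>
        (\<forall>M. \<exists>C>0. \<forall>w0 w.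
          exact_solution bc f a b T w0 w \<and> smooth_with_bound m a b T M w \<longrightarrow>
          (\<exists>h0>0. \<forall>N X u.
            is_mesh a b N X \<and> quasi_uniform \<kappa> N X \<and> mesh_size N X \<le> h0 \<and>
            numerical_solution k \<beta> bc f fh S T N X w0 u \<longrightarrow>
            (\<forall>t\<in>{0..T}. L2dist_broken N X (\<lambda>x. w x t) (u t)
               \<le> C * mesh_size N X ^ (k + 1))))) \<and>
      (monotone_flux f fh \<longrightarrow>
        (\<forall>M. \<exists>C>0. \<forall>w0 w.
          exact_solution bc f a b T w0 w \<and> smooth_with_bound m a b T M w \<longrightarrow>
          (\<exists>h0>0. \<forall>N X u.
            is_mesh a b N X \<and> quasi_uniform \<kappa> N X \<and> mesh_size N X \<le> h0 \<and>
            numerical_solution k \<beta> bc f fh S T N X w0 u \<longrightarrow>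
            (\<forall>t\<in>{0..T}. L2dist_broken N X (\<lambda>x. w x t) (u t)
               \<le> C * mesh_size N X powr (real k + 1 / 2)))))"
proof (intro exI[of _ "k + 4"] allI impI conjI; elim conjE)
  fix \<beta> a b T \<kappa> :: real and f :: "real \<Rightarrow> real" and fh bc S and M :: real
  assume \<beta>: "beta_admissible k \<beta>" and ab: "a < b" "0 < T" and f: "C_class (k + 4) f"
    and S: "scheme_admissible k S"
  \<comment> \<open>For \<open>M < 0\<close> or \<open>\<kappa> \<le> 0\<close> no data satisfy the hypotheses, and any constant will do.\<close>
  have vacuous: "0 \<le> M \<and> 0 < \<kappa>"
    if sm: "smooth_with_bound (k + 4) a b T M w" and me: "is_mesh a b N X"
      and qu: "quasi_uniform \<kappa> N X" for w N X
  proof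
    from sm obtain D :: "nat \<Rightarrow> nat \<Rightarrow> real \<Rightarrow> real \<Rightarrow> real" where
      "\<forall>i j. i + j \<le> k + 4 \<longrightarrow> continuous_on (UNIV \<times> {0..T}) (\<lambda>(x, t). D i j x t) \<and>
        (\<forall>x\<in>{a..b}. \<forall>t\<in>{0..T}. \<bar>D i j x t\<bar> \<le> M)"
      unfolding smooth_with_bound_def by blast
    then have "\<bar>D 0 0 a 0\<bar> \<le> M" using ab by auto
    then show "0 \<le> M" by linarith
    have "1 \<in> {1..N}" using me by (simp add: is_mesh_def)
    then show "0 < \<kappa>" by (rule mesh_size_bounds(4)[OF me qu])
  qed
  show "\<exists>C>0. \<forall>w0 w. exact_solution bc f a b T w0 w \<and> smooth_with_bound (k + 4) a b T M w \<longrightarrow>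
      (\<exists>h0>0. \<forall>N X u. is_mesh a b N X \<and> quasi_uniform \<kappa> N X \<and> mesh_size N X \<le> h0 \<and>
        numerical_solution k \<beta> bc f fh S T N X w0 u \<longrightarrow>
        (\<forall>t\<in>{0..T}. L2dist_broken N X (\<lambda>x. w x t) (u t) \<le> C * mesh_size N X ^ (k + 1)))"
    if up: "upwind_flux f fh"
  proof (cases "0 \<le> M \<and> 0 < \<kappa>")
    case True
    then obtain C h0 where C: "0 < C" "0 < h0" "\<forall>w0 w N X u.
      exact_solution bc f a b T w0 w \<longrightarrow> smooth_with_bound (k + 4) a b T M w \<longrightarrow>
      is_mesh a b N X \<longrightarrow> quasi_uniform \<kappa> N X \<longrightarrow> mesh_size N X \<le> h0 \<longrightarrow>
      numerical_solution k \<beta> bc f fh S T N X w0 u \<longrightarrow>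
      (\<forall>t\<in>{0..T}. L2dist_broken N X (\<lambda>x. w x t) (u t) \<le> C * mesh_size N X ^ (k + 1))"
      using upwind_error[OF assms \<beta> ab f S up, of M \<kappa> bc] by blast
    show ?thesis
      by (rule exI[of _ C], intro conjI C(1) allI impI, rule exI[of _ h0], intro conjI C(2) allI impI)
        (use C(3) in blast)
  next
    case False
    then show ?thesis using vacuous by (intro exI[of _ 1] conjI allI impI zero_less_one) blast
  qed
  show "\<exists>C>0. \<forall>w0 w. exact_solution bc f a b T w0 w \<and> smooth_with_bound (k + 4) a b T M w \<longrightarrow>
      (\<exists>h0>0. \<forall>N X u. is_mesh a b N X \<and> quasi_uniform \<kappa> N X \<and> mesh_size N X \<le> h0 \<and>
        numerical_solution k \<beta> bc f fh S T N X w0 u \<longrightarrow>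
        (\<forall>t\<in>{0..T}. L2dist_broken N X (\<lambda>x. w x t) (u t) \<le> C * mesh_size N X powr (real k + 1 / 2)))"
    if mo: "monotone_flux f fh"
  proof (cases "0 \<le> M \<and> 0 < \<kappa>")
    case True
    then obtain C h0 where C: "0 < C" "0 < h0" "\<forall>w0 w N X u.
      exact_solution bc f a b T w0 w \<longrightarrow> smooth_with_bound (k + 4) a b T M w \<longrightarrow>
      is_mesh a b N X \<longrightarrow> quasi_uniform \<kappa> N X \<longrightarrow> mesh_size N X \<le> h0 \<longrightarrow>
      numerical_solution k \<beta> bc f fh S T N X w0 u \<longrightarrow>
      (\<forall>t\<in>{0..T}. L2dist_broken N X (\<lambda>x. w x t) (u t) \<le> C * mesh_size N X powr (real k + 1 / 2))"
      using monotone_error[OF assms \<beta> ab f S mo, of M \<kappa> bc] by blast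
    show ?thesis
      by (rule exI[of _ C], intro conjI C(1) allI impI, rule exI[of _ h0], intro conjI C(2) allI impI)
        (use C(3) in blast)
  next
    case False
    then show ?thesis using vacuous by (intro exI[of _ 1] conjI allI impI zero_less_one) blast
  qed
qed

end
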